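(* Let $X_1,\dots,X_N$ be i.i.d. real random variables with distribution function $F$, let $0<\alpha<\beta<1$, and let $T_N$, $\mu(\alpha,\beta)$, $\sigma_W$, $\lambda_1$, $\lambda_2$, $\beta_N$, $S_N$ be as defined in the context. Suppose that $f=F'$ exists in neighborhoods of $\xi_\alpha$ and $\xi_\beta$ and satisfies a Lipschitz condition there, and that $f(\xi_\alpha)>0$, $f(\xi_\beta)>0$. Let $$F_{N,S}(x)=P\left(\frac{N^{1/2}(T_N-\mu(\alpha,\beta))}{(\beta-\alpha)^{-1}S_N}\le x\right),\qquad H_N(x)=\Phi(x)+\frac{\phi(x)}{6\sqrt N}\left((2x^2+1)\lambda_1+3(x^2+1)\lambda_2-6N\frac{\beta_N}{\sigma_W}\right),$$ where $\Phi$ is the standard normal distribution function and $\phi=\Phi'$. Then $$\sup_{x\in\mathbb R}|F_{N,S}(x)-H_N(x)|=o(N^{-1/2})\quad\text{as }N\to\infty.$$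
   Context: $X_{1:N}\le\dots\le X_{N:N}$ are the order statistics. $T_N=\frac{1}{[\beta N]-[\alpha N]}\sum_{i=[\alpha N]+1}^{[\beta N]}X_{i:N}$ ($[\cdot]$ the integer part). $F^{-1}(u)=\inf\{x:F(x)\ge u\}$, $\xi_\nu=F^{-1}(\nu)$. $Q(u)=\xi_\alpha$ for $u\le\alpha$, $F^{-1}(u)$ for $\alpha<u\le\beta$, $\xi_\beta$ for $u>\beta$; $\mu_W=\int_0^1Q$, $\sigma_W^2=\int_0^1(Q-\mu_W)^2$, $\gamma_{3,W}=\int_0^1(Q-\mu_W)^3$, $\delta_{2,W}=-\alpha^2\frac{1}{f(\xi_\alpha)}[\mu_W-\xi_\alpha]^2+(1-\beta)^2\frac{1}{f(\xi_\beta)}[\mu_W-\xi_\beta]^2$, $\lambda_1=\gamma_{3,W}/\sigma_W^3$, $\lambda_2=\delta_{2,W}/\sigma_W^3$. $\mu(\alpha,\beta)=\frac{1}{\beta-\alpha}\int_\alpha^\beta F^{-1}(u)du$. $\beta_N=\frac1N\{-(\alpha N-[\alpha N])(\mu(\alpha,\beta)-\xi_\alpha)-\frac12\alpha(1-\alpha)/f(\xi_\alpha)+(\beta N-[\beta N])(\mu(\alpha,\beta)-\xi_\beta)+\frac12\beta(1-\beta)/f(\xi_\beta)\}$. With $k=[\alpha N]+1$, $m=[\beta N]$, define $\hat\mu_W=\frac kN X_{k:N}+\frac1N\sum_{i=k+1}^{m-1}X_{i:N}+\frac{N-m+1}{N}X_{m:N}$ and $S_N^2=\frac kN X_{k:N}^2+\frac1N\sum_{i=k+1}^{m-1}X_{i:N}^2+\frac{N-m+1}{N}X_{m:N}^2-\hat\mu_W^2$,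 $S_N=\sqrt{S_N^2}$. *)

theory Defs
  imports "HOL-Probability.Probability"
begin

definition order_stat :: "(nat \<Rightarrow> 'a \<Rightarrow> real) \<Rightarrow> nat \<Rightarrow> nat \<Rightarrow> 'a \<Rightarrow> real" where
  "order_stat X N i \<omega> = sort (map (\<lambda>j. X j \<omega>) [0..<N]) ! (i - 1)"

definition quantile :: "(real \<Rightarrow> real) \<Rightarrow> real \<Rightarrow> real" where
  "quantile F u = Inf {x. u \<le> F x}"

definition Qfun :: "(real \<Rightarrow> real) \<Rightarrow> real \<Rightarrow> real \<Rightarrow> real \<Rightarrow> real" where
  "Qfun F \<alpha> \<beta> u = (if u \<le> \<alpha> then quantile F \<alpha> else if u \<le> \<beta> then quantile F u else quantile F \<beta>)"

definition muW :: "(real \<Rightarrow> real) \<Rightarrow> real \<Rightarrow> real \<Rightarrow> real" where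
  "muW F \<alpha> \<beta> = integral {0..1} (Qfun F \<alpha> \<beta>)"

definition sigmaW :: "(real \<Rightarrow> real) \<Rightarrow> real \<Rightarrow> real \<Rightarrow> real" where
  "sigmaW F \<alpha> \<beta> = sqrt (integral {0..1} (\<lambda>u. (Qfun F \<alpha> \<beta> u - muW F \<alpha> \<beta>) ^ 2))"

definition gamma3W :: "(real \<Rightarrow> real) \<Rightarrow> real \<Rightarrow> real \<Rightarrow> real" where
  "gamma3W F \<alpha> \<beta> = integral {0..1} (\<lambda>u. (Qfun F \<alpha> \<beta> u - muW F \<alpha> \<beta>) ^ 3)"

definition delta2W :: "(real \<Rightarrow> real) \<Rightarrow> (real \<Rightarrow> real) \<Rightarrow> real \<Rightarrow> real \<Rightarrow> real" where
  "delta2W F f \<alpha> \<beta> =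
     - (\<alpha> ^ 2) * (1 / f (quantile F \<alpha>)) * (muW F \<alpha> \<beta> - quantile F \<alpha>)^2
     + (1 - \<beta>) ^ 2 * (1 / f (quantile F \<beta>)) * (muW F \<alpha> \<beta> - quantile F \<beta>)^2"

definition lambda1 :: "(real \<Rightarrow> real) \<Rightarrow> real \<Rightarrow> real \<Rightarrow> real" where
  "lambda1 F \<alpha> \<beta> = gamma3W F \<alpha> \<beta> / sigmaW F \<alpha> \<beta> ^ 3"

definition lambda2 :: "(real \<Rightarrow> real) \<Rightarrow> (real \<Rightarrow> real) \<Rightarrow> real \<Rightarrow> real \<Rightarrow> real" where
  "lambda2 F f \<alpha> \<beta> = delta2W F f \<alpha> \<beta> / sigmaW F \<alpha> \<beta> ^ 3"

definition mu_ab :: "(real \<Rightarrow> real) \<Rightarrow> real \<Rightarrow> real \<Rightarrow> real" where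
  "mu_ab F \<alpha> \<beta> = (1 / (\<beta> - \<alpha>)) * integral {\<alpha>..\<beta>} (quantile F)"

definition betaN :: "(real \<Rightarrow> real) \<Rightarrow> (real \<Rightarrow> real) \<Rightarrow> real \<Rightarrow> real \<Rightarrow> nat \<Rightarrow> real" where
  "betaN F f \<alpha> \<beta> N = (1 / real N) *
     ( - (\<alpha> * real N - real_of_int \<lfloor>\<alpha> * real N\<rfloor>) * (mu_ab F \<alpha> \<beta> - quantile F \<alpha>)
       - (1/2) * \<alpha> * (1 - \<alpha>) / f (quantile F \<alpha>)
       + (\<beta> * real N - real_of_int \<lfloor>\<beta> * real N\<rfloor>) * (mu_ab F \<alpha> \<beta> - quantile F \<beta>)
       + (1/2) * \<beta> * (1 - \<beta>) / f (quantile F \<beta>))"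

definition trimmed_mean :: "(nat \<Rightarrow> 'a \<Rightarrow> real) \<Rightarrow> real \<Rightarrow> real \<Rightarrow> nat \<Rightarrow> 'a \<Rightarrow> real" where
  "trimmed_mean X \<alpha> \<beta> N \<omega> =
     (1 / (real (nat \<lfloor>\<beta> * real N\<rfloor>) - real (nat \<lfloor>\<alpha> * real N\<rfloor>))) *
     (\<Sum>i = nat \<lfloor>\<alpha> * real N\<rfloor> + 1 .. nat \<lfloor>\<beta> * real N\<rfloor>. order_stat X N i \<omega>)"

definition muW_hat :: "(nat \<Rightarrow> 'a \<Rightarrow> real) \<Rightarrow> real \<Rightarrow> real \<Rightarrow> nat \<Rightarrow> 'a \<Rightarrow> real" where
  "muW_hat X \<alpha> \<beta> N \<omega> =
     (let k = nat \<lfloor>\<alpha> * real N\<rfloor> + 1; m = nat \<lfloor>\<beta> * real N\<rfloor> in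
       real k / real N * order_stat X N k \<omega>
       + (1 / real N) * (\<Sum>i = k + 1 .. m - 1. order_stat X N i \<omega>)
       + (real N - real m + 1) / real N * order_stat X N m \<omega>)"

definition SN :: "(nat \<Rightarrow> 'a \<Rightarrow> real) \<Rightarrow> real \<Rightarrow> real \<Rightarrow> nat \<Rightarrow> 'a \<Rightarrow> real" where
  "SN X \<alpha> \<beta> N \<omega> = sqrt
     (let k = nat \<lfloor>\<alpha> * real N\<rfloor> + 1; m = nat \<lfloor>\<beta> * real N\<rfloor> in
       real k / real N * (order_stat X N k \<omega>)^2
       + (1 / real N) * (\<Sum>i = k + 1 .. m - 1. (order_stat X N i \<omega>)^2)
       + (real N - real m + 1) / real N * (order_stat X N m \<omega>)^2
       - (muW_hat X \<alpha> \<beta> N \<omega>)^2)"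

definition Phi :: "real \<Rightarrow> real" where
  "Phi x = (LBINT t:{..x}. std_normal_density t)"

definition phi :: "real \<Rightarrow> real" where
  "phi x = std_normal_density x"

definition H_N :: "(real \<Rightarrow> real) \<Rightarrow> (real \<Rightarrow> real) \<Rightarrow> real \<Rightarrow> real \<Rightarrow> nat \<Rightarrow> real \<Rightarrow> real" where
  "H_N F f \<alpha> \<beta> N x = Phi x + phi x / (6 * sqrt (real N)) *
     ((2 * x^2 + 1) * lambda1 F \<alpha> \<beta> + 3 * (x^2 + 1) * lambda2 F f \<alpha> \<beta>
      - 6 * real N * betaN F f \<alpha> \<beta> N / sigmaW F \<alpha> \<beta>)"

definition deriv_lipschitz_near :: "(real \<Rightarrow> real) \<Rightarrow> (real \<Rightarrow> real) \<Rightarrow> real \<Rightarrow> bool" where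
  "deriv_lipschitz_near F f \<xi> \<longleftrightarrow>
     (\<exists>\<delta>>0. \<exists>L. (\<forall>x\<in>{\<xi>-\<delta><..<\<xi>+\<delta>}. (F has_real_derivative f x) (at x)) \<and>
               (\<forall>x\<in>{\<xi>-\<delta><..<\<xi>+\<delta>}. \<forall>y\<in>{\<xi>-\<delta><..<\<xi>+\<delta>}. \<bar>f x - f y\<bar> \<le> L * \<bar>x - y\<bar>))"

end

theory Submission imports Defs "HOL-Real_Asymp.Real_Asymp"
begin

text \<open>Write \<open>W\<close> for the observation clamped to \<open>[\<xi>\<^sub>\<alpha>, \<xi>\<^sub>\<beta>]\<close>, \<open>z = (W - \<mu>) / \<sigma>\<close>, and let \<open>S\<^sub>A\<close>, \<open>S\<^sub>B\<close> be the
  centred counts of observations below the two quantiles. Since the empirical distribution function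
  oscillates little near the quantiles, outside an event of probability \<open>o(N\<^sup>-\<^sup>1\<^sup>/\<^sup>2)\<close> the numerator of the
  statistic is \<open>\<sigma> (S\<^sub>z + q\<^sub>A S\<^sub>A\<^sup>2 / N + q\<^sub>B S\<^sub>B\<^sup>2 / N)\<close> plus a deterministic rounding term, and
  \<open>S\<^sub>N / \<sigma> = 1 + S\<^sub>v / N\<close>, both up to negligible errors. Hence, for \<open>\<bar>x\<bar> \<le> ln N\<close>, the event that the studentized
  mean is at most \<open>x\<close> is an event \<open>T\<^sub>x \<le> y\<close> for the quadratic statistic
  \<open>T\<^sub>x = (S\<^sub>z + q\<^sub>A S\<^sub>A\<^sup>2 / N + q\<^sub>B S\<^sub>B\<^sup>2 / N - x S\<^sub>v / N\<^sup>1\<^sup>/\<^sup>2) / N\<^sup>1\<^sup>/\<^sup>2\<close>, which is treated by Esseen's smoothing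
  inequality. At low frequencies its characteristic function is expanded around that of \<open>S\<^sub>z\<close>. At high
  frequencies one conditions on which of the three cells cut out by the quantiles each observation falls
  into: the quadratic terms become constants and the modulus factorizes, so that the smoothness of \<open>F\<close> at
  the quantile provides a Cramer-type bound. The range \<open>\<bar>x\<bar> > ln N\<close> follows by monotonicity.\<close>

section \<open>Smoothing inequality\<close>

text \<open>Precision \<open>o(1 / sqrt N)\<close> forces smoothing on a finer scale, here
  \<open>1 / N\<close>, so the characteristic function must be small at all frequencies beyond
  \<open>ln N\<close>, which no expansion in moments provides. The statistic is not a sum either.
  Once the random denominator is cleared, the event depends on \<open>x\<close> only through a term
  linear in \<open>v\<close>, so that \<open>z - \<zeta> * v\<close> with
  \<open>\<zeta> = x / sqrt N\<close> acts as a single summand; the restriction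
  \<open>\<bar>x\<bar> \<le> ln N\<close> keeps \<open>\<zeta>\<close> small. Splitting the
  frequencies at \<open>ln N\<close> balances the regimes: below, errors are powers of
  \<open>ln N\<close> over \<open>N\<close>; beyond, \<open>exp (- \<kappa> * (ln N)^2)\<close>
  beats every power of \<open>N\<close>. The quadratic terms come from completing a square: cutting
  a partial sum at a sample quantile instead of the true one changes it by the squared count
  deviation over twice \<open>N\<close> times the density. The rounding term stays of order one in
  the numerator and therefore enters as a shift of order \<open>1 / sqrt N\<close> of the
  argument.\<close>

definition unif :: "real measure" where
  "unif = density lborel (\<lambda>x. ennreal (indicator {-1..1} x / 2))"

lemma real_distribution_unif: "real_distribution unif"
proof -
  have "(\<integral>\<^sup>+x. ennreal (indicator {-1..1::real} x / 2) \<partial>lborel)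
      = (\<integral>\<^sup>+x. ennreal (1/2) * indicator {-1..1::real} x \<partial>lborel)"
    by (intro nn_integral_cong) (auto split: split_indicator)
  also have "\<dots> = ennreal (1/2) * 2"
    by (subst nn_integral_cmult_indicator) auto
  also have "\<dots> = 1"
    by (subst ennreal_numeral[symmetric], subst ennreal_mult[symmetric]) auto
  finally have "prob_space unif"
    unfolding unif_def by (intro prob_spaceI) (simp add: emeasure_density)
  then show ?thesis
    by (simp add: real_distribution_def real_distribution_axioms_def unif_def)
qed

interpretation unif: real_distribution unif
  by (rule real_distribution_unif)

lemma measure_unif_UNIV [simp]: "measure unif UNIV = 1"
  using unif.prob_space by simp

lemma integral_unif:
  fixes g :: "real \<Rightarrow> 'b::{banach, second_countable_topology}"
  assumes [measurable]: "g \<in> borel_measurable borel"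
  shows "(\<integral>x. g x \<partial>unif) = (\<integral>x. (indicator {-1..1} x / 2) *\<^sub>R g x \<partial>lborel)"
  unfolding unif_def by (subst integral_density) auto

lemma AE_unif: "AE x in unif. \<bar>x\<bar> \<le> 1"
  unfolding unif_def by (subst AE_density) (auto split: split_indicator)

text \<open>The kernel has bounded support, so undoing the smoothing costs only a shift by the
  bandwidth and no tail. The price is a transform that decays only like
  \<open>1 / \<bar>s\<bar>\<close>, which is the rate that the weight
  \<open>\<bar>t\<bar> / (1 + t^2)\<close> of the smoothing bound admits.\<close>

lemma char_unif_bound: "cmod (char unif s) * \<bar>s\<bar> \<le> 1"
proof (cases "s = 0")
  case False
  have "char unif s = (\<integral>x. (indicator {-1..1} x / 2) *\<^sub>R iexp (s * x) \<partial>lborel)"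
    unfolding char_def by (subst integral_unif) auto
  also have "\<dots> = (\<integral>x. (1/2) * (indicator {-1..1} x *\<^sub>R iexp (s * x)) \<partial>lborel)"
    by (intro Bochner_Integration.integral_cong) (auto split: split_indicator simp: scaleR_conv_of_real)
  also have "\<dots> = (1/2) * (\<integral>x. indicator {-1..1} x *\<^sub>R iexp (s * x) \<partial>lborel)"
    by (rule integral_mult_right_zero)
  also have "(\<integral>x. indicator {-1..1} x *\<^sub>R iexp (s * x) \<partial>lborel) = (CLBINT x=-1..1. iexp (s * x))"
    by (simp add: interval_integral_Icc[of "-1" 1, simplified] set_lebesgue_integral_def
        one_ereal_def)
  also have "(CLBINT x=-1..1. iexp (s * x)) = - (\<i> / s) * iexp (s * 1) - - (\<i> / s) * iexp (s * -1)"
    unfolding one_ereal_def uminus_ereal.simps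
    using False
    by (subst interval_integral_FTC_finite[where F = "\<lambda>x. - (\<i> / s) * iexp (s * x)"])
       (auto intro!: derivative_eq_intros continuous_intros simp: has_vector_derivative_complex_iff Re_exp Im_exp)
  finally have eq: "char unif s = (1/2) * (- (\<i> / s) * iexp (s * 1) - - (\<i> / s) * iexp (s * -1))" .
  have "cmod (- (\<i> / s) * iexp (s * 1) - - (\<i> / s) * iexp (s * -1)) \<le> 1 / \<bar>s\<bar> + 1 / \<bar>s\<bar>"
    by (rule order_trans[OF norm_triangle_ineq4], intro add_mono)
       (simp_all add: norm_mult norm_divide del: of_real_mult)
  then have "cmod (char unif s) \<le> 1 / \<bar>s\<bar>"
    unfolding eq by (simp add: norm_mult)
  then show ?thesis using False by (simp add: field_simps)
qed simp

text \<open>At low frequencies the kernel is replaced by 1; the error is linear in \<open>s\<close>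
  and so carries the factor \<open>\<bar>t\<bar>\<close> that the smoothing bound demands.\<close>

lemma char_unif_minus_1: "cmod (char unif s - 1) \<le> \<bar>s\<bar>"
proof -
  have i: "integrable unif (\<lambda>x. iexp (s * x))"
    by (intro unif.integrable_iexp) auto
  have "char unif s - 1 = (CLINT x|unif. iexp (s * x) - 1)"
    unfolding char_def using i unif.prob_space
    by (subst Bochner_Integration.integral_diff) (auto simp del: unif.space_eq_univ)
  also have "cmod \<dots> \<le> (\<integral>x. cmod (iexp (s * x) - 1) \<partial>unif)"
    by (rule integral_norm_bound)
  also have "\<dots> \<le> (\<integral>x. \<bar>s\<bar> \<partial>unif)"
  proof (rule integral_mono_AE)
    show "integrable unif (\<lambda>x. cmod (iexp (s * x) - 1))" using i by auto
    show "AE x in unif. cmod (iexp (s * x) - 1) \<le> \<bar>s\<bar>"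
      using AE_unif
    proof eventually_elim
      case (elim x)
      have "cmod (iexp (s * x) - 1) \<le> \<bar>s * x\<bar>"
        using iexp_approx1[of "s * x" 0] by simp
      also have "\<dots> \<le> \<bar>s\<bar>"
        using elim by (simp add: abs_mult mult_left_le)
      finally show ?case .
    qed
  qed simp
  finally show ?thesis by simp
qed

text \<open>A weight \<open>K / (1 + t\<^sup>2)\<close> for the difference of the transforms suffices, since it has total mass \<open>K\<pi>\<close>.\<close>

lemma (in real_distribution) inversion_bound:
  fixes g :: "real \<Rightarrow> complex" and G :: "real \<Rightarrow> real"
  assumes na: "\<And>a. measure M {a} = 0"
    and inv: "\<And>a b. a \<le> b \<Longrightarrow> (\<lambda>T::nat. 1 / (2 * pi) * (CLBINT t=-T..T. (iexp (-(t * a)) - iexp (-(t * b))) / (\<i> * t) * g t))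
        \<longlonglongrightarrow> complex_of_real (G b - G a)"
    and lim: "(G \<longlongrightarrow> 0) at_bot"
    and g[measurable]: "g \<in> borel_measurable borel"
    and bound: "\<And>t. cmod (char M t - g t) \<le> K * \<bar>t\<bar> / (1 + t\<^sup>2)"
  shows "\<bar>cdf M y - G y\<bar> \<le> K"
proof -
  have K0: "0 \<le> K"
    using order_trans[OF norm_ge_zero bound[of 1]] by simp
  \<comment> \<open>The kernel of Levy's inversion formula. Division by zero makes it 0 at
    \<open>t = 0\<close>, a null set.\<close>
  define k :: "real \<Rightarrow> real \<Rightarrow> real \<Rightarrow> complex" where
    "k a b t = (iexp (-(t * a)) - iexp (-(t * b))) / (\<i> * t)" for a b t
  have k[measurable]: "k a b \<in> borel_measurable borel" for a b
    unfolding k_def by measurable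
  have kb: "cmod (k a b t) \<le> 2 / \<bar>t\<bar>" for a b t
  proof -
    have "cmod (k a b t) \<le> (1 + 1) / \<bar>t\<bar>"
      unfolding k_def norm_divide norm_mult
      by (auto intro!: divide_right_mono order_trans[OF norm_triangle_ineq4] simp del: of_real_mult of_real_minus)
    then show ?thesis by simp
  qed
  have kb2: "cmod (k a b t) \<le> \<bar>b - a\<bar>" if "a \<le> b" for a b t
  proof (cases "t = 0")
    case False
    then show ?thesis
      using Levy_Inversion_aux2[of "-b" "-a" t] that by (simp add: k_def)
  qed (simp add: k_def)
  have gb: "cmod (g t) \<le> 1 + K" for t
  proof -
    have "cmod (g t) \<le> cmod (char M t) + cmod (char M t - g t)"
      by (metis add.commute norm_minus_commute norm_triangle_sub)
    also have "\<dots> \<le> 1 + K * \<bar>t\<bar> / (1 + t\<^sup>2)"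
      by (intro add_mono cmod_char_le_1 bound)
    also have "K * \<bar>t\<bar> / (1 + t\<^sup>2) \<le> K"
    proof -
      have "0 \<le> (\<bar>t\<bar> - 1)\<^sup>2" by simp
      then have "\<bar>t\<bar> \<le> 1 + t\<^sup>2" by (simp add: power2_eq_square algebra_simps)
      then have "K * \<bar>t\<bar> \<le> K * (1 + t\<^sup>2)" using K0 by (intro mult_left_mono)
      then show ?thesis by (simp add: divide_le_eq add_pos_nonneg)
    qed
    finally show ?thesis by simp
  qed
  have int: "complex_interval_lebesgue_integrable lborel (ereal (-T)) (ereal T) (\<lambda>t. k a b t * h t)"
    if "a \<le> b" and [measurable]: "h \<in> borel_measurable borel" and "\<And>t. cmod (h t) \<le> C" and "T \<ge> 0"
    for a b h C T
    unfolding interval_lebesgue_integrable_def set_integrable_def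
    using that(1,4) mult_mono[OF kb2[OF that(1)] that(3)]
    by (auto intro!: integrableI_bounded_set_indicator[where B="\<bar>b - a\<bar> * C"] simp: norm_mult)
  have main: "cmod (complex_of_real (measure M {a<..b}) - complex_of_real (G b - G a)) \<le> K" if ab: "a \<le> b" for a b
  proof (rule tendsto_upperbound[where F=sequentially])
    let ?I = "\<lambda>T::nat. 1 / (2 * pi) * (CLBINT t=-T..T. k a b t * char M t)"
    let ?J = "\<lambda>T::nat. 1 / (2 * pi) * (CLBINT t=-T..T. k a b t * g t)"
    show "(\<lambda>T. cmod (?I T - ?J T)) \<longlonglongrightarrow> cmod (complex_of_real (measure M {a<..b}) - complex_of_real (G b - G a))"
      unfolding k_def
      by (intro tendsto_norm tendsto_diff Levy_Inversion[OF ab na na] inv[OF ab])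
    have "cmod (?I T - ?J T) \<le> K" for T
    proof -
      \<comment> \<open>The kernel contributes \<open>2 / \<bar>t\<bar>\<close> and the hypothesis
        \<open>K * \<bar>t\<bar> / (1 + t^2)\<close>. The product \<open>2 * K / (1 + t^2)\<close>
        integrates through \<open>arctan\<close> to at most \<open>2 * K * pi\<close>, which the
        prefactor \<open>1 / (2 * pi)\<close> turns into \<open>K\<close>.\<close>
      have "(LINT t|lborel. 2 * K * (indicator {-real T<..<real T} t * inverse (1 + t\<^sup>2)))
          = 2 * K * (LINT t|lborel. indicator {-real T<..<real T} t * inverse (1 + t\<^sup>2))"
        by (rule integral_mult_right_zero)
      moreover have "(LINT t|lborel. indicator {-real T<..<real T} t * inverse (1 + t\<^sup>2))
          = (LBINT t=-real T..real T. inverse (1 + t\<^sup>2))"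
        by (simp add: interval_lebesgue_integral_def set_lebesgue_integral_def)
      moreover have "(LBINT t=-real T..real T. inverse (1 + t\<^sup>2)) = arctan (real T) - arctan (- real T)"
        by (subst interval_integral_FTC_finite[where F = arctan])
           (auto intro!: derivative_eq_intros continuous_intros
             simp: has_real_derivative_iff_has_vector_derivative[symmetric] add_nonneg_eq_0_iff)
      moreover have "2 * K * (arctan (real T) - arctan (- real T)) \<le> 2 * K * pi"
        using arctan_ubound[of "real T"] arctan_lbound[of "- real T"] K0
        by (intro mult_left_mono) auto
      ultimately have I: "(LINT t|lborel. 2 * K * (indicator {-real T<..<real T} t * inverse (1 + t\<^sup>2))) \<le> 2 * K * pi"
        by simp
      have "?I T - ?J T = 1 / (2 * pi) * (CLBINT t=-T..T. k a b t * char M t - k a b t * g t)"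
        using int[OF ab char_measurable cmod_char_le_1, of "real T"] int[OF ab g gb, of "real T"]
        by (subst interval_lebesgue_integral_diff(2)) (auto simp: algebra_simps)
      also have "\<dots> = 1 / (2 * pi) * (CLINT t|lborel. indicator {-real T<..<real T} t *\<^sub>R (k a b t * char M t - k a b t * g t))"
        by (simp add: interval_lebesgue_integral_def set_lebesgue_integral_def)
      finally have d: "?I T - ?J T = 1 / (2 * pi) * (CLINT t|lborel. indicator {-real T<..<real T} t *\<^sub>R (k a b t * char M t - k a b t * g t))" .
      have "cmod (?I T - ?J T) \<le> 1 / (2 * pi) * (LINT t|lborel. 2 * K * (indicator {-real T<..<real T} t * inverse (1 + t\<^sup>2)))"
        unfolding d norm_mult
      proof (rule mult_mono)
        have "cmod (CLINT t|lborel. indicator {-real T<..<real T} t *\<^sub>R (k a b t * char M t - k a b t * g t))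
            \<le> (LINT t|lborel. cmod (indicator {-real T<..<real T} t *\<^sub>R (k a b t * char M t - k a b t * g t)))"
          by (rule integral_norm_bound)
        also have "\<dots> \<le> (LINT t|lborel. 2 * K * (indicator {-real T<..<real T} t * inverse (1 + t\<^sup>2)))"
        proof (rule integral_mono)
          have "integrable lborel (\<lambda>t. indicator {-real T<..<real T} t *\<^sub>R (k a b t * char M t) - indicator {-real T<..<real T} t *\<^sub>R (k a b t * g t))"
            using int[OF ab char_measurable cmod_char_le_1, of "real T"] int[OF ab g gb, of "real T"]
            by (intro Bochner_Integration.integrable_diff)
               (auto simp: interval_lebesgue_integrable_def set_integrable_def)
          then show "integrable lborel (\<lambda>t. cmod (indicator {-real T<..<real T} t *\<^sub>R (k a b t * char M t - k a b t * g t)))"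
            by (intro integrable_norm) (simp add: scaleR_diff_right)
          have "integrable lborel (\<lambda>t. indicator {-real T<..<real T} t *\<^sub>R inverse (1 + t\<^sup>2))"
            by (intro integrableI_bounded_set_indicator[where B=1])
               (auto simp: emeasure_lborel_Ioo field_simps add_pos_nonneg add_nonneg_eq_0_iff)
          then show "integrable lborel (\<lambda>t. 2 * K * (indicator {-real T<..<real T} t * inverse (1 + t\<^sup>2)))"
            by (intro integrable_mult_right) simp
          fix t
          have "cmod (k a b t * char M t - k a b t * g t) \<le> 2 / \<bar>t\<bar> * (K * \<bar>t\<bar> / (1 + t\<^sup>2))"
            unfolding right_diff_distrib[symmetric] norm_mult
            by (intro mult_mono kb bound) auto
          also have "\<dots> \<le> 2 * K * inverse (1 + t\<^sup>2)"
            using K0 by (cases "t = 0") (auto simp: field_simps)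
          finally show "cmod (indicator {-real T<..<real T} t *\<^sub>R (k a b t * char M t - k a b t * g t))
              \<le> 2 * K * (indicator {-real T<..<real T} t * inverse (1 + t\<^sup>2))"
            by (auto split: split_indicator)
        qed
        finally show "cmod (CLINT t|lborel. indicator {-real T<..<real T} t *\<^sub>R (k a b t * char M t - k a b t * g t))
            \<le> (LINT t|lborel. 2 * K * (indicator {-real T<..<real T} t * inverse (1 + t\<^sup>2)))" .
        show "cmod (complex_of_real (1 / (2 * pi))) \<le> 1 / (2 * pi)"
          by (simp only: norm_of_real) simp
        show "0 \<le> 1 / (2 * pi)" by simp
      qed (rule norm_ge_zero)
      moreover have "1 / (2 * pi) * (LINT t|lborel. 2 * K * (indicator {-real T<..<real T} t * inverse (1 + t\<^sup>2)))
          \<le> 1 / (2 * pi) * (2 * K * pi)"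
        by (intro mult_left_mono I) auto
      moreover have "1 / (2 * pi) * (2 * K * pi) = K" by simp
      ultimately show ?thesis by linarith
    qed
    then show "\<forall>\<^sub>F T in sequentially. cmod (?I T - ?J T) \<le> K" by simp
  qed simp
  have main': "\<bar>(cdf M b - cdf M a) - (G b - G a)\<bar> \<le> K" if "a < b" for a b
  proof -
    have "complex_of_real (measure M {a<..b}) - complex_of_real (G b - G a)
        = complex_of_real ((cdf M b - cdf M a) - (G b - G a))"
      using that by (simp add: cdf_diff_eq)
    then show ?thesis
      using main[of a b] that by (metis less_imp_le norm_of_real)
  qed
  \<comment> \<open>Inversion sees only increments; \<open>cdf M\<close> and \<open>G\<close> both
    vanish at minus infinity, so moving the left end point there yields the values
    themselves.\<close>
  have "\<bar>(cdf M y - 0) - (G y - 0)\<bar> \<le> K"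
  proof (rule tendsto_upperbound[where F=at_bot])
    show "((\<lambda>a. \<bar>(cdf M y - cdf M a) - (G y - G a)\<bar>) \<longlongrightarrow> \<bar>(cdf M y - 0) - (G y - 0)\<bar>) at_bot"
      by (intro tendsto_intros cdf_lim_at_bot lim)
    show "\<forall>\<^sub>F a in at_bot. \<bar>(cdf M y - cdf M a) - (G y - G a)\<bar> \<le> K"
      unfolding eventually_at_bot_dense using main' by blast
  qed simp
  then show ?thesis by simp
qed

text \<open>Adding an independent \<open>\<theta> * U\<close>, with \<open>U\<close> uniform on
  \<open>[-1, 1]\<close>, removes atoms and multiplies the transform by
  \<open>char unif (\<theta> * t)\<close>, so that \<open>inversion_bound\<close> applies. As the
  sum differs from \<open>S\<close> by at most \<open>\<theta>\<close>, the original distribution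
  function lies between two shifts of the smoothed one, and the Lipschitz bound on \<open>G\<close>
  charges \<open>L * \<theta>\<close> for the shift.\<close>

lemma smoothing:
  fixes g :: "real \<Rightarrow> complex" and G :: "real \<Rightarrow> real" and S :: "'a \<Rightarrow> real"
  assumes M: "prob_space M" and S[measurable]: "S \<in> borel_measurable M" and th: "0 < \<theta>"
    and inv: "\<And>a b. a \<le> b \<Longrightarrow> (\<lambda>T::nat. 1 / (2 * pi) * (CLBINT t=-T..T. (iexp (-(t * a)) - iexp (-(t * b))) / (\<i> * t) * g t))
        \<longlonglongrightarrow> complex_of_real (G b - G a)"
    and lim: "(G \<longlongrightarrow> 0) at_bot"
    and g[measurable]: "g \<in> borel_measurable borel"
    and bound: "\<And>t. cmod ((CLINT w|M. iexp (t * S w)) * char unif (\<theta> * t) - g t) \<le> K * \<bar>t\<bar> / (1 + t\<^sup>2)"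
    and lip: "\<And>y y'. \<bar>G y - G y'\<bar> \<le> L * \<bar>y - y'\<bar>"
  shows "\<bar>measure M {w \<in> space M. S w \<le> y} - G y\<bar> \<le> K + L * \<theta>"
proof -
  interpret M: prob_space M by (rule M)
  interpret P: pair_prob_space M unif ..
  define R where "R = (\<lambda>(w, u). S w + \<theta> * u)"
  have R[measurable]: "R \<in> borel_measurable (M \<Otimes>\<^sub>M unif)"
    unfolding R_def by measurable
  define \<nu> where "\<nu> = distr (M \<Otimes>\<^sub>M unif) borel R"
  interpret \<nu>: real_distribution \<nu>
    unfolding \<nu>_def by (rule P.real_distribution_distr) measurable
  have na: "measure \<nu> {a} = 0" for a
  proof -
    have "emeasure \<nu> {a} = emeasure (M \<Otimes>\<^sub>M unif) (R -` {a} \<inter> space (M \<Otimes>\<^sub>M unif))"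
      unfolding \<nu>_def by (subst emeasure_distr) auto
    also have "\<dots> = (\<integral>\<^sup>+w. emeasure unif (Pair w -` (R -` {a} \<inter> space (M \<Otimes>\<^sub>M unif))) \<partial>M)"
      by (rule unif.emeasure_pair_measure_alt) measurable
    \<comment> \<open>For fixed \<open>w\<close> only one value of the uniform variable leads to
      \<open>a\<close>.\<close>
    also have "\<dots> = (\<integral>\<^sup>+w. 0 \<partial>M)"
    proof (rule nn_integral_cong)
      fix w assume "w \<in> space M"
      have "Pair w -` (R -` {a} \<inter> space (M \<Otimes>\<^sub>M unif)) \<subseteq> {(a - S w) / \<theta>}"
        using th by (auto simp: R_def field_simps)
      moreover have "emeasure unif {c} = 0" for c
      proof -
        have "emeasure unif {c} = (\<integral>\<^sup>+x. ennreal (indicator {- 1..1} x / 2) * indicator {c} x \<partial>lborel)"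
          unfolding unif_def by (subst emeasure_density) auto
        also have "\<dots> = (\<integral>\<^sup>+(x::real). 0 \<partial>lborel)"
          by (intro nn_integral_cong_AE) (use AE_lborel_singleton[of c] in \<open>auto elim!: eventually_mono\<close>)
        finally show ?thesis by simp
      qed
      ultimately show "emeasure unif (Pair w -` (R -` {a} \<inter> space (M \<Otimes>\<^sub>M unif))) = 0"
        by (metis emeasure_mono le_zero_eq unif.M_is_borel insert_Diff subset_singletonD emeasure_empty)
    qed
    finally show ?thesis by (simp add: measure_def)
  qed
  have ch: "char \<nu> t = (CLINT w|M. iexp (t * S w)) * char unif (\<theta> * t)" for t
  proof -
    have "char \<nu> t = (CLINT p|(M \<Otimes>\<^sub>M unif). iexp (t * R p))"
      unfolding \<nu>_def char_def by (subst integral_distr) auto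
    also have "\<dots> = (CLINT w|M. CLINT u|unif. iexp (t * R (w, u)))"
      by (rule P.integral_fst'[symmetric]) (auto intro!: P.integrable_iexp)
    also have "\<dots> = (CLINT w|M. CLINT u|unif. iexp (t * S w) * iexp (\<theta> * t * u))"
      unfolding R_def by (simp add: algebra_simps exp_add[symmetric])
    also have "\<dots> = (CLINT w|M. iexp (t * S w) * char unif (\<theta> * t))"
      unfolding char_def by (subst integral_mult_right_zero) auto
    finally show ?thesis by simp
  qed
  have B: "\<bar>cdf \<nu> z - G z\<bar> \<le> K" for z
    by (rule \<nu>.inversion_bound[OF na inv lim g]) (use bound in \<open>auto simp: ch\<close>)
  have cdf: "cdf \<nu> z = measure (M \<Otimes>\<^sub>M unif) {p \<in> space (M \<Otimes>\<^sub>M unif). R p \<le> z}" for z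
    unfolding cdf_def \<nu>_def by (subst measure_distr) (auto intro!: arg_cong[where f="measure _"])
  have fst: "measure M {w \<in> space M. S w \<le> y} = measure (M \<Otimes>\<^sub>M unif) {p \<in> space (M \<Otimes>\<^sub>M unif). S (fst p) \<le> y}"
  proof -
    have "measure (M \<Otimes>\<^sub>M unif) {p \<in> space (M \<Otimes>\<^sub>M unif). S (fst p) \<le> y} = measure (M \<Otimes>\<^sub>M unif) ({w \<in> space M. S w \<le> y} \<times> space unif)"
      by (intro arg_cong[where f="measure _"]) (auto simp: space_pair_measure)
    also have "\<dots> = measure M {w \<in> space M. S w \<le> y} * measure unif (space unif)"
      unfolding measure_def by (subst unif.emeasure_pair_measure_Times) (auto simp: enn2real_mult)
    finally show ?thesis by simp
  qed
  have ae: "AE p in M \<Otimes>\<^sub>M unif. \<bar>snd p\<bar> \<le> 1"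
  proof -
    have "AE w in M. AE u in unif. \<bar>snd (w, u)\<bar> \<le> 1"
      using AE_unif by simp
    moreover have "{p \<in> space (M \<Otimes>\<^sub>M unif). \<bar>snd p\<bar> \<le> 1} \<in> sets (M \<Otimes>\<^sub>M unif)"
      by measurable
    ultimately show ?thesis
      by (intro P.AE_pair_measure)
  qed
  have up: "measure M {w \<in> space M. S w \<le> y} \<le> cdf \<nu> (y + \<theta>)"
    unfolding fst cdf
  proof (rule P.finite_measure_mono_AE)
    show "AE p in M \<Otimes>\<^sub>M unif. p \<in> {p \<in> space (M \<Otimes>\<^sub>M unif). S (fst p) \<le> y} \<longrightarrow> p \<in> {p \<in> space (M \<Otimes>\<^sub>M unif). R p \<le> y + \<theta>}"
      using ae
    proof eventually_elim
      case (elim p)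
      then have "\<theta> * snd p \<le> \<theta> * 1" using th by (intro mult_left_mono) auto
      then show ?case by (auto simp: R_def split: prod.splits)
    qed
  qed measurable
  have lo: "cdf \<nu> (y - \<theta>) \<le> measure M {w \<in> space M. S w \<le> y}"
    unfolding fst cdf
  proof (rule P.finite_measure_mono_AE)
    show "AE p in M \<Otimes>\<^sub>M unif. p \<in> {p \<in> space (M \<Otimes>\<^sub>M unif). R p \<le> y - \<theta>} \<longrightarrow> p \<in> {p \<in> space (M \<Otimes>\<^sub>M unif). S (fst p) \<le> y}"
      using ae
    proof eventually_elim
      case (elim p)
      then have "\<theta> * (- snd p) \<le> \<theta> * 1" using th by (intro mult_left_mono) auto
      then show ?case by (auto simp: R_def split: prod.splits)
    qed
  qed measurable
  have "\<bar>G (y + \<theta>) - G y\<bar> \<le> L * \<theta>" "\<bar>G (y - \<theta>) - G y\<bar> \<le> L * \<theta>"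
    using lip[of "y + \<theta>" y] lip[of "y - \<theta>" y] th by auto
  then show ?thesis
    using up lo B[of "y + \<theta>"] B[of "y - \<theta>"] by linarith
qed

section \<open>Edgeworth distribution functions\<close>

interpretation nd: real_distribution std_normal_distribution
  by (rule real_dist_normal_dist)

text \<open>The polynomials \<open>1\<close>, \<open>y\<close>, \<open>y^2 - 1\<close> are the
  Hermite polynomials of degree 0, 1, 2. The derivative of \<open>- phi\<close> times the one of
  degree \<open>j - 1\<close> is \<open>phi\<close> times the one of degree \<open>j\<close>, whose
  Fourier transform is \<open>(\<i> * t) ^ j * exp (- t^2 / 2)\<close>; thus
  \<open>edge_char\<close> is the transform belonging to the same coefficients.\<close>

definition edge_cdf :: "real \<Rightarrow> real \<Rightarrow> real \<Rightarrow> real \<Rightarrow> real" where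
  "edge_cdf a1 a2 a3 y = Phi y - phi y * (a1 + a2 * y + a3 * (y\<^sup>2 - 1))"

definition edge_char :: "real \<Rightarrow> real \<Rightarrow> real \<Rightarrow> real \<Rightarrow> complex" where
  "edge_char a1 a2 a3 t = complex_of_real (exp (- (t\<^sup>2) / 2)) * (1 + (\<i> * t) * a1 + (\<i> * t)\<^sup>2 * a2 + (\<i> * t) ^ 3 * a3)"

lemma phi_nonneg: "0 \<le> phi x"
  by (simp add: phi_def)

lemma phi_exp: "exp (- (x\<^sup>2) / 2) = sqrt (2 * pi) * phi x"
  by (simp add: phi_def std_normal_density_def)

text \<open>Both \<open>1\<close> and half the square of \<open>c * y^2\<close> lie below
  \<open>exp (c * y^2)\<close>, and \<open>\<bar>y\<bar> ^ k \<le> 1 + y ^ 4\<close>; together they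
  give the factor 3. The case \<open>k = 4\<close> is reached when a cubic polynomial is multiplied
  by one more \<open>\<bar>t\<bar>\<close>.\<close>

lemma power_exp_bound:
  fixes y c :: real
  assumes "k \<le> 4" "0 < c" "c \<le> 1"
  shows "\<bar>y\<bar> ^ k * exp (- c * y\<^sup>2) \<le> 3 / c\<^sup>2"
proof -
  have "(c * y\<^sup>2)\<^sup>2 / 2 \<le> exp (c * y\<^sup>2)" "1 \<le> exp (c * y\<^sup>2)"
    using exp_lower_Taylor_quadratic[of "c * y\<^sup>2"] mult_nonneg_nonneg[of c "y\<^sup>2"] assms
    by (simp_all del: mult_nonneg_nonneg)
  moreover have le: "\<bar>y\<bar> ^ k \<le> 1 + y ^ 4"
  proof (cases "\<bar>y\<bar> \<le> 1")
    case True
    then have "\<bar>y\<bar> ^ k \<le> 1" by (simp add: power_le_one)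
    moreover have "0 \<le> y ^ 4" by simp
    ultimately show ?thesis by linarith
  next
    case False
    then have "\<bar>y\<bar> ^ k \<le> \<bar>y\<bar> ^ 4" using assms by (intro power_increasing) auto
    then show ?thesis by simp
  qed
  moreover have "c\<^sup>2 * (1 + y ^ 4) = c\<^sup>2 + (c * y\<^sup>2)\<^sup>2"
    by (simp add: power2_eq_square power4_eq_xxxx algebra_simps)
  moreover have "c\<^sup>2 \<le> 1" using assms by (simp add: power_le_one)
  moreover have "c\<^sup>2 * \<bar>y\<bar> ^ k \<le> c\<^sup>2 * (1 + y ^ 4)" using le by (intro mult_left_mono) auto
  ultimately have *: "c\<^sup>2 * \<bar>y\<bar> ^ k \<le> 3 * exp (c * y\<^sup>2)"
    by linarith
  have "c\<^sup>2 * (\<bar>y\<bar> ^ k * exp (- c * y\<^sup>2)) = (c\<^sup>2 * \<bar>y\<bar> ^ k) * exp (- (c * y\<^sup>2))"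
    by simp
  also have "\<dots> \<le> 3 * exp (c * y\<^sup>2) * exp (- (c * y\<^sup>2))"
    using * by (intro mult_right_mono) auto
  also have "\<dots> = 3" by (simp flip: exp_add)
  finally show ?thesis
    using assms by (simp add: pos_le_divide_eq mult.commute)
qed

text \<open>The constant is \<open>3 / c^2\<close> at \<open>c = 1/2\<close>; it recurs as the 12 in
  the Taylor and Lipschitz bounds for \<open>Phi\<close>.\<close>

lemma power_phi_bound:
  assumes "k \<le> 4"
  shows "\<bar>y\<bar> ^ k * phi y \<le> 12"
proof -
  have "phi y \<le> exp (- (1/2) * y\<^sup>2)"
  proof -
    have "1 \<le> sqrt (2 * pi)" using pi_ge_two by simp
    then have "1 * phi y \<le> sqrt (2 * pi) * phi y" by (intro mult_right_mono phi_nonneg)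
    then show ?thesis using phi_exp[of y] by simp
  qed
  then have "\<bar>y\<bar> ^ k * phi y \<le> \<bar>y\<bar> ^ k * exp (- (1/2) * y\<^sup>2)" by (intro mult_left_mono) auto
  also have "\<dots> \<le> 3 / (1/2)\<^sup>2" using assms by (intro power_exp_bound) auto
  finally show ?thesis by (simp add: power2_eq_square)
qed

lemma phi_deriv: "(phi has_real_derivative - x * phi x) (at x)"
  unfolding phi_def[abs_def] std_normal_density_def
  by (auto intro!: derivative_eq_intros simp: field_simps)

lemma integrable_indicator_std_normal_density:
  "A \<in> sets borel \<Longrightarrow> integrable lborel (\<lambda>t. indicator A t * std_normal_density t)"
  using integrable_mult_indicator[of A lborel std_normal_density] by (simp add: integrable_normal_density)

lemma Phi_cdf: "Phi x = cdf std_normal_distribution x"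
proof -
  have i: "integrable lborel (\<lambda>t. indicator {..x} t * std_normal_density t)"
    by (rule integrable_indicator_std_normal_density) auto
  have "emeasure std_normal_distribution {..x} = (\<integral>\<^sup>+t. ennreal (indicator {..x} t * std_normal_density t) \<partial>lborel)"
    by (subst emeasure_density) (auto intro!: nn_integral_cong split: split_indicator)
  also have "\<dots> = ennreal (LINT t|lborel. indicator {..x} t * std_normal_density t)"
    using i by (intro nn_integral_eq_integral) (auto split: split_indicator)
  finally show ?thesis
    unfolding cdf_def measure_def Phi_def set_lebesgue_integral_def
    by (simp add: Bochner_Integration.integral_nonneg)
qed

text \<open>\<open>Phi\<close> is an integral over a half-line; splitting off the fixed part up to
  \<open>x - 1\<close> leaves a compact interval, to which the fundamental theorem applies.\<close>

lemma Phi_deriv: "(Phi has_real_derivative phi x) (at x)"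
proof -
  have cont: "continuous_on A phi" for A
    unfolding phi_def[abs_def] std_normal_density_def by (intro continuous_intros) auto
  have eq: "Phi u = Phi (x - 1) + (LBINT t=x-1..u. phi t)" if "u \<in> {x - 1..x + 1}" for u
  proof -
    have "Phi u = (LBINT t:{..x-1} \<union> {x-1<..u}. std_normal_density t)"
      unfolding Phi_def using that by (intro arg_cong2[where f="set_lebesgue_integral lborel"]) auto
    also have "\<dots> = Phi (x - 1) + (LBINT t:{x-1<..u}. std_normal_density t)"
      unfolding Phi_def
      by (rule set_integral_Un)
         (auto simp: set_integrable_def intro!: integrable_indicator_std_normal_density)
    also have "(LBINT t:{x-1<..u}. std_normal_density t) = (LBINT t=x-1..u. phi t)"
      using that interval_integral_Ioc[of "x - 1" u phi] by (simp add: phi_def[abs_def])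
    finally show ?thesis .
  qed
  have "((\<lambda>u. LBINT t=x-1..u. phi t) has_vector_derivative phi x) (at x within {x - 1..x + 1})"
    by (rule interval_integral_FTC2) (auto intro: cont)
  then have "((\<lambda>u. Phi (x - 1) + (LBINT t=x-1..u. phi t)) has_vector_derivative 0 + phi x) (at x within {x - 1..x + 1})"
    by (intro derivative_intros)
  then have "(Phi has_vector_derivative phi x) (at x within {x - 1..x + 1})"
    by (intro has_vector_derivative_transform[OF _ eq]) auto
  moreover have "at x within {x - 1..x + 1} = at x"
    by (intro at_within_interior) simp
  ultimately show ?thesis by (simp add: has_real_derivative_iff_has_vector_derivative)
qed

lemma lipschitz_by_deriv:
  fixes h :: "real \<Rightarrow> real"
  assumes "\<And>x. (h has_real_derivative h' x) (at x)" "\<And>x. \<bar>h' x\<bar> \<le> C"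
  shows "\<bar>h x - h y\<bar> \<le> C * \<bar>x - y\<bar>"
  using field_differentiable_bound[of UNIV h h' C x y] assms by simp

text \<open>The derivative is a combination of terms \<open>x ^ k * phi x\<close> with
  \<open>k \<le> 3\<close>, each at most 12 in modulus. The coefficient \<open>a3\<close> occurs
  with total multiplicity four, whence 48.\<close>

lemma edge_poly_lipschitz:
  "\<bar>phi x * (a1 + a2 * x + a3 * (x\<^sup>2 - 1)) - phi y * (a1 + a2 * y + a3 * (y\<^sup>2 - 1))\<bar>
    \<le> 48 * (\<bar>a1\<bar> + \<bar>a2\<bar> + \<bar>a3\<bar>) * \<bar>x - y\<bar>"
proof (rule lipschitz_by_deriv)
  show "((\<lambda>x. phi x * (a1 + a2 * x + a3 * (x\<^sup>2 - 1))) has_real_derivative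
      phi x * (a2 + 2 * a3 * x) - x * phi x * (a1 + a2 * x + a3 * (x\<^sup>2 - 1))) (at x)" for x
    by (auto intro!: derivative_eq_intros phi_deriv simp: algebra_simps)
  show "\<bar>phi x * (a2 + 2 * a3 * x) - x * phi x * (a1 + a2 * x + a3 * (x\<^sup>2 - 1))\<bar> \<le> 48 * (\<bar>a1\<bar> + \<bar>a2\<bar> + \<bar>a3\<bar>)" for x
  proof -
    have b: "\<bar>x ^ k * phi x\<bar> \<le> 12" if "k \<le> 4" for k
      using power_phi_bound[OF that, of x] by (simp add: abs_mult power_abs phi_nonneg)
    have eq: "phi x * (a2 + 2 * a3 * x) - x * phi x * (a1 + a2 * x + a3 * (x\<^sup>2 - 1)) =
      - a1 * (x ^ 1 * phi x) + a2 * (x ^ 0 * phi x) - a2 * (x ^ 2 * phi x) + 3 * a3 * (x ^ 1 * phi x) - a3 * (x ^ 3 * phi x)"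
      by (simp add: algebra_simps power2_eq_square power3_eq_cube)
    have c: "\<bar>c * (x ^ k * phi x)\<bar> \<le> \<bar>c\<bar> * 12" if "k \<le> 4" for c k
      unfolding abs_mult[of c] by (intro mult_left_mono b that) auto
    have gen: "\<bar>t1 + t2 - t3 + t4 - t5\<bar> \<le> 48 * (b1 + b2 + b3)"
      if "\<bar>t1\<bar> \<le> b1 * 12" "\<bar>t2\<bar> \<le> b2 * 12" "\<bar>t3\<bar> \<le> b2 * 12" "\<bar>t4\<bar> \<le> 3 * (b3 * 12)" "\<bar>t5\<bar> \<le> b3 * 12"
      for t1 t2 t3 t4 t5 b1 b2 b3 :: real
      using that by argo
    have c': "\<bar>- a1 * (x ^ 1 * phi x)\<bar> \<le> \<bar>a1\<bar> * 12" "\<bar>3 * a3 * (x ^ 1 * phi x)\<bar> \<le> 3 * (\<bar>a3\<bar> * 12)"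
      using c[of 1 "- a1"] c[of 1 "3 * a3"] by (simp_all add: abs_mult)
    show ?thesis
      unfolding eq by (rule gen; (rule c' c)?) auto
  qed
qed

lemma Phi_taylor: "\<bar>Phi (x + h) - Phi x - phi x * h\<bar> \<le> 12 * h\<^sup>2"
proof -
  have "\<exists>z. \<bar>z - x\<bar> \<le> \<bar>h\<bar> \<and> Phi (x + h) - Phi x = h * phi z"
  proof (cases h "0 :: real" rule: linorder_cases)
    case less
    then obtain z where "x + h < z" "z < x" "Phi x - Phi (x + h) = (x - (x + h)) * phi z"
      using MVT2[of "x + h" x Phi phi] Phi_deriv by auto
    then show ?thesis by (intro exI[of _ z]) (auto simp: algebra_simps)
  next
    case greater
    then obtain z where "x < z" "z < x + h" "Phi (x + h) - Phi x = (x + h - x) * phi z"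
      using MVT2[of x "x + h" Phi phi] Phi_deriv by auto
    then show ?thesis by (intro exI[of _ z]) auto
  qed auto
  then obtain z where z: "\<bar>z - x\<bar> \<le> \<bar>h\<bar>" "Phi (x + h) - Phi x = h * phi z" by blast
  have "\<bar>phi z - phi x\<bar> \<le> 12 * \<bar>z - x\<bar>"
    using phi_deriv power_phi_bound[of 1]
    by (intro lipschitz_by_deriv[where h' = "\<lambda>x. - x * phi x"]) (auto simp: abs_mult phi_nonneg)
  also have "\<dots> \<le> 12 * \<bar>h\<bar>" using z by simp
  finally have "\<bar>h\<bar> * \<bar>phi z - phi x\<bar> \<le> \<bar>h\<bar> * (12 * \<bar>h\<bar>)" by (intro mult_left_mono) auto
  moreover have "Phi (x + h) - Phi x - phi x * h = h * (phi z - phi x)" using z by (simp add: algebra_simps)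
  ultimately show ?thesis by (simp add: abs_mult power2_eq_square)
qed

lemma Phi_lipschitz: "\<bar>Phi x - Phi y\<bar> \<le> 12 * \<bar>x - y\<bar>"
  using Phi_deriv power_phi_bound[of 0]
  by (intro lipschitz_by_deriv[where h' = phi]) (auto simp: phi_nonneg)

lemma edge_cdf_lipschitz:
  "\<bar>edge_cdf a1 a2 a3 x - edge_cdf a1 a2 a3 y\<bar> \<le> 48 * (1 + \<bar>a1\<bar> + \<bar>a2\<bar> + \<bar>a3\<bar>) * \<bar>x - y\<bar>"
proof -
  define p where "p z = phi z * (a1 + a2 * z + a3 * (z\<^sup>2 - 1))" for z
  have "\<bar>p x - p y\<bar> \<le> 48 * (\<bar>a1\<bar> + \<bar>a2\<bar> + \<bar>a3\<bar>) * \<bar>x - y\<bar>"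
    unfolding p_def by (rule edge_poly_lipschitz)
  moreover have "48 * (1 + \<bar>a1\<bar> + \<bar>a2\<bar> + \<bar>a3\<bar>) * \<bar>x - y\<bar> = 48 * (\<bar>a1\<bar> + \<bar>a2\<bar> + \<bar>a3\<bar>) * \<bar>x - y\<bar> + 48 * \<bar>x - y\<bar>"
    by (simp add: algebra_simps)
  ultimately show ?thesis
    using Phi_lipschitz[of x y] unfolding edge_cdf_def p_def[symmetric] by linarith
qed

lemma edge_cdf_at_bot: "(edge_cdf a1 a2 a3 \<longlongrightarrow> 0) at_bot"
proof -
  have "(Phi \<longlongrightarrow> 0) at_bot"
    unfolding Phi_cdf[abs_def] by (rule nd.cdf_lim_at_bot)
  moreover have "((\<lambda>y. phi y * (a1 + a2 * y + a3 * (y\<^sup>2 - 1))) \<longlongrightarrow> 0) at_bot"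
    unfolding phi_def std_normal_density_def by real_asymp
  ultimately have "((\<lambda>y. Phi y - phi y * (a1 + a2 * y + a3 * (y\<^sup>2 - 1))) \<longlongrightarrow> 0 - 0) at_bot"
    by (intro tendsto_diff)
  then show ?thesis by (simp add: edge_cdf_def[abs_def])
qed

text \<open>Half of the Gaussian exponent absorbs \<open>\<bar>t\<bar> ^ 4\<close> at the cost
  \<open>3 / (1/4)^2 = 48\<close>; the other half survives as decay and makes the comparison
  function negligible beyond frequency \<open>ln N\<close>.\<close>

lemma edge_char_bound:
  assumes "1 \<le> \<bar>t\<bar>"
  shows "cmod (edge_char a1 a2 a3 t) * \<bar>t\<bar> \<le> 48 * (1 + \<bar>a1\<bar> + \<bar>a2\<bar> + \<bar>a3\<bar>) * exp (- (t\<^sup>2) / 4)"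
proof -
  have "cmod (1 + (\<i> * t) * a1 + (\<i> * t)\<^sup>2 * a2 + (\<i> * t) ^ 3 * a3)
      \<le> 1 + \<bar>t\<bar> * \<bar>a1\<bar> + \<bar>t\<bar>\<^sup>2 * \<bar>a2\<bar> + \<bar>t\<bar> ^ 3 * \<bar>a3\<bar>"
    by (intro order_trans[OF norm_triangle_ineq] add_mono order_refl)
       (auto simp: norm_mult norm_power power_mult_distrib)
  also have "\<dots> \<le> \<bar>t\<bar> ^ 3 * (1 + \<bar>a1\<bar> + \<bar>a2\<bar> + \<bar>a3\<bar>)"
    using assms power_increasing[of 1 3 "\<bar>t\<bar>"] power_increasing[of 2 3 "\<bar>t\<bar>"] one_le_power[of "\<bar>t\<bar>" 3]
    by (auto simp: algebra_simps simp del: power2_abs power_abs intro!: add_mono mult_left_mono)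
  finally have "cmod (edge_char a1 a2 a3 t) * \<bar>t\<bar> \<le> exp (- (t\<^sup>2) / 2) * (\<bar>t\<bar> ^ 3 * (1 + \<bar>a1\<bar> + \<bar>a2\<bar> + \<bar>a3\<bar>)) * \<bar>t\<bar>"
    unfolding edge_char_def norm_mult by (intro mult_right_mono mult_mono) auto
  also have "\<dots> = (1 + \<bar>a1\<bar> + \<bar>a2\<bar> + \<bar>a3\<bar>) * exp (- (t\<^sup>2) / 4) * (\<bar>t\<bar> ^ 4 * exp (- (1/4) * t\<^sup>2))"
  proof -
    have "exp (- (t\<^sup>2) / 2) = exp (- (t\<^sup>2) / 4) * exp (- (1/4) * t\<^sup>2)"
      by (simp flip: exp_add)
    then show ?thesis by (simp add: power4_eq_xxxx power3_eq_cube)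
  qed
  also have "\<dots> \<le> (1 + \<bar>a1\<bar> + \<bar>a2\<bar> + \<bar>a3\<bar>) * exp (- (t\<^sup>2) / 4) * (3 / (1/4)\<^sup>2)"
    by (intro mult_left_mono power_exp_bound) auto
  also have "\<dots> = 48 * (1 + \<bar>a1\<bar> + \<bar>a2\<bar> + \<bar>a3\<bar>) * exp (- (t\<^sup>2) / 4)"
    by (simp add: power2_eq_square)
  finally show ?thesis .
qed

lemma CLBINT_symmetric_limit:
  fixes h :: "real \<Rightarrow> complex"
  assumes [measurable]: "integrable lborel h"
  shows "(\<lambda>T::nat. CLBINT t=ereal (real_of_int (- int T))..ereal (real T). h t) \<longlonglongrightarrow> (CLINT t|lborel. h t)"
proof -
  have "(\<lambda>T::nat. CLINT t|lborel. indicator {-real T<..<real T} t *\<^sub>R h t) \<longlonglongrightarrow> (CLINT t|lborel. h t)"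
  proof (rule integral_dominated_convergence[where w="\<lambda>t. norm (h t)"])
    show "AE t in lborel. (\<lambda>T. indicator {-real T<..<real T} t *\<^sub>R h t) \<longlonglongrightarrow> h t"
    proof (rule AE_I2)
      fix t :: real
      obtain n :: nat where n: "\<bar>t\<bar> < real n" using reals_Archimedean2 by blast
      have "\<forall>\<^sub>F T in sequentially. indicator {-real T<..<real T} t *\<^sub>R h t = h t"
        using eventually_ge_at_top[of n] by eventually_elim (use n in \<open>auto split: split_indicator\<close>)
      then show "(\<lambda>T. indicator {-real T<..<real T} t *\<^sub>R h t) \<longlonglongrightarrow> h t"
        by (rule tendsto_eventually)
    qed
  qed (use assms in \<open>auto split: split_indicator\<close>)
  then show ?thesis
    by (simp add: interval_lebesgue_integral_def set_lebesgue_integral_def)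
qed

section \<open>Fourier integrals of the Gaussian density times powers\<close>

context
  fixes a :: real
begin

private definition e :: "real \<Rightarrow> complex" where "e t = iexp (-(t * a))"

private lemma e_deriv: "(e has_vector_derivative - (\<i> * a) * e t) (at t within s)"
  unfolding e_def[abs_def]
  by (auto intro!: derivative_eq_intros simp: has_vector_derivative_complex_iff Re_exp Im_exp)

private lemma e_norm: "cmod (e t) = 1"
  unfolding e_def by (simp del: of_real_mult of_real_minus)

private lemma e_cont: "continuous_on s e"
  unfolding e_def[abs_def] by (intro continuous_intros)

private lemma e_meas[measurable]: "e \<in> borel_measurable borel"
  unfolding e_def[abs_def] by measurable

private lemma int: "integrable lborel (\<lambda>t. e t * of_real (phi t * t ^ k))"
proof (rule Bochner_Integration.integrable_bound)
  show "integrable lborel (\<lambda>t. std_normal_density t * t ^ k)" by (rule integrable_std_normal_moment)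
qed (auto simp: norm_mult e_norm phi_def abs_mult norm_power power_abs)

private definition m :: "nat \<Rightarrow> complex" where "m k = (CLINT t|lborel. e t * of_real (phi t * t ^ k))"

private lemma m0: "m 0 = of_real (exp (- (a\<^sup>2) / 2))"
proof -
  have "char std_normal_distribution (- a) = (CLINT t|lborel. std_normal_density t *\<^sub>R iexp (- a * t))"
    unfolding char_def by (subst integral_density) auto
  also have "\<dots> = m 0"
    unfolding m_def e_def phi_def by (intro Bochner_Integration.integral_cong) (auto simp: scaleR_conv_of_real mult.commute)
  finally show ?thesis by (simp add: char_std_normal_distribution)
qed

private lemma ftc:
  assumes F: "\<And>t. (F has_vector_derivative f t) (at t)" and f: "integrable lborel f" "continuous_on UNIV f"
    and lim: "(\<lambda>T. norm (F (real T))) \<longlonglongrightarrow> 0" "(\<lambda>T. norm (F (- real T))) \<longlonglongrightarrow> 0"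
  shows "(CLINT t|lborel. f t) = 0"
proof -
  have "(CLBINT t=-real T..real T. f t) = F (real T) - F (- real T)" for T :: nat
    by (rule interval_integral_FTC_finite)
       (auto intro: continuous_on_subset[OF f(2)] has_vector_derivative_at_within[OF F])
  moreover have "(\<lambda>T. F (real T) - F (- real T)) \<longlonglongrightarrow> 0 - 0"
    using lim by (intro tendsto_diff) (auto intro: tendsto_norm_zero_cancel)
  ultimately show ?thesis
    using CLBINT_symmetric_limit[OF f(1)] LIMSEQ_unique by fastforce
qed

private lemma phi_lim:
  "(\<lambda>T. norm (e (real T) * of_real (phi (real T) * real T ^ k))) \<longlonglongrightarrow> 0"
  "(\<lambda>T. norm (e (- real T) * of_real (phi (- real T) * (- real T) ^ k))) \<longlonglongrightarrow> 0"
proof -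
  have *: "(\<lambda>T. phi (real T) * real T ^ k) \<longlonglongrightarrow> 0"
    unfolding phi_def std_normal_density_def by real_asymp
  show "(\<lambda>T. norm (e (real T) * of_real (phi (real T) * real T ^ k))) \<longlonglongrightarrow> 0"
    using * by (simp add: norm_mult e_norm phi_def norm_power del: of_real_mult)
  have "norm (e (- real T) * of_real (phi (- real T) * (- real T) ^ k)) = phi (real T) * real T ^ k" for T
    unfolding norm_mult e_norm norm_of_real by (simp add: abs_mult power_abs phi_def std_normal_density_def)
  then show "(\<lambda>T. norm (e (- real T) * of_real (phi (- real T) * (- real T) ^ k))) \<longlonglongrightarrow> 0"
    using * by simp
qed

private lemma phi_cont: "continuous_on s phi"
  unfolding phi_def[abs_def] std_normal_density_def by (intro continuous_intros) auto

private lemma m_linear: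
  "(CLINT t|lborel. c1 * (e t * of_real (phi t * t ^ i)) + c2 * (e t * of_real (phi t * t ^ j)) + c3 * (e t * of_real (phi t * t ^ k)))
    = c1 * m i + c2 * m j + c3 * m k"
proof -
  have "(CLINT t|lborel. c1 * (e t * of_real (phi t * t ^ i)) + c2 * (e t * of_real (phi t * t ^ j)) + c3 * (e t * of_real (phi t * t ^ k)))
     = (CLINT t|lborel. c1 * (e t * of_real (phi t * t ^ i)) + c2 * (e t * of_real (phi t * t ^ j))) + (CLINT t|lborel. c3 * (e t * of_real (phi t * t ^ k)))"
    by (intro Bochner_Integration.integral_add Bochner_Integration.integrable_add integrable_mult_right int)
  also have "(CLINT t|lborel. c1 * (e t * of_real (phi t * t ^ i)) + c2 * (e t * of_real (phi t * t ^ j)))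
     = (CLINT t|lborel. c1 * (e t * of_real (phi t * t ^ i))) + (CLINT t|lborel. c2 * (e t * of_real (phi t * t ^ j)))"
    by (intro Bochner_Integration.integral_add integrable_mult_right int)
  finally show ?thesis
    unfolding m_def by (simp only: integral_mult_right_zero)
qed

text \<open>Integration by parts: the derivative of \<open>e t * phi t * t ^ k\<close> integrates to
  0 because the boundary terms vanish. For \<open>k = 0\<close> the truncated \<open>k - 1\<close>
  does no harm, its coefficient being 0.\<close>

private lemma m_rec: "m (Suc k) = of_nat k * m (k - 1) - \<i> * a * m k"
proof -
  let ?f = "\<lambda>t. of_nat k * (e t * of_real (phi t * t ^ (k - 1))) - \<i> * a * (e t * of_real (phi t * t ^ k)) - e t * of_real (phi t * t ^ Suc k)"
  have "(CLINT t|lborel. ?f t) = 0"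
  proof (rule ftc[where F = "\<lambda>t. e t * of_real (phi t * t ^ k)"])
    show "((\<lambda>t. e t * of_real (phi t * t ^ k)) has_vector_derivative ?f t) (at t)" for t
    proof -
      have "((\<lambda>t. phi t * t ^ k) has_real_derivative (- t * phi t) * t ^ k + (k * t ^ (k - 1)) * phi t) (at t)"
        by (auto intro!: derivative_eq_intros phi_deriv)
      then have "((\<lambda>t. complex_of_real (phi t * t ^ k)) has_vector_derivative of_real ((- t * phi t) * t ^ k + (k * t ^ (k - 1)) * phi t)) (at t)"
        by (intro has_vector_derivative_of_real) (simp add: has_real_derivative_iff_has_vector_derivative)
      from has_vector_derivative_mult[OF e_deriv this]
      show ?thesis
        by (rule has_vector_derivative_eq_rhs) (auto simp: algebra_simps)
    qed
    show "integrable lborel ?f"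
      by (intro Bochner_Integration.integrable_diff integrable_mult_right int)
    show "continuous_on UNIV ?f"
      by (intro continuous_intros e_cont phi_cont)
  qed (rule phi_lim)+
  moreover have "(CLINT t|lborel. ?f t) = of_nat k * m (k - 1) - \<i> * a * m k - m (Suc k)"
    using m_linear[of "of_nat k" "k - 1" "- (\<i> * a)" k "-1" "Suc k"] by simp
  ultimately show ?thesis by (simp add: algebra_simps)
qed

text \<open>The recursion reduces everything to \<open>m 0\<close>, a value of the normal
  characteristic function: \<open>m 1 = - \<i> * a * m 0\<close> and
  \<open>m 2 = (1 - a^2) * m 0\<close>. One \<open>sqrt (2 * pi)\<close> comes from writing the
  exponential through \<open>phi t\<close>, the other from writing \<open>m 0\<close> through
  \<open>phi a\<close>; inversion divides their product out.\<close>

lemma edge_integral: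
  "integrable lborel (\<lambda>t. iexp (-(t * a)) * of_real (exp (- (t\<^sup>2) / 2)) * (a1 + \<i> * t * a2 + (\<i> * t)\<^sup>2 * a3))" (is "integrable _ ?f")
  "(CLINT t|lborel. iexp (-(t * a)) * of_real (exp (- (t\<^sup>2) / 2)) * (a1 + \<i> * t * a2 + (\<i> * t)\<^sup>2 * a3))
    = of_real (2 * pi * phi a * (a1 + a2 * a + a3 * (a\<^sup>2 - 1)))"
proof -
  have eq: "?f = (\<lambda>t. of_real (sqrt (2 * pi) * a1) * (e t * of_real (phi t * t ^ 0)) + \<i> * of_real (sqrt (2 * pi) * a2) * (e t * of_real (phi t * t ^ 1))
      + (- of_real (sqrt (2 * pi) * a3)) * (e t * of_real (phi t * t ^ 2)))"
  proof
    fix t :: real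
    have "E * of_real (s * p) * (a1 + \<i> * t * a2 + (\<i> * t)\<^sup>2 * a3) = of_real (s * a1) * (E * of_real (p * t ^ 0)) + \<i> * of_real (s * a2) * (E * of_real (p * t ^ 1))
      + (- of_real (s * a3)) * (E * of_real (p * t ^ 2))" for E and s p :: real
      by (simp add: power_mult_distrib algebra_simps)
    then show "?f t = of_real (sqrt (2 * pi) * a1) * (e t * of_real (phi t * t ^ 0)) + \<i> * of_real (sqrt (2 * pi) * a2) * (e t * of_real (phi t * t ^ 1))
      + (- of_real (sqrt (2 * pi) * a3)) * (e t * of_real (phi t * t ^ 2))"
      unfolding phi_exp e_def by blast
  qed
  show "integrable lborel ?f"
    unfolding eq by (intro Bochner_Integration.integrable_add integrable_mult_right int)
  have "(CLINT t|lborel. ?f t) = of_real (sqrt (2 * pi) * a1) * m 0 + \<i> * of_real (sqrt (2 * pi) * a2) * m 1 - of_real (sqrt (2 * pi) * a3) * m 2"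
    unfolding eq m_linear by simp
  also have "m 2 = m 0 - \<i> * a * m 1" using m_rec[of 1] by (simp add: numeral_2_eq_2)
  also have "m 1 = - \<i> * a * m 0" using m_rec[of 0] by simp
  also have "of_real (sqrt (2 * pi) * a1) * m 0 + \<i> * of_real (sqrt (2 * pi) * a2) * (- \<i> * a * m 0) - of_real (sqrt (2 * pi) * a3) * (m 0 - \<i> * a * (- \<i> * a * m 0))
    = of_real (sqrt (2 * pi) * (a1 + a2 * a + a3 * (a\<^sup>2 - 1))) * m 0"
    by (simp add: algebra_simps power2_eq_square)
  also have "\<dots> = of_real (sqrt (2 * pi) * (a1 + a2 * a + a3 * (a\<^sup>2 - 1)) * (sqrt (2 * pi) * phi a))"
    unfolding m0 phi_exp by simp
  also have "sqrt (2 * pi) * (a1 + a2 * a + a3 * (a\<^sup>2 - 1)) * (sqrt (2 * pi) * phi a) = 2 * pi * phi a * (a1 + a2 * a + a3 * (a\<^sup>2 - 1))"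
  proof -
    have "sqrt (2 * pi) * sqrt (2 * pi) = 2 * pi" by simp
    then show ?thesis by (metis mult.assoc mult.commute)
  qed
  finally show "(CLINT t|lborel. ?f t) = of_real (2 * pi * phi a * (a1 + a2 * a + a3 * (a\<^sup>2 - 1)))" .
qed

end

text \<open>The Gaussian part is inverted by Levy's theorem for the normal law. In the correction
  the common factor \<open>\<i> * t\<close> cancels the denominator of the kernel, and an absolutely
  convergent integral remains, evaluated by \<open>edge_integral\<close> at both end points.\<close>

lemma edge_inversion:
  assumes ab: "a \<le> b"
  shows "(\<lambda>T::nat. 1 / (2 * pi) * (CLBINT t=-T..T. (iexp (-(t * a)) - iexp (-(t * b))) / (\<i> * t) * edge_char a1 a2 a3 t))
        \<longlonglongrightarrow> complex_of_real (edge_cdf a1 a2 a3 b - edge_cdf a1 a2 a3 a)"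
proof -
  let ?k = "\<lambda>t. (iexp (-(t * a)) - iexp (-(t * b))) / (\<i> * t)"
  let ?h = "\<lambda>a t. iexp (-(t * a)) * of_real (exp (- (t\<^sup>2) / 2)) * (a1 + \<i> * t * a2 + (\<i> * t)\<^sup>2 * a3)"
  have na: "measure std_normal_distribution {x} = 0" for x
  proof -
    have "emeasure std_normal_distribution {x} = (\<integral>\<^sup>+y. ennreal (std_normal_density y) * indicator {x} y \<partial>lborel)"
      by (subst emeasure_density) auto
    also have "\<dots> = (\<integral>\<^sup>+(y::real). 0 \<partial>lborel)"
      by (intro nn_integral_cong_AE) (use AE_lborel_singleton[of x] in \<open>auto elim!: eventually_mono\<close>)
    finally show ?thesis by (simp add: measure_def)
  qed
  \<comment> \<open>At \<open>t = 0\<close> the left side is 0 by division by zero, and the right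
    side is 0 since both \<open>?h\<close> terms equal \<open>a1\<close>.\<close>
  have split: "?k t * edge_char a1 a2 a3 t = ?k t * of_real (exp (- (t\<^sup>2) / 2)) + (?h a t - ?h b t)" for t
  proof (cases "t = 0")
    case False
    then have "edge_char a1 a2 a3 t = of_real (exp (- (t\<^sup>2) / 2)) + of_real (exp (- (t\<^sup>2) / 2)) * ((\<i> * t) * (a1 + \<i> * t * a2 + (\<i> * t)\<^sup>2 * a3))"
      unfolding edge_char_def by (simp add: algebra_simps power2_eq_square power3_eq_cube)
    moreover have "(A - B) / z * (E + E * (z * p)) = (A - B) / z * E + (A * E * p - B * E * p)" if "z \<noteq> 0" for A B z E p :: complex
      using that by (simp add: field_simps)
    ultimately show ?thesis using False by simp
  qed simp
  have int1: "complex_interval_lebesgue_integrable lborel (ereal (- real T)) (ereal (real T)) (\<lambda>t. ?k t * of_real (exp (- (t\<^sup>2) / 2)))" for T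
  proof -
    have "cmod (?k t) \<le> b - a" for t
      using Levy_Inversion_aux2[of "-b" "-a" t] ab by (cases "t = 0") auto
    then have "cmod (?k t * of_real (exp (- (t\<^sup>2) / 2))) \<le> (b - a) * 1" for t
      unfolding norm_mult by (intro mult_mono) (use ab in auto)
    then show ?thesis
      unfolding interval_lebesgue_integrable_def set_integrable_def
      by (auto intro!: integrableI_bounded_set_indicator[where B="(b - a) * 1"])
  qed
  have int2: "complex_interval_lebesgue_integrable lborel (ereal (- real T)) (ereal (real T)) (\<lambda>t. ?h a t - ?h b t)" for T
  proof -
    have "integrable lborel (\<lambda>t. ?h a t - ?h b t)"
      by (intro Bochner_Integration.integrable_diff edge_integral(1))
    from integrable_mult_indicator[OF _ this, of "{- real T<..<real T}"] show ?thesis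
      by (simp add: interval_lebesgue_integrable_def set_integrable_def)
  qed
  have i: "integrable lborel (\<lambda>t. ?h a t - ?h b t)"
    by (intro Bochner_Integration.integrable_diff edge_integral(1))
  have eq: "(CLBINT t=-T..T. ?k t * char std_normal_distribution t) + (CLBINT t=-T..T. ?h a t - ?h b t)
    = (CLBINT t=-T..T. ?k t * edge_char a1 a2 a3 t)" for T :: nat
  proof -
    have "(\<lambda>t. ?k t * edge_char a1 a2 a3 t) = (\<lambda>t. ?k t * of_real (exp (- (t\<^sup>2) / 2)) + (?h a t - ?h b t))"
      by (rule ext) (rule split)
    then show ?thesis
      unfolding char_std_normal_distribution
      using interval_lebesgue_integral_add(2)[OF int1[of T] int2[of T]] by simp
  qed
  have "(\<lambda>T::nat. 1 / (2 * pi) * (CLBINT t=-T..T. ?k t * char std_normal_distribution t) + 1 / (2 * pi) * (CLBINT t=-T..T. ?h a t - ?h b t))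
      \<longlonglongrightarrow> of_real (measure std_normal_distribution {a<..b}) + 1 / (2 * pi) * (CLINT t|lborel. ?h a t - ?h b t)"
    by (rule tendsto_add[OF nd.Levy_Inversion[OF ab na na] tendsto_mult[OF tendsto_const CLBINT_symmetric_limit[OF i]]])
  then have "(\<lambda>T::nat. 1 / (2 * pi) * (CLBINT t=-T..T. ?k t * edge_char a1 a2 a3 t))
      \<longlonglongrightarrow> of_real (measure std_normal_distribution {a<..b}) + 1 / (2 * pi) * (CLINT t|lborel. ?h a t - ?h b t)"
    unfolding distrib_left[symmetric] eq .
  moreover have "of_real (measure std_normal_distribution {a<..b}) + 1 / (2 * pi) * (CLINT t|lborel. ?h a t - ?h b t)
    = complex_of_real (edge_cdf a1 a2 a3 b - edge_cdf a1 a2 a3 a)"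
  proof -
    have "measure std_normal_distribution {a<..b} = Phi b - Phi a"
      using ab by (cases "a = b") (auto simp: Phi_cdf nd.cdf_diff_eq)
    moreover have A: "(CLINT t|lborel. ?h a t - ?h b t)
        = of_real (2 * pi * phi a * (a1 + a2 * a + a3 * (a\<^sup>2 - 1))) - of_real (2 * pi * phi b * (a1 + a2 * b + a3 * (b\<^sup>2 - 1)))"
      unfolding edge_integral(2)[symmetric]
      by (intro Bochner_Integration.integral_diff edge_integral(1))
    moreover have "complex_of_real (1 / (2 * pi)) * (complex_of_real (2 * pi * p) - complex_of_real (2 * pi * q)) = complex_of_real (p - q)" for p q
      by (simp add: field_simps)
    from this[of "phi a * (a1 + a2 * a + a3 * (a\<^sup>2 - 1))" "phi b * (a1 + a2 * b + a3 * (b\<^sup>2 - 1))"]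
    have "1 / (2 * pi) * (CLINT t|lborel. ?h a t - ?h b t)
      = complex_of_real (phi a * (a1 + a2 * a + a3 * (a\<^sup>2 - 1)) - phi b * (a1 + a2 * b + a3 * (b\<^sup>2 - 1)))"
      unfolding A by (simp only: mult.assoc)
    ultimately show ?thesis
      unfolding edge_cdf_def by (simp only: of_real_add[symmetric]) (simp add: algebra_simps)
  qed
  ultimately show ?thesis by (simp only:)
qed

section \<open>Sums of bounded independent variables\<close>

text \<open>The coefficient 1 instead of 1/2 buys validity on both sides of 0; for negative
  \<open>u\<close> the bound is multiplied by the lower Taylor bound of
  \<open>exp (- u)\<close>.\<close>

lemma exp_le_quadratic:
  fixes u :: real
  assumes "\<bar>u\<bar> \<le> 1"
  shows "exp u \<le> 1 + u + u\<^sup>2"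
proof (cases "0 \<le> u")
  case True
  then show ?thesis using exp_bound[of u] assms by simp
next
  case False
  define y where "y = - u"
  have y: "0 \<le> y" "y \<le> 1" using False assms by (auto simp: y_def)
  have "1 + y + y\<^sup>2 / 2 \<le> exp y" using exp_lower_Taylor_quadratic[of y] y by simp
  moreover have "1 \<le> (1 - y + y\<^sup>2) * (1 + y + y\<^sup>2 / 2)"
  proof -
    have "(1 - y + y\<^sup>2) * (1 + y + y\<^sup>2 / 2) = 1 + y\<^sup>2 * (1/2 + y / 2 + y\<^sup>2 / 2)"
      by (simp add: power2_eq_square field_simps)
    then show ?thesis using y by simp
  qed
  moreover have "0 \<le> 1 - y + y\<^sup>2" using y by simp
  ultimately have "1 \<le> (1 - y + y\<^sup>2) * exp y"
    by (meson mult_left_mono order_trans)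
  then have "exp (- y) \<le> 1 - y + y\<^sup>2"
    by (simp add: exp_minus field_simps)
  then show ?thesis by (simp add: y_def)
qed

lemma abs_power2_le: "\<bar>a\<bar> \<le> B \<Longrightarrow> a\<^sup>2 \<le> B\<^sup>2" for a B :: real
  using power_mono[of "\<bar>a\<bar>" B 2] by simp

locale iid_sample = prob_space M for M :: "'a measure" +
  fixes X :: "nat \<Rightarrow> 'a \<Rightarrow> real" and D :: "real measure"
  assumes X_meas [measurable]: "\<And>i. X i \<in> borel_measurable M"
    and X_indep: "indep_vars (\<lambda>_. borel) X UNIV"
    and X_distr: "\<And>i. distr M borel (X i) = D"
begin

lemma real_distribution_D: "real_distribution D"
  unfolding X_distr[of 0, symmetric] by simp

sublocale D: real_distribution D
  by (rule real_distribution_D)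

lemma expectation_X:
  fixes g :: "real \<Rightarrow> 'c::{banach, second_countable_topology}"
  assumes [measurable]: "g \<in> borel_measurable borel"
  shows "(\<integral>w. g (X i w) \<partial>M) = (\<integral>x. g x \<partial>D)"
  unfolding X_distr[of i, symmetric] by (subst integral_distr) auto

lemma integrable_bounded_D:
  fixes g :: "real \<Rightarrow> 'c::{banach, second_countable_topology}"
  assumes "g \<in> borel_measurable borel" "\<And>x. norm (g x) \<le> B"
  shows "integrable D g"
  using assms by (intro D.integrable_const_bound[where B=B]) auto

lemma expectation_prod:
  fixes g :: "nat \<Rightarrow> real \<Rightarrow> 'c::{real_normed_field, banach, second_countable_topology}"
  assumes g: "\<And>i. g i \<in> borel_measurable borel" "\<And>i. integrable D (g i)"
  shows "(\<integral>w. (\<Prod>i<N. g i (X i w)) \<partial>M) = (\<Prod>i<N. \<integral>x. g i x \<partial>D)"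
    and "integrable M (\<lambda>w. \<Prod>i<N. g i (X i w))"
proof -
  note g(1)[measurable]
  have ind: "indep_vars (\<lambda>_. borel) (\<lambda>i w. g i (X i w)) {..<N}"
    by (rule indep_vars_compose2[OF indep_vars_subset[OF X_indep]]) auto
  have int: "integrable M (\<lambda>w. g i (X i w))" for i
    using g(2)[of i] unfolding X_distr[of i, symmetric] by (subst (asm) integrable_distr_eq) auto
  have "(\<integral>w. (\<Prod>i<N. g i (X i w)) \<partial>M) = (\<Prod>i<N. \<integral>w. g i (X i w) \<partial>M)"
    by (rule indep_vars_lebesgue_integral) (use ind int in auto)
  then show "(\<integral>w. (\<Prod>i<N. g i (X i w)) \<partial>M) = (\<Prod>i<N. \<integral>x. g i x \<partial>D)"
    by (simp add: expectation_X)
  show "integrable M (\<lambda>w. \<Prod>i<N. g i (X i w))"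
    by (rule indep_vars_integrable) (use ind int in auto)
qed

definition S :: "(real \<Rightarrow> real) \<Rightarrow> nat \<Rightarrow> 'a \<Rightarrow> real" where
  "S g N w = (\<Sum>i<N. g (X i w))"

lemma S_measurable [measurable]:
  assumes [measurable]: "g \<in> borel_measurable borel"
  shows "S g N \<in> borel_measurable M"
  unfolding S_def[abs_def] by measurable

lemma S_bound: "(\<And>x. \<bar>g x\<bar> \<le> B) \<Longrightarrow> \<bar>S g N w\<bar> \<le> N * B"
  unfolding S_def by (rule order_trans[OF sum_abs]) (use sum_bounded_above[of "{..<N}" "\<lambda>i. \<bar>g (X i w)\<bar>" B] in auto)

lemma exp_S_integrable:
  assumes "g \<in> borel_measurable borel" "\<And>x. \<bar>g x\<bar> \<le> B"
  shows "integrable M (\<lambda>w. exp (c * S g N w))"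
proof (rule integrable_const_bound[where B="exp (\<bar>c\<bar> * (N * B))"])
  show "AE w in M. norm (exp (c * S g N w)) \<le> exp (\<bar>c\<bar> * (N * B))"
  proof (rule AE_I2)
    fix w
    have "c * S g N w \<le> \<bar>c * S g N w\<bar>" by simp
    also have "\<dots> \<le> \<bar>c\<bar> * (N * B)"
      unfolding abs_mult using S_bound[OF assms(2)] by (intro mult_left_mono) auto
    finally show "norm (exp (c * S g N w)) \<le> exp (\<bar>c\<bar> * (N * B))" by simp
  qed
qed (use assms in measurable)

text \<open>Bernstein's form: the variance, not the range, enters the exponent. This makes the bound
  sharp enough for indicators of short intervals, whose variance is of the order of the probability
  of the interval.\<close>

lemma mgf_bound:
  assumes [measurable]: "g \<in> borel_measurable borel" and B: "\<And>x. \<bar>g x\<bar> \<le> B"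
    and mean: "(\<integral>x. g x \<partial>D) = 0" and var: "(\<integral>x. (g x)\<^sup>2 \<partial>D) \<le> v" and c: "\<bar>c\<bar> * B \<le> 1"
  shows "(\<integral>w. exp (c * S g N w) \<partial>M) \<le> exp (N * c\<^sup>2 * v)"
proof -
  have ig: "integrable D g" by (rule integrable_bounded_D[where B=B]) (use B in auto)
  have ig2: "integrable D (\<lambda>x. (g x)\<^sup>2)"
    by (rule integrable_bounded_D[where B="B\<^sup>2"]) (auto intro: abs_power2_le[OF B])
  have cg: "\<bar>c * g x\<bar> \<le> 1" for x
    unfolding abs_mult using mult_left_mono[OF B[of x], of "\<bar>c\<bar>"] c by auto
  have ie: "integrable D (\<lambda>x. exp (c * g x))"
    by (rule integrable_bounded_D[where B="exp 1"]) (use cg in \<open>auto simp: abs_le_iff\<close>)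
  have "(\<integral>x. exp (c * g x) \<partial>D) \<le> (\<integral>x. 1 + c * g x + c\<^sup>2 * (g x)\<^sup>2 \<partial>D)"
    using exp_le_quadratic[OF cg]
    by (intro integral_mono ie Bochner_Integration.integrable_add integrable_mult_right ig ig2)
       (auto simp: power_mult_distrib)
  also have "\<dots> = 1 + c\<^sup>2 * (\<integral>x. (g x)\<^sup>2 \<partial>D)"
    using ig ig2 mean D.prob_space by simp
  also have "\<dots> \<le> 1 + c\<^sup>2 * v" using var by (intro add_left_mono mult_left_mono) auto
  also have "\<dots> \<le> exp (c\<^sup>2 * v)" by (rule exp_ge_add_one_self)
  finally have one: "(\<integral>x. exp (c * g x) \<partial>D) \<le> exp (c\<^sup>2 * v)" .
  have "(\<integral>w. exp (c * S g N w) \<partial>M) = (\<integral>w. (\<Prod>i<N. exp (c * g (X i w))) \<partial>M)"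
    unfolding S_def by (simp add: exp_sum sum_distrib_left)
  also have "\<dots> = (\<Prod>i<N. \<integral>x. exp (c * g x) \<partial>D)"
    by (rule expectation_prod) (use ie in auto)
  also have "\<dots> \<le> (\<Prod>i<N. exp (c\<^sup>2 * v))"
    by (intro prod_mono conjI one Bochner_Integration.integral_nonneg) auto
  also have "\<dots> = exp (N * c\<^sup>2 * v)" by (simp add: exp_of_nat_mult[symmetric] mult.assoc)
  finally show ?thesis .
qed

text \<open>Chernoff's method with the parameter \<open>c\<close> left free: \<open>sum_tail\<close>
  optimizes it, while the oscillation estimate picks it so that the variance term is of order
  \<open>(ln N)^2\<close>.\<close>

lemma tail_bound:
  assumes g[measurable]: "g \<in> borel_measurable borel" and B: "\<And>x. \<bar>g x\<bar> \<le> B"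
    and mean: "(\<integral>x. g x \<partial>D) = 0" and var: "(\<integral>x. (g x)\<^sup>2 \<partial>D) \<le> v" and c: "0 < c" "c * B \<le> 1"
  shows "prob {w \<in> space M. r \<le> \<bar>S g N w\<bar>} \<le> 2 * exp (N * c\<^sup>2 * v - c * r)"
proof -
  have half: "prob {w \<in> space M. r \<le> d * S g N w} \<le> exp (N * c\<^sup>2 * v - c * r)" if d: "\<bar>d\<bar> = 1" for d
  proof -
    have "prob {w \<in> space M. exp (c * r) \<le> exp (c * d * S g N w)} \<le> (\<integral>w. exp (c * d * S g N w) \<partial>M) / exp (c * r)"
      using exp_S_integrable[OF g B, of "c * d" N] by (intro integral_Markov_inequality_measure[where A="{}"]) auto
    moreover have "{w \<in> space M. r \<le> d * S g N w} = {w \<in> space M. exp (c * r) \<le> exp (c * d * S g N w)}"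
      using c by (auto simp: mult.assoc)
    moreover have "(\<integral>w. exp (c * d * S g N w) \<partial>M) \<le> exp (N * (c * d)\<^sup>2 * v)"
      using c d by (intro mgf_bound[OF g B mean var]) (auto simp: abs_mult)
    moreover have "(c * d)\<^sup>2 = c\<^sup>2" using d by (auto simp: power_mult_distrib abs_if split: if_splits)
    ultimately show ?thesis
      by (smt (verit, best) divide_right_mono exp_diff exp_ge_zero)
  qed
  have "{w \<in> space M. r \<le> \<bar>S g N w\<bar>} \<subseteq> {w \<in> space M. r \<le> 1 * S g N w} \<union> {w \<in> space M. r \<le> (-1) * S g N w}"
    by auto
  then have "prob {w \<in> space M. r \<le> \<bar>S g N w\<bar>} \<le> prob ({w \<in> space M. r \<le> 1 * S g N w} \<union> {w \<in> space M. r \<le> (-1) * S g N w})"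
    by (intro finite_measure_mono) auto
  also have "\<dots> \<le> prob {w \<in> space M. r \<le> 1 * S g N w} + prob {w \<in> space M. r \<le> (-1) * S g N w}"
    by (intro measure_Un_le) auto
  also have "\<dots> \<le> 2 * exp (N * c\<^sup>2 * v - c * r)"
    using half[of 1] half[of "-1"] by simp
  finally show ?thesis .
qed

text \<open>Moments are read off exponential moments instead of expanding a multiple sum. At
  \<open>c = 1 / (B * sqrt N)\<close> the exponential moments of both signs are at most
  \<open>exp 1 \<le> 3\<close>, so their sum is at most 6, and
  \<open>y ^ k \<le> K * (exp y + exp (- y))\<close> holds with \<open>K = 2\<close> for
  \<open>k = 2\<close> and \<open>K = 256\<close> for \<open>k = 4\<close>; hence
  \<open>12 = 2 * 6\<close> and \<open>1536 = 256 * 6\<close>.\<close>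

lemma S_moments:
  assumes g[measurable]: "g \<in> borel_measurable borel" and B: "\<And>x. \<bar>g x\<bar> \<le> B" "0 < B"
    and mean: "(\<integral>x. g x \<partial>D) = 0"
  shows "(\<integral>w. (S g N w) ^ 2 \<partial>M) \<le> 12 * B\<^sup>2 * N" "(\<integral>w. (S g N w) ^ 4 \<partial>M) \<le> 1536 * B ^ 4 * (real N)\<^sup>2"
proof -
  have "(\<integral>w. (S g N w) ^ 2 \<partial>M) \<le> 12 * B\<^sup>2 * N \<and> (\<integral>w. (S g N w) ^ 4 \<partial>M) \<le> 1536 * B ^ 4 * (real N)\<^sup>2"
  proof (cases "N = 0")
    case True
    then show ?thesis by (simp add: S_def)
  next
    case False
    define c where "c = 1 / (B * sqrt N)"
    have c: "0 < c" using B False by (simp add: c_def)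
    have c2: "N * c\<^sup>2 * B\<^sup>2 = 1"
      using B False by (simp add: c_def power_divide power_mult_distrib)
    have cB: "c * B \<le> 1"
    proof -
      have "c * B = 1 / sqrt N" using B by (simp add: c_def)
      also have "\<dots> \<le> 1" using False by simp
      finally show ?thesis .
    qed
    have var: "(\<integral>x. (g x)\<^sup>2 \<partial>D) \<le> B\<^sup>2"
    proof -
      have "(\<integral>x. (g x)\<^sup>2 \<partial>D) \<le> (\<integral>x. B\<^sup>2 \<partial>D)"
        by (intro integral_mono integrable_bounded_D[where B="B\<^sup>2"])
           (auto intro: abs_power2_le[OF B(1)])
      then show ?thesis using D.prob_space by simp
    qed
    have m: "(\<integral>w. exp (c * S g N w) \<partial>M) \<le> exp 1" "(\<integral>w. exp (- c * S g N w) \<partial>M) \<le> exp 1"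
      using mgf_bound[OF g B(1) mean var, of c N] mgf_bound[OF g B(1) mean var, of "- c" N] c cB c2
      by auto
    have e: "integrable M (\<lambda>w. exp (c * S g N w) + exp (- c * S g N w))"
      by (intro Bochner_Integration.integrable_add exp_S_integrable[OF g B(1)])
    have e3: "exp 1 \<le> (3 :: real)" by (rule exp_le)
    have E: "(\<integral>w. exp (c * S g N w) + exp (- c * S g N w) \<partial>M) \<le> 6"
      using m e3 by (subst Bochner_Integration.integral_add; (intro exp_S_integrable[OF g B(1)])?) auto
    have pow: "(\<integral>w. (S g N w) ^ k \<partial>M) \<le> K * 6 / c ^ k"
      if K: "\<And>y :: real. y ^ k \<le> K * (exp y + exp (- y))" "0 \<le> K" for k K
    proof -
      have "(\<integral>w. (S g N w) ^ k \<partial>M) \<le> (\<integral>w. (K / c ^ k) * (exp (c * S g N w) + exp (- c * S g N w)) \<partial>M)"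
      proof (rule integral_mono)
        show "integrable M (\<lambda>w. S g N w ^ k)"
          by (rule integrable_const_bound[where B="(N * B) ^ k"])
             (use S_bound[OF B(1), where N=N] in \<open>auto simp: power_abs intro!: power_mono\<close>)
        show "integrable M (\<lambda>w. (K / c ^ k) * (exp (c * S g N w) + exp (- c * S g N w)))"
          by (intro integrable_mult_right e)
        fix w
        have "(c * S g N w) ^ k \<le> K * (exp (c * S g N w) + exp (- (c * S g N w)))" by (rule K)
        then show "S g N w ^ k \<le> (K / c ^ k) * (exp (c * S g N w) + exp (- c * S g N w))"
          using c by (simp add: power_mult_distrib field_simps)
      qed
      also have "\<dots> = (K / c ^ k) * (\<integral>w. (exp (c * S g N w) + exp (- c * S g N w)) \<partial>M)" by (rule integral_mult_right_zero)
      also have "\<dots> \<le> (K / c ^ k) * 6" using E K c by (intro mult_left_mono) auto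
      finally show ?thesis by simp
    qed
    have y2: "y ^ 2 \<le> 2 * (exp y + exp (- y))" for y :: real
    proof -
      have *: "y ^ 2 \<le> 2 * exp y" if "0 \<le> y" for y :: real
        using exp_lower_Taylor_quadratic[OF that] that by simp
      show ?thesis using *[of y] *[of "-y"] by (cases "0 \<le> y") (auto intro: order_trans)
    qed
    have y4: "y ^ 4 \<le> 256 * (exp y + exp (- y))" for y :: real
    proof -
      have *: "y ^ 4 \<le> 256 * exp y" if "0 \<le> y" for y :: real
      proof -
        have "(y / 4) ^ 4 \<le> (1 + y / 4) ^ 4" using that by (intro power_mono) auto
        also have "\<dots> \<le> exp y" using exp_ge_one_plus_x_over_n_power_n[of 4 y] that by simp
        finally show ?thesis by (simp add: power_divide)
      qed
      show ?thesis using *[of y] *[of "-y"] by (cases "0 \<le> y") (auto intro: order_trans)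
    qed
    have "c ^ 2 = 1 / (B\<^sup>2 * N)" "c ^ 4 = 1 / (B ^ 4 * (real N)\<^sup>2)"
    proof -
      show a: "c ^ 2 = 1 / (B\<^sup>2 * N)" by (simp add: c_def power_divide power_mult_distrib)
      have "c ^ 4 = (c ^ 2) ^ 2" by (simp add: power_mult[symmetric])
      then show "c ^ 4 = 1 / (B ^ 4 * (real N)\<^sup>2)"
        unfolding a by (simp add: power_divide power_mult_distrib power_mult[symmetric])
    qed
    then show ?thesis using pow[OF y2] pow[OF y4] by simp
  qed
  then show "(\<integral>w. (S g N w) ^ 2 \<partial>M) \<le> 12 * B\<^sup>2 * N" "(\<integral>w. (S g N w) ^ 4 \<partial>M) \<le> 1536 * B ^ 4 * (real N)\<^sup>2"
    by auto
qed

text \<open>Expanding \<open>1 = \<Sum>c. 1{cell = c}\<close> in every factor decouples the modulus of the integrand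
  from a unimodular factor depending on the cells only.\<close>

lemma cell_bound:
  fixes cell :: "real \<Rightarrow> nat" and h :: "real \<Rightarrow> complex" and \<Theta> :: "(nat \<Rightarrow> nat) \<Rightarrow> complex"
  assumes cell[measurable]: "cell \<in> measurable borel (count_space UNIV)" and K: "\<And>x. cell x < K"
    and h[measurable]: "h \<in> borel_measurable borel" and h1: "\<And>x. cmod (h x) \<le> 1" and \<Theta>: "\<And>s. cmod (\<Theta> s) \<le> 1"
  shows "cmod (\<integral>w. (\<Prod>i<N. h (X i w)) * \<Theta> (restrict (\<lambda>i. cell (X i w)) {..<N}) \<partial>M)
    \<le> (\<Sum>c<K. cmod (\<integral>x. h x * indicator {x. cell x = c} x \<partial>D)) ^ N"
proof -
  define f where "f c x = h x * indicator {x. cell x = c} x" for c x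
  have f[measurable]: "f c \<in> borel_measurable borel" for c unfolding f_def by measurable
  have fi: "integrable D (f c)" for c
    by (rule integrable_bounded_D[where B=1]) (use h1 in \<open>auto simp: f_def norm_mult split: split_indicator\<close>)
  let ?P = "PiE {..<N} (\<lambda>_. {..<K})"
  have fin: "finite ?P" by (intro finite_PiE) auto
  \<comment> \<open>For a given outcome every assignment of cells but the actual one contributes a
    factor 0.\<close>
  have eq: "(\<Prod>i<N. h (X i w)) * \<Theta> (restrict (\<lambda>i. cell (X i w)) {..<N}) = (\<Sum>s\<in>?P. \<Theta> s * (\<Prod>i<N. f (s i) (X i w)))" for w
  proof -
    let ?s = "restrict (\<lambda>i. cell (X i w)) {..<N}"
    have s: "?s \<in> ?P" using K by auto
    have 0: "\<Theta> s * (\<Prod>i<N. f (s i) (X i w)) = 0" if "s \<in> ?P - {?s}" for s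
    proof -
      have "\<exists>i<N. s i \<noteq> cell (X i w)"
      proof (rule ccontr)
        assume "\<not> (\<exists>i<N. s i \<noteq> cell (X i w))"
        then have "s = ?s" using that by (intro PiE_ext[of s "{..<N}" "\<lambda>_. {..<K}"]) (use s in auto)
        then show False using that by auto
      qed
      then obtain i where "i < N" "s i \<noteq> cell (X i w)" by blast
      then have "f (s i) (X i w) = 0" by (simp add: f_def)
      then have "(\<Prod>i<N. f (s i) (X i w)) = 0" using \<open>i < N\<close> by (intro prod_zero) auto
      then show ?thesis by simp
    qed
    have "(\<Sum>s\<in>?P. \<Theta> s * (\<Prod>i<N. f (s i) (X i w))) = \<Theta> ?s * (\<Prod>i<N. f (?s i) (X i w)) + (\<Sum>s\<in>?P - {?s}. \<Theta> s * (\<Prod>i<N. f (s i) (X i w)))"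
      by (rule sum.remove[OF fin s])
    also have "(\<Sum>s\<in>?P - {?s}. \<Theta> s * (\<Prod>i<N. f (s i) (X i w))) = 0"
      using 0 by (intro sum.neutral) blast
    also have "(\<Prod>i<N. f (?s i) (X i w)) = (\<Prod>i<N. h (X i w))"
      by (intro prod.cong) (auto simp: f_def)
    finally show ?thesis by (simp only: add_0_right mult.commute)
  qed
  have pr: "(\<integral>w. (\<Prod>i<N. f (s i) (X i w)) \<partial>M) = (\<Prod>i<N. \<integral>x. f (s i) x \<partial>D)"
      "integrable M (\<lambda>w. \<Prod>i<N. f (s i) (X i w))" for s
    by (rule expectation_prod; use fi in auto)+
  have "(\<integral>w. (\<Prod>i<N. h (X i w)) * \<Theta> (restrict (\<lambda>i. cell (X i w)) {..<N}) \<partial>M)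
    = (\<Sum>s\<in>?P. \<Theta> s * (\<Prod>i<N. \<integral>x. f (s i) x \<partial>D))"
    unfolding eq by (subst Bochner_Integration.integral_sum) (auto simp: pr)
  also have "cmod \<dots> \<le> (\<Sum>s\<in>?P. \<Prod>i<N. cmod (\<integral>x. f (s i) x \<partial>D))"
  proof (rule sum_norm_le)
    fix s
    have "cmod (\<Theta> s * (\<Prod>i<N. \<integral>x. f (s i) x \<partial>D)) \<le> 1 * (\<Prod>i<N. cmod (\<integral>x. f (s i) x \<partial>D))"
      unfolding norm_mult prod_norm[symmetric] by (intro mult_right_mono \<Theta> prod_nonneg) auto
    then show "cmod (\<Theta> s * (\<Prod>i<N. \<integral>x. f (s i) x \<partial>D)) \<le> (\<Prod>i<N. cmod (\<integral>x. f (s i) x \<partial>D))" by simp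
  qed
  \<comment> \<open>Once \<open>\<Theta>\<close> is gone, the sum over assignments factorizes again
    into \<open>N\<close> identical sums over cells.\<close>
  also have "\<dots> = (\<Prod>i<N. \<Sum>c<K. cmod (\<integral>x. f c x \<partial>D))"
    by (rule prod_sum_PiE[symmetric]) auto
  also have "\<dots> = (\<Sum>c<K. cmod (\<integral>x. f c x \<partial>D)) ^ N" by simp
  finally show ?thesis unfolding f_def .
qed

context
  fixes h :: "real \<Rightarrow> complex" and g :: "real \<Rightarrow> real" and B :: real
  assumes h[measurable]: "h \<in> borel_measurable borel" and h1: "\<And>x. cmod (h x) \<le> 1"
    and g[measurable]: "g \<in> borel_measurable borel" and B: "\<And>x. \<bar>g x\<bar> \<le> B"
begin

private lemma hint: "integrable D (\<lambda>x. h x * of_real (g x) ^ k)"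
proof (rule integrable_bounded_D[where B="1 * B ^ k"])
  show "cmod (h x * of_real (g x) ^ k) \<le> 1 * B ^ k" for x
    unfolding norm_mult norm_power norm_of_real using B by (intro mult_mono power_mono h1) auto
qed measurable

text \<open>Expanding the sum marks one factor with \<open>g\<close>; the exponent
  \<open>a i k\<close> gives all \<open>N\<close> factors the same shape, so that
  \<open>expectation_prod\<close> applies to each term.\<close>

lemma expectation_prod_S:
  "(\<integral>w. (\<Prod>k<N. h (X k w)) * of_real (S g N w) \<partial>M) = of_nat N * (\<integral>x. h x \<partial>D) ^ (N - 1) * (\<integral>x. h x * of_real (g x) \<partial>D)"
proof -
  define a where "a i k = (if k = i then (1::nat) else 0)" for i k :: nat
  have eq: "(\<Prod>k<N. h (X k w)) * of_real (S g N w) = (\<Sum>i<N. \<Prod>k<N. h (X k w) * of_real (g (X k w)) ^ a i k)" for w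
  proof -
    have "(\<Prod>k<N. of_real (g (X k w)) ^ a i k) = complex_of_real (g (X i w))" if "i < N" for i
    proof -
      have "(\<Prod>k<N. complex_of_real (g (X k w)) ^ a i k) = (\<Prod>k<N. if k = i then of_real (g (X i w)) else 1)"
        by (intro prod.cong) (auto simp: a_def)
      also have "\<dots> = of_real (g (X i w))" using that by simp
      finally show ?thesis .
    qed
    then show ?thesis unfolding S_def prod.distrib by (simp add: sum_distrib_left)
  qed
  have pr: "(\<integral>w. (\<Prod>k<N. h (X k w) * of_real (g (X k w)) ^ a i k) \<partial>M) = (\<Prod>k<N. \<integral>x. h x * of_real (g x) ^ a i k \<partial>D)"
     "integrable M (\<lambda>w. \<Prod>k<N. h (X k w) * of_real (g (X k w)) ^ a i k)" for i
    by (rule expectation_prod; use hint in auto)+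
  have val: "(\<Prod>k<N. \<integral>x. h x * of_real (g x) ^ a i k \<partial>D) = (\<integral>x. h x \<partial>D) ^ (N - 1) * (\<integral>x. h x * of_real (g x) \<partial>D)" if "i < N" for i
  proof -
    have "(\<Prod>k<N. \<integral>x. h x * of_real (g x) ^ a i k \<partial>D) = (\<integral>x. h x * of_real (g x) ^ a i i \<partial>D) * (\<Prod>k\<in>{..<N} - {i}. \<integral>x. h x * of_real (g x) ^ a i k \<partial>D)"
      using that by (intro prod.remove) auto
    also have "(\<Prod>k\<in>{..<N} - {i}. \<integral>x. h x * of_real (g x) ^ a i k \<partial>D) = (\<Prod>k\<in>{..<N} - {i}. \<integral>x. h x \<partial>D)"
      by (intro prod.cong) (auto simp: a_def)
    also have "\<dots> = (\<integral>x. h x \<partial>D) ^ (N - 1)" using that by simp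
    finally show ?thesis by (simp add: a_def mult.commute)
  qed
  show ?thesis
    unfolding eq using pr val by (subst Bochner_Integration.integral_sum) auto
qed

text \<open>Now two factors are marked. Diagonal pairs put \<open>g^2\<close> on one factor, the
  \<open>N * (N - 1)\<close> off-diagonal pairs put \<open>g\<close> on two; the powers
  \<open>N - 1\<close> and \<open>N - 2\<close> count the unmarked factors.\<close>

lemma expectation_prod_S_square:
  "(\<integral>w. (\<Prod>k<N. h (X k w)) * of_real ((S g N w)\<^sup>2) \<partial>M) = of_nat N * (\<integral>x. h x \<partial>D) ^ (N - 1) * (\<integral>x. h x * of_real ((g x)\<^sup>2) \<partial>D)
    + of_nat (N * (N - 1)) * (\<integral>x. h x \<partial>D) ^ (N - 2) * (\<integral>x. h x * of_real (g x) \<partial>D)\<^sup>2"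
proof -
  define a where "a i j k = (if k = i then (1::nat) else 0) + (if k = j then 1 else 0)" for i j k :: nat
  have eq: "(\<Prod>k<N. h (X k w)) * of_real ((S g N w)\<^sup>2) = (\<Sum>i<N. \<Sum>j<N. \<Prod>k<N. h (X k w) * of_real (g (X k w)) ^ a i j k)" for w
  proof -
    have "(\<Prod>k<N. of_real (g (X k w)) ^ a i j k) = complex_of_real (g (X i w) * g (X j w))" if "i < N" "j < N" for i j
    proof -
      have "(\<Prod>k<N. complex_of_real (g (X k w)) ^ a i j k) = (\<Prod>k<N. (if k = i then of_real (g (X i w)) else 1) * (if k = j then of_real (g (X j w)) else 1))"
        by (intro prod.cong) (auto simp: a_def power2_eq_square)
      also have "\<dots> = of_real (g (X i w)) * of_real (g (X j w))" using that by (simp add: prod.distrib)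
      finally show ?thesis by simp
    qed
    then have "(\<Sum>i<N. \<Sum>j<N. \<Prod>k<N. h (X k w) * of_real (g (X k w)) ^ a i j k)
       = (\<Sum>i<N. \<Sum>j<N. (\<Prod>k<N. h (X k w)) * complex_of_real (g (X i w) * g (X j w)))"
      unfolding prod.distrib by (intro sum.cong refl) simp
    also have "\<dots> = (\<Prod>k<N. h (X k w)) * of_real ((S g N w)\<^sup>2)"
      unfolding S_def power2_eq_square sum_product by (simp add: sum_distrib_left)
    finally show ?thesis by simp
  qed
  have pr: "(\<integral>w. (\<Prod>k<N. h (X k w) * of_real (g (X k w)) ^ a i j k) \<partial>M) = (\<Prod>k<N. \<integral>x. h x * of_real (g x) ^ a i j k \<partial>D)"
     "integrable M (\<lambda>w. \<Prod>k<N. h (X k w) * of_real (g (X k w)) ^ a i j k)" for i j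
    by (rule expectation_prod; use hint in auto)+
  let ?d = "(\<integral>x. h x \<partial>D) ^ (N - 1) * (\<integral>x. h x * of_real ((g x)\<^sup>2) \<partial>D)"
  let ?o = "(\<integral>x. h x \<partial>D) ^ (N - 2) * (\<integral>x. h x * of_real (g x) \<partial>D)\<^sup>2"
  have val: "(\<Prod>k<N. \<integral>x. h x * of_real (g x) ^ a i j k \<partial>D) = (if i = j then ?d else ?o)" if "i < N" "j < N" for i j
  proof (cases "i = j")
    case True
    have "(\<Prod>k<N. \<integral>x. h x * of_real (g x) ^ a i j k \<partial>D) = (\<integral>x. h x * of_real (g x) ^ a i j i \<partial>D) * (\<Prod>k\<in>{..<N} - {i}. \<integral>x. h x * of_real (g x) ^ a i j k \<partial>D)"
      using that by (intro prod.remove) auto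
    also have "(\<Prod>k\<in>{..<N} - {i}. \<integral>x. h x * of_real (g x) ^ a i j k \<partial>D) = (\<Prod>k\<in>{..<N} - {i}. \<integral>x. h x \<partial>D)"
      using True by (intro prod.cong) (auto simp: a_def)
    also have "\<dots> = (\<integral>x. h x \<partial>D) ^ (N - 1)" using that by simp
    finally show ?thesis using True by (simp add: a_def mult.commute power2_eq_square)
  next
    case False
    have "(\<Prod>k<N. \<integral>x. h x * of_real (g x) ^ a i j k \<partial>D) = (\<integral>x. h x * of_real (g x) ^ a i j i \<partial>D) * (\<Prod>k\<in>{..<N} - {i}. \<integral>x. h x * of_real (g x) ^ a i j k \<partial>D)"
      using that by (intro prod.remove) auto
    also have "(\<Prod>k\<in>{..<N} - {i}. \<integral>x. h x * of_real (g x) ^ a i j k \<partial>D) = (\<integral>x. h x * of_real (g x) ^ a i j j \<partial>D) * (\<Prod>k\<in>{..<N} - {i} - {j}. \<integral>x. h x * of_real (g x) ^ a i j k \<partial>D)"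
      using that False by (intro prod.remove) auto
    also have "(\<Prod>k\<in>{..<N} - {i} - {j}. \<integral>x. h x * of_real (g x) ^ a i j k \<partial>D) = (\<Prod>k\<in>{..<N} - {i} - {j}. \<integral>x. h x \<partial>D)"
      by (intro prod.cong) (auto simp: a_def)
    also have "\<dots> = (\<integral>x. h x \<partial>D) ^ (N - 2)"
    proof -
      have "card ({..<N} - {i} - {j}) = N - 2" using that False by (auto simp: card_Diff_singleton)
      then show ?thesis by simp
    qed
    finally show ?thesis using False by (simp add: a_def power2_eq_square)
  qed
  have "(\<integral>w. (\<Prod>k<N. h (X k w)) * of_real ((S g N w)\<^sup>2) \<partial>M) = (\<Sum>i<N. \<Sum>j<N. if i = j then ?d else ?o)"
    unfolding eq using pr val by (simp add: Bochner_Integration.integral_sum)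
  also have "\<dots> = (\<Sum>i<N. ?d + of_nat (N - 1) * ?o)"
  proof (intro sum.cong refl)
    fix i assume "i \<in> {..<N}"
    then have "(\<Sum>j<N. if i = j then ?d else ?o) = ?d + (\<Sum>j\<in>{..<N} - {i}. if i = j then ?d else ?o)"
      by (subst sum.remove[of _ i]) auto
    also have "(\<Sum>j\<in>{..<N} - {i}. if i = j then ?d else ?o) = (\<Sum>j\<in>{..<N} - {i}. ?o)"
      by (intro sum.cong) auto
    also have "\<dots> = of_nat (N - 1) * ?o"
      using \<open>i \<in> _\<close> by (simp only: sum_constant) (simp add: card_Diff_singleton del: of_nat_diff)
    finally show "(\<Sum>j<N. if i = j then ?d else ?o) = ?d + of_nat (N - 1) * ?o" .
  qed
  also have "\<dots> = of_nat N * (?d + of_nat (N - 1) * ?o)" by (simp only: sum_constant card_lessThan)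
  finally show ?thesis by (simp only: of_nat_mult distrib_left mult.assoc)
qed

end

end

section \<open>Expansions of characteristic functions\<close>

lemma exp_minus_taylor1:
  fixes y :: real
  assumes "0 \<le> y"
  shows "\<bar>exp (- y) - (1 - y)\<bar> \<le> y\<^sup>2 / 2"
proof -
  have "1 - y \<le> exp (- y)" using exp_ge_add_one_self[of "- y"] by simp
  moreover have "exp (- y) \<le> 1 - y + y\<^sup>2 / 2"
  proof -
    have "1 + y + y\<^sup>2 / 2 \<le> exp y" using exp_lower_Taylor_quadratic[of y] assms by simp
    moreover have "1 \<le> (1 - y + y\<^sup>2 / 2) * (1 + y + y\<^sup>2 / 2)"
    proof -
      have "(1 - y + y\<^sup>2 / 2) * (1 + y + y\<^sup>2 / 2) = 1 + y ^ 4 / 4"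
        by (simp add: power2_eq_square power4_eq_xxxx field_simps)
      then show ?thesis by simp
    qed
    moreover have "0 \<le> 1 - y + y\<^sup>2 / 2"
      using zero_le_power2[of "1 - y"] by (simp add: power2_eq_square algebra_simps)
    ultimately have "1 \<le> (1 - y + y\<^sup>2 / 2) * exp y"
      by (meson mult_left_mono order_trans)
    then show ?thesis by (simp add: exp_minus field_simps)
  qed
  ultimately show ?thesis by simp
qed

lemma iexp_taylor:
  "cmod (iexp u - 1) \<le> \<bar>u\<bar>" "cmod (iexp u - 1 - \<i> * u) \<le> u\<^sup>2 / 2"
  "cmod (iexp u - (1 + \<i> * u - u\<^sup>2 / 2 - \<i> * u ^ 3 / 6)) \<le> u ^ 4 / 24"
proof -
  show "cmod (iexp u - 1) \<le> \<bar>u\<bar>" using iexp_approx1[of u 0] by simp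
  show "cmod (iexp u - 1 - \<i> * u) \<le> u\<^sup>2 / 2"
    using iexp_approx1[of u 1] by (simp add: algebra_simps power2_eq_square)
  have "(\<Sum>k\<le>3. (\<i> * u) ^ k / fact k) = 1 + \<i> * u - u\<^sup>2 / 2 - \<i> * u ^ 3 / 6"
    by (simp add: numeral_3_eq_3 numeral_2_eq_2 fact_numeral) (simp add: field_simps)
  then show "cmod (iexp u - (1 + \<i> * u - u\<^sup>2 / 2 - \<i> * u ^ 3 / 6)) \<le> u ^ 4 / 24"
    using iexp_approx1[of u 3] by (simp add: fact_numeral)
qed

context iid_sample
begin

lemma integral_le_D:
  assumes "\<And>x. cmod (g x) \<le> B" "g \<in> borel_measurable borel"
  shows "cmod (CLINT x|D. g x) \<le> B"
proof -
  have "cmod (CLINT x|D. g x) \<le> (\<integral>x. cmod (g x) \<partial>D)" by (rule integral_norm_bound)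
  also have "\<dots> \<le> (\<integral>x. B \<partial>D)"
    using assms order_trans[OF norm_ge_zero assms(1)]
    by (intro integral_mono integrable_norm integrable_bounded_D[where B=B]) auto
  finally show ?thesis using D.prob_space by simp
qed

context
  fixes z :: "real \<Rightarrow> real" and C :: real
  assumes z[measurable]: "z \<in> borel_measurable borel" and zC: "\<And>x. \<bar>z x\<bar> \<le> C" and C1: "1 \<le> C"
    and z_mean: "(\<integral>x. z x \<partial>D) = 0" and z_var: "(\<integral>x. (z x)\<^sup>2 \<partial>D) = 1"
begin

definition "cf s = (CLINT x|D. iexp (s * z x))"
definition "lam = (\<integral>x. (z x) ^ 3 \<partial>D)"

lemma cf_le_1: "cmod (cf s) \<le> 1"
  unfolding cf_def by (rule integral_le_D) (auto simp del: of_real_mult)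

lemma lam_le: "\<bar>lam\<bar> \<le> C ^ 3"
proof -
  have "cmod (CLINT x|D. of_real ((z x) ^ 3)) \<le> C ^ 3"
    by (rule integral_le_D) (auto simp: norm_power intro!: power_mono zC)
  then show ?thesis unfolding lam_def by (simp del: of_real_power)
qed

lemma cf_mult_0:
  assumes g[measurable]: "g \<in> borel_measurable borel" and gB: "\<And>x. \<bar>g x\<bar> \<le> B"
  shows "cmod ((CLINT x|D. iexp (s * z x) * of_real (g x)) - of_real (\<integral>x. g x \<partial>D)) \<le> \<bar>s\<bar> * C * B"
proof -
  have i1: "integrable D (\<lambda>x. iexp (s * z x) * of_real (g x))"
    by (rule integrable_bounded_D[where B=B]) (use gB in \<open>auto simp: norm_mult simp del: of_real_mult\<close>)
  have i2: "integrable D (\<lambda>x. complex_of_real (g x))"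
    by (rule integrable_bounded_D[where B=B]) (use gB in auto)
  have "(CLINT x|D. iexp (s * z x) * of_real (g x)) - of_real (\<integral>x. g x \<partial>D) = (CLINT x|D. iexp (s * z x) * of_real (g x) - of_real (g x))"
    using i1 i2 by simp
  also have "cmod \<dots> \<le> \<bar>s\<bar> * C * B"
  proof (rule integral_le_D)
    fix x
    have "cmod ((iexp (s * z x) - 1) * of_real (g x)) \<le> \<bar>s\<bar> * C * B"
      unfolding norm_mult norm_of_real using zC[of x] gB[of x] C1
      by (intro mult_mono order_trans[OF iexp_taylor(1)]) (auto simp: abs_mult intro!: mult_left_mono)
    then show "cmod (iexp (s * z x) * of_real (g x) - of_real (g x)) \<le> \<bar>s\<bar> * C * B"
      by (simp add: algebra_simps)
  qed measurable
  finally show ?thesis .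
qed

text \<open>The constant term is the mean of \<open>g\<close>, which vanishes; the covariance with
  \<open>z\<close> becomes the leading term, of order \<open>s\<close>.\<close>

lemma cf_mult_1:
  assumes g[measurable]: "g \<in> borel_measurable borel" and gB: "\<And>x. \<bar>g x\<bar> \<le> C"
    and mean: "(\<integral>x. g x \<partial>D) = 0"
  shows "cmod ((CLINT x|D. iexp (s * z x) * of_real (g x)) - \<i> * s * of_real (\<integral>x. z x * g x \<partial>D)) \<le> s\<^sup>2 * C ^ 3 / 2"
proof -
  have i1: "integrable D (\<lambda>x. iexp (s * z x) * of_real (g x))"
    by (rule integrable_bounded_D[where B=C]) (use gB in \<open>auto simp: norm_mult simp del: of_real_mult\<close>)
  have i2: "integrable D (\<lambda>x. complex_of_real (g x))"
    by (rule integrable_bounded_D[where B=C]) (use gB in auto)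
  have i3: "integrable D (\<lambda>x. complex_of_real (z x * g x))"
    by (rule integrable_bounded_D[where B="C * C"]) (use gB zC C1 in \<open>auto simp: norm_mult intro!: mult_mono\<close>)
  have "(CLINT x|D. iexp (s * z x) * of_real (g x) - of_real (g x) - \<i> * s * of_real (z x * g x))
    = (CLINT x|D. iexp (s * z x) * of_real (g x)) - of_real (\<integral>x. g x \<partial>D) - \<i> * s * of_real (\<integral>x. z x * g x \<partial>D)"
    using i1 i2 i3 by (simp del: of_real_mult)
  then have "(CLINT x|D. iexp (s * z x) * of_real (g x)) - \<i> * s * of_real (\<integral>x. z x * g x \<partial>D)
     = (CLINT x|D. iexp (s * z x) * of_real (g x) - of_real (g x) - \<i> * s * of_real (z x * g x))"
    using mean by simp
  also have "cmod \<dots> \<le> s\<^sup>2 * C ^ 3 / 2"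
  proof (rule integral_le_D)
    fix x
    have "cmod ((iexp (s * z x) - 1 - \<i> * of_real (s * z x)) * of_real (g x)) \<le> (s\<^sup>2 * C\<^sup>2 / 2) * C"
      unfolding norm_mult norm_of_real using zC[of x] gB[of x] C1 abs_power2_le[OF zC[of x]]
      by (intro mult_mono order_trans[OF iexp_taylor(2)]) (auto simp: power_mult_distrib intro!: mult_left_mono)
    then show "cmod (iexp (s * z x) * of_real (g x) - of_real (g x) - \<i> * s * of_real (z x * g x)) \<le> s\<^sup>2 * C ^ 3 / 2"
      by (simp add: algebra_simps power2_eq_square power3_eq_cube)
  qed measurable
  finally show ?thesis .
qed

lemma cf_taylor: "cmod (cf s - (1 - s\<^sup>2 / 2 - \<i> * s ^ 3 * lam / 6)) \<le> s ^ 4 * C ^ 4 / 24"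
proof -
  have i: "integrable D (\<lambda>x. complex_of_real ((z x) ^ k))" for k
    by (rule integrable_bounded_D[where B="C ^ k"]) (auto simp: norm_power intro!: power_mono zC)
  have ie: "integrable D (\<lambda>x. iexp (s * z x))"
    by (rule integrable_bounded_D[where B=1]) (auto simp del: of_real_mult)
  have "(CLINT x|D. iexp (s * z x) - (1 + \<i> * s * of_real (z x ^ 1) - of_real (s\<^sup>2 / 2) * of_real ((z x) ^ 2) - \<i> * of_real (s ^ 3 / 6) * of_real ((z x) ^ 3)))
    = cf s - (1 + \<i> * s * of_real (\<integral>x. z x ^ 1 \<partial>D) - of_real (s\<^sup>2 / 2) * of_real (\<integral>x. (z x) ^ 2 \<partial>D) - \<i> * of_real (s ^ 3 / 6) * of_real (\<integral>x. (z x) ^ 3 \<partial>D))"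
    unfolding cf_def using i[of 1] i[of 2] i[of 3] ie D.prob_space
    by (simp del: of_real_power of_real_mult of_real_divide power_one_right)
  then have "cf s - (1 - of_real s ^ 2 / 2 - \<i> * of_real s ^ 3 * lam / 6) = (CLINT x|D. iexp (s * z x) - (1 + \<i> * s * of_real (z x ^ 1) - of_real (s\<^sup>2 / 2) * of_real ((z x) ^ 2) - \<i> * of_real (s ^ 3 / 6) * of_real ((z x) ^ 3)))"
    using z_mean z_var by (simp add: lam_def)
  also have "cmod \<dots> \<le> s ^ 4 * C ^ 4 / 24"
  proof (rule integral_le_D)
    fix x
    have "cmod (iexp (s * z x) - (1 + \<i> * (s * z x) - (s * z x)\<^sup>2 / 2 - \<i> * (s * z x) ^ 3 / 6)) \<le> (s * z x) ^ 4 / 24"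
      using iexp_taylor(3)[of "s * z x"] by simp
    also have "\<dots> \<le> s ^ 4 * C ^ 4 / 24"
      using power_mono[OF zC[of x], of 4] by (simp add: power_mult_distrib mult_left_mono)
    finally show "cmod (iexp (s * z x) - (1 + \<i> * s * of_real (z x ^ 1) - of_real (s\<^sup>2 / 2) * of_real ((z x) ^ 2) - \<i> * of_real (s ^ 3 / 6) * of_real ((z x) ^ 3))) \<le> s ^ 4 * C ^ 4 / 24"
      by (simp add: power_mult_distrib algebra_simps)
  qed measurable
  finally show ?thesis by simp
qed

text \<open>The comparison function has modulus at most 1, so \<open>n\<close>-th powers are compared by \<open>norm_power_diff\<close>.\<close>

definition "cg s = complex_of_real (exp (- (s\<^sup>2 / 2))) * iexp (- (s ^ 3 * lam / 6))"

lemma cg_le_1: "cmod (cg s) \<le> 1"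
  unfolding cg_def norm_mult by (simp del: of_real_mult of_real_minus of_real_divide of_real_power)

text \<open>Both functions have the same Taylor polynomial of degree 3 at 0, so they differ by order
  \<open>s ^ 4\<close>. For \<open>\<bar>s\<bar> > 1\<close> the bound 1 on each modulus already
  suffices, which makes the estimate valid on the whole line.\<close>

lemma cf_cg: "cmod (cf s - cg s) \<le> 5 * C ^ 6 * s ^ 4"
proof -
  have C6: "1 \<le> C ^ 6" "C ^ 4 \<le> C ^ 6" "C ^ 3 \<le> C ^ 6"
    using C1 by (auto intro: one_le_power power_increasing)
  show ?thesis
  proof (cases "\<bar>s\<bar> \<le> 1")
    case False
    then have "1 \<le> \<bar>s\<bar> ^ 4" by (intro one_le_power) auto
    then have s4: "1 \<le> s ^ 4" by simp
    have "cmod (cf s - cg s) \<le> 1 + 1"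
      by (intro order_trans[OF norm_triangle_ineq4] add_mono cf_le_1 cg_le_1)
    also have "\<dots> \<le> 5 * (1 * 1)" by simp
    also have "\<dots> \<le> 5 * (C ^ 6 * s ^ 4)"
      using C6 s4 by (intro mult_left_mono mult_mono) auto
    finally show ?thesis by (simp add: mult.assoc)
  next
    case True
    define a where "a = exp (- (s\<^sup>2 / 2))"
    define v where "v = s ^ 3 * lam / 6"
    define ra where "ra = a - (1 - s\<^sup>2 / 2)"
    define rb where "rb = iexp (- v) - 1 - \<i> * of_real (- v)"
    have ra: "\<bar>ra\<bar> \<le> s ^ 4 / 8"
      using exp_minus_taylor1[of "s\<^sup>2 / 2"] by (simp add: ra_def a_def power_divide power_mult[symmetric])
    have rb: "cmod rb \<le> v\<^sup>2 / 2"
      using iexp_taylor(2)[of "- v"] by (simp add: rb_def)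
    have s2: "s\<^sup>2 \<le> 1" using True by (simp add: abs_square_le_1)
    have s64: "s ^ 6 \<le> s ^ 4"
    proof -
      have "s ^ 6 = s ^ 4 * s\<^sup>2" by (simp flip: power_add)
      also have "\<dots> \<le> s ^ 4 * 1" using s2 by (intro mult_left_mono) auto
      finally show ?thesis by simp
    qed
    have lam2: "lam\<^sup>2 \<le> C ^ 6"
      using abs_power2_le[OF lam_le] by (simp flip: power_mult)
    have v2: "v\<^sup>2 \<le> s ^ 4 * C ^ 6"
    proof -
      have "v\<^sup>2 = s ^ 6 * lam\<^sup>2 / 36" by (simp add: v_def power_divide power_mult_distrib flip: power_mult)
      also have "\<dots> \<le> s ^ 4 * C ^ 6 / 36"
        using s64 lam2 by (intro divide_right_mono mult_mono) auto
      also have "\<dots> \<le> s ^ 4 * C ^ 6" using C1 by simp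
      finally show ?thesis .
    qed
    have sv: "s\<^sup>2 * \<bar>v\<bar> \<le> s ^ 4 * C ^ 6"
    proof -
      have "s\<^sup>2 * \<bar>v\<bar> = s ^ 4 * (\<bar>s\<bar> * \<bar>lam\<bar>) / 6"
      proof -
        have "s ^ 4 * \<bar>s\<bar> = s\<^sup>2 * \<bar>s ^ 3\<bar>"
          by (simp add: abs_mult power_abs[symmetric] power4_eq_xxxx power2_eq_square power3_eq_cube)
        then show ?thesis by (simp add: v_def abs_mult)
      qed
      also have "\<dots> \<le> s ^ 4 * (1 * C ^ 6) / 6"
        using True lam_le C6 by (intro divide_right_mono mult_left_mono mult_mono) auto
      also have "\<dots> \<le> s ^ 4 * C ^ 6" using C1 by simp
      finally show ?thesis .
    qed
    \<comment> \<open>The remainders \<open>ra\<close> of the real exponential and \<open>rb\<close>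
      of the phase, plus the cross term of \<open>s^2 / 2\<close> and \<open>v\<close>, which has
      degree 5.\<close>
    have "cg s - (1 - s\<^sup>2 / 2 - \<i> * v) = ra * iexp (- v) + of_real (1 - s\<^sup>2 / 2) * rb + \<i> * of_real (s\<^sup>2 / 2 * v)"
      unfolding cg_def a_def[symmetric] ra_def rb_def v_def[symmetric] by (simp add: algebra_simps)
    also have "cmod \<dots> \<le> \<bar>ra\<bar> * 1 + 1 * cmod rb + s\<^sup>2 / 2 * \<bar>v\<bar>"
    proof (intro order_trans[OF norm_triangle_ineq] add_mono)
      show "cmod (ra * iexp (- v)) \<le> \<bar>ra\<bar> * 1"
        by (simp add: norm_mult del: of_real_minus)
      show "cmod (of_real (1 - s\<^sup>2 / 2) * rb) \<le> 1 * cmod rb"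
        unfolding norm_mult norm_of_real using s2 by (intro mult_right_mono) auto
      show "cmod (\<i> * of_real (s\<^sup>2 / 2 * v)) \<le> s\<^sup>2 / 2 * \<bar>v\<bar>"
        unfolding norm_mult norm_of_real by (simp add: abs_mult)
    qed
    also have "\<dots> \<le> s ^ 4 * C ^ 6 + s ^ 4 * C ^ 6 + s ^ 4 * C ^ 6"
    proof (intro add_mono)
      have "s ^ 4 * 1 \<le> s ^ 4 * C ^ 6" using C6 by (intro mult_left_mono) auto
      then show "\<bar>ra\<bar> * 1 \<le> s ^ 4 * C ^ 6" using ra zero_le_even_power[of 4 s] by simp
      show "1 * cmod rb \<le> s ^ 4 * C ^ 6" "s\<^sup>2 / 2 * \<bar>v\<bar> \<le> s ^ 4 * C ^ 6"
        using rb v2 sv zero_le_power2[of v] mult_nonneg_nonneg[of "s\<^sup>2" "\<bar>v\<bar>"] by linarith+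
    qed
    finally have 1: "cmod (cg s - (1 - s\<^sup>2 / 2 - \<i> * v)) \<le> 3 * (s ^ 4 * C ^ 6)"
      by (simp add: mult.commute)
    have "cmod (cf s - (1 - s\<^sup>2 / 2 - \<i> * v)) \<le> s ^ 4 * C ^ 4 / 24"
      using cf_taylor[of s] by (simp add: v_def mult.assoc)
    also have "\<dots> \<le> s ^ 4 * C ^ 6"
  proof -
    have "0 \<le> s ^ 4 * C ^ 6" using C1 by (intro mult_nonneg_nonneg) auto
    moreover have "s ^ 4 * C ^ 4 \<le> s ^ 4 * C ^ 6" using C6 by (intro mult_left_mono) auto
    ultimately show ?thesis by linarith
  qed
    finally have 2: "cmod (cf s - (1 - s\<^sup>2 / 2 - \<i> * v)) \<le> s ^ 4 * C ^ 6" .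
    have "cmod (cf s - cg s) = cmod ((cf s - (1 - s\<^sup>2 / 2 - \<i> * v)) - (cg s - (1 - s\<^sup>2 / 2 - \<i> * v)))"
      by simp
    also have "\<dots> \<le> cmod (cf s - (1 - s\<^sup>2 / 2 - \<i> * v)) + cmod (cg s - (1 - s\<^sup>2 / 2 - \<i> * v))"
      by (rule norm_triangle_ineq4)
    also have "\<dots> \<le> s ^ 4 * C ^ 6 + 3 * (s ^ 4 * C ^ 6)" using 1 2 by (intro add_mono)
    also have "\<dots> \<le> 5 * (s ^ 4 * C ^ 6)"
    proof -
      have "0 \<le> s ^ 4 * C ^ 6" using C1 by (intro mult_nonneg_nonneg) auto
      then show ?thesis by linarith
    qed
    finally show ?thesis by (simp add: mult_ac)
  qed
qed

section \<open>Expansions at the scale \<open>s = t / sqrt N\<close>\<close>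

context
  fixes N :: nat and t :: real
  assumes N: "2 \<le> N"
begin

private definition "s = t / sqrt N"
private definition "u = 1 + \<bar>t\<bar>"
private definition "E = exp (- (t\<^sup>2 / 2))"

private lemma N1: "1 \<le> real N" "1 \<le> sqrt N" "sqrt N * sqrt N = N" "0 < sqrt N"
  using N by auto

private lemma u1: "1 \<le> u" "0 \<le> u" by (auto simp: u_def)

private lemma tu: "\<bar>t\<bar> ^ a \<le> u ^ b" if "a \<le> b" for a b
proof -
  have "\<bar>t\<bar> ^ a \<le> u ^ a" by (intro power_mono) (auto simp: u_def)
  also have "\<dots> \<le> u ^ b" using that by (intro power_increasing u1)
  finally show ?thesis .
qed

private lemma s_powers: "s\<^sup>2 = t\<^sup>2 / N" "s ^ 4 = t ^ 4 / (real N)\<^sup>2" "N * s\<^sup>2 = t\<^sup>2" "N * s ^ 3 = t ^ 3 / sqrt N" "\<bar>s\<bar> = \<bar>t\<bar> / sqrt N"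
proof -
  show 2: "s\<^sup>2 = t\<^sup>2 / N" by (simp add: s_def power_divide)
  have "s ^ 4 = (s\<^sup>2)\<^sup>2" by (simp flip: power_mult)
  then show "s ^ 4 = t ^ 4 / (real N)\<^sup>2" unfolding 2 by (simp add: power_divide flip: power_mult)
  show *: "N * s\<^sup>2 = t\<^sup>2" unfolding 2 using N by simp
  have "N * s ^ 3 = (N * s\<^sup>2) * s" by (simp add: power2_eq_square power3_eq_cube)
  then show "N * s ^ 3 = t ^ 3 / sqrt N" unfolding * by (simp add: s_def power2_eq_square power3_eq_cube)
  show "\<bar>s\<bar> = \<bar>t\<bar> / sqrt N" by (simp add: s_def)
qed

private lemma E1: "0 \<le> E" "E \<le> 1" by (auto simp: E_def)

private lemma C_powers: "1 \<le> C ^ a" "a \<le> b \<Longrightarrow> C ^ a \<le> C ^ b"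
  using C1 by (auto intro: one_le_power power_increasing)

private lemma cf_cg_power: "cmod (cf s ^ N - cg s ^ N) \<le> 5 * C ^ 6 * (t ^ 4 / N)"
proof -
  have "cmod (cf s ^ N - cg s ^ N) \<le> N * cmod (cf s - cg s)"
    by (intro norm_power_diff cf_le_1 cg_le_1)
  also have "\<dots> \<le> N * (5 * C ^ 6 * s ^ 4)" by (intro mult_left_mono cf_cg) auto
  also have "\<dots> = 5 * C ^ 6 * (t ^ 4 / N)"
    unfolding s_powers using N by (simp add: power2_eq_square)
  finally show ?thesis .
qed

private definition "V = t ^ 3 * lam / (6 * sqrt N)"

private lemma cg_power: "cg s ^ N = of_real E * iexp (- V)"
proof -
  have "iexp (- (s ^ 3 * lam / 6)) ^ N = iexp (- (N * s ^ 3 * lam / 6))"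
    by (simp add: exp_of_nat_mult[symmetric] algebra_simps)
  also have "N * s ^ 3 * lam / 6 = V" unfolding s_powers V_def by simp
  finally have 1: "iexp (- (s ^ 3 * lam / 6)) ^ N = iexp (- V)" .
  have "exp (- (s\<^sup>2 / 2)) ^ N = exp (- (N * s\<^sup>2 / 2))"
    by (simp add: exp_of_nat_mult[symmetric])
  then have 2: "exp (- (s\<^sup>2 / 2)) ^ N = E" unfolding s_powers(3) E_def .
  show ?thesis
    unfolding cg_def power_mult_distrib 1 of_real_power[symmetric] 2 ..
qed

private lemma V_le: "\<bar>V\<bar> \<le> C ^ 3 * (\<bar>t\<bar> ^ 3 / sqrt N)"
proof -
  have "\<bar>V\<bar> = (\<bar>lam\<bar> / 6) * (\<bar>t\<bar> ^ 3 / sqrt N)"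
    by (simp add: V_def abs_mult power_abs)
  also have "\<dots> \<le> C ^ 3 * (\<bar>t\<bar> ^ 3 / sqrt N)"
    using lam_le by (intro mult_right_mono) auto
  finally show ?thesis .
qed

text \<open>One factor \<open>\<bar>t\<bar>\<close> is kept outside the power of \<open>u\<close> on
  purpose: the smoothing bound requires errors that vanish linearly at \<open>t = 0\<close>.\<close>

private lemma cf_power_expansion: "cmod (cf s ^ N - of_real E * (1 - \<i> * of_real V)) \<le> 6 * C ^ 6 * (\<bar>t\<bar> * u ^ 5 / N)"
proof -
  have "cmod (of_real E * iexp (- V) - of_real E * (1 - \<i> * of_real V)) = E * cmod (iexp (- V) - 1 - \<i> * of_real (- V))"
    unfolding right_diff_distrib[symmetric] norm_mult using E1 by (simp add: algebra_simps)
  also have "\<dots> \<le> 1 * ((- V)\<^sup>2 / 2)"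
    by (intro mult_mono E1 iexp_taylor) auto
  also have "\<dots> \<le> V\<^sup>2" by simp
  also have "\<dots> \<le> (C ^ 3 * (\<bar>t\<bar> ^ 3 / sqrt N))\<^sup>2" by (rule abs_power2_le[OF V_le])
  also have "\<dots> = C ^ 6 * (\<bar>t\<bar> ^ 6 / N)"
    by (simp add: power_mult_distrib power_divide flip: power_mult)
  also have "\<dots> \<le> C ^ 6 * (\<bar>t\<bar> * u ^ 5 / N)"
    using mult_left_mono[OF tu[of 5 5], of "\<bar>t\<bar>"] C1 by (intro mult_left_mono divide_right_mono) (auto simp: power_abs eval_nat_numeral)
  finally have 1: "cmod (of_real E * iexp (- V) - of_real E * (1 - \<i> * of_real V)) \<le> C ^ 6 * (\<bar>t\<bar> * u ^ 5 / N)" .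
  have "t ^ 4 \<le> \<bar>t\<bar> * u ^ 5"
    using mult_left_mono[OF tu[of 3 5], of "\<bar>t\<bar>"] by (simp add: power_abs[symmetric] power3_eq_cube power4_eq_xxxx abs_mult)
  then have "5 * C ^ 6 * (t ^ 4 / N) \<le> 5 * C ^ 6 * (\<bar>t\<bar> * u ^ 5 / N)"
    using C1 by (intro mult_left_mono divide_right_mono) auto
  then have 2: "cmod (cf s ^ N - of_real E * iexp (- V)) \<le> 5 * C ^ 6 * (\<bar>t\<bar> * u ^ 5 / N)"
    using cf_cg_power unfolding cg_power by linarith
  show ?thesis
    using norm_triangle_le[OF add_mono[OF 1 2]] by (simp add: algebra_simps)
qed

private lemma over_sqrt: "0 \<le> a \<Longrightarrow> a / N \<le> a / sqrt N"
  using N1 by (intro divide_left_mono) (auto simp: real_le_rsqrt sqrt_le_D power2_eq_square real_sqrt_le_iff' intro!: real_le_lsqrt)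

text \<open>Marked factors leave the powers \<open>N - 1\<close> and \<open>N - 2\<close>; dropping
  a factor costs at most \<open>\<bar>s\<bar> * C\<close>, because \<open>cf s\<close> is that close
  to 1. Accuracy \<open>1 / sqrt N\<close> suffices, since these terms are later multiplied by
  \<open>t / sqrt N\<close>.\<close>

private lemma cf_power_shift:
  assumes j: "j \<le> 2"
  shows "cmod (cf s ^ (N - j) - of_real E) \<le> 8 * C ^ 6 * (u ^ 4 / sqrt N)"
proof -
  have cf1: "cmod (1 - cf s) \<le> \<bar>s\<bar> * C"
    using cf_mult_0[of "\<lambda>_. 1" 1 s] D.prob_space unfolding cf_def by (simp add: norm_minus_commute)
  have "cf s ^ (N - j) - cf s ^ N = cf s ^ (N - j) * (1 - cf s ^ j)"
    using N j by (simp add: algebra_simps power_add[symmetric])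
  also have "cmod \<dots> \<le> 1 * (2 * (\<bar>s\<bar> * C))"
    unfolding norm_mult norm_power
  proof (intro mult_mono power_le_one cf_le_1)
    have "cmod (1 ^ j - cf s ^ j) \<le> j * cmod (1 - cf s)" by (intro norm_power_diff cf_le_1) auto
    also have "\<dots> \<le> 2 * (\<bar>s\<bar> * C)" using j cf1 by (intro mult_mono) auto
    finally show "cmod (1 - cf s ^ j) \<le> 2 * (\<bar>s\<bar> * C)" by simp
  qed auto
  also have "1 * (2 * (\<bar>s\<bar> * C)) = 2 * C * (\<bar>t\<bar> / sqrt N)" unfolding s_powers by simp
  also have "\<dots> \<le> 2 * C ^ 6 * (u ^ 4 / sqrt N)"
    using tu[of 1 4] C_powers(2)[of 1 6] C1 by (intro mult_mono divide_right_mono) auto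
  finally have 1: "cmod (cf s ^ (N - j) - cf s ^ N) \<le> 2 * C ^ 6 * (u ^ 4 / sqrt N)" .
  have "t ^ 4 / N \<le> u ^ 4 / sqrt N"
    using tu[of 4 4] over_sqrt[of "t ^ 4"] divide_right_mono[of "t ^ 4" "u ^ 4" "sqrt N"] by simp
  then have "5 * C ^ 6 * (t ^ 4 / N) \<le> 5 * C ^ 6 * (u ^ 4 / sqrt N)" using C1 by (intro mult_left_mono) auto
  then have 2: "cmod (cf s ^ N - of_real E * iexp (- V)) \<le> 5 * C ^ 6 * (u ^ 4 / sqrt N)"
    using cf_cg_power unfolding cg_power by linarith
  have "of_real E * iexp (- V) - of_real E = of_real E * (iexp (- V) - 1)" by (simp add: algebra_simps)
  also have "cmod \<dots> \<le> 1 * \<bar>- V\<bar>"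
    unfolding norm_mult norm_of_real using E1 by (intro mult_mono iexp_taylor) auto
  also have "\<dots> \<le> C ^ 3 * (\<bar>t\<bar> ^ 3 / sqrt N)" using V_le by simp
  also have "\<dots> \<le> C ^ 6 * (u ^ 4 / sqrt N)"
    using tu[of 3 4] C_powers(2)[of 3 6] C1 by (intro mult_mono divide_right_mono) auto
  finally have 3: "cmod (of_real E * iexp (- V) - of_real E) \<le> C ^ 6 * (u ^ 4 / sqrt N)" .
  have "cmod (cf s ^ (N - j) - of_real E) \<le> cmod (cf s ^ (N - j) - cf s ^ N) + cmod (cf s ^ N - of_real E * iexp (- V)) + cmod (of_real E * iexp (- V) - of_real E)"
    using norm_triangle_ineq[of "cf s ^ (N - j) - cf s ^ N" "cf s ^ N - of_real E"]
      norm_triangle_ineq[of "cf s ^ N - of_real E * iexp (- V)" "of_real E * iexp (- V) - of_real E"] by simp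
  then show ?thesis using 1 2 3 by linarith
qed

private lemma iexp_S: "iexp (t * (S z N w / sqrt N)) = (\<Prod>k<N. iexp (s * z (X k w)))"
proof -
  have "t * (S z N w / sqrt N) = (\<Sum>k<N. s * z (X k w))"
    unfolding S_def s_def by (simp add: sum_distrib_left sum_divide_distrib)
  then show ?thesis by (simp add: exp_sum sum_distrib_left)
qed

context
  fixes g :: "real \<Rightarrow> real"
  assumes g[measurable]: "g \<in> borel_measurable borel" and gC: "\<And>x. \<bar>g x\<bar> \<le> C"
    and g_mean: "(\<integral>x. g x \<partial>D) = 0"
begin

private definition "d = (\<integral>x. z x * g x \<partial>D)"
private definition "mg = (CLINT x|D. iexp (s * z x) * of_real (g x))"
private definition "mgg = (CLINT x|D. iexp (s * z x) * of_real ((g x)\<^sup>2))"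

private lemma d_le: "\<bar>d\<bar> \<le> C\<^sup>2"
proof -
  have "cmod (CLINT x|D. of_real (z x * g x)) \<le> C * C"
  proof (rule integral_le_D)
    show "cmod (of_real (z x * g x)) \<le> C * C" for x
      unfolding norm_of_real abs_mult using zC gC C1 by (intro mult_mono) auto
  qed measurable
  then show ?thesis unfolding d_def by (simp del: of_real_mult add: power2_eq_square)
qed

private lemma mg1: "cmod (mg - \<i> * s * of_real d) \<le> s\<^sup>2 * C ^ 3 / 2"
  unfolding mg_def d_def by (rule cf_mult_1[OF g gC g_mean])

private lemma mg0: "cmod mg \<le> \<bar>s\<bar> * C\<^sup>2"
  using cf_mult_0[OF g gC, of s] g_mean unfolding mg_def by (simp add: power2_eq_square)

text \<open>The exact value is \<open>sqrt N * cf s ^ (N - 1) * mg\<close>, where \<open>mg\<close>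
  is close to \<open>\<i> * s * d\<close>, \<open>sqrt N * s = t\<close>, and the power is close to
  the Gaussian.\<close>

lemma cf_S_linear:
  "cmod ((CLINT w|M. iexp (t * (S z N w / sqrt N)) * of_real (S g N w / sqrt N)) - \<i> * of_real (t * (\<integral>x. z x * g x \<partial>D) * exp (- (t\<^sup>2 / 2))))
    \<le> 9 * C ^ 8 * ((1 + \<bar>t\<bar>) ^ 5 / sqrt N)"
proof -
  have "(CLINT w|M. iexp (t * (S z N w / sqrt N)) * of_real (S g N w / sqrt N))
    = (CLINT w|M. of_real (1 / sqrt N) * ((\<Prod>k<N. iexp (s * z (X k w))) * of_real (S g N w)))"
    unfolding iexp_S by (intro Bochner_Integration.integral_cong) (auto simp: field_simps)
  also have "\<dots> = of_real (1 / sqrt N) * (of_nat N * cf s ^ (N - 1) * mg)"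
    unfolding cf_def mg_def
    by (subst integral_mult_right_zero, subst expectation_prod_S[where B=C]) (use gC in \<open>auto simp del: of_real_mult\<close>)
  also have "\<dots> = of_real (sqrt N) * (cf s ^ (N - 1) * mg)"
  proof -
    have "of_real (1 / sqrt N) * of_nat N = complex_of_real (1 / sqrt N * (sqrt N * sqrt N))"
      unfolding N1(3) by simp
    also have "1 / sqrt N * (sqrt N * sqrt N) = sqrt N"
    proof -
      have "1 / a * (a * a) = a" for a :: real by simp
      then show ?thesis .
    qed
    finally show ?thesis by (metis mult.assoc)
  qed
  finally have eq: "(CLINT w|M. iexp (t * (S z N w / sqrt N)) * of_real (S g N w / sqrt N)) = of_real (sqrt N) * (cf s ^ (N - 1) * mg)" .
  have "of_real (sqrt N) * (cf s ^ (N - 1) * mg) - \<i> * of_real (t * d * E)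
     = of_real (sqrt N) * cf s ^ (N - 1) * (mg - \<i> * s * of_real d) + (cf s ^ (N - 1) - of_real E) * (\<i> * of_real (t * d))"
  proof -
    have "sqrt N * s = t" using N1(4) by (simp add: s_def)
    then have "complex_of_real t = of_real (sqrt N) * of_real s" by (metis of_real_mult)
    then show ?thesis by (simp add: algebra_simps)
  qed
  also have "cmod \<dots> \<le> sqrt N * 1 * (s\<^sup>2 * C ^ 3 / 2) + 8 * C ^ 6 * (u ^ 4 / sqrt N) * (\<bar>t\<bar> * C\<^sup>2)"
  proof (intro order_trans[OF norm_triangle_ineq] add_mono)
    have pw: "cmod (cf s ^ (N - 1)) \<le> 1" unfolding norm_power by (intro power_le_one cf_le_1) auto
    have d: "cmod (\<i> * of_real (t * d)) \<le> \<bar>t\<bar> * C\<^sup>2"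
      unfolding norm_mult[of \<i>] norm_of_real abs_mult using mult_left_mono[OF d_le, of "\<bar>t\<bar>"] by simp
    show "cmod (of_real (sqrt N) * cf s ^ (N - 1) * (mg - \<i> * s * of_real d)) \<le> sqrt N * 1 * (s\<^sup>2 * C ^ 3 / 2)"
      unfolding norm_mult[of "_ * _"] norm_mult[of "of_real (sqrt N)"] norm_of_real using C1 N1 by (intro mult_mono mg1 pw) auto
    show "cmod ((cf s ^ (N - 1) - of_real E) * (\<i> * of_real (t * d))) \<le> 8 * C ^ 6 * (u ^ 4 / sqrt N) * (\<bar>t\<bar> * C\<^sup>2)"
      unfolding norm_mult[of "_ - _"] using u1 C1 by (intro mult_mono cf_power_shift d) auto
  qed
  also have "sqrt N * 1 * (s\<^sup>2 * C ^ 3 / 2) = C ^ 3 / 2 * (\<bar>t\<bar>\<^sup>2 / sqrt N)"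
  proof -
    have "sqrt N * s\<^sup>2 = t\<^sup>2 / sqrt N"
    proof -
      have "sqrt N * (t / sqrt N)\<^sup>2 = t\<^sup>2 / sqrt N" using N1(4) by (simp add: field_simps power2_eq_square del: real_sqrt_mult_self)
      then show ?thesis by (simp add: s_def)
    qed
    then have *: "C ^ 3 / 2 * (sqrt N * s\<^sup>2) = C ^ 3 / 2 * (\<bar>t\<bar>\<^sup>2 / sqrt N)" by (simp only: power2_abs)
    have "a * 1 * (b * c / 2) = c / 2 * (a * b)" for a b c :: real by simp
    then show ?thesis unfolding *[symmetric] .
  qed
  also have "\<dots> + 8 * C ^ 6 * (u ^ 4 / sqrt N) * (\<bar>t\<bar> * C\<^sup>2) \<le> C ^ 8 * (u ^ 5 / sqrt N) + 8 * C ^ 8 * (u ^ 5 / sqrt N)"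
  proof (rule add_mono)
    show "C ^ 3 / 2 * (\<bar>t\<bar>\<^sup>2 / sqrt N) \<le> C ^ 8 * (u ^ 5 / sqrt N)"
    proof (intro mult_mono divide_right_mono)
      show "C ^ 3 / 2 \<le> C ^ 8" using C_powers(2)[of 3 8] C_powers(1)[of 8] by linarith
    qed (use tu[of 2 5] C1 in auto)
    have "u ^ 4 * \<bar>t\<bar> \<le> u ^ 4 * u" by (intro mult_left_mono) (auto simp: u_def)
    then have "8 * C ^ 8 * (u ^ 4 * \<bar>t\<bar> / sqrt N) \<le> 8 * C ^ 8 * (u ^ 5 / sqrt N)"
      using C1 by (intro mult_left_mono divide_right_mono) (auto simp: eval_nat_numeral mult_ac)
    moreover have "8 * C ^ 6 * (u ^ 4 / sqrt N) * (\<bar>t\<bar> * C\<^sup>2) = 8 * C ^ 8 * (u ^ 4 * \<bar>t\<bar> / sqrt N)"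
      by (simp add: power_add[of C 6 2, simplified])
    ultimately show "8 * C ^ 6 * (u ^ 4 / sqrt N) * (\<bar>t\<bar> * C\<^sup>2) \<le> 8 * C ^ 8 * (u ^ 5 / sqrt N)" by linarith
  qed
  finally show ?thesis unfolding eq E_def u_def d_def by simp
qed

text \<open>The diagonal pairs give the variance of \<open>g\<close>; the off-diagonal pairs give
  \<open>(N - 1) * mg^2\<close>, close to \<open>N * (\<i> * s * d)^2 = - t^2 * d^2\<close>.\<close>

lemma cf_S_quadratic:
  "cmod ((CLINT w|M. iexp (t * (S z N w / sqrt N)) * of_real ((S g N w)\<^sup>2 / N))
      - of_real (exp (- (t\<^sup>2 / 2)) * ((\<integral>x. (g x)\<^sup>2 \<partial>D) - t\<^sup>2 * (\<integral>x. z x * g x \<partial>D)\<^sup>2)))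
    \<le> 21 * C ^ 10 * ((1 + \<bar>t\<bar>) ^ 6 / sqrt N)"
proof -
  define vg where "vg = (\<integral>x. (g x)\<^sup>2 \<partial>D)"
  have gC2: "\<bar>(g x)\<^sup>2\<bar> \<le> C\<^sup>2" for x using abs_power2_le[OF gC[of x]] by simp
  have vg: "\<bar>vg\<bar> \<le> C\<^sup>2"
  proof -
    have "cmod (CLINT x|D. of_real ((g x)\<^sup>2)) \<le> C\<^sup>2"
      by (rule integral_le_D) (use gC2 in \<open>auto simp del: of_real_power\<close>)
    then show ?thesis unfolding vg_def by (simp del: of_real_power)
  qed
  have "(CLINT w|M. iexp (t * (S z N w / sqrt N)) * of_real ((S g N w)\<^sup>2 / N))
    = (CLINT w|M. of_real (1 / N) * ((\<Prod>k<N. iexp (s * z (X k w))) * of_real ((S g N w)\<^sup>2)))"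
    unfolding iexp_S by (intro Bochner_Integration.integral_cong) (auto simp: field_simps)
  also have "\<dots> = of_real (1 / N) * (of_nat N * cf s ^ (N - 1) * mgg + of_nat (N * (N - 1)) * cf s ^ (N - 2) * mg\<^sup>2)"
    unfolding cf_def mgg_def mg_def
    by (subst integral_mult_right_zero, subst expectation_prod_S_square[where B=C]) (use gC in \<open>auto simp del: of_real_mult\<close>)
  also have "\<dots> = cf s ^ (N - 1) * mgg + of_nat (N - 1) * cf s ^ (N - 2) * mg\<^sup>2"
    using N by (simp add: field_simps del: of_nat_diff)
  finally have eq: "(CLINT w|M. iexp (t * (S z N w / sqrt N)) * of_real ((S g N w)\<^sup>2 / N)) = cf s ^ (N - 1) * mgg + of_nat (N - 1) * cf s ^ (N - 2) * mg\<^sup>2" .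
  define r1 where "r1 = mgg - of_real vg"
  define r2 where "r2 = of_nat (N - 1) * mg\<^sup>2 + of_real (t\<^sup>2 * d\<^sup>2)"
  have r1: "cmod r1 \<le> C ^ 3 * (\<bar>t\<bar> / sqrt N)"
    using cf_mult_0[of "\<lambda>x. (g x)\<^sup>2" "C\<^sup>2" s] gC2 unfolding r1_def mgg_def vg_def s_powers
    by (simp add: power2_eq_square power3_eq_cube mult_ac)
  have r2: "cmod r2 \<le> 3 * C ^ 5 * (u ^ 3 / sqrt N)"
  proof -
    define r where "r = mg - \<i> * s * of_real d"
    \<comment> \<open>A difference of squares, so that the error of \<open>mg\<close> enters only
      linearly; the last summand repairs the discrepancy between \<open>N - 1\<close> and
      \<open>N\<close> in \<open>N * s^2 = t^2\<close>.\<close>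
    have "r2 = of_nat (N - 1) * (mg - \<i> * s * of_real d) * (mg + \<i> * s * of_real d) + of_real (s\<^sup>2 * d\<^sup>2)"
    proof -
      have "t\<^sup>2 = s\<^sup>2 + real (N - 1) * s\<^sup>2"
        using s_powers(3) N by (simp add: of_nat_diff algebra_simps)
      then have "complex_of_real (t\<^sup>2 * d\<^sup>2) = of_real (s\<^sup>2 * d\<^sup>2) + of_nat (N - 1) * of_real (s\<^sup>2 * d\<^sup>2)"
        by (simp only: distrib_right of_real_add mult.assoc of_real_mult[of "real (N - 1)"] of_real_of_nat_eq)
      moreover have p: "(mg - \<i> * s * of_real d) * (mg + \<i> * s * of_real d) = mg\<^sup>2 + of_real (s\<^sup>2 * d\<^sup>2)"
        by (simp add: power2_eq_square algebra_simps)
      ultimately show ?thesis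
        unfolding r2_def mult.assoc[of "of_nat (N - 1)"] p by (simp only: distrib_left add_ac)
    qed
    also have "cmod \<dots> \<le> N * (s\<^sup>2 * C ^ 3 / 2) * (2 * (\<bar>s\<bar> * C\<^sup>2)) + s\<^sup>2 * C ^ 4"
    proof (intro order_trans[OF norm_triangle_ineq] add_mono)
      have "cmod (\<i> * s * of_real d) \<le> \<bar>s\<bar> * C\<^sup>2"
        using d_le by (simp add: norm_mult mult_left_mono)
      then have "cmod (mg + \<i> * s * of_real d) \<le> 2 * (\<bar>s\<bar> * C\<^sup>2)"
        using norm_triangle_ineq[of mg "\<i> * s * of_real d"] mg0 by linarith
      then show "cmod (of_nat (N - 1) * (mg - \<i> * s * of_real d) * (mg + \<i> * s * of_real d)) \<le> N * (s\<^sup>2 * C ^ 3 / 2) * (2 * (\<bar>s\<bar> * C\<^sup>2))"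
        unfolding norm_mult norm_of_nat using C1 by (intro mult_mono mg1) auto
      have "\<bar>s\<^sup>2 * d\<^sup>2\<bar> \<le> s\<^sup>2 * (C\<^sup>2)\<^sup>2"
        using abs_power2_le[OF d_le] by (simp add: abs_mult mult_left_mono)
      then show "cmod (of_real (s\<^sup>2 * d\<^sup>2)) \<le> s\<^sup>2 * C ^ 4"
        unfolding norm_of_real by (simp flip: power_mult)
    qed
    also have "N * (s\<^sup>2 * C ^ 3 / 2) * (2 * (\<bar>s\<bar> * C\<^sup>2)) = (N * s\<^sup>2) * \<bar>s\<bar> * C ^ 5"
      by (simp add: eval_nat_numeral)
    also have "\<dots> = C ^ 5 * (\<bar>t\<bar> ^ 3 / sqrt N)"
      unfolding s_powers(3,5) by (simp add: power2_eq_square power3_eq_cube)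
    also have "s\<^sup>2 * C ^ 4 = C ^ 4 * (\<bar>t\<bar>\<^sup>2 / N)" unfolding s_powers by simp
    also have "C ^ 5 * (\<bar>t\<bar> ^ 3 / sqrt N) + C ^ 4 * (\<bar>t\<bar>\<^sup>2 / N) \<le> C ^ 5 * (u ^ 3 / sqrt N) + C ^ 5 * (u ^ 3 / sqrt N)"
    proof (rule add_mono)
      show "C ^ 5 * (\<bar>t\<bar> ^ 3 / sqrt N) \<le> C ^ 5 * (u ^ 3 / sqrt N)"
        using tu[of 3 3] C1 by (intro mult_left_mono divide_right_mono) auto
      have "\<bar>t\<bar>\<^sup>2 / N \<le> u ^ 3 / sqrt N"
        using over_sqrt[of "\<bar>t\<bar>\<^sup>2"] divide_right_mono[OF tu[of 2 3], of "sqrt N"] by simp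
      then show "C ^ 4 * (\<bar>t\<bar>\<^sup>2 / N) \<le> C ^ 5 * (u ^ 3 / sqrt N)"
        using C_powers(2)[of 4 5] C1 by (intro mult_mono) auto
    qed
    also have "\<dots> \<le> 3 * C ^ 5 * (u ^ 3 / sqrt N)"
    proof -
      have "0 \<le> C ^ 5 * (u ^ 3 / sqrt N)" using C1 u1 by simp
      then show ?thesis unfolding mult.assoc by linarith
    qed
    finally show ?thesis .
  qed
  have "cf s ^ (N - 1) * mgg + of_nat (N - 1) * cf s ^ (N - 2) * mg\<^sup>2 - of_real (E * (vg - t\<^sup>2 * d\<^sup>2))
    = (cf s ^ (N - 1) - of_real E) * of_real vg + cf s ^ (N - 1) * r1 - (cf s ^ (N - 2) - of_real E) * of_real (t\<^sup>2 * d\<^sup>2) + cf s ^ (N - 2) * r2"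
    unfolding r1_def r2_def by (simp add: algebra_simps)
  also have "cmod \<dots> \<le> 8 * C ^ 6 * (u ^ 4 / sqrt N) * C\<^sup>2 + 1 * (C ^ 3 * (\<bar>t\<bar> / sqrt N)) + 8 * C ^ 6 * (u ^ 4 / sqrt N) * (\<bar>t\<bar>\<^sup>2 * C ^ 4) + 1 * (3 * C ^ 5 * (u ^ 3 / sqrt N))"
  proof (intro order_trans[OF norm_triangle_ineq] order_trans[OF norm_triangle_ineq4] add_mono)
    have pw: "cmod (cf s ^ k) \<le> 1" for k unfolding norm_power by (intro power_le_one cf_le_1) auto
    show "cmod ((cf s ^ (N - 1) - of_real E) * of_real vg) \<le> 8 * C ^ 6 * (u ^ 4 / sqrt N) * C\<^sup>2"
      unfolding norm_mult norm_of_real using u1 C1 by (intro mult_mono cf_power_shift vg) auto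
    show "cmod (cf s ^ (N - 1) * r1) \<le> 1 * (C ^ 3 * (\<bar>t\<bar> / sqrt N))"
      unfolding norm_mult by (intro mult_mono pw r1) auto
    show "cmod (cf s ^ (N - 2) * r2) \<le> 1 * (3 * C ^ 5 * (u ^ 3 / sqrt N))"
      unfolding norm_mult by (intro mult_mono pw r2) auto
    have "\<bar>t\<^sup>2 * d\<^sup>2\<bar> \<le> \<bar>t\<bar>\<^sup>2 * (C\<^sup>2)\<^sup>2"
      using abs_power2_le[OF d_le] by (simp add: abs_mult mult_left_mono)
    then have "\<bar>t\<^sup>2 * d\<^sup>2\<bar> \<le> \<bar>t\<bar>\<^sup>2 * C ^ 4" by (simp flip: power_mult)
    then show "cmod ((cf s ^ (N - 2) - of_real E) * of_real (t\<^sup>2 * d\<^sup>2)) \<le> 8 * C ^ 6 * (u ^ 4 / sqrt N) * (\<bar>t\<bar>\<^sup>2 * C ^ 4)"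
      unfolding norm_mult[of "_ - _"] norm_of_real using u1 C1 by (intro mult_mono cf_power_shift) auto
  qed
  also have "\<dots> \<le> 8 * (C ^ 10 * (u ^ 6 / sqrt N)) + C ^ 10 * (u ^ 6 / sqrt N) + 8 * (C ^ 10 * (u ^ 6 / sqrt N)) + 3 * (C ^ 10 * (u ^ 6 / sqrt N))"
  proof (intro add_mono)
    have m: "C ^ a * (y / sqrt N) \<le> C ^ 10 * (u ^ 6 / sqrt N)" if "a \<le> 10" "y \<le> u ^ 6" "0 \<le> y" for a y
      using that C1 by (intro mult_mono divide_right_mono C_powers(2)) auto
    show "8 * C ^ 6 * (u ^ 4 / sqrt N) * C\<^sup>2 \<le> 8 * (C ^ 10 * (u ^ 6 / sqrt N))"
    proof -
      have "8 * C ^ 6 * (u ^ 4 / sqrt N) * C\<^sup>2 = 8 * (C ^ 8 * (u ^ 4 / sqrt N))"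
        by (simp add: power_add[of C 6 2, simplified])
      moreover have "C ^ 8 * (u ^ 4 / sqrt N) \<le> C ^ 10 * (u ^ 6 / sqrt N)"
        by (rule m) (use power_increasing[of 4 6 u] u1 in auto)
      ultimately show ?thesis by linarith
    qed
    show "1 * (C ^ 3 * (\<bar>t\<bar> / sqrt N)) \<le> C ^ 10 * (u ^ 6 / sqrt N)"
      using m[of 3 "\<bar>t\<bar>"] tu[of 1 6] by simp
    have "u ^ 4 * \<bar>t\<bar>\<^sup>2 \<le> u ^ 4 * u\<^sup>2" by (intro mult_left_mono tu) (use u1 in auto)
    then have "u ^ 4 * \<bar>t\<bar>\<^sup>2 \<le> u ^ 6" by (simp flip: power_add)
    from m[OF _ this, of 10] have "C ^ 10 * (u ^ 4 * \<bar>t\<bar>\<^sup>2 / sqrt N) \<le> C ^ 10 * (u ^ 6 / sqrt N)"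
      using u1 by simp
    moreover have "8 * C ^ 6 * (u ^ 4 / sqrt N) * (\<bar>t\<bar>\<^sup>2 * C ^ 4) = 8 * (C ^ 10 * (u ^ 4 * \<bar>t\<bar>\<^sup>2 / sqrt N))"
      by (simp add: power_add[of C 6 4, simplified])
    ultimately show "8 * C ^ 6 * (u ^ 4 / sqrt N) * (\<bar>t\<bar>\<^sup>2 * C ^ 4) \<le> 8 * (C ^ 10 * (u ^ 6 / sqrt N))"
      by linarith
    show "1 * (3 * C ^ 5 * (u ^ 3 / sqrt N)) \<le> 3 * (C ^ 10 * (u ^ 6 / sqrt N))"
      using m[of 5 "u ^ 3"] power_increasing[of 3 6 u] u1 by simp
  qed
  also have "\<dots> \<le> 21 * C ^ 10 * (u ^ 6 / sqrt N)"
  proof -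
    have "0 \<le> C ^ 10 * (u ^ 6 / sqrt N)" using C1 u1 by simp
    then show ?thesis unfolding mult.assoc by linarith
  qed
  finally show ?thesis unfolding eq E_def u_def d_def vg_def by simp
qed

end

lemma cf_S_main:
  "cmod ((CLINT w|M. iexp (t * (S z N w / sqrt N))) - of_real (exp (- (t\<^sup>2 / 2))) * (1 - \<i> * of_real (t ^ 3 * (\<integral>x. (z x) ^ 3 \<partial>D) / (6 * sqrt N))))
   \<le> 6 * C ^ 6 * (\<bar>t\<bar> * (1 + \<bar>t\<bar>) ^ 5 / N)"
proof -
  have i: "integrable D (\<lambda>x. iexp (s * z x))"
    by (rule integrable_bounded_D[where B=1]) (auto simp del: of_real_mult)
  have "(CLINT w|M. iexp (t * (S z N w / sqrt N))) = (CLINT w|M. \<Prod>k<N. iexp (s * z (X k w)))"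
    by (simp only: iexp_S)
  also have "\<dots> = cf s ^ N"
    using expectation_prod(1)[of "\<lambda>_ x. iexp (s * z x)" N] i unfolding cf_def by simp
  finally show ?thesis using cf_power_expansion unfolding E_def V_def u_def lam_def by simp
qed

end

end

end

section \<open>Edgeworth expansion of a quadratic statistic\<close>

context iid_sample
begin

context
  fixes z v A B :: "real \<Rightarrow> real" and C qA qB :: real
  assumes z[measurable]: "z \<in> borel_measurable borel" and zC: "\<And>x. \<bar>z x\<bar> \<le> C"
    and v[measurable]: "v \<in> borel_measurable borel" and vC: "\<And>x. \<bar>v x\<bar> \<le> C"
    and A[measurable]: "A \<in> borel_measurable borel" and AC: "\<And>x. \<bar>A x\<bar> \<le> C"
    and B[measurable]: "B \<in> borel_measurable borel" and BC: "\<And>x. \<bar>B x\<bar> \<le> C"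
    and C1: "1 \<le> C"
    and means: "(\<integral>x. z x \<partial>D) = 0" "(\<integral>x. v x \<partial>D) = 0" "(\<integral>x. A x \<partial>D) = 0" "(\<integral>x. B x \<partial>D) = 0"
    and z_var: "(\<integral>x. (z x)\<^sup>2 \<partial>D) = 1"
begin

definition pert :: "nat \<Rightarrow> real \<Rightarrow> 'a \<Rightarrow> real" where
  "pert N x w = qA * ((S A N w)\<^sup>2 / N) + qB * ((S B N w)\<^sup>2 / N) - x * (S v N w / sqrt N)"

definition T :: "nat \<Rightarrow> real \<Rightarrow> 'a \<Rightarrow> real" where
  "T N x w = S z N w / sqrt N + pert N x w / sqrt N"

text \<open>The coefficients of \<open>\<i> * t\<close>, its square and its cube in the expansion to
  order \<open>1 / sqrt N\<close> are \<open>c0\<close>, \<open>- x * c1\<close> and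
  \<open>c2\<close>. A quadratic term contributes a variance to the first and, through its
  off-diagonal pairs, a squared covariance to the third, next to the skewness of
  \<open>z\<close>.\<close>

definition c0 :: real where "c0 = qA * (\<integral>x. (A x)\<^sup>2 \<partial>D) + qB * (\<integral>x. (B x)\<^sup>2 \<partial>D)"
definition c1 :: real where "c1 = (\<integral>x. z x * v x \<partial>D)"
definition c2 :: real where
  "c2 = (\<integral>x. (z x) ^ 3 \<partial>D) / 6 + qA * (\<integral>x. z x * A x \<partial>D)\<^sup>2 + qB * (\<integral>x. z x * B x \<partial>D)\<^sup>2"

lemma pert_measurable [measurable]: "pert N x \<in> borel_measurable M"
  unfolding pert_def[abs_def] by measurable

lemma T_measurable [measurable]: "T N x \<in> borel_measurable M"
  unfolding T_def[abs_def] by measurable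

private lemma S_power_integrable:
  assumes "g \<in> borel_measurable borel" "\<And>x. \<bar>g x\<bar> \<le> C"
  shows "integrable M (\<lambda>w. S g N w ^ k)"
proof (rule integrable_const_bound[where B="(N * C) ^ k"])
  show "AE w in M. norm (S g N w ^ k) \<le> (N * C) ^ k"
    using S_bound[OF assms(2), where N=N] by (auto simp: power_abs intro!: power_mono)
qed (use assms in measurable)

private lemma pert_square_le:
  "(pert N x w)\<^sup>2 \<le> 3 * (qA\<^sup>2 * ((S A N w) ^ 4 / (real N)\<^sup>2) + qB\<^sup>2 * ((S B N w) ^ 4 / (real N)\<^sup>2) + x\<^sup>2 * ((S v N w) ^ 2 / N))"
proof -
  have gen: "(a + b - c)\<^sup>2 \<le> 3 * (a\<^sup>2 + b\<^sup>2 + c\<^sup>2)" for a b c :: real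
  proof -
    have "0 \<le> (a - b)\<^sup>2 + (a + c)\<^sup>2 + (b + c)\<^sup>2" by simp
    then show ?thesis by (simp add: power2_eq_square algebra_simps)
  qed
  show ?thesis
    unfolding pert_def
    by (rule order_trans[OF gen]) (simp add: power_mult_distrib power_divide flip: power_mult)
qed

private definition "K1 = 4608 * C ^ 4 * (qA\<^sup>2 + qB\<^sup>2 + 1)"

text \<open>The fourth moments of \<open>S A\<close> and \<open>S B\<close> are of order
  \<open>N^2\<close>, so the quadratic part has bounded second moment; only the term with
  \<open>v\<close> grows, like \<open>x^2\<close>. In \<open>K1\<close> the constant is
  \<open>4608 = 3 * 1536\<close>, the 3 coming from squaring three summands.\<close>

private lemma pert_moment:
  assumes N: "1 \<le> N"
  shows "integrable M (\<lambda>w. (pert N x w)\<^sup>2)" "(\<integral>w. (pert N x w)\<^sup>2 \<partial>M) \<le> K1 * (1 + x\<^sup>2)"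
proof -
  let ?R = "\<lambda>w. 3 * (qA\<^sup>2 * ((S A N w) ^ 4 / (real N)\<^sup>2) + qB\<^sup>2 * ((S B N w) ^ 4 / (real N)\<^sup>2) + x\<^sup>2 * ((S v N w) ^ 2 / N))"
  have iA: "integrable M (\<lambda>w. S A N w ^ 4)" and iB: "integrable M (\<lambda>w. S B N w ^ 4)" and iv: "integrable M (\<lambda>w. S v N w ^ 2)"
    by (rule S_power_integrable; use AC BC vC in auto)+
  have iR: "integrable M ?R"
    by (intro integrable_mult_right Bochner_Integration.integrable_add integrable_divide_zero iA iB iv)
  show "integrable M (\<lambda>w. (pert N x w)\<^sup>2)"
    by (rule Bochner_Integration.integrable_bound[OF iR]) (use pert_square_le in \<open>auto intro: order_trans[OF _ abs_ge_self]\<close>)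
  then have "(\<integral>w. (pert N x w)\<^sup>2 \<partial>M) \<le> (\<integral>w. ?R w \<partial>M)"
    by (rule integral_mono[OF _ iR pert_square_le])
  also have "\<dots> = 3 * (qA\<^sup>2 * ((\<integral>w. (S A N w) ^ 4 \<partial>M) / (real N)\<^sup>2) + qB\<^sup>2 * ((\<integral>w. (S B N w) ^ 4 \<partial>M) / (real N)\<^sup>2) + x\<^sup>2 * ((\<integral>w. (S v N w) ^ 2 \<partial>M) / N))"
    using iA iB iv by simp
  also have "\<dots> \<le> 3 * (qA\<^sup>2 * (1536 * C ^ 4) + qB\<^sup>2 * (1536 * C ^ 4) + x\<^sup>2 * (12 * C\<^sup>2))"
  proof (intro mult_left_mono add_mono)
    show "(\<integral>w. (S A N w) ^ 4 \<partial>M) / (real N)\<^sup>2 \<le> 1536 * C ^ 4" "(\<integral>w. (S B N w) ^ 4 \<partial>M) / (real N)\<^sup>2 \<le> 1536 * C ^ 4"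
      using S_moments(2)[OF A AC _ means(3), of N] S_moments(2)[OF B BC _ means(4), of N] C1 N
      by (simp_all add: pos_divide_le_eq)
    show "(\<integral>w. (S v N w) ^ 2 \<partial>M) / N \<le> 12 * C\<^sup>2"
      using S_moments(1)[OF v vC _ means(2), of N] C1 N by (simp add: pos_divide_le_eq)
  qed auto
  also have "\<dots> \<le> K1 * (1 + x\<^sup>2)"
  proof -
    have "C\<^sup>2 \<le> C ^ 4" using C1 by (intro power_increasing) auto
    moreover have "0 \<le> C ^ 4" by simp
    ultimately have "12 * C\<^sup>2 \<le> 1536 * C ^ 4" by linarith
    then have h: "x\<^sup>2 * (12 * C\<^sup>2) \<le> x\<^sup>2 * (1536 * C ^ 4)" by (intro mult_left_mono) auto
    have "3 * (qA\<^sup>2 * (1536 * C ^ 4) + qB\<^sup>2 * (1536 * C ^ 4) + x\<^sup>2 * (12 * C\<^sup>2))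
        \<le> 3 * (qA\<^sup>2 * (1536 * C ^ 4) + qB\<^sup>2 * (1536 * C ^ 4) + x\<^sup>2 * (1536 * C ^ 4))"
      by (intro mult_left_mono add_left_mono h) simp
    also have "\<dots> \<le> 3 * (qA\<^sup>2 * (1536 * C ^ 4) + qB\<^sup>2 * (1536 * C ^ 4) + x\<^sup>2 * (1536 * C ^ 4))
        + 4608 * C ^ 4 * ((qA\<^sup>2 + qB\<^sup>2) * x\<^sup>2 + 1)"
      using C1 by simp
    also have "\<dots> = K1 * (1 + x\<^sup>2)" by (simp add: K1_def algebra_simps)
    finally show ?thesis .
  qed
  finally show "(\<integral>w. (pert N x w)\<^sup>2 \<partial>M) \<le> K1 * (1 + x\<^sup>2)" .
qed

text \<open>The exponential of the perturbation is linearized; the remainder is at most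
  \<open>t^2 / N\<close> times the second moment of \<open>pert\<close>. The linear part consists of
  the expectations in \<open>cf_S_linear\<close> and \<open>cf_S_quadratic\<close>, whose errors of
  order \<open>1 / sqrt N\<close> are multiplied by \<open>\<bar>t\<bar> / sqrt N\<close>. Thus
  every error carries both \<open>\<bar>t\<bar>\<close> and \<open>1 / N\<close>.\<close>

lemma cf_T_expansion:
  obtains K where "0 \<le> K" "\<And>N x t. 2 \<le> N \<Longrightarrow>
    cmod ((CLINT w|M. iexp (t * T N x w)) - edge_char (c0 / sqrt N) (- (x * c1 / sqrt N)) (c2 / sqrt N) t)
      \<le> K * (\<bar>t\<bar> * (1 + \<bar>t\<bar>) ^ 6 * (1 + x\<^sup>2) / N)"
proof -
  define K where "K = K1 + 6 * C ^ 6 + 21 * C ^ 10 * \<bar>qA\<bar> + 21 * C ^ 10 * \<bar>qB\<bar> + 9 * C ^ 8"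
  have K1: "0 \<le> K1" unfolding K1_def using C1 by simp
  have "0 \<le> K" unfolding K_def using C1 K1 by simp
  moreover have "cmod ((CLINT w|M. iexp (t * T N x w)) - edge_char (c0 / sqrt N) (- (x * c1 / sqrt N)) (c2 / sqrt N) t)
      \<le> K * (\<bar>t\<bar> * (1 + \<bar>t\<bar>) ^ 6 * (1 + x\<^sup>2) / N)" if N: "2 \<le> N" for N x t
  proof -
    define u where "u = 1 + \<bar>t\<bar>"
    define R where "R = \<bar>t\<bar> * u ^ 6 * (1 + x\<^sup>2) / N"
    have u1: "1 \<le> u" "\<bar>t\<bar> \<le> u" by (auto simp: u_def)
    have N0: "0 < real N" "0 < sqrt N" "sqrt N * sqrt N = N" using N by auto
    define e where "e w = iexp (t * (S z N w / sqrt N))" for w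
    have em[measurable]: "e \<in> borel_measurable M" unfolding e_def[abs_def] by measurable
    have e1: "cmod (e w) = 1" for w unfolding e_def by (simp del: of_real_mult of_real_divide)
    have ei: "integrable M (\<lambda>w. e w * of_real (g w))" if "integrable M g" for g
      using that by (intro Bochner_Integration.integrable_bound[OF integrable_norm[OF that]]) (auto simp: norm_mult e1)
    have ie: "integrable M e" using ei[of "\<lambda>_. 1"] by simp
    have iA: "integrable M (\<lambda>w. (S A N w)\<^sup>2 / N)" and iB: "integrable M (\<lambda>w. (S B N w)\<^sup>2 / N)" and iv: "integrable M (\<lambda>w. S v N w / sqrt N)"
      using S_power_integrable[of A N 2] S_power_integrable[of B N 2] S_power_integrable[of v N 1] AC BC vC by auto
    define I where "I g = (CLINT w|M. e w * of_real (g w))" for g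
    have ip: "integrable M (pert N x)"
      unfolding pert_def[abs_def] using iA iB iv by (intro Bochner_Integration.integrable_add Bochner_Integration.integrable_diff integrable_mult_right)
    define lin where "lin w = e w * (1 + \<i> * of_real (t / sqrt N * pert N x w))" for w
    have lin_eq: "lin w = e w + \<i> * of_real (t / sqrt N) * (of_real qA * (e w * of_real ((S A N w)\<^sup>2 / N)) + of_real qB * (e w * of_real ((S B N w)\<^sup>2 / N)) - of_real x * (e w * of_real (S v N w / sqrt N)))" for w
    proof -
      have "y * (1 + \<i> * of_real (k * (qA * a + qB * b - x * c))) = y + \<i> * of_real k * (of_real qA * (y * of_real a) + of_real qB * (y * of_real b) - of_real x * (y * of_real c))"
        for y and k a b c :: real
        by (simp add: algebra_simps)
      then show ?thesis unfolding lin_def pert_def .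
    qed
    have ilin: "integrable M lin"
      unfolding lin_eq[abs_def]
      by (intro Bochner_Integration.integrable_add Bochner_Integration.integrable_diff integrable_mult_right ie ei iA iB iv)
    have lin_int: "(CLINT w|M. lin w) = (CLINT w|M. e w) + \<i> * of_real (t / sqrt N) * (of_real qA * I (\<lambda>w. (S A N w)\<^sup>2 / N) + of_real qB * I (\<lambda>w. (S B N w)\<^sup>2 / N) - of_real x * I (\<lambda>w. S v N w / sqrt N))"
      unfolding lin_eq[abs_def] I_def
      using ie ei[OF iA] ei[OF iB] ei[OF iv]
      by (simp del: of_real_divide of_real_power)
    have iT: "integrable M (\<lambda>w. iexp (t * T N x w))"
      by (intro integrable_iexp) auto
    have 1: "cmod ((CLINT w|M. iexp (t * T N x w)) - (CLINT w|M. lin w)) \<le> K1 * R"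
    proof -
      have "cmod ((CLINT w|M. iexp (t * T N x w)) - (CLINT w|M. lin w)) = cmod (CLINT w|M. iexp (t * T N x w) - lin w)"
        using iT ilin by simp
      also have "\<dots> \<le> (\<integral>w. cmod (iexp (t * T N x w) - lin w) \<partial>M)" by (rule integral_norm_bound)
      also have "\<dots> \<le> (\<integral>w. t\<^sup>2 / N * (pert N x w)\<^sup>2 \<partial>M)"
      proof (rule integral_mono)
        show "integrable M (\<lambda>w. cmod (iexp (t * T N x w) - lin w))" using iT ilin by auto
        show "integrable M (\<lambda>w. t\<^sup>2 / N * (pert N x w)\<^sup>2)" using N by (intro integrable_mult_right pert_moment) auto
        fix w
        have "iexp (t * T N x w) = e w * iexp (t / sqrt N * pert N x w)"
          unfolding e_def T_def by (simp add: exp_add[symmetric] algebra_simps)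
        then have "iexp (t * T N x w) - lin w = e w * (iexp (t / sqrt N * pert N x w) - 1 - \<i> * of_real (t / sqrt N * pert N x w))"
          unfolding lin_def by (simp add: algebra_simps)
        then have "cmod (iexp (t * T N x w) - lin w) = cmod (iexp (t / sqrt N * pert N x w) - 1 - \<i> * of_real (t / sqrt N * pert N x w))"
          by (simp only: norm_mult e1 mult_1)
        also have "\<dots> \<le> (t / sqrt N * pert N x w)\<^sup>2 / 2" by (rule iexp_taylor(2))
        also have "\<dots> \<le> (t / sqrt N * pert N x w)\<^sup>2" by simp
        also have "\<dots> = t\<^sup>2 / N * (pert N x w)\<^sup>2" using N by (simp add: power_mult_distrib power_divide)
        finally show "cmod (iexp (t * T N x w) - lin w) \<le> t\<^sup>2 / N * (pert N x w)\<^sup>2" .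
      qed
      also have "\<dots> = t\<^sup>2 / N * (\<integral>w. (pert N x w)\<^sup>2 \<partial>M)" by simp
      also have "\<dots> \<le> t\<^sup>2 / N * (K1 * (1 + x\<^sup>2))" using N by (intro mult_left_mono pert_moment) auto
      also have "\<dots> = K1 * (t\<^sup>2 * (1 + x\<^sup>2) / N)" by simp
      also have "\<dots> \<le> K1 * R"
      proof -
        have "t\<^sup>2 = \<bar>t\<bar> * \<bar>t\<bar>" by (simp add: power2_eq_square)
        also have "\<dots> \<le> \<bar>t\<bar> * u ^ 6"
          using u1 power_increasing[of 1 6 u] by (intro mult_left_mono) auto
        finally show ?thesis unfolding R_def using K1 by (intro mult_left_mono divide_right_mono mult_right_mono) auto
      qed
      finally show ?thesis .
    qed
    define E where "E = exp (- (t\<^sup>2 / 2))"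
    define gA where "gA = complex_of_real (E * ((\<integral>x. (A x)\<^sup>2 \<partial>D) - t\<^sup>2 * (\<integral>x. z x * A x \<partial>D)\<^sup>2))"
    define gB where "gB = complex_of_real (E * ((\<integral>x. (B x)\<^sup>2 \<partial>D) - t\<^sup>2 * (\<integral>x. z x * B x \<partial>D)\<^sup>2))"
    define gv where "gv = \<i> * complex_of_real (t * c1 * E)"
    define g0 where "g0 = complex_of_real E * (1 - \<i> * of_real (t ^ 3 * (\<integral>x. (z x) ^ 3 \<partial>D) / (6 * sqrt N)))"
    have bA: "cmod (I (\<lambda>w. (S A N w)\<^sup>2 / N) - gA) \<le> 21 * C ^ 10 * (u ^ 6 / sqrt N)"
      unfolding I_def e_def gA_def E_def u_def by (rule cf_S_quadratic[OF z zC C1 means(1) z_var N A AC means(3)])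
    have bB: "cmod (I (\<lambda>w. (S B N w)\<^sup>2 / N) - gB) \<le> 21 * C ^ 10 * (u ^ 6 / sqrt N)"
      unfolding I_def e_def gB_def E_def u_def by (rule cf_S_quadratic[OF z zC C1 means(1) z_var N B BC means(4)])
    have bv: "cmod (I (\<lambda>w. S v N w / sqrt N) - gv) \<le> 9 * C ^ 8 * (u ^ 5 / sqrt N)"
      unfolding I_def e_def gv_def E_def u_def c1_def by (rule cf_S_linear[OF z zC C1 means(1) z_var N v vC means(2)])
    have b0: "cmod ((CLINT w|M. e w) - g0) \<le> 6 * C ^ 6 * (\<bar>t\<bar> * u ^ 5 / N)"
      unfolding e_def g0_def E_def u_def by (rule cf_S_main[OF z zC C1 means(1) z_var N])
    have edge: "edge_char (c0 / sqrt N) (- (x * c1 / sqrt N)) (c2 / sqrt N) t = g0 + \<i> * of_real (t / sqrt N) * (of_real qA * gA + of_real qB * gB - of_real x * gv)"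
    proof -
      have i2: "(\<i> * complex_of_real t)\<^sup>2 = - (of_real t)\<^sup>2" by (simp add: power_mult_distrib)
      have "(\<i> * complex_of_real t) ^ 3 = (\<i> * complex_of_real t)\<^sup>2 * (\<i> * complex_of_real t)"
        by (simp only: power2_eq_square power3_eq_cube)
      also have "\<dots> = - \<i> * (of_real t) ^ 3"
        unfolding i2 by (simp add: power2_eq_square power3_eq_cube)
      finally have i3: "(\<i> * complex_of_real t) ^ 3 = - \<i> * (of_real t) ^ 3" .
      have alg: "e * (1 + \<i> * y * ((a * vA + b * vB) * k) + (- y\<^sup>2) * (- (r * c * k)) + (- \<i> * y ^ 3) * ((l + a * dA\<^sup>2 + b * dB\<^sup>2) * k))
        = e * (1 - \<i> * (y ^ 3 * l * k)) + \<i> * (y * k) * (a * (e * (vA - y\<^sup>2 * dA\<^sup>2)) + b * (e * (vB - y\<^sup>2 * dB\<^sup>2)) - r * (\<i> * (y * c * e)))"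
        for e y a b k r c l vA vB dA dB :: complex
        by (simp add: algebra_simps power2_eq_square power3_eq_cube)
      show ?thesis
        using alg[of "of_real E" "of_real t" "of_real qA" "of_real (\<integral>x. (A x)\<^sup>2 \<partial>D)" "of_real qB" "of_real (\<integral>x. (B x)\<^sup>2 \<partial>D)"
            "of_real (1 / sqrt N)" "of_real x" "of_real c1" "of_real ((\<integral>x. (z x) ^ 3 \<partial>D) / 6)" "of_real (\<integral>x. z x * A x \<partial>D)" "of_real (\<integral>x. z x * B x \<partial>D)"]
        unfolding edge_char_def i2 i3 g0_def gA_def gB_def gv_def c0_def c2_def E_def
        by (simp del: of_real_power add: of_real_power[symmetric])
    qed
    have 2: "cmod ((CLINT w|M. lin w) - edge_char (c0 / sqrt N) (- (x * c1 / sqrt N)) (c2 / sqrt N) t) \<le> 6 * C ^ 6 * R + (21 * C ^ 10 * \<bar>qA\<bar> + 21 * C ^ 10 * \<bar>qB\<bar> + 9 * C ^ 8) * R"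
    proof -
      have "(CLINT w|M. lin w) - edge_char (c0 / sqrt N) (- (x * c1 / sqrt N)) (c2 / sqrt N) t
        = ((CLINT w|M. e w) - g0) + \<i> * of_real (t / sqrt N) * (of_real qA * (I (\<lambda>w. (S A N w)\<^sup>2 / N) - gA) + of_real qB * (I (\<lambda>w. (S B N w)\<^sup>2 / N) - gB) - of_real x * (I (\<lambda>w. S v N w / sqrt N) - gv))"
      proof -
        have "(a + k * (p * b1 + q * b2 - r * b3)) - (g + k * (p * g1 + q * g2 - r * g3)) = (a - g) + k * (p * (b1 - g1) + q * (b2 - g2) - r * (b3 - g3))"
          for a k p q r b1 b2 b3 g g1 g2 g3 :: complex by (simp add: algebra_simps)
        then show ?thesis unfolding lin_int edge .
      qed
      also have "cmod \<dots> \<le> 6 * C ^ 6 * (\<bar>t\<bar> * u ^ 5 / N) + \<bar>t\<bar> / sqrt N * (\<bar>qA\<bar> * (21 * C ^ 10 * (u ^ 6 / sqrt N)) + \<bar>qB\<bar> * (21 * C ^ 10 * (u ^ 6 / sqrt N)) + \<bar>x\<bar> * (9 * C ^ 8 * (u ^ 5 / sqrt N)))"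
      proof (intro order_trans[OF norm_triangle_ineq] add_mono b0)
        have "cmod (of_real qA * (I (\<lambda>w. (S A N w)\<^sup>2 / N) - gA) + of_real qB * (I (\<lambda>w. (S B N w)\<^sup>2 / N) - gB) - of_real x * (I (\<lambda>w. S v N w / sqrt N) - gv))
          \<le> \<bar>qA\<bar> * (21 * C ^ 10 * (u ^ 6 / sqrt N)) + \<bar>qB\<bar> * (21 * C ^ 10 * (u ^ 6 / sqrt N)) + \<bar>x\<bar> * (9 * C ^ 8 * (u ^ 5 / sqrt N))"
          by (intro order_trans[OF norm_triangle_ineq4] order_trans[OF norm_triangle_ineq] add_mono; unfold norm_mult norm_of_real; intro mult_left_mono bA bB bv) auto
        then show "cmod (\<i> * of_real (t / sqrt N) * (of_real qA * (I (\<lambda>w. (S A N w)\<^sup>2 / N) - gA) + of_real qB * (I (\<lambda>w. (S B N w)\<^sup>2 / N) - gB) - of_real x * (I (\<lambda>w. S v N w / sqrt N) - gv)))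
          \<le> \<bar>t\<bar> / sqrt N * (\<bar>qA\<bar> * (21 * C ^ 10 * (u ^ 6 / sqrt N)) + \<bar>qB\<bar> * (21 * C ^ 10 * (u ^ 6 / sqrt N)) + \<bar>x\<bar> * (9 * C ^ 8 * (u ^ 5 / sqrt N)))"
          unfolding norm_mult[of "\<i> * _"] by (intro mult_mono) (auto simp: norm_mult norm_divide)
      qed
      also have "\<dots> \<le> 6 * C ^ 6 * R + (21 * C ^ 10 * \<bar>qA\<bar> + 21 * C ^ 10 * \<bar>qB\<bar> + 9 * C ^ 8) * R"
      proof (rule add_mono)
        have x1: "1 \<le> 1 + x\<^sup>2" "\<bar>x\<bar> \<le> 1 + x\<^sup>2"
        proof -
          have "0 \<le> (\<bar>x\<bar> - 1)\<^sup>2" by simp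
          then have "2 * \<bar>x\<bar> \<le> 1 + x\<^sup>2" by (simp add: power2_diff)
          then show "\<bar>x\<bar> \<le> 1 + x\<^sup>2" using abs_ge_zero[of x] by linarith
        qed simp
        have u56: "u ^ 5 \<le> u ^ 6" using u1 by (intro power_increasing) auto
        have m: "\<bar>t\<bar> * a * b / N \<le> R" if "0 \<le> a" "a \<le> u ^ 6" "0 \<le> b" "b \<le> 1 + x\<^sup>2" for a b
          unfolding R_def using that u1 by (intro divide_right_mono mult_mono) auto
        show "6 * C ^ 6 * (\<bar>t\<bar> * u ^ 5 / N) \<le> 6 * C ^ 6 * R"
          using m[of "u ^ 5" 1] u56 x1 u1 C1 by (intro mult_left_mono) auto
        have sq: "\<bar>t\<bar> / sqrt N * (a * (b * (c / sqrt N))) = b * a * (\<bar>t\<bar> * c / N)" for a b c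
          using N0 by (simp add: field_simps)
        have "\<bar>t\<bar> / sqrt N * (\<bar>qA\<bar> * (21 * C ^ 10 * (u ^ 6 / sqrt N)) + \<bar>qB\<bar> * (21 * C ^ 10 * (u ^ 6 / sqrt N)) + \<bar>x\<bar> * (9 * C ^ 8 * (u ^ 5 / sqrt N)))
          = 21 * C ^ 10 * \<bar>qA\<bar> * (\<bar>t\<bar> * u ^ 6 * 1 / N) + 21 * C ^ 10 * \<bar>qB\<bar> * (\<bar>t\<bar> * u ^ 6 * 1 / N) + 9 * C ^ 8 * (\<bar>t\<bar> * u ^ 5 * \<bar>x\<bar> / N)"
          unfolding distrib_left sq by (simp add: mult_ac)
        also have "\<dots> \<le> 21 * C ^ 10 * \<bar>qA\<bar> * R + 21 * C ^ 10 * \<bar>qB\<bar> * R + 9 * C ^ 8 * R"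
          using u56 x1 u1 C1 by (intro add_mono mult_left_mono m) auto
        finally show "\<bar>t\<bar> / sqrt N * (\<bar>qA\<bar> * (21 * C ^ 10 * (u ^ 6 / sqrt N)) + \<bar>qB\<bar> * (21 * C ^ 10 * (u ^ 6 / sqrt N)) + \<bar>x\<bar> * (9 * C ^ 8 * (u ^ 5 / sqrt N)))
          \<le> (21 * C ^ 10 * \<bar>qA\<bar> + 21 * C ^ 10 * \<bar>qB\<bar> + 9 * C ^ 8) * R"
          by (simp add: algebra_simps)
      qed
      finally show ?thesis .
    qed
    have "cmod ((CLINT w|M. iexp (t * T N x w)) - edge_char (c0 / sqrt N) (- (x * c1 / sqrt N)) (c2 / sqrt N) t)
       \<le> K1 * R + (6 * C ^ 6 * R + (21 * C ^ 10 * \<bar>qA\<bar> + 21 * C ^ 10 * \<bar>qB\<bar> + 9 * C ^ 8) * R)"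
      using norm_triangle_le[OF add_mono[OF 1 2]] by simp
    also have "\<dots> = K * R" by (simp add: K_def algebra_simps)
    finally show ?thesis by (simp add: R_def u_def)
  qed
  ultimately show ?thesis using that by blast
qed

section \<open>Decay at high frequencies and expansion of the distribution function\<close>

context
  fixes cell :: "real \<Rightarrow> nat" and A' B' :: "nat \<Rightarrow> real" and m :: nat and \<kappa> \<zeta>0 :: real
  assumes cell[measurable]: "cell \<in> measurable borel (count_space UNIV)" and cell_less: "\<And>y. cell y < m"
    and A': "\<And>y. A y = A' (cell y)" and B': "\<And>y. B y = B' (cell y)"
    and cramer: "0 < \<kappa>" "0 < \<zeta>0" "\<And>s \<zeta>. \<bar>\<zeta>\<bar> \<le> \<zeta>0 \<Longrightarrow>
      (\<Sum>c<m. cmod (CLINT y|D. iexp (s * (z y - \<zeta> * v y)) * indicator {y. cell y = c} y)) \<le> 1 - \<kappa> * min 1 (s\<^sup>2)"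
begin

text \<open>The term with \<open>v\<close> is linear with coefficient \<open>x / sqrt N\<close>, so
  it merges with \<open>z\<close> into one summand per observation, while the terms with
  \<open>A\<close> and \<open>B\<close> depend on cells only. \<open>cell_bound\<close> gives an
  \<open>N\<close>-th power, and \<open>N * min 1 (s^2) = min N (t^2)\<close>.\<close>

lemma cf_T_decay:
  assumes N: "1 \<le> N" and x: "\<bar>x\<bar> \<le> \<zeta>0 * sqrt N"
  shows "cmod (CLINT w|M. iexp (t * T N x w)) \<le> exp (- \<kappa> * min N (t\<^sup>2))"
proof -
  define s where "s = t / sqrt N"
  define \<zeta> where "\<zeta> = x / sqrt N"
  have N0: "0 < sqrt N" using N by simp
  have z: "\<bar>\<zeta>\<bar> \<le> \<zeta>0" using x N0 by (simp add: \<zeta>_def pos_divide_le_eq)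
  define h where "h y = iexp (s * (z y - \<zeta> * v y))" for y
  define \<Theta> where "\<Theta> p = iexp (t / sqrt N * (qA * ((\<Sum>i<N. A' (p i))\<^sup>2 / N) + qB * ((\<Sum>i<N. B' (p i))\<^sup>2 / N)))" for p
  have "iexp (t * T N x w) = (\<Prod>i<N. h (X i w)) * \<Theta> (restrict (\<lambda>i. cell (X i w)) {..<N})" for w
  proof -
    have "(\<Sum>i<N. s * (z (X i w) - \<zeta> * v (X i w))) = t / sqrt N * (S z N w - x * (S v N w / sqrt N))"
      unfolding S_def s_def \<zeta>_def by (simp add: sum_distrib_left sum_subtractf sum_divide_distrib algebra_simps)
    then have "t * T N x w = (\<Sum>i<N. s * (z (X i w) - \<zeta> * v (X i w)))
        + t / sqrt N * (qA * ((S A N w)\<^sup>2 / N) + qB * ((S B N w)\<^sup>2 / N))"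
      unfolding T_def pert_def by (simp add: algebra_simps add_divide_distrib diff_divide_distrib)
    moreover have "S A N w = (\<Sum>i<N. A' (restrict (\<lambda>i. cell (X i w)) {..<N} i))" "S B N w = (\<Sum>i<N. B' (restrict (\<lambda>i. cell (X i w)) {..<N} i))"
      by (simp_all add: S_def A' B')
    ultimately show ?thesis
      unfolding h_def \<Theta>_def by (simp add: exp_sum[symmetric] exp_add[symmetric] sum_distrib_left distrib_left)
  qed
  then have "cmod (CLINT w|M. iexp (t * T N x w)) = cmod (CLINT w|M. (\<Prod>i<N. h (X i w)) * \<Theta> (restrict (\<lambda>i. cell (X i w)) {..<N}))"
    by simp
  also have "\<dots> \<le> (\<Sum>c<m. cmod (CLINT y|D. h y * indicator {y. cell y = c} y)) ^ N"
  proof (rule cell_bound[OF cell cell_less])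
    show "h \<in> borel_measurable borel" unfolding h_def[abs_def] by measurable
    show "cmod (h y) \<le> 1" for y unfolding h_def by (simp del: of_real_mult of_real_diff)
    show "cmod (\<Theta> p) \<le> 1" for p unfolding \<Theta>_def by (simp del: of_real_mult of_real_divide of_real_add of_real_power)
  qed
  also have "\<dots> \<le> (exp (- \<kappa> * min 1 (s\<^sup>2))) ^ N"
  proof (rule power_mono)
    have "(\<Sum>c<m. cmod (CLINT y|D. h y * indicator {y. cell y = c} y)) \<le> 1 + (- \<kappa> * min 1 (s\<^sup>2))"
      using cramer(3)[OF z, of s] unfolding h_def by simp
    also have "\<dots> \<le> exp (- \<kappa> * min 1 (s\<^sup>2))" by (rule exp_ge_add_one_self)
    finally show "(\<Sum>c<m. cmod (CLINT y|D. h y * indicator {y. cell y = c} y)) \<le> exp (- \<kappa> * min 1 (s\<^sup>2))" .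
  qed (intro sum_nonneg norm_ge_zero)
  also have "\<dots> = exp (- \<kappa> * min N (t\<^sup>2))"
  proof -
    have "N * min 1 (s\<^sup>2) = min N (N * s\<^sup>2)" using N by (simp add: min_def)
    also have "N * s\<^sup>2 = t\<^sup>2" using N by (simp add: s_def power_divide)
    finally show ?thesis by (simp add: exp_of_nat_mult[symmetric] mult.left_commute)
  qed
  finally show ?thesis .
qed

text \<open>Uniformity in \<open>x\<close> costs powers of \<open>ln N\<close>; this is affordable
  because the errors, before multiplication by \<open>sqrt N\<close>, are of order
  \<open>1 / N\<close> up to such powers. The inequality \<open>ln N \<le> \<zeta>0 * sqrt N\<close>
  makes the decay bound available.\<close>

lemma edgeworth_T:
  obtains e :: "nat \<Rightarrow> real" where "e \<longlonglongrightarrow> 0" "\<forall>\<^sub>F N in sequentially. \<forall>x y. \<bar>x\<bar> \<le> ln N \<longrightarrow>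
    \<bar>prob {w \<in> space M. T N x w \<le> y} - edge_cdf (c0 / sqrt N) (- (x * c1 / sqrt N)) (c2 / sqrt N) y\<bar> \<le> e N / sqrt N"
proof -
  obtain K where K: "0 \<le> K" "\<And>N x t. 2 \<le> N \<Longrightarrow>
    cmod ((CLINT w|M. iexp (t * T N x w)) - edge_char (c0 / sqrt N) (- (x * c1 / sqrt N)) (c2 / sqrt N) t)
      \<le> K * (\<bar>t\<bar> * (1 + \<bar>t\<bar>) ^ 6 * (1 + x\<^sup>2) / N)"
    using cf_T_expansion by blast
  define A0 where "A0 = \<bar>c0\<bar> + \<bar>c1\<bar> + \<bar>c2\<bar>"
  have A0: "0 \<le> A0" by (simp add: A0_def)
  \<comment> \<open>\<open>e1\<close> is the low-frequency error of expansion and kernel, enlarged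
    by \<open>1 + (ln N)^2\<close> to pay for the weight \<open>1 / (1 + t^2)\<close> up to
    \<open>\<bar>t\<bar> = ln N\<close>. \<open>e2\<close> covers the range beyond, its factor
    \<open>N\<close> coming from the kernel of bandwidth \<open>1 / N\<close>, and \<open>e3\<close>
    is the Lipschitz cost of that bandwidth.\<close>
  define e1 where "e1 N = (K * ((1 + ln (real N)) ^ 6 * (1 + (ln (real N))\<^sup>2) / N) + 1 / N) * (1 + (ln (real N))\<^sup>2)" for N :: nat
  define e2 where "e2 N = 2 * (exp (- \<kappa> * (ln (real N))\<^sup>2) * N + 48 * (1 + A0 * (1 + ln (real N))) * exp (- ((ln (real N))\<^sup>2) / 4))" for N :: nat
  define e3 where "e3 N = 48 * (1 + A0 * (1 + ln (real N))) * (1 / N)" for N :: nat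
  define e where "e N = sqrt N * (e1 N + e2 N + e3 N)" for N :: nat
  have lim: "e \<longlonglongrightarrow> 0"
  proof -
    have 1: "(\<lambda>N. K * (sqrt N * ((1 + ln (real N)) ^ 6 * (1 + (ln (real N))\<^sup>2) / N) * (1 + (ln (real N))\<^sup>2)) + sqrt N * (1 / N) * (1 + (ln (real N))\<^sup>2)) \<longlonglongrightarrow> K * 0 + 0"
      by (intro tendsto_intros) real_asymp+
    have 2: "(\<lambda>N. 2 * (sqrt N * exp (- \<kappa> * (ln (real N))\<^sup>2) * N) + 96 * (sqrt N * exp (- ((ln (real N))\<^sup>2) / 4)) + 96 * (A0 * (sqrt N * (1 + ln (real N)) * exp (- ((ln (real N))\<^sup>2) / 4)))) \<longlonglongrightarrow> 2 * 0 + 96 * 0 + 96 * (A0 * 0)"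
      using cramer(1) by (intro tendsto_intros) real_asymp+
    have 3: "(\<lambda>N. 48 * (sqrt N * (1 / N)) + 48 * (A0 * (sqrt N * (1 + ln (real N)) * (1 / N)))) \<longlonglongrightarrow> 48 * 0 + 48 * (A0 * 0)"
      by (intro tendsto_intros) real_asymp+
    show ?thesis
      using tendsto_add[OF tendsto_add[OF 1 2] 3] unfolding e_def[abs_def] e1_def e2_def e3_def
      by (simp add: algebra_simps)
  qed
  have ev: "\<forall>\<^sub>F N :: nat in sequentially. 2 \<le> N \<and> 1 \<le> ln (real N) \<and> (ln (real N))\<^sup>2 \<le> N \<and> ln (real N) \<le> \<zeta>0 * sqrt N"
  proof (intro eventually_conj)
    show "\<forall>\<^sub>F N :: nat in sequentially. 2 \<le> N" by (rule eventually_ge_at_top)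
    show "\<forall>\<^sub>F N :: nat in sequentially. 1 \<le> ln (real N)" by real_asymp
    show "\<forall>\<^sub>F N :: nat in sequentially. (ln (real N))\<^sup>2 \<le> N" by real_asymp
    show "\<forall>\<^sub>F N :: nat in sequentially. ln (real N) \<le> \<zeta>0 * sqrt N" using cramer(2) by real_asymp
  qed
  have main: "\<forall>\<^sub>F N in sequentially. \<forall>x y. \<bar>x\<bar> \<le> ln N \<longrightarrow>
    \<bar>prob {w \<in> space M. T N x w \<le> y} - edge_cdf (c0 / sqrt N) (- (x * c1 / sqrt N)) (c2 / sqrt N) y\<bar> \<le> e N / sqrt N"
    using ev
  proof (eventually_elim, intro allI impI)
    fix N :: nat and x y :: real
    assume *: "2 \<le> N \<and> 1 \<le> ln (real N) \<and> (ln (real N))\<^sup>2 \<le> N \<and> ln (real N) \<le> \<zeta>0 * sqrt N" and x: "\<bar>x\<bar> \<le> ln N"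
    define l where "l = ln (real N)"
    have N: "2 \<le> N" and l: "1 \<le> l" "l\<^sup>2 \<le> N" "l \<le> \<zeta>0 * sqrt N" "\<bar>x\<bar> \<le> l" using * x by (auto simp: l_def)
    have N0: "0 < real N" "1 \<le> sqrt N" using N by auto
    define a1 where "a1 = c0 / sqrt N"
    define a2 where "a2 = - (x * c1 / sqrt N)"
    define a3 where "a3 = c2 / sqrt N"
    have a: "\<bar>a1\<bar> + \<bar>a2\<bar> + \<bar>a3\<bar> \<le> A0 * (1 + l)"
    proof -
      have d: "\<bar>c / sqrt N\<bar> \<le> \<bar>c\<bar>" for c :: real
      proof -
        have "\<bar>c\<bar> / sqrt N \<le> \<bar>c\<bar> / 1" using N0 by (intro divide_left_mono) auto
        then show ?thesis by simp
      qed
      have "\<bar>a2\<bar> \<le> \<bar>x * c1\<bar>" unfolding a2_def using d[of "x * c1"] by simp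
      also have "\<dots> \<le> l * \<bar>c1\<bar>" unfolding abs_mult using l by (intro mult_right_mono) auto
      finally have "\<bar>a2\<bar> \<le> l * \<bar>c1\<bar>" .
      moreover have "\<bar>a1\<bar> \<le> \<bar>c0\<bar>" "\<bar>a3\<bar> \<le> \<bar>c2\<bar>" unfolding a1_def a3_def by (rule d)+
      moreover have "A0 * (1 + l) = \<bar>c0\<bar> + \<bar>c1\<bar> + \<bar>c2\<bar> + l * \<bar>c1\<bar> + l * (\<bar>c0\<bar> + \<bar>c2\<bar>)" by (simp add: A0_def algebra_simps)
      moreover have "0 \<le> l * (\<bar>c0\<bar> + \<bar>c2\<bar>)" using l by simp
      ultimately show ?thesis by linarith
    qed
    have bnd: "cmod ((CLINT w|M. iexp (t * T N x w)) * char unif (1 / N * t) - edge_char a1 a2 a3 t) \<le> (e1 N + e2 N) * \<bar>t\<bar> / (1 + t\<^sup>2)" for t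
    proof (cases "\<bar>t\<bar> \<le> l")
      case True
      let ?\<chi> = "CLINT w|M. iexp (t * T N x w)"
      define r where "r = K * ((1 + l) ^ 6 * (1 + l\<^sup>2) / N) + 1 / N"
      have r0: "0 \<le> r" unfolding r_def using K l by simp
      have chi1: "cmod ?\<chi> \<le> 1"
      proof -
        have "cmod ?\<chi> \<le> (\<integral>w. cmod (iexp (t * T N x w)) \<partial>M)" by (rule integral_norm_bound)
        then show ?thesis by (simp add: prob_space del: of_real_mult)
      qed
      have "?\<chi> * char unif (1 / N * t) - edge_char a1 a2 a3 t = (?\<chi> - edge_char a1 a2 a3 t) + ?\<chi> * (char unif (1 / N * t) - 1)"
        by (simp add: algebra_simps)
      also have "cmod \<dots> \<le> K * (\<bar>t\<bar> * (1 + \<bar>t\<bar>) ^ 6 * (1 + x\<^sup>2) / N) + 1 * \<bar>1 / N * t\<bar>"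
        unfolding a1_def a2_def a3_def
        by (intro order_trans[OF norm_triangle_ineq] add_mono K(2) N; unfold norm_mult; intro mult_mono chi1 char_unif_minus_1) auto
      also have "\<dots> \<le> K * (\<bar>t\<bar> * (1 + l) ^ 6 * (1 + l\<^sup>2) / N) + 1 * (1 / N * \<bar>t\<bar>)"
        using True K(1) l
        by (intro add_mono mult_left_mono divide_right_mono mult_mono abs_power2_le power_mono) (auto simp: abs_mult)
      also have "\<dots> = r * \<bar>t\<bar>" by (simp add: r_def algebra_simps)
      also have "\<dots> \<le> r * \<bar>t\<bar> * ((1 + l\<^sup>2) / (1 + t\<^sup>2))"
      proof -
        have "t\<^sup>2 \<le> l\<^sup>2" using True by (rule abs_power2_le)
        then have "1 \<le> (1 + l\<^sup>2) / (1 + t\<^sup>2)" by (simp add: pos_le_divide_eq add_pos_nonneg)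
        from mult_left_mono[OF this, of "r * \<bar>t\<bar>"] show ?thesis using r0 by simp
      qed
      also have "\<dots> = e1 N * \<bar>t\<bar> / (1 + t\<^sup>2)" by (simp add: e1_def r_def l_def)
      also have "\<dots> \<le> (e1 N + e2 N) * \<bar>t\<bar> / (1 + t\<^sup>2)"
      proof -
        have "0 \<le> e2 N" unfolding e2_def l_def[symmetric] using A0 l by simp
        then show ?thesis by (intro divide_right_mono mult_right_mono) auto
      qed
      finally show ?thesis .
    next
      case False
      \<comment> \<open>Beyond \<open>l\<close> the two transforms are no longer compared; each is
        small by itself.\<close>
      then have t: "l < \<bar>t\<bar>" "1 < \<bar>t\<bar>" using l by auto
      let ?\<chi> = "CLINT w|M. iexp (t * T N x w)"
      have t2: "l\<^sup>2 \<le> t\<^sup>2" using t l by (metis abs_le_square_iff abs_of_nonneg le_less order_trans zero_le_one)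
      have "cmod ?\<chi> \<le> exp (- \<kappa> * min N (t\<^sup>2))"
        using N l by (intro cf_T_decay) auto
      also have "\<dots> \<le> exp (- \<kappa> * l\<^sup>2)" using l t2 cramer(1) by simp
      finally have chi: "cmod ?\<chi> \<le> exp (- \<kappa> * l\<^sup>2)" .
      have cu: "cmod (char unif (1 / N * t)) * \<bar>t\<bar> \<le> N"
        using char_unif_bound[of "1 / N * t"] N0 by (simp add: abs_mult field_simps)
      have 1: "cmod (?\<chi> * char unif (1 / N * t)) * \<bar>t\<bar> \<le> exp (- \<kappa> * l\<^sup>2) * N"
        unfolding norm_mult mult.assoc by (intro mult_mono chi cu) auto
      have "cmod (edge_char a1 a2 a3 t) * \<bar>t\<bar> \<le> 48 * (1 + \<bar>a1\<bar> + \<bar>a2\<bar> + \<bar>a3\<bar>) * exp (- (t\<^sup>2) / 4)"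
        using t by (intro edge_char_bound) auto
      also have "\<dots> \<le> 48 * (1 + A0 * (1 + l)) * exp (- (l\<^sup>2) / 4)"
        using a t2 by (intro mult_mono) auto
      finally have 2: "cmod (edge_char a1 a2 a3 t) * \<bar>t\<bar> \<le> 48 * (1 + A0 * (1 + l)) * exp (- (l\<^sup>2) / 4)" .
      have "cmod (?\<chi> * char unif (1 / N * t) - edge_char a1 a2 a3 t) * \<bar>t\<bar>
         \<le> (cmod (?\<chi> * char unif (1 / N * t)) + cmod (edge_char a1 a2 a3 t)) * \<bar>t\<bar>"
        by (intro mult_right_mono norm_triangle_ineq4) auto
      also have "\<dots> \<le> e2 N / 2"
      proof -
        have "e2 N / 2 = exp (- \<kappa> * l\<^sup>2) * N + 48 * (1 + A0 * (1 + l)) * exp (- (l\<^sup>2) / 4)"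
          unfolding e2_def l_def by simp
        then show ?thesis unfolding distrib_right using add_mono[OF 1 2] by (simp only:)
      qed
      finally have 3: "cmod (?\<chi> * char unif (1 / N * t) - edge_char a1 a2 a3 t) * \<bar>t\<bar> \<le> e2 N / 2" .
      have e2: "0 \<le> e2 N" unfolding e2_def l_def[symmetric] using A0 l by simp
      have e1: "0 \<le> e1 N" unfolding e1_def l_def[symmetric] using K l by simp
      have "cmod (?\<chi> * char unif (1 / N * t) - edge_char a1 a2 a3 t) \<le> e2 N / 2 / \<bar>t\<bar>"
        using 3 t by (simp add: pos_le_divide_eq)
      also have "\<dots> \<le> e2 N * \<bar>t\<bar> / (1 + t\<^sup>2)"
      proof -
        \<comment> \<open>Since \<open>\<bar>t\<bar> > 1\<close>, a bound by
          \<open>1 / \<bar>t\<bar>\<close> converts into the weight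
          \<open>\<bar>t\<bar> / (1 + t^2)\<close> with a factor 2, which is the leading 2 in
          \<open>e2\<close>.\<close>
        have "1 + t\<^sup>2 \<le> 2 * (\<bar>t\<bar> * \<bar>t\<bar>)" using t one_le_power[of "\<bar>t\<bar>" 2] by (simp add: power2_eq_square)
        then have "e2 N * (1 + t\<^sup>2) \<le> e2 N * (2 * (\<bar>t\<bar> * \<bar>t\<bar>))" using e2 by (intro mult_left_mono)
        then show ?thesis using t by (simp add: field_simps add_pos_nonneg)
      qed
      also have "\<dots> \<le> (e1 N + e2 N) * \<bar>t\<bar> / (1 + t\<^sup>2)"
        using e1 by (intro divide_right_mono mult_right_mono) auto
      finally show ?thesis .
    qed
    have "\<bar>prob {w \<in> space M. T N x w \<le> y} - edge_cdf a1 a2 a3 y\<bar> \<le> (e1 N + e2 N) + 48 * (1 + \<bar>a1\<bar> + \<bar>a2\<bar> + \<bar>a3\<bar>) * (1 / N)"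
    proof (rule smoothing[where g="edge_char a1 a2 a3"])
      show "prob_space M" by unfold_locales
      show "edge_char a1 a2 a3 \<in> borel_measurable borel" unfolding edge_char_def[abs_def] by measurable
    qed (use N0 bnd edge_inversion edge_cdf_at_bot edge_cdf_lipschitz in auto)
    also have "\<dots> \<le> e1 N + e2 N + e3 N"
      unfolding e3_def l_def[symmetric] using a N0 by (intro add_left_mono mult_right_mono) auto
    also have "\<dots> = e N / sqrt N" using N0 by (simp add: e_def)
    finally show "\<bar>prob {w \<in> space M. T N x w \<le> y} - edge_cdf (c0 / sqrt N) (- (x * c1 / sqrt N)) (c2 / sqrt N) y\<bar> \<le> e N / sqrt N"
      unfolding a1_def a2_def a3_def .
  qed
  show ?thesis using that[OF lim main] .
qed

end

end

end

section \<open>Clamped observations\<close>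

lemma one_minus_cos_ge:
  fixes y :: real
  assumes "\<bar>y\<bar> \<le> 1"
  shows "y\<^sup>2 / 4 \<le> 1 - cos y"
proof -
  have "\<bar>Re (iexp y - (1 + \<i> * y - y\<^sup>2 / 2 - \<i> * y ^ 3 / 6))\<bar> \<le> y ^ 4 / 24"
    using iexp_taylor(3)[of y] abs_Re_le_cmod order_trans by blast
  moreover have "Re (iexp y - (1 + \<i> * y - y\<^sup>2 / 2 - \<i> * y ^ 3 / 6)) = cos y - (1 - y\<^sup>2 / 2)"
    by (simp add: Re_exp flip: of_real_power)
  ultimately have "\<bar>cos y - (1 - y\<^sup>2 / 2)\<bar> \<le> y ^ 4 / 24" by simp
  moreover have "y ^ 4 \<le> y\<^sup>2"
  proof -
    have "y ^ 4 = y\<^sup>2 * y\<^sup>2" by (simp flip: power_add)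
    also have "\<dots> \<le> y\<^sup>2 * 1" using assms by (intro mult_left_mono) (auto simp: abs_square_le_1)
    finally show ?thesis by simp
  qed
  ultimately show ?thesis using zero_le_power2[of y] by linarith
qed

text \<open>Pairing \<open>u\<close> with \<open>u + h\<close> for \<open>h\<close> of order \<open>1 / s\<close> forces a phase difference of order 1.\<close>

lemma oscillation_gap:
  fixes g :: "real \<Rightarrow> real"
  assumes g[measurable]: "g \<in> borel_measurable borel" and l: "0 < l" and c: "0 < c1" "0 < c2"
    and inc: "\<And>u h. a < u \<Longrightarrow> 0 < h \<Longrightarrow> u + h \<le> a + l \<Longrightarrow> c1 * h \<le> g (u + h) - g u \<and> g (u + h) - g u \<le> c2 * h"
  shows "l * c1\<^sup>2 * min (l\<^sup>2 / 4) (1 / c2\<^sup>2) / 32 * min 1 (s\<^sup>2)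
    \<le> (LINT u:{a<..a + l}|lborel. 1 - cos (s * g u - \<omega>))"
proof (cases "s = 0")
  case True
  have "0 \<le> (LINT u:{a<..a + l}|lborel. 1 - cos (s * g u - \<omega>))"
    unfolding set_lebesgue_integral_def by (intro Bochner_Integration.integral_nonneg) (auto split: split_indicator)
  then show ?thesis using True by simp
next
  case False
  \<comment> \<open>The bound \<open>l / 2\<close> leaves pairs \<open>u\<close>,
    \<open>u + h\<close> for at least half of the interval; the bound
    \<open>1 / (c2 * \<bar>s\<bar>)\<close> keeps half the phase difference below 1 in modulus,
    where its cosine is nonnegative and \<open>one_minus_cos_ge\<close> applies.\<close>
  define h where "h = min (l / 2) (1 / (c2 * \<bar>s\<bar>))"
  have h: "0 < h" "h \<le> l / 2" "h \<le> 1 / (c2 * \<bar>s\<bar>)" using l c False by (auto simp: h_def)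
  have hs: "c2 * h * \<bar>s\<bar> \<le> 1" using h(3) c False by (simp add: pos_le_divide_eq mult_ac)
  define p where "p u = 1 - cos (s * g u - \<omega>)" for u
  have p[measurable]: "p \<in> borel_measurable borel" unfolding p_def[abs_def] by measurable
  have p0: "0 \<le> p u" "p u \<le> 2" for u unfolding p_def using cos_le_one[of "s * g u - \<omega>"] cos_ge_minus_one[of "s * g u - \<omega>"] by linarith+
  have pair: "s\<^sup>2 * c1\<^sup>2 * h\<^sup>2 / 8 \<le> p u + p (u + h)" if "a < u" "u + h \<le> a + l" for u
  proof -
    define d where "d = g (u + h) - g u"
    define y where "y = s * d / 2"
    have d: "c1 * h \<le> d" "d \<le> c2 * h" using inc[OF that(1) h(1) that(2)] by (auto simp: d_def)
    have d0: "0 \<le> d" using d mult_pos_pos[OF c(1) h(1)] by linarith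
    have "\<bar>s\<bar> * d \<le> \<bar>s\<bar> * (c2 * h)" using d by (intro mult_left_mono) auto
    then have y1: "\<bar>y\<bar> \<le> 1" using hs d0 unfolding y_def by (simp add: abs_mult mult_ac)
    \<comment> \<open>Whatever the mean phase is, the two cosines add up to at most
      \<open>2 * cos y\<close>, so the free phase \<open>\<omega>\<close> cannot compensate for the
      phase difference.\<close>
    have "cos (s * g u - \<omega>) + cos (s * g (u + h) - \<omega>) = 2 * cos ((s * g u - \<omega> + (s * g (u + h) - \<omega>)) / 2) * cos ((s * g u - \<omega> - (s * g (u + h) - \<omega>)) / 2)"
      by (rule cos_plus_cos)
    also have "(s * g u - \<omega> - (s * g (u + h) - \<omega>)) / 2 = - y" by (simp add: y_def d_def field_simps)
    finally have eq: "cos (s * g u - \<omega>) + cos (s * g (u + h) - \<omega>) = 2 * (cos ((s * g u - \<omega> + (s * g (u + h) - \<omega>)) / 2) * cos y)" by simp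
    have cy: "y\<^sup>2 / 4 \<le> 1 - cos y" using y1 by (rule one_minus_cos_ge)
    have cy0: "0 \<le> cos y"
    proof -
      have "\<bar>y\<bar> \<le> pi / 2" using y1 pi_ge_two by linarith
      then show ?thesis by (intro cos_ge_zero) auto
    qed
    have "cos ((s * g u - \<omega> + (s * g (u + h) - \<omega>)) / 2) * cos y \<le> 1 * cos y" using cy0 by (intro mult_right_mono) auto
    then have "y\<^sup>2 / 2 \<le> p u + p (u + h)" using eq cy unfolding p_def by linarith
    moreover have "s\<^sup>2 * c1\<^sup>2 * h\<^sup>2 / 8 \<le> y\<^sup>2 / 2"
    proof -
      have "(c1 * h)\<^sup>2 \<le> d\<^sup>2" using d c h by (intro power_mono) auto
      then have "s\<^sup>2 * (c1 * h)\<^sup>2 \<le> s\<^sup>2 * d\<^sup>2" by (intro mult_left_mono) auto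
      then show ?thesis by (simp add: y_def power_mult_distrib power_divide)
    qed
    ultimately show ?thesis by linarith
  qed
  have int: "integrable lborel (\<lambda>u. indicator A u * p (u + b))" if "A \<in> sets borel" "emeasure lborel A < \<infinity>" for A b
  proof -
    have "integrable lborel (\<lambda>u. indicator A u *\<^sub>R p (u + b))"
      by (rule integrableI_bounded_set_indicator[where B=2]) (use that p0 in auto)
    then show ?thesis by simp
  qed
  define I where "I = (\<integral>u. indicator {a<..a + l} u * p u \<partial>lborel)"
  \<comment> \<open>Translation by \<open>b\<close> keeps the shortened interval inside the original
    one, so each member of the pairs is accounted for by one copy of \<open>I\<close>.\<close>
  have le: "(\<integral>u. indicator {a<..a + l - h} u * p (u + b) \<partial>lborel) \<le> I" if "b = 0 \<or> b = h" for b
  proof -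
    have "(\<integral>u. indicator {a<..a + l - h} u * p (u + b) \<partial>lborel) = (\<integral>u. indicator {a + b<..a + l - h + b} (b + 1 * u) * p (b + 1 * u) \<partial>lborel)"
      by (intro Bochner_Integration.integral_cong) (auto simp: add.commute split: split_indicator)
    also have "\<dots> = (\<integral>u. indicator {a + b<..a + l - h + b} u * p u \<partial>lborel)"
      by (subst lborel_integral_real_affine[where c=1 and t=b, of "\<lambda>u. indicator {a + b<..a + l - h + b} u * p u"]) auto
    also have "\<dots> \<le> I"
      unfolding I_def using int[of "{a + b<..a + l - h + b}" 0] int[of "{a<..a + l}" 0] that h p0
      by (intro integral_mono) (auto split: split_indicator)
    finally show ?thesis .
  qed
  have em: "emeasure lborel {a<..a + l - h} < \<infinity>" using h l by simp
  have "(l / 2) * (s\<^sup>2 * c1\<^sup>2 * h\<^sup>2 / 8) \<le> (l - h) * (s\<^sup>2 * c1\<^sup>2 * h\<^sup>2 / 8)"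
    using h by (intro mult_right_mono) auto
  also have "\<dots> = (\<integral>u. indicator {a<..a + l - h} u * (s\<^sup>2 * c1\<^sup>2 * h\<^sup>2 / 8) \<partial>lborel)"
    using h l by simp
  also have "\<dots> \<le> (\<integral>u. indicator {a<..a + l - h} u * p u + indicator {a<..a + l - h} u * p (u + h) \<partial>lborel)"
  proof (rule integral_mono)
    show "integrable lborel (\<lambda>u. indicator {a<..a + l - h} u * (s\<^sup>2 * c1\<^sup>2 * h\<^sup>2 / 8))"
      by (intro integrable_mult_left integrable_real_indicator) (use h in auto)
    show "integrable lborel (\<lambda>u. indicator {a<..a + l - h} u * p u + indicator {a<..a + l - h} u * p (u + h))"
      using int[of "{a<..a + l - h}" 0] int[of "{a<..a + l - h}" h] em by simp
    show "indicator {a<..a + l - h} u * (s\<^sup>2 * c1\<^sup>2 * h\<^sup>2 / 8) \<le> indicator {a<..a + l - h} u * p u + indicator {a<..a + l - h} u * p (u + h)" for u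
      using pair[of u] by (auto split: split_indicator)
  qed
  also have "\<dots> \<le> I + I"
    using le[of 0] le[of h] int[of "{a<..a + l - h}" 0] int[of "{a<..a + l - h}" h] em by simp
  finally have I: "l * s\<^sup>2 * c1\<^sup>2 * h\<^sup>2 / 32 \<le> I" by simp
  \<comment> \<open>According to which bound defines \<open>h\<close>, the product
    \<open>s^2 * h^2\<close> is \<open>s^2 * l^2 / 4\<close> or \<open>1 / c2^2\<close>; the former
    covers small \<open>s\<close>, the latter large \<open>s\<close>.\<close>
  have "min (l\<^sup>2 / 4) (1 / c2\<^sup>2) * min 1 (s\<^sup>2) \<le> s\<^sup>2 * h\<^sup>2"
  proof -
    have "s\<^sup>2 * h\<^sup>2 = (\<bar>s\<bar> * h)\<^sup>2" by (simp add: power_mult_distrib)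
    moreover have "\<bar>s\<bar> * h = min (\<bar>s\<bar> * (l / 2)) (1 / c2)" unfolding h_def using False c by (simp add: min_mult_distrib_left)
    ultimately have "s\<^sup>2 * h\<^sup>2 = s\<^sup>2 * (l\<^sup>2 / 4) \<or> s\<^sup>2 * h\<^sup>2 = 1 / c2\<^sup>2"
      by (auto simp: min_def power_mult_distrib power_divide)
    then show ?thesis
    proof
      assume *: "s\<^sup>2 * h\<^sup>2 = s\<^sup>2 * (l\<^sup>2 / 4)"
      have "min (l\<^sup>2 / 4) (1 / c2\<^sup>2) * min 1 (s\<^sup>2) \<le> (l\<^sup>2 / 4) * s\<^sup>2" by (intro mult_mono) auto
      then show ?thesis unfolding * by (simp add: mult.commute)
    next
      assume *: "s\<^sup>2 * h\<^sup>2 = 1 / c2\<^sup>2"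
      have "min (l\<^sup>2 / 4) (1 / c2\<^sup>2) * min 1 (s\<^sup>2) \<le> (1 / c2\<^sup>2) * 1" by (intro mult_mono) auto
      then show ?thesis unfolding * by simp
    qed
  qed
  then have "l * c1\<^sup>2 / 32 * (min (l\<^sup>2 / 4) (1 / c2\<^sup>2) * min 1 (s\<^sup>2)) \<le> l * c1\<^sup>2 / 32 * (s\<^sup>2 * h\<^sup>2)"
    using l by (intro mult_left_mono) auto
  then show ?thesis using I unfolding I_def p_def set_lebesgue_integral_def by (simp add: mult_ac)
qed

text \<open>A radius of at most \<open>f p / (2 * (\<bar>L\<bar> + 1))\<close> keeps
  \<open>f\<close> within a factor 2 of \<open>f p\<close>. The mean value theorem and the Lipschitz
  condition on \<open>f\<close> give the quadratic Taylor error without a second derivative.\<close>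

lemma deriv_lipschitz_nearE:
  assumes "deriv_lipschitz_near F f p" "0 < f p"
  obtains \<delta> L where "0 < \<delta>" "0 \<le> L"
    "\<And>x. \<bar>x - p\<bar> \<le> \<delta> \<Longrightarrow> (F has_real_derivative f x) (at x)"
    "\<And>x. \<bar>x - p\<bar> \<le> \<delta> \<Longrightarrow> f p / 2 \<le> f x \<and> f x \<le> 2 * f p"
    "\<And>s. \<bar>s\<bar> \<le> \<delta> \<Longrightarrow> \<bar>F (p + s) - F p - f p * s\<bar> \<le> L * s\<^sup>2"
proof -
  obtain d L where d: "0 < d" and F: "\<And>x. x \<in> {p - d<..<p + d} \<Longrightarrow> (F has_real_derivative f x) (at x)"
    and L: "\<And>x y. x \<in> {p - d<..<p + d} \<Longrightarrow> y \<in> {p - d<..<p + d} \<Longrightarrow> \<bar>f x - f y\<bar> \<le> L * \<bar>x - y\<bar>"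
    using assms(1) unfolding deriv_lipschitz_near_def by blast
  define \<delta> where "\<delta> = min (d / 2) (f p / (2 * (\<bar>L\<bar> + 1)))"
  have \<delta>: "0 < \<delta>" "\<delta> < d" using d assms(2) by (auto simp: \<delta>_def)
  have mem: "x \<in> {p - d<..<p + d}" if "\<bar>x - p\<bar> \<le> \<delta>" for x
    using that \<delta> by (auto simp: abs_le_iff)
  have fl: "\<bar>f x - f p\<bar> \<le> \<bar>L\<bar> * \<bar>x - p\<bar>" if "\<bar>x - p\<bar> \<le> \<delta>" for x
  proof -
    have "\<bar>f x - f p\<bar> \<le> L * \<bar>x - p\<bar>" using L[OF mem[OF that], of p] d by auto
    also have "\<dots> \<le> \<bar>L\<bar> * \<bar>x - p\<bar>" by (intro mult_right_mono) auto
    finally show ?thesis .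
  qed
  have near: "f p / 2 \<le> f x \<and> f x \<le> 2 * f p" if "\<bar>x - p\<bar> \<le> \<delta>" for x
  proof -
    have "\<bar>f x - f p\<bar> \<le> \<bar>L\<bar> * \<bar>x - p\<bar>" by (rule fl[OF that])
    also have "\<dots> \<le> (\<bar>L\<bar> + 1) * (f p / (2 * (\<bar>L\<bar> + 1)))"
      using that by (intro mult_mono) (auto simp: \<delta>_def)
    also have "\<dots> = f p / 2" by (simp add: field_simps)
    finally show ?thesis using assms(2) by linarith
  qed
  have taylor: "\<bar>F (p + s) - F p - f p * s\<bar> \<le> \<bar>L\<bar> * s\<^sup>2" if s: "\<bar>s\<bar> \<le> \<delta>" for s
  proof -
    have "\<exists>c. \<bar>c - p\<bar> \<le> \<bar>s\<bar> \<and> F (p + s) - F p = s * f c"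
    proof (cases s "0 :: real" rule: linorder_cases)
      case less
      then obtain c where "p + s < c" "c < p" "F p - F (p + s) = (p - (p + s)) * f c"
        using MVT2[of "p + s" p F f] F[OF mem] s by (auto simp: abs_le_iff)
      then show ?thesis by (intro exI[of _ c]) (auto simp: algebra_simps)
    next
      case greater
      then obtain c where "p < c" "c < p + s" "F (p + s) - F p = (p + s - p) * f c"
        using MVT2[of p "p + s" F f] F[OF mem] s by (auto simp: abs_le_iff)
      then show ?thesis by (intro exI[of _ c]) auto
    qed auto
    then obtain c where c: "\<bar>c - p\<bar> \<le> \<bar>s\<bar>" "F (p + s) - F p = s * f c" by blast
    have "\<bar>f c - f p\<bar> \<le> \<bar>L\<bar> * \<bar>s\<bar>"
      using fl[of c] c s mult_left_mono[OF c(1), of "\<bar>L\<bar>"] by auto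
    then have "\<bar>s\<bar> * \<bar>f c - f p\<bar> \<le> \<bar>s\<bar> * (\<bar>L\<bar> * \<bar>s\<bar>)" by (intro mult_left_mono) auto
    moreover have "F (p + s) - F p - f p * s = s * (f c - f p)" using c by (simp add: algebra_simps)
    ultimately show ?thesis by (simp add: abs_mult power2_eq_square mult_ac)
  qed
  show ?thesis
    by (rule that[of \<delta> "\<bar>L\<bar>"]) (use \<delta> F[OF mem] near taylor in auto)
qed

section \<open>The clamped variable and the quantile transform\<close>

locale trimmed_sample = iid_sample M X D for M :: "'a measure" and X D +
  fixes F f :: "real \<Rightarrow> real" and \<alpha> \<beta> :: real
  assumes F_cdf: "\<And>x. cdf D x = F x"
    and ab: "0 < \<alpha>" "\<alpha> < \<beta>" "\<beta> < 1"
    and F_near_\<alpha>: "deriv_lipschitz_near F f (quantile F \<alpha>)"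
    and F_near_\<beta>: "deriv_lipschitz_near F f (quantile F \<beta>)"
    and f_pos: "0 < f (quantile F \<alpha>)" "0 < f (quantile F \<beta>)"
begin

definition \<xi> where "\<xi> = quantile F \<alpha>"
definition \<eta> where "\<eta> = quantile F \<beta>"
definition W :: "real \<Rightarrow> real" where "W x = max \<xi> (min \<eta> x)"

sublocale C: cdf_distribution D
  by unfold_locales

lemma F_eq: "F = cdf D" using F_cdf by auto

text \<open>The Galois connection between \<open>F\<close> and its quantile function, through which
  order properties of \<open>quantile F\<close> are derived below.\<close>

lemma quantile_le_iff: "0 < u \<Longrightarrow> u < 1 \<Longrightarrow> quantile F u \<le> x \<longleftrightarrow> u \<le> F x"
  unfolding F_eq quantile_def using C.pseudoinverse[of u x] by simp

lemma F_mono: "x \<le> y \<Longrightarrow> F x \<le> F y"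
  unfolding F_eq by (rule D.cdf_nondecreasing)

text \<open>One inequality is the Galois connection. For the other, \<open>F\<close> stays below
  \<open>u\<close> strictly left of the quantile, and differentiability makes \<open>F\<close> left
  continuous there.\<close>

lemma F_quantile:
  assumes u: "0 < u" "u < 1" and d: "(F has_real_derivative d) (at (quantile F u))"
  shows "F (quantile F u) = u"
proof (rule antisym)
  show "u \<le> F (quantile F u)" using quantile_le_iff[OF u, of "quantile F u"] by simp
  have "((\<lambda>x. F x) \<longlongrightarrow> F (quantile F u)) (at_left (quantile F u))"
    using DERIV_isCont[OF d] by (simp add: isCont_def filterlim_at_split)
  moreover have "\<forall>\<^sub>F x in at_left (quantile F u). F x \<le> u"
    using quantile_le_iff[OF u] by (auto simp: eventually_at_filter intro!: always_eventually) (metis linorder_not_le less_imp_le)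
  ultimately show "F (quantile F u) \<le> u"
    by (rule tendsto_upperbound) simp
qed

lemma F_\<xi>: "F \<xi> = \<alpha>" and F_\<eta>: "F \<eta> = \<beta>"
proof -
  obtain d where "(F has_real_derivative d) (at \<xi>)"
    using deriv_lipschitz_nearE[OF F_near_\<alpha> f_pos(1)] unfolding \<xi>_def by (metis abs_zero diff_self less_imp_le)
  then show "F \<xi> = \<alpha>" using F_quantile[of \<alpha>] ab by (simp add: \<xi>_def)
  obtain d where "(F has_real_derivative d) (at \<eta>)"
    using deriv_lipschitz_nearE[OF F_near_\<beta> f_pos(2)] unfolding \<eta>_def by (metis abs_zero diff_self less_imp_le)
  then show "F \<eta> = \<beta>" using F_quantile[of \<beta>] ab by (simp add: \<eta>_def)
qed

lemma \<xi>_less_\<eta>: "\<xi> < \<eta>"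
proof (rule ccontr)
  assume "\<not> \<xi> < \<eta>"
  then show False using F_mono[of \<eta> \<xi>] F_\<xi> F_\<eta> ab by simp
qed

lemma W_bounds: "\<xi> \<le> W x" "W x \<le> \<eta>" "\<bar>W x\<bar> \<le> \<bar>\<xi>\<bar> + \<bar>\<eta>\<bar>"
  using \<xi>_less_\<eta> unfolding W_def by auto

lemma W_measurable [measurable]: "W \<in> borel_measurable borel"
  unfolding W_def[abs_def] by measurable

lemma Qfun_eq: "0 < u \<Longrightarrow> u < 1 \<Longrightarrow> Qfun F \<alpha> \<beta> u = W (quantile F u)"
  using quantile_le_iff[of u \<xi>] quantile_le_iff[of u \<eta>] F_\<xi> F_\<eta> \<xi>_less_\<eta> ab
  by (auto simp: Qfun_def W_def \<xi>_def[symmetric] \<eta>_def[symmetric] max_def min_def)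

text \<open>Outside the open unit interval the infimum may be taken over an empty set or one
  unbounded below; the cutoff yields a function that is measurable on the whole line.\<close>

definition q :: "real \<Rightarrow> real" where "q u = indicator {0<..<1} u * quantile F u"

lemma q_measurable [measurable]: "q \<in> borel_measurable borel"
proof -
  have "(\<lambda>u. indicator {0<..<1} u *\<^sub>R C.I u) \<in> borel_measurable borel"
    using C.measurable_CI by (subst (asm) borel_measurable_restrict_space_iff) auto
  then show ?thesis by (simp add: q_def[abs_def] quantile_def F_cdf)
qed

lemma expectation_quantile:
  fixes h :: "real \<Rightarrow> 'c::{banach, second_countable_topology}"
  assumes [measurable]: "h \<in> borel_measurable borel"
  shows "(\<integral>x. h x \<partial>D) = (LINT u:{0<..<1}|lborel. h (q u))"
proof -
  have m: "quantile F \<in> measurable (restrict_space lborel {0<..<1}) borel"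
    using C.measurable_CI unfolding F_eq quantile_def[abs_def]
    by (simp cong: measurable_cong_sets add: sets_restrict_space)
  have "(\<integral>x. h x \<partial>D) = (\<integral>x. h x \<partial>distr (restrict_space lborel {0<..<1::real}) borel (quantile F))"
    using C.distr_I_eq_M unfolding F_eq quantile_def[abs_def] by simp
  also have "\<dots> = (\<integral>u. h (quantile F u) \<partial>restrict_space lborel {0<..<1})"
    by (rule integral_distr[OF m]) simp
  also have "\<dots> = (\<integral>u. indicator {0<..<1} u *\<^sub>R h (quantile F u) \<partial>lborel)"
    by (rule integral_restrict_space) simp
  also have "\<dots> = (LINT u:{0<..<1}|lborel. h (q u))"
    unfolding set_lebesgue_integral_def
    by (intro Bochner_Integration.integral_cong) (auto simp: q_def split: split_indicator)
  finally show ?thesis .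
qed

text \<open>The given definitions use the gauge integral over \<open>[0, 1]\<close>, the sample uses
  \<open>D\<close>. On the open interval \<open>Qfun\<close> is \<open>W\<close> after the quantile
  transform, whose law is \<open>D\<close>, and the end points form a null set.\<close>

lemma integral_Qfun:
  fixes h :: "real \<Rightarrow> real"
  assumes [measurable]: "h \<in> borel_measurable borel" and B: "\<And>x. \<bar>h (W x)\<bar> \<le> B"
  shows "(\<lambda>u. h (Qfun F \<alpha> \<beta> u)) integrable_on {0..1}" "integral {0..1} (\<lambda>u. h (Qfun F \<alpha> \<beta> u)) = (\<integral>x. h (W x) \<partial>D)"
proof -
  have s: "set_integrable lborel {0<..<1} (\<lambda>u. h (W (q u)))"
    unfolding set_integrable_def using B
    by (intro integrableI_bounded_set_indicator[where B=B]) auto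
  have i: "(\<lambda>u. h (Qfun F \<alpha> \<beta> u)) integrable_on {0<..<1}"
    using set_borel_integral_eq_integral(1)[OF s] by (rule integrable_eq) (simp add: Qfun_eq q_def)
  then show "(\<lambda>u. h (Qfun F \<alpha> \<beta> u)) integrable_on {0..1}"
    using integrable_on_open_interval[of "\<lambda>u. h (Qfun F \<alpha> \<beta> u)" 0 1] by simp
  have "integral {0..1} (\<lambda>u. h (Qfun F \<alpha> \<beta> u)) = integral {0<..<1} (\<lambda>u. h (Qfun F \<alpha> \<beta> u))"
    by (metis integral_open_interval_real)
  also have "\<dots> = integral {0<..<1} (\<lambda>u. h (W (q u)))"
    by (intro Henstock_Kurzweil_Integration.integral_cong) (simp add: Qfun_eq q_def)
  also have "\<dots> = (LINT u:{0<..<1}|lborel. h (W (q u)))"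
    using set_borel_integral_eq_integral(2)[OF s] by simp
  also have "\<dots> = (\<integral>x. h (W x) \<partial>D)" by (rule expectation_quantile[symmetric]) measurable
  finally show "integral {0..1} (\<lambda>u. h (Qfun F \<alpha> \<beta> u)) = (\<integral>x. h (W x) \<partial>D)" .
qed

definition \<mu> where "\<mu> = muW F \<alpha> \<beta>"
definition \<sigma> where "\<sigma> = sigmaW F \<alpha> \<beta>"
definition RW where "RW = \<bar>\<xi>\<bar> + \<bar>\<eta>\<bar> + \<bar>\<mu>\<bar> + 1"

lemma RW: "1 \<le> RW" "\<bar>W x - \<mu>\<bar> \<le> RW" "\<bar>\<xi> - \<mu>\<bar> \<le> RW" "\<bar>\<eta> - \<mu>\<bar> \<le> RW" "\<xi> \<le> x \<Longrightarrow> x \<le> \<eta> \<Longrightarrow> \<bar>x - \<mu>\<bar> \<le> RW"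
  using W_bounds[of x] by (auto simp: RW_def)

lemma \<mu>_eq: "\<mu> = (\<integral>x. W x \<partial>D)"
  unfolding \<mu>_def muW_def using integral_Qfun(2)[of "\<lambda>x. x"] W_bounds(3) by auto

lemma W_moment: "integral {0..1} (\<lambda>u. (Qfun F \<alpha> \<beta> u - \<mu>) ^ k) = (\<integral>x. (W x - \<mu>) ^ k \<partial>D)"
  by (rule integral_Qfun(2)[where B="RW ^ k"]) (auto simp: power_abs intro!: power_mono RW)

lemma \<sigma>_square: "\<sigma>\<^sup>2 = (\<integral>x. (W x - \<mu>)\<^sup>2 \<partial>D)"
proof -
  have "0 \<le> (\<integral>x. (W x - \<mu>)\<^sup>2 \<partial>D)" by (intro Bochner_Integration.integral_nonneg) auto
  then show ?thesis unfolding \<sigma>_def sigmaW_def \<mu>_def[symmetric] W_moment by simp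
qed

lemma gamma3W_eq: "gamma3W F \<alpha> \<beta> = (\<integral>x. (W x - \<mu>) ^ 3 \<partial>D)"
  unfolding gamma3W_def \<mu>_def[symmetric] by (rule W_moment)

text \<open>Relates the Winsorized to the trimmed mean. It later turns the constants left over in
  the numerator into the rounding term \<open>bN\<close>.\<close>

lemma mu_ab_eq: "\<mu> = \<alpha> * \<xi> + (\<beta> - \<alpha>) * mu_ab F \<alpha> \<beta> + (1 - \<beta>) * \<eta>"
proof -
  let ?Q = "Qfun F \<alpha> \<beta>"
  have i: "?Q integrable_on {0..1}" using integral_Qfun(1)[of "\<lambda>x. x"] W_bounds(3) by auto
  have "integral {0..1} ?Q = integral {0..\<alpha>} ?Q + integral {\<alpha>..1} ?Q"
    using ab i by (intro Henstock_Kurzweil_Integration.integral_combine[symmetric]) auto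
  also have "integral {\<alpha>..1} ?Q = integral {\<alpha>..\<beta>} ?Q + integral {\<beta>..1} ?Q"
    using ab i by (intro Henstock_Kurzweil_Integration.integral_combine[symmetric]) (auto intro: integrable_subinterval_real)
  also have "integral {0..\<alpha>} ?Q = integral {0..\<alpha>} (\<lambda>_. \<xi>)"
    by (intro Henstock_Kurzweil_Integration.integral_cong) (auto simp: Qfun_def \<xi>_def)
  also have "integral {\<beta>..1} ?Q = integral {\<beta>..1} (\<lambda>_. \<eta>)"
    using ab by (intro Henstock_Kurzweil_Integration.integral_cong) (auto simp: Qfun_def \<eta>_def)
  also have "integral {\<alpha>..\<beta>} ?Q = integral {\<alpha>..\<beta>} (quantile F)"
    by (intro Henstock_Kurzweil_Integration.integral_cong) (auto simp: Qfun_def)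
  finally show ?thesis
    unfolding \<mu>_def muW_def mu_ab_def using ab by simp
qed

lemma prob_le: "(\<integral>x. indicator {..a} x \<partial>D) = F a"
  unfolding F_eq cdf_def by simp

text \<open>\<open>W\<close> puts mass \<open>\<alpha>\<close> on \<open>\<xi>\<close> and at least
  \<open>1 - \<beta>\<close> on \<open>\<eta>\<close>; as these points differ, \<open>\<mu>\<close>
  cannot equal both.\<close>

lemma \<sigma>_pos: "0 < \<sigma>"
proof -
  have b: "\<alpha> * (\<xi> - \<mu>)\<^sup>2 + (1 - \<beta>) * (\<eta> - \<mu>)\<^sup>2 \<le> \<sigma>\<^sup>2"
  proof -
    have "(\<integral>x. (\<xi> - \<mu>)\<^sup>2 * indicator {..\<xi>} x + (\<eta> - \<mu>)\<^sup>2 * (1 - indicator {..\<eta>} x) \<partial>D) \<le> (\<integral>x. (W x - \<mu>)\<^sup>2 \<partial>D)"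
    proof (rule integral_mono)
      show "integrable D (\<lambda>x. (\<xi> - \<mu>)\<^sup>2 * indicator {..\<xi>} x + (\<eta> - \<mu>)\<^sup>2 * (1 - indicator {..\<eta>} x))"
        by (intro Bochner_Integration.integrable_add integrable_mult_right integrable_bounded_D[where B=1]) (auto split: split_indicator)
      show "integrable D (\<lambda>x. (W x - \<mu>)\<^sup>2)"
        by (rule integrable_bounded_D[where B="RW\<^sup>2"]) (auto intro: abs_power2_le RW)
      show "(\<xi> - \<mu>)\<^sup>2 * indicator {..\<xi>} x + (\<eta> - \<mu>)\<^sup>2 * (1 - indicator {..\<eta>} x) \<le> (W x - \<mu>)\<^sup>2" for x
        using \<xi>_less_\<eta> by (auto simp: W_def max_def min_def split: split_indicator)
    qed
    moreover have "(\<integral>x. (\<xi> - \<mu>)\<^sup>2 * indicator {..\<xi>} x + (\<eta> - \<mu>)\<^sup>2 * (1 - indicator {..\<eta>} x) \<partial>D)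
       = (\<xi> - \<mu>)\<^sup>2 * F \<xi> + (\<eta> - \<mu>)\<^sup>2 * (1 - F \<eta>)"
    proof -
      have "integrable D (indicator {..a} :: real \<Rightarrow> real)" for a
        by (rule integrable_bounded_D[where B=1]) (auto split: split_indicator)
      then show ?thesis using D.prob_space by (simp add: prob_le[symmetric])
    qed
    ultimately show ?thesis unfolding \<sigma>_square F_\<xi> F_\<eta> by (simp add: mult.commute)
  qed
  have "0 < \<alpha> * (\<xi> - \<mu>)\<^sup>2 + (1 - \<beta>) * (\<eta> - \<mu>)\<^sup>2"
  proof (cases "\<xi> = \<mu>")
    case True
    then show ?thesis using \<xi>_less_\<eta> ab by (intro add_nonneg_pos) auto
  next
    case False
    then show ?thesis using ab by (intro add_pos_nonneg) auto
  qed
  then have "\<sigma>\<^sup>2 > 0" using b by linarith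
  moreover have "0 \<le> \<sigma>" unfolding \<sigma>_def sigmaW_def \<mu>_def[symmetric] W_moment
    by (intro real_sqrt_ge_zero Bochner_Integration.integral_nonneg) auto
  ultimately show ?thesis by (cases "\<sigma> = 0") auto
qed

definition z where "z x = (W x - \<mu>) / \<sigma>"
definition A where "A x = indicator {..\<xi>} x - \<alpha>"
definition B where "B x = indicator {..\<eta>} x - \<beta>"
text \<open>The linear part of \<open>SN / \<sigma> - 1\<close>. Besides the fluctuation of
  \<open>(W - \<mu>)^2\<close> it contains the effect of clamping at sample quantiles: these deviate
  by about \<open>- S A / (N * f \<xi>)\<close> and \<open>- S B / (N * f \<eta>)\<close>, and
  shifting a clamp moves all the mass collected there. The divisor \<open>2 * \<sigma>^2\<close>
  normalizes the variance and accounts for the square root to first order.\<close>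

definition v where "v x = ((W x - \<mu>)\<^sup>2 - \<sigma>\<^sup>2 - 2 * \<alpha> * (\<xi> - \<mu>) / f \<xi> * A x - 2 * (1 - \<beta>) * (\<eta> - \<mu>) / f \<eta> * B x) / (2 * \<sigma>\<^sup>2)"
text \<open>Completing the square produces \<open>S A ^ 2 / (2 * N * f \<xi>)\<close> in the lower
  partial sum, and likewise with \<open>B\<close> and \<open>\<eta>\<close> in the upper one.
  Dividing by \<open>\<sigma>\<close> gives the coefficients; the lower sum is subtracted, hence the
  minus sign.\<close>

definition qA where "qA = - 1 / (2 * \<sigma> * f \<xi>)"
definition qB where "qB = 1 / (2 * \<sigma> * f \<eta>)"
definition cell :: "real \<Rightarrow> nat" where "cell x = (if x \<le> \<xi> then 0 else if x \<le> \<eta> then 1 else 2)"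

lemma zvAB_measurable [measurable]: "z \<in> borel_measurable borel" "A \<in> borel_measurable borel" "B \<in> borel_measurable borel" "v \<in> borel_measurable borel"
proof -
  show 1[measurable]: "z \<in> borel_measurable borel" "A \<in> borel_measurable borel" "B \<in> borel_measurable borel"
    unfolding z_def[abs_def] A_def[abs_def] B_def[abs_def] by measurable
  show "v \<in> borel_measurable borel" unfolding v_def[abs_def] by measurable
qed

lemma AB_le: "\<bar>A x\<bar> \<le> 1" "\<bar>B x\<bar> \<le> 1"
  using ab by (auto simp: A_def B_def split: split_indicator)

text \<open>One constant \<open>C \<ge> 1\<close> for all four functions allows powers of
  \<open>C\<close> to be enlarged freely in the estimates.\<close>

lemma bound_exists: "\<exists>C\<ge>1. \<forall>x. \<bar>z x\<bar> \<le> C \<and> \<bar>v x\<bar> \<le> C \<and> \<bar>A x\<bar> \<le> C \<and> \<bar>B x\<bar> \<le> C"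
proof -
  define kA where "kA = 2 * \<alpha> * (\<xi> - \<mu>) / f \<xi>"
  define kB where "kB = 2 * (1 - \<beta>) * (\<eta> - \<mu>) / f \<eta>"
  define Cz where "Cz = RW / \<sigma>"
  define Cv where "Cv = (RW\<^sup>2 + \<sigma>\<^sup>2 + \<bar>kA\<bar> + \<bar>kB\<bar>) / (2 * \<sigma>\<^sup>2)"
  have z: "\<bar>z x\<bar> \<le> Cz" for x
    using RW(2)[of x] \<sigma>_pos by (simp add: z_def Cz_def divide_right_mono)
  have v: "\<bar>v x\<bar> \<le> Cv" for x
  proof -
    have "\<bar>kA * A x\<bar> \<le> \<bar>kA\<bar>" "\<bar>kB * B x\<bar> \<le> \<bar>kB\<bar>"
      using AB_le[of x] by (auto simp: abs_mult intro: mult_left_le)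
    moreover have "(W x - \<mu>)\<^sup>2 \<le> RW\<^sup>2" by (rule abs_power2_le[OF RW(2)])
    ultimately have "\<bar>(W x - \<mu>)\<^sup>2 - \<sigma>\<^sup>2 - kA * A x - kB * B x\<bar> \<le> RW\<^sup>2 + \<sigma>\<^sup>2 + \<bar>kA\<bar> + \<bar>kB\<bar>"
      using zero_le_power2[of "W x - \<mu>"] zero_le_power2[of \<sigma>] by linarith
    then show ?thesis
      unfolding v_def kA_def[symmetric] kB_def[symmetric] Cv_def abs_divide using \<sigma>_pos
      by (intro divide_mono) auto
  qed
  have "1 \<le> max 1 (max Cz Cv)" "Cz \<le> max 1 (max Cz Cv)" "Cv \<le> max 1 (max Cz Cv)" by auto
  then show ?thesis
    using z v AB_le by (intro exI[of _ "max 1 (max Cz Cv)"]) (meson order_trans)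
qed

lemma integrable_zvAB:
  "integrable D z" "integrable D v" "integrable D A" "integrable D B" "integrable D W" "integrable D (\<lambda>x. (W x - \<mu>)\<^sup>2)" "integrable D (indicator {..a} :: real \<Rightarrow> real)"
proof -
  obtain C where C: "\<And>x. \<bar>z x\<bar> \<le> C \<and> \<bar>v x\<bar> \<le> C \<and> \<bar>A x\<bar> \<le> C \<and> \<bar>B x\<bar> \<le> C" using bound_exists by blast
  show "integrable D z" "integrable D v" "integrable D A" "integrable D B"
    by (rule integrable_bounded_D[where B=C]; use C in simp)+
  show "integrable D W" by (rule integrable_bounded_D[where B="\<bar>\<xi>\<bar> + \<bar>\<eta>\<bar>"]) (use W_bounds in auto)
  show "integrable D (\<lambda>x. (W x - \<mu>)\<^sup>2)"
    by (rule integrable_bounded_D[where B="RW\<^sup>2"]) (auto intro: abs_power2_le RW)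
  show "integrable D (indicator {..a} :: real \<Rightarrow> real)"
    by (rule integrable_bounded_D[where B=1]) (auto split: split_indicator)
qed

lemma means: "(\<integral>x. z x \<partial>D) = 0" "(\<integral>x. v x \<partial>D) = 0" "(\<integral>x. A x \<partial>D) = 0" "(\<integral>x. B x \<partial>D) = 0"
  and z_var: "(\<integral>x. (z x)\<^sup>2 \<partial>D) = 1"
proof -
  note [simp] = integrable_zvAB
  show "(\<integral>x. z x \<partial>D) = 0"
    unfolding z_def using D.prob_space \<mu>_eq by simp
  show A: "(\<integral>x. A x \<partial>D) = 0" unfolding A_def using D.prob_space prob_le[of \<xi>] F_\<xi> by simp
  show B: "(\<integral>x. B x \<partial>D) = 0" unfolding B_def using D.prob_space prob_le[of \<eta>] F_\<eta> by simp
  show "(\<integral>x. v x \<partial>D) = 0" unfolding v_def using A B \<sigma>_square D.prob_space by simp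
  show "(\<integral>x. (z x)\<^sup>2 \<partial>D) = 1"
    unfolding z_def power_divide using \<sigma>_pos by (simp add: \<sigma>_square[symmetric])
qed

end

section \<open>Moments and the Cramer condition\<close>

context trimmed_sample
begin

lemma W_cases: "W x = (if x \<le> \<xi> then \<xi> else if x \<le> \<eta> then x else \<eta>)"
  using \<xi>_less_\<eta> by (auto simp: W_def)

lemma A_square: "(\<integral>x. (A x)\<^sup>2 \<partial>D) = \<alpha> * (1 - \<alpha>)" and B_square: "(\<integral>x. (B x)\<^sup>2 \<partial>D) = \<beta> * (1 - \<beta>)"
proof -
  have *: "(\<integral>x. (indicator {..a} x - p)\<^sup>2 \<partial>D) = F a * (1 - 2 * p) + p\<^sup>2" for a p :: real
  proof -
    have "(indicator {..a} x - p)\<^sup>2 = indicator {..a} x * (1 - 2 * p) + p\<^sup>2" for x :: real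
      by (auto simp: power2_eq_square algebra_simps split: split_indicator)
    then show ?thesis using D.prob_space prob_le[of a] integrable_zvAB(7)[of a] by simp
  qed
  show "(\<integral>x. (A x)\<^sup>2 \<partial>D) = \<alpha> * (1 - \<alpha>)" unfolding A_def * F_\<xi> by (simp add: power2_eq_square algebra_simps)
  show "(\<integral>x. (B x)\<^sup>2 \<partial>D) = \<beta> * (1 - \<beta>)" unfolding B_def * F_\<eta> by (simp add: power2_eq_square algebra_simps)
qed

text \<open>\<open>z\<close> is constant on \<open>{..\<xi>}\<close>, so the product is a multiple
  of the indicator minus a multiple of the centred \<open>z\<close>.\<close>

lemma z_A: "(\<integral>x. z x * A x \<partial>D) = \<alpha> * (\<xi> - \<mu>) / \<sigma>"
proof -
  have "z x * A x = (\<xi> - \<mu>) / \<sigma> * indicator {..\<xi>} x - \<alpha> * z x" for x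
    using \<sigma>_pos by (auto simp: z_def A_def W_cases field_simps split: split_indicator)
  then show ?thesis using prob_le[of \<xi>] F_\<xi> means(1) integrable_zvAB by simp
qed

lemma z_B: "(\<integral>x. z x * B x \<partial>D) = - ((1 - \<beta>) * (\<eta> - \<mu>) / \<sigma>)"
proof -
  have "z x * B x = (\<eta> - \<mu>) / \<sigma> * (indicator {..\<eta>} x - 1) + (1 - \<beta>) * z x" for x
    using \<xi>_less_\<eta> \<sigma>_pos by (auto simp: z_def B_def W_cases field_simps split: split_indicator)
  then have "(\<integral>x. z x * B x \<partial>D) = (\<eta> - \<mu>) / \<sigma> * (\<beta> - 1)"
    using prob_le[of \<eta>] F_\<eta> means(1) integrable_zvAB D.prob_space by simp
  moreover have "a / s * (b - 1) = - ((1 - b) * a / s)" for a b s :: real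
    by (simp add: algebra_simps diff_divide_distrib)
  ultimately show ?thesis by simp
qed

lemma z_cube: "(\<integral>x. (z x) ^ 3 \<partial>D) = lambda1 F \<alpha> \<beta>"
  unfolding z_def power_divide lambda1_def gamma3W_eq \<sigma>_def by simp

text \<open>\<open>v\<close> is \<open>(z^2 - 1) / 2\<close> minus multiples of \<open>A\<close> and
  \<open>B\<close>: the first part yields half the skewness \<open>lambda1\<close>, and the
  covariances \<open>z_A\<close>, \<open>z_B\<close> reproduce the two terms of
  \<open>delta2W\<close>.\<close>

lemma z_v: "(\<integral>x. z x * v x \<partial>D) = (lambda1 F \<alpha> \<beta> + 2 * lambda2 F f \<alpha> \<beta>) / 2"
proof -
  define kA where "kA = 2 * \<alpha> * (\<xi> - \<mu>) / f \<xi>"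
  define kB where "kB = 2 * (1 - \<beta>) * (\<eta> - \<mu>) / f \<eta>"
  obtain C where C: "1 \<le> C" "\<And>x. \<bar>z x\<bar> \<le> C \<and> \<bar>v x\<bar> \<le> C \<and> \<bar>A x\<bar> \<le> C \<and> \<bar>B x\<bar> \<le> C" using bound_exists by blast
  have iA: "integrable D (\<lambda>x. z x * A x)" and iB: "integrable D (\<lambda>x. z x * B x)"
    by (rule integrable_bounded_D[where B="C * C"]; use C in \<open>auto simp: abs_mult intro!: mult_mono\<close>)+
  have i3: "integrable D (\<lambda>x. (z x) ^ 3)"
    by (rule integrable_bounded_D[where B="C ^ 3"]) (use C in \<open>auto simp: power_abs intro!: power_mono\<close>)
  have eq: "z x * v x = (z x) ^ 3 / 2 - z x / 2 - kA / (2 * \<sigma>\<^sup>2) * (z x * A x) - kB / (2 * \<sigma>\<^sup>2) * (z x * B x)" for x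
  proof -
    have "v x = (W x - \<mu>)\<^sup>2 / \<sigma>\<^sup>2 / 2 - 1 / 2 - kA / (2 * \<sigma>\<^sup>2) * A x - kB / (2 * \<sigma>\<^sup>2) * B x"
      unfolding v_def kA_def[symmetric] kB_def[symmetric] using \<sigma>_pos by (simp add: field_simps)
    also have "(W x - \<mu>)\<^sup>2 / \<sigma>\<^sup>2 = (z x)\<^sup>2" by (simp add: z_def power_divide)
    finally have "v x = (z x)\<^sup>2 / 2 - 1 / 2 - kA / (2 * \<sigma>\<^sup>2) * A x - kB / (2 * \<sigma>\<^sup>2) * B x" .
    moreover have "t * (t\<^sup>2 / 2 - 1 / 2 - a * b - c * d) = t ^ 3 / 2 - t / 2 - a * (t * b) - c * (t * d)" for t a b c d :: real
      by (simp add: algebra_simps power2_eq_square power3_eq_cube)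
    ultimately show ?thesis by (simp only:)
  qed
  have "(\<integral>x. z x * v x \<partial>D) = lambda1 F \<alpha> \<beta> / 2 - kA / (2 * \<sigma>\<^sup>2) * (\<alpha> * (\<xi> - \<mu>) / \<sigma>) - kB / (2 * \<sigma>\<^sup>2) * (- ((1 - \<beta>) * (\<eta> - \<mu>) / \<sigma>))"
  proof -
    have "(\<integral>x. z x * v x \<partial>D) = (\<integral>x. (z x) ^ 3 \<partial>D) / 2 - (\<integral>x. z x \<partial>D) / 2 - kA / (2 * \<sigma>\<^sup>2) * (\<integral>x. z x * A x \<partial>D) - kB / (2 * \<sigma>\<^sup>2) * (\<integral>x. z x * B x \<partial>D)"
      unfolding eq using iA iB i3 integrable_zvAB(1) by simp
    then show ?thesis unfolding z_A z_B z_cube means by simp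
  qed
  also have "\<dots> = (lambda1 F \<alpha> \<beta> + 2 * lambda2 F f \<alpha> \<beta>) / 2"
  proof -
    have e: "2 * a * p / x / (2 * s\<^sup>2) * (a * p / s) = a\<^sup>2 * (1 / x) * p\<^sup>2 / s ^ 3" for a p x s :: real
      by (simp add: power2_eq_square power3_eq_cube mult_ac)
    have "lambda2 F f \<alpha> \<beta> = - (\<alpha>\<^sup>2 * (1 / f \<xi>) * (\<xi> - \<mu>)\<^sup>2 / \<sigma> ^ 3) + (1 - \<beta>)\<^sup>2 * (1 / f \<eta>) * (\<eta> - \<mu>)\<^sup>2 / \<sigma> ^ 3"
      unfolding lambda2_def delta2W_def \<xi>_def[symmetric] \<eta>_def[symmetric] \<mu>_def[symmetric] \<sigma>_def[symmetric]
        power2_commute[of \<mu> \<xi>] power2_commute[of \<mu> \<eta>] add_divide_distrib by simp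
    moreover have "L / 2 - P - - Q = (L + 2 * (- P + Q)) / 2" for L P Q :: real by simp
    ultimately show ?thesis unfolding kA_def kB_def mult_minus_right e by (simp only:)
  qed
  finally show ?thesis .
qed

text \<open>The outer cells contribute at most their probabilities \<open>\<alpha>\<close> and
  \<open>1 - \<beta>\<close>; no gain is possible there because \<open>W\<close> is constant. The
  gain comes from the part of the middle cell just above \<open>\<xi>\<close>, where the density is
  bounded away from 0 and infinity.\<close>

lemma cramer_condition:
  "\<exists>\<kappa> \<zeta>0. 0 < \<kappa> \<and> 0 < \<zeta>0 \<and> (\<forall>s \<zeta>. \<bar>\<zeta>\<bar> \<le> \<zeta>0 \<longrightarrow>
      (\<Sum>c<3. cmod (CLINT y|D. iexp (s * (z y - \<zeta> * v y)) * indicator {y. cell y = c} y)) \<le> 1 - \<kappa> * min 1 (s\<^sup>2))"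
proof -
  obtain \<delta> where \<delta>: "0 < \<delta>" "\<And>x. \<bar>x - \<xi>\<bar> \<le> \<delta> \<Longrightarrow> (F has_real_derivative f x) (at x)"
    "\<And>x. \<bar>x - \<xi>\<bar> \<le> \<delta> \<Longrightarrow> f \<xi> / 2 \<le> f x \<and> f x \<le> 2 * f \<xi>"
    using deriv_lipschitz_nearE[OF F_near_\<alpha> f_pos(1)] unfolding \<xi>_def by metis
  have f\<xi>: "0 < f \<xi>" using f_pos by (simp add: \<xi>_def)
  \<comment> \<open>The part used must stay in the smooth neighbourhood of \<open>\<xi>\<close> and
    in the middle cell; \<open>l\<close> below is its probability, that is, its length on the
    quantile scale.\<close>
  define x1 where "x1 = \<xi> + min \<delta> (\<eta> - \<xi>)"
  have x1: "\<xi> < x1" "x1 \<le> \<eta>" "x1 \<le> \<xi> + \<delta>" using \<delta> \<xi>_less_\<eta> by (auto simp: x1_def)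
  define l where "l = F x1 - \<alpha>"
  have mv: "f \<xi> / 2 * (y - x) \<le> F y - F x \<and> F y - F x \<le> 2 * f \<xi> * (y - x)" if "\<xi> \<le> x" "x \<le> y" "y \<le> x1" for x y
  proof (cases "x = y")
    case False
    then have "x < y" using that by simp
    moreover have "(F has_real_derivative f t) (at t)" if "x \<le> t" "t \<le> y" for t
      using that \<open>\<xi> \<le> x\<close> \<open>y \<le> x1\<close> x1 by (intro \<delta>(2)) (simp add: abs_le_iff)
    ultimately obtain c where c: "x < c" "c < y" "F y - F x = (y - x) * f c"
      using MVT2[of x y F f] by blast
    have "f \<xi> / 2 \<le> f c \<and> f c \<le> 2 * f \<xi>" using c that x1 by (intro \<delta>(3)) auto
    then have "f \<xi> / 2 * (y - x) \<le> f c * (y - x)" "f c * (y - x) \<le> 2 * f \<xi> * (y - x)"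
      using that by (intro mult_right_mono; simp)+
    then show ?thesis unfolding c(3) by (simp only: mult.commute[of "y - x"])
  qed simp
  have l: "0 < l" "\<alpha> + l \<le> \<beta>"
  proof -
    have "0 < f \<xi> / 2 * (x1 - \<xi>)" using f\<xi> x1 by simp
    then show "0 < l" using mv[of \<xi> x1] x1 F_\<xi> unfolding l_def by linarith
    show "\<alpha> + l \<le> \<beta>" using F_mono[OF x1(2)] F_\<eta> by (simp add: l_def)
  qed
  have q: "\<xi> < q u \<and> q u \<le> x1 \<and> F (q u) = u" if u: "\<alpha> < u" "u \<le> \<alpha> + l" for u
  proof -
    have u01: "0 < u" "u < 1" using u l ab by auto
    have qu: "q u = quantile F u" using u01 by (simp add: q_def)
    have "\<not> q u \<le> \<xi>" "q u \<le> x1"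
      unfolding qu quantile_le_iff[OF u01] F_\<xi> using u by (auto simp: l_def)
    moreover from this have "(F has_real_derivative f (q u)) (at (quantile F u))"
      using x1 unfolding qu by (intro \<delta>(2)) auto
    ultimately show ?thesis using F_quantile[OF u01] unfolding qu by auto
  qed
  \<comment> \<open>Bounds on \<open>f\<close> invert into bounds on the slope of the quantile
    function.\<close>
  have qinc: "h / (2 * f \<xi>) \<le> q (u + h) - q u \<and> q (u + h) - q u \<le> 2 * h / f \<xi>" if "\<alpha> < u" "0 < h" "u + h \<le> \<alpha> + l" for u h
  proof -
    have q1: "\<xi> < q u" "q u \<le> x1" "F (q u) = u" and q2: "\<xi> < q (u + h)" "q (u + h) \<le> x1" "F (q (u + h)) = u + h"
      using q[of u] q[of "u + h"] that by auto
    have le: "q u \<le> q (u + h)"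
    proof (rule ccontr)
      assume "\<not> ?thesis"
      then have "F (q (u + h)) \<le> F (q u)" by (intro F_mono) auto
      then show False using q1 q2 that by simp
    qed
    have m: "f \<xi> / 2 * (q (u + h) - q u) \<le> h" "h \<le> 2 * f \<xi> * (q (u + h) - q u)"
      using mv[of "q u" "q (u + h)"] q1 q2 le by auto
    show ?thesis
      using m f\<xi> by (simp add: field_simps)
  qed
  \<comment> \<open>Chosen so that \<open>\<zeta> * v\<close> changes the slope
    \<open>1 / \<sigma>\<close> of \<open>z\<close> by at most one half of it. The resulting
    extremes \<open>1 / (2 * \<sigma>)\<close> and \<open>3 / (2 * \<sigma>)\<close>, times the
    extreme slopes of the quantile function, are \<open>c1\<close> and \<open>c2\<close>.\<close>
  define \<zeta>0 where "\<zeta>0 = \<sigma> / (2 * RW)"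
  have \<zeta>0: "0 < \<zeta>0" using \<sigma>_pos RW(1) by (simp add: \<zeta>0_def)
  define c1 where "c1 = 1 / (2 * \<sigma>) * (1 / (2 * f \<xi>))"
  define c2 where "c2 = 3 / (2 * \<sigma>) * (2 / f \<xi>)"
  have c: "0 < c1" "0 < c2" using \<sigma>_pos f\<xi> by (auto simp: c1_def c2_def)
  define \<kappa> where "\<kappa> = l * c1\<^sup>2 * min (l\<^sup>2 / 4) (1 / c2\<^sup>2) / 32"
  have \<kappa>: "0 < \<kappa>" using l c by (simp add: \<kappa>_def)
  have "(\<Sum>c<3. cmod (CLINT y|D. iexp (s * (z y - \<zeta> * v y)) * indicator {y. cell y = c} y)) \<le> 1 - \<kappa> * min 1 (s\<^sup>2)"
    if \<zeta>: "\<bar>\<zeta>\<bar> \<le> \<zeta>0" for s \<zeta>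
  proof -
    define Y where "Y y = z y - \<zeta> * v y" for y
    have Y[measurable]: "Y \<in> borel_measurable borel" unfolding Y_def[abs_def] by measurable
    define J where "J c = (CLINT y|D. iexp (s * Y y) * indicator {y. cell y = c} y)" for c
    have cellm[measurable]: "{y. cell y = c} \<in> sets borel" for c
    proof -
      have "{y. cell y = c} = (if c = 0 then {..\<xi>} else if c = 1 then {\<xi><..\<eta>} else if c = 2 then {\<eta><..} else {})"
        using \<xi>_less_\<eta> by (auto simp: cell_def)
      then show ?thesis by simp
    qed
    have Jle: "cmod (J c) \<le> D.prob {y. cell y = c}" for c
    proof -
      have "cmod (J c) \<le> (\<integral>y. cmod (iexp (s * Y y) * indicator {y. cell y = c} y) \<partial>D)"
        unfolding J_def by (rule integral_norm_bound)
      also have "\<dots> = (\<integral>y. indicator {y. cell y = c} y \<partial>D)"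
        by (intro Bochner_Integration.integral_cong) (auto simp: norm_mult simp del: of_real_mult split: split_indicator)
      finally show ?thesis by simp
    qed
    have J0: "cmod (J 0) \<le> \<alpha>"
    proof -
      have "{y. cell y = 0} = {..\<xi>}" by (auto simp: cell_def)
      then show ?thesis using Jle[of 0] F_\<xi> unfolding F_eq cdf_def by simp
    qed
    have J2: "cmod (J 2) \<le> 1 - \<beta>"
    proof -
      have "{y. cell y = 2} = UNIV - {..\<eta>}" using \<xi>_less_\<eta> by (auto simp: cell_def)
      then have "D.prob {y. cell y = 2} = 1 - D.prob {..\<eta>}"
        using D.prob_compl[of "{..\<eta>}"] by simp
      then show ?thesis using Jle[of 2] F_\<eta> unfolding F_eq cdf_def by simp
    qed
    have J1: "cmod (J 1) \<le> (\<beta> - \<alpha>) - \<kappa> * min 1 (s\<^sup>2)"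
    proof -
      \<comment> \<open>Rotating by the argument of \<open>J 1\<close> makes the integral equal to
        its modulus, so that the gain is the integral of \<open>1 - cos\<close> with this
        phase.\<close>
      define \<omega> where "\<omega> = Arg (J 1)"
      define g where "g u = Y (q u)" for u
      have g[measurable]: "g \<in> borel_measurable borel" unfolding g_def[abs_def] by measurable
      have cell1: "{y. cell y = 1} = {\<xi><..\<eta>}" by (auto simp: cell_def)
      define r where "r = complex_of_real (cmod (J 1))"
      have J1: "J 1 = r * iexp \<omega>"
        using rcis_cmod_Arg[of "J 1"] by (simp add: rcis_def cis_conv_exp \<omega>_def r_def)
      have "iexp (- \<omega>) * (r * iexp \<omega>) = r * (iexp \<omega> * iexp (- \<omega>))" by (simp only: mult_ac)
      also have "iexp \<omega> * iexp (- \<omega>) = 1" by (simp flip: exp_add)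
      finally have "complex_of_real (cmod (J 1)) = iexp (- \<omega>) * J 1"
        unfolding J1[symmetric] r_def[symmetric] by simp
      also have "\<dots> = (CLINT y|D. iexp (- \<omega>) * (iexp (s * Y y) * indicator {\<xi><..\<eta>} y))"
        unfolding J_def cell1 by (rule integral_mult_right_zero[symmetric])
      also have "\<dots> = (CLINT y|D. iexp (s * Y y - \<omega>) * indicator {\<xi><..\<eta>} y)"
      proof (intro Bochner_Integration.integral_cong refl)
        fix y
        have "iexp (- \<omega>) * iexp (s * Y y) = iexp (s * Y y - \<omega>)"
          unfolding exp_add[symmetric] by (simp add: algebra_simps)
        then show "iexp (- \<omega>) * (iexp (s * Y y) * indicator {\<xi><..\<eta>} y) = iexp (s * Y y - \<omega>) * indicator {\<xi><..\<eta>} y"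
          by (simp only: mult.assoc[symmetric])
      qed
      finally have eq: "complex_of_real (cmod (J 1)) = (CLINT y|D. iexp (s * Y y - \<omega>) * indicator {\<xi><..\<eta>} y)" .
      have ii: "integrable D (\<lambda>y. iexp (s * Y y - \<omega>) * indicator {\<xi><..\<eta>} y)"
        by (rule integrable_bounded_D[where B=1]) (auto simp: norm_mult simp del: of_real_mult of_real_diff split: split_indicator)
      have "cmod (J 1) = Re (CLINT y|D. iexp (s * Y y - \<omega>) * indicator {\<xi><..\<eta>} y)"
        using eq by (metis Re_complex_of_real)
      also have "\<dots> = (\<integral>y. Re (iexp (s * Y y - \<omega>) * indicator {\<xi><..\<eta>} y) \<partial>D)"
        by (rule integral_Re[OF ii, symmetric])
      also have "\<dots> = (\<integral>y. indicator {\<xi><..\<eta>} y - (1 - cos (s * Y y - \<omega>)) * indicator {\<xi><..\<eta>} y \<partial>D)"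
        by (intro Bochner_Integration.integral_cong) (auto simp: Re_exp split: split_indicator)
      also have "\<dots> = (\<integral>y. indicator {\<xi><..\<eta>} y \<partial>D) - (\<integral>y. (1 - cos (s * Y y - \<omega>)) * indicator {\<xi><..\<eta>} y \<partial>D)"
      proof (rule Bochner_Integration.integral_diff)
        show "integrable D (\<lambda>y. (1 - cos (s * Y y - \<omega>)) * indicator {\<xi><..\<eta>} y)"
        proof (rule integrable_bounded_D[where B=2])
          show "norm ((1 - cos (s * Y y - \<omega>)) * indicator {\<xi><..\<eta>} y) \<le> 2" for y
            using cos_le_one[of "s * Y y - \<omega>"] cos_ge_minus_one[of "s * Y y - \<omega>"] by (auto split: split_indicator)
        qed measurable
        show "integrable D (indicat_real {\<xi><..\<eta>})"
          by (rule integrable_bounded_D[where B=1]) (auto split: split_indicator)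
      qed
      also have "(\<integral>y. indicator {\<xi><..\<eta>} y \<partial>D) = \<beta> - \<alpha>"
        using D.cdf_diff_eq[OF \<xi>_less_\<eta>] F_\<xi> F_\<eta> unfolding F_eq by simp
      also have "(\<integral>y. (1 - cos (s * Y y - \<omega>)) * indicator {\<xi><..\<eta>} y \<partial>D)
         = (LINT u:{0<..<1}|lborel. (1 - cos (s * g u - \<omega>)) * indicator {\<xi><..\<eta>} (q u))"
        unfolding g_def by (rule expectation_quantile) measurable
      finally have val: "cmod (J 1) = (\<beta> - \<alpha>) - (LINT u:{0<..<1}|lborel. (1 - cos (s * g u - \<omega>)) * indicator {\<xi><..\<eta>} (q u))" .
      have p2: "0 \<le> 1 - cos t" "1 - cos t \<le> 2" for t :: real
        using cos_le_one[of t] cos_ge_minus_one[of t] by linarith+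
      have "\<kappa> * min 1 (s\<^sup>2) \<le> (LINT u:{\<alpha><..\<alpha> + l}|lborel. 1 - cos (s * g u - \<omega>))"
        unfolding \<kappa>_def
      proof (rule oscillation_gap[OF g l(1) c])
        fix u h :: real assume u: "\<alpha> < u" "0 < h" "u + h \<le> \<alpha> + l"
        define x where "x = q u"
        define y where "y = q (u + h)"
        have x: "\<xi> < x" "x \<le> \<eta>" and y: "\<xi> < y" "y \<le> \<eta>"
          using q[of u] q[of "u + h"] u x1 by (auto simp: x_def y_def)
        have inc: "h / (2 * f \<xi>) \<le> y - x" "y - x \<le> 2 * h / f \<xi>" using qinc[OF u] by (auto simp: x_def y_def)
        have xy: "0 \<le> y - x"
        proof -
          have "0 \<le> h / (2 * f \<xi>)" using u f\<xi> by simp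
          then show ?thesis using inc(1) by linarith
        qed
        \<comment> \<open>In the middle cell \<open>W\<close> is the identity and \<open>A\<close>,
          \<open>B\<close> are constant, so \<open>v\<close> is quadratic there and \<open>r\<close>
          is the exact difference quotient of \<open>z - \<zeta> * v\<close>.\<close>
        define r where "r = 1 / \<sigma> - \<zeta> * (x + y - 2 * \<mu>) / (2 * \<sigma>\<^sup>2)"
        have Yd: "g (u + h) - g u = (y - x) * r"
        proof -
          have W: "W x = x" "W y = y" using x y by (auto simp: W_cases)
          have AB: "A x = A y" "B x = B y" using x y by (auto simp: A_def B_def)
          have "v y - v x = ((y - \<mu>)\<^sup>2 - (x - \<mu>)\<^sup>2) / (2 * \<sigma>\<^sup>2)"
            unfolding v_def W AB by (simp add: diff_divide_distrib)
          also have "(y - \<mu>)\<^sup>2 - (x - \<mu>)\<^sup>2 = (y - x) * (x + y - 2 * \<mu>)"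
            by (simp add: power2_eq_square algebra_simps)
          finally have "v y - v x = (y - x) * ((x + y - 2 * \<mu>) / (2 * \<sigma>\<^sup>2))" by simp
          moreover have "z y - z x = (y - x) * (1 / \<sigma>)" unfolding z_def W by (simp add: diff_divide_distrib)
          moreover have "g (u + h) - g u = (z y - z x) - \<zeta> * (v y - v x)"
            unfolding g_def Y_def x_def[symmetric] y_def[symmetric] by (simp add: algebra_simps)
          ultimately show ?thesis unfolding r_def by (simp add: algebra_simps)
        qed
        have "\<bar>\<zeta> * (x + y - 2 * \<mu>) / (2 * \<sigma>\<^sup>2)\<bar> \<le> \<zeta>0 * (2 * RW) / (2 * \<sigma>\<^sup>2)"
        proof -
          have "\<bar>x + y - 2 * \<mu>\<bar> \<le> 2 * RW" using RW(5)[of x] RW(5)[of y] x y by linarith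
          then have "\<bar>\<zeta>\<bar> * \<bar>x + y - 2 * \<mu>\<bar> \<le> \<zeta>0 * (2 * RW)" using \<zeta> \<zeta>0 by (intro mult_mono) auto
          then have "\<bar>\<zeta>\<bar> * \<bar>x + y - 2 * \<mu>\<bar> / (2 * \<sigma>\<^sup>2) \<le> \<zeta>0 * (2 * RW) / (2 * \<sigma>\<^sup>2)"
            by (intro divide_right_mono) auto
          moreover have "\<bar>\<zeta> * (x + y - 2 * \<mu>) / (2 * \<sigma>\<^sup>2)\<bar> = \<bar>\<zeta>\<bar> * \<bar>x + y - 2 * \<mu>\<bar> / (2 * \<sigma>\<^sup>2)"
            by (simp add: abs_mult)
          ultimately show ?thesis by (simp only:)
        qed
        also have "\<zeta>0 * (2 * RW) / (2 * \<sigma>\<^sup>2) = 1 / (2 * \<sigma>)"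
          using \<sigma>_pos RW(1) by (simp add: \<zeta>0_def power2_eq_square)
        finally have "\<bar>1 / \<sigma> - r\<bar> \<le> 1 / (2 * \<sigma>)" by (simp add: r_def)
        moreover have "1 / \<sigma> = 2 * (1 / (2 * \<sigma>))" "3 / (2 * \<sigma>) = 3 * (1 / (2 * \<sigma>))" by simp_all
        ultimately have r: "1 / (2 * \<sigma>) \<le> r" "r \<le> 3 / (2 * \<sigma>)" by linarith+
        have sp: "0 < 1 / (2 * \<sigma>)" using \<sigma>_pos by simp
        have "c1 * h = h / (2 * f \<xi>) * (1 / (2 * \<sigma>))" by (simp add: c1_def)
        also have "\<dots> \<le> (y - x) * r" using inc r sp xy by (intro mult_mono) auto
        finally have "c1 * h \<le> g (u + h) - g u" unfolding Yd .
        moreover have "(y - x) * r \<le> 2 * h / f \<xi> * (3 / (2 * \<sigma>))"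
          using inc r sp xy u f\<xi> by (intro mult_mono) auto
        then have "g (u + h) - g u \<le> c2 * h" unfolding Yd c2_def by (simp add: mult_ac)
        ultimately show "c1 * h \<le> g (u + h) - g u \<and> g (u + h) - g u \<le> c2 * h" ..
      qed
      also have "\<dots> \<le> (LINT u:{0<..<1}|lborel. (1 - cos (s * g u - \<omega>)) * indicator {\<xi><..\<eta>} (q u))"
        unfolding set_lebesgue_integral_def
      proof (rule integral_mono)
        show "integrable lborel (\<lambda>u. indicat_real {\<alpha><..\<alpha> + l} u *\<^sub>R (1 - cos (s * g u - \<omega>)))"
          by (rule integrableI_bounded_set_indicator[where B=2]) (use p2 l in auto)
        show "integrable lborel (\<lambda>u. indicat_real {0<..<1} u *\<^sub>R ((1 - cos (s * g u - \<omega>)) * indicator {\<xi><..\<eta>} (q u)))"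
          by (rule integrableI_bounded_set_indicator[where B=2]) (use p2 in \<open>auto split: split_indicator\<close>)
        fix u :: real
        show "indicat_real {\<alpha><..\<alpha> + l} u *\<^sub>R (1 - cos (s * g u - \<omega>)) \<le> indicat_real {0<..<1} u *\<^sub>R ((1 - cos (s * g u - \<omega>)) * indicator {\<xi><..\<eta>} (q u))"
        proof (cases "u \<in> {\<alpha><..\<alpha> + l}")
          case True
          then have "\<xi> < q u" "q u \<le> \<eta>" "0 < u" "u < 1" using q[of u] x1 ab l by auto
          then show ?thesis using True by simp
        next
          case False
          then show ?thesis using p2 by (auto split: split_indicator)
        qed
      qed
      finally show ?thesis unfolding val by simp
    qed
    have "(\<Sum>c<3. cmod (J c)) = cmod (J 0) + cmod (J 1) + cmod (J 2)"
      by (simp add: numeral_3_eq_3 numeral_2_eq_2)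
    also have "\<dots> \<le> 1 - \<kappa> * min 1 (s\<^sup>2)" using J0 J1 J2 by linarith
    finally show ?thesis unfolding J_def Y_def .
  qed
  then show ?thesis using \<kappa> \<zeta>0 by blast
qed

end

section \<open>Oscillation of the empirical distribution function\<close>

context trimmed_sample
begin

definition cnt :: "nat \<Rightarrow> 'a \<Rightarrow> real \<Rightarrow> real" where
  "cnt N w y = (\<Sum>i<N. indicator {..y} (X i w))"

text \<open>Counts are allowed to deviate by \<open>ln N * sqrt N\<close>, which moves a sample
  quantile by order \<open>ln N / sqrt N\<close>; the additional factor \<open>ln N\<close> in the
  window beats the constants \<open>1 / f \<xi>\<close> and \<open>1 / f \<eta>\<close>.\<close>

definition rad :: "nat \<Rightarrow> real" where "rad N = (ln (real N))\<^sup>2 / sqrt N"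

lemma cnt_mono: "x \<le> y \<Longrightarrow> cnt N w x \<le> cnt N w y"
  unfolding cnt_def by (intro sum_mono) (auto split: split_indicator)

text \<open>The difference of two nested indicators has a square equal to its absolute value, so its
  variance is at most the increment of \<open>F\<close>.\<close>

lemma oscillation_tail:
  assumes s: "\<bar>F (p + s) - F p\<bar> \<le> V" and c: "0 < c" "c * 2 \<le> 1"
  shows "prob {w \<in> space M. r \<le> \<bar>cnt N w (p + s) - cnt N w p - N * (F (p + s) - F p)\<bar>} \<le> 2 * exp (N * c\<^sup>2 * V - c * r)"
proof -
  define e where "e = F (p + s) - F p"
  define i where "i y = (indicator {..p + s} y - indicator {..p} y :: real)" for y
  define g where "g y = i y - e" for y
  have F01: "0 \<le> F x" "F x \<le> 1" for x unfolding F_eq by (simp_all add: D.cdf_nonneg D.cdf_bounded_prob)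
  have i1: "\<bar>i y\<bar> \<le> 1" for y by (auto simp: i_def split: split_indicator)
  have i2: "(i y)\<^sup>2 \<le> 1" for y using abs_power2_le[OF i1[of y]] by simp
  have e1: "\<bar>e\<bar> \<le> 1" using F01[of p] F01[of "p + s"] unfolding e_def by linarith
  have [measurable]: "i \<in> borel_measurable borel" unfolding i_def[abs_def] by measurable
  have g[measurable]: "g \<in> borel_measurable borel" unfolding g_def[abs_def] by measurable
  have ii: "integrable D i" by (rule integrable_bounded_D[where B=1]) (use i1 in auto)
  have ii2: "integrable D (\<lambda>y. (i y)\<^sup>2)" by (rule integrable_bounded_D[where B=1]) (use i2 in auto)
  have Ei: "(\<integral>y. i y \<partial>D) = e"
    unfolding i_def e_def using integrable_zvAB(7)[of "p + s"] integrable_zvAB(7)[of p] prob_le[of p] prob_le[of "p + s"] by simp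
  have Ei2: "(\<integral>y. (i y)\<^sup>2 \<partial>D) = \<bar>e\<bar>"
  proof -
    have "(i y)\<^sup>2 = (if 0 \<le> s then 1 else -1) * i y" for y
      by (auto simp: i_def split: split_indicator)
    then have "(\<integral>y. (i y)\<^sup>2 \<partial>D) = (if 0 \<le> s then 1 else -1) * e" using Ei by simp
    moreover have "0 \<le> s \<Longrightarrow> 0 \<le> e" "\<not> 0 \<le> s \<Longrightarrow> e \<le> 0" unfolding e_def by (auto intro!: F_mono)
    ultimately show ?thesis by auto
  qed
  have S: "S g N w = cnt N w (p + s) - cnt N w p - N * (F (p + s) - F p)" for w
    unfolding S_def g_def i_def cnt_def e_def[symmetric] by (simp add: sum_subtractf)
  have "prob {w \<in> space M. r \<le> \<bar>S g N w\<bar>} \<le> 2 * exp (N * c\<^sup>2 * V - c * r)"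
  proof (rule tail_bound[where B=2])
    show "\<bar>g y\<bar> \<le> 2" for y using i1[of y] e1 unfolding g_def by linarith
    show "(\<integral>y. g y \<partial>D) = 0" unfolding g_def using ii Ei D.prob_space by simp
    have "(g y)\<^sup>2 = (i y)\<^sup>2 - 2 * e * i y + e\<^sup>2" for y by (simp add: g_def power2_eq_square algebra_simps)
    then have "(\<integral>y. (g y)\<^sup>2 \<partial>D) = \<bar>e\<bar> - e\<^sup>2" using ii ii2 Ei Ei2 D.prob_space by (simp add: power2_eq_square)
    then show "(\<integral>y. (g y)\<^sup>2 \<partial>D) \<le> V" using s unfolding e_def[symmetric] by (simp add: order_trans[rotated])
  qed (use c g in auto)
  then show ?thesis unfolding S .
qed

text \<open>The supremum over \<open>s\<close> is controlled on a grid of \<open>2 N + 1\<close> points by monotonicity.\<close>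

lemma oscillation:
  fixes p d \<delta> L :: real
  assumes d: "0 < d" and \<delta>: "0 < \<delta>" and L: "0 \<le> L"
    and taylor: "\<And>s. \<bar>s\<bar> \<le> \<delta> \<Longrightarrow> \<bar>F (p + s) - F p - d * s\<bar> \<le> L * s\<^sup>2"
  obtains G :: "nat \<Rightarrow> 'a set" and e :: "nat \<Rightarrow> real" where "\<And>N. G N \<in> events" "e \<longlonglongrightarrow> 0"
    "\<forall>\<^sub>F N in sequentially. prob (space M - G N) \<le> e N / sqrt N \<and>
      (\<forall>w\<in>G N. \<forall>s. \<bar>s\<bar> \<le> rad N \<longrightarrow> \<bar>cnt N w (p + s) - cnt N w p - N * d * s\<bar> \<le> 3 * N powr (3/8))"
proof -
  define pt where "pt N j = rad N * real_of_int j / N" for N :: nat and j :: int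
  define dev where "dev N j w = \<bar>cnt N w (p + pt N j) - cnt N w p - N * (F (p + pt N j) - F p)\<bar>" for N j w
  have cm[measurable]: "(\<lambda>w. cnt N w y) \<in> borel_measurable M" for N y
    unfolding cnt_def by measurable
  have dm[measurable]: "dev N j \<in> borel_measurable M" for N j unfolding dev_def[abs_def] by measurable
  \<comment> \<open>A count increment over the window has variance of order
    \<open>sqrt N * (ln N)^2\<close>, hence typical size \<open>N powr (1/4)\<close> up to a
    logarithm; an exponent above 1/4 makes exceedance negligible. An exponent below 1/2 is required
    so that the threshold times \<open>rad N\<close> and its square over \<open>N\<close> tend to 0
    later. The choice 3/8 lies midway.\<close>
  define G where "G N = {w \<in> space M. \<forall>j\<in>{- int N..int N}. dev N j w < N powr (3/8)}" for N
  define e where "e N = sqrt N * ((2 * real N + 1) * (2 * exp (2 * d * (ln (real N))\<^sup>2 - N powr (1/8))))" for N :: nat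
  have G: "G N \<in> events" for N unfolding G_def by measurable
  have e: "e \<longlonglongrightarrow> 0" unfolding e_def[abs_def] using d by real_asymp
  have ev: "\<forall>\<^sub>F N :: nat in sequentially. 2 \<le> N \<and> 1 \<le> ln (real N) \<and> rad N \<le> \<delta> \<and> L * rad N \<le> d
      \<and> d * rad N \<le> N powr (3/8) \<and> N * (L * (rad N)\<^sup>2) \<le> N powr (3/8) \<and> N powr (-(1/4)) * 2 \<le> 1"
  proof (intro eventually_conj)
    show "\<forall>\<^sub>F N :: nat in sequentially. 2 \<le> N" by (rule eventually_ge_at_top)
    show "\<forall>\<^sub>F N :: nat in sequentially. 1 \<le> ln (real N)" by real_asymp
    show "\<forall>\<^sub>F N :: nat in sequentially. rad N \<le> \<delta>" unfolding rad_def using \<delta> by real_asymp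
    have "(\<lambda>N. L * rad N) \<longlonglongrightarrow> L * 0" unfolding rad_def by (intro tendsto_intros) real_asymp
    then have "\<forall>\<^sub>F N :: nat in sequentially. L * rad N < d"
      using d by (intro order_tendstoD(2)) auto
    then show "\<forall>\<^sub>F N :: nat in sequentially. L * rad N \<le> d"
      by eventually_elim simp
    show "\<forall>\<^sub>F N :: nat in sequentially. d * rad N \<le> N powr (3/8)" unfolding rad_def using d by real_asymp
    have "(\<lambda>N::nat. L * (N * (rad N)\<^sup>2 / N powr (3/8))) \<longlonglongrightarrow> L * 0" unfolding rad_def by (intro tendsto_intros) real_asymp
    then have "\<forall>\<^sub>F N :: nat in sequentially. L * (N * (rad N)\<^sup>2 / N powr (3/8)) < 1"
      by (intro order_tendstoD(2)) auto
    then show "\<forall>\<^sub>F N :: nat in sequentially. N * (L * (rad N)\<^sup>2) \<le> N powr (3/8)"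
      using eventually_gt_at_top[of 0] by eventually_elim (simp add: field_simps)
    show "\<forall>\<^sub>F N :: nat in sequentially. N powr (-(1/4)) * 2 \<le> 1" by real_asymp
  qed
  have main: "\<forall>\<^sub>F N in sequentially. prob (space M - G N) \<le> e N / sqrt N \<and>
      (\<forall>w\<in>G N. \<forall>s. \<bar>s\<bar> \<le> rad N \<longrightarrow> \<bar>cnt N w (p + s) - cnt N w p - N * d * s\<bar> \<le> 3 * N powr (3/8))"
    using ev
  proof eventually_elim
    case (elim N)
    define l where "l = ln (real N)"
    define r where "r = rad N"
    define K where "K = real N powr (3/8)"
    have N: "2 \<le> N" and l: "1 \<le> l" and r: "r \<le> \<delta>" "L * r \<le> d" "d * r \<le> K" "N * (L * r\<^sup>2) \<le> K" "N powr (-(1/4)) * 2 \<le> 1"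
      using elim by (auto simp: l_def r_def K_def)
    have r0: "0 < r" using l N by (simp add: r_def rad_def l_def[symmetric])
    have N0: "0 < real N" using N by simp
    have ptr: "\<bar>pt N j\<bar> \<le> r" if "j \<in> {- int N..int N}" for j
    proof -
      have "\<bar>real_of_int j\<bar> \<le> N" using that by (auto simp: abs_le_iff)
      then have "r * \<bar>real_of_int j\<bar> \<le> r * N" using r0 by (intro mult_left_mono) auto
      then show ?thesis using r0 N0 by (simp add: pt_def r_def[symmetric] abs_mult pos_divide_le_eq)
    qed
    have Fd: "\<bar>F (p + s) - F p\<bar> \<le> 2 * d * r" if "\<bar>s\<bar> \<le> r" for s
    proof -
      have "L * s\<^sup>2 \<le> d * r"
      proof -
        have "s\<^sup>2 \<le> r\<^sup>2" by (rule abs_power2_le[OF that])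
        then have "L * s\<^sup>2 \<le> (L * r) * r" using L mult_left_mono[of "s\<^sup>2" "r\<^sup>2" L] by (simp add: power2_eq_square mult.assoc)
        also have "\<dots> \<le> d * r" using r r0 by (intro mult_right_mono) auto
        finally show ?thesis .
      qed
      moreover have "\<bar>d * s\<bar> \<le> d * r" using that d by (simp add: abs_mult)
      ultimately show ?thesis using taylor[of s] that r by linarith
    qed
    have "prob (space M - G N) \<le> prob (\<Union>j\<in>{- int N..int N}. {w \<in> space M. K \<le> dev N j w})"
      by (rule finite_measure_mono) (auto simp: G_def K_def not_less)
    also have "\<dots> \<le> (\<Sum>j\<in>{- int N..int N}. prob {w \<in> space M. K \<le> dev N j w})"
      by (rule measure_UNION_le) auto
    also have "\<dots> \<le> (\<Sum>j\<in>{- int N..int N}. 2 * exp (2 * d * l\<^sup>2 - N powr (1/8)))"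
    proof (rule sum_mono)
      fix j assume j: "j \<in> {- int N..int N}"
      \<comment> \<open>This makes the variance term \<open>2 * d * (ln N)^2\<close> and the linear
        term \<open>N powr (1/8)\<close>, which outweighs both the former and the number of grid
        points.\<close>
      define c where "c = real N powr (-(1/4))"
      have "prob {w \<in> space M. K \<le> dev N j w} \<le> 2 * exp (N * c\<^sup>2 * (2 * d * r) - c * K)"
        unfolding dev_def
      proof (rule oscillation_tail)
        show "\<bar>F (p + pt N j) - F p\<bar> \<le> 2 * d * r" by (rule Fd[OF ptr[OF j]])
        show "0 < c" "c * 2 \<le> 1" using r(5) N0 by (simp_all add: c_def)
      qed
      also have "c * K = N powr (1/8)" unfolding c_def K_def powr_add[symmetric] by simp
      also have "N * c\<^sup>2 * (2 * d * r) = 2 * d * l\<^sup>2"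
      proof -
        have "c\<^sup>2 = N powr (- (1/2))"
          unfolding c_def power2_eq_square powr_add[symmetric] by simp
        also have "\<dots> = 1 / sqrt N"
          using N0 by (simp add: powr_minus_divide powr_half_sqrt)
        finally have "c\<^sup>2 = 1 / sqrt N" .
        moreover have "real N * (1 / a) * (y / a) = y" if "a * a = real N" for a y :: real
        proof -
          have "a \<noteq> 0" using that N0 by auto
          then show ?thesis unfolding that[symmetric] by simp
        qed
        from this[of "sqrt N" "l\<^sup>2"] have "N * (1 / sqrt N) * r = l\<^sup>2"
          by (simp add: r_def rad_def l_def)
        ultimately have "N * c\<^sup>2 * r = l\<^sup>2" by simp
        then show ?thesis by (simp add: algebra_simps)
      qed
      finally show "prob {w \<in> space M. K \<le> dev N j w} \<le> 2 * exp (2 * d * l\<^sup>2 - N powr (1/8))" .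
    qed
    also have "\<dots> = e N / sqrt N"
      using N0 by (simp add: e_def l_def)
    finally have 1: "prob (space M - G N) \<le> e N / sqrt N" .
    have 2: "\<bar>cnt N w (p + s) - cnt N w p - N * d * s\<bar> \<le> 3 * K" if w: "w \<in> G N" and s: "\<bar>s\<bar> \<le> r" for w s
    proof -
      \<comment> \<open>Of the three multiples of \<open>K\<close> in the claim, one pays for the
        deviation at a grid point, one for the Taylor error of \<open>F\<close>, and one for the
        expected count \<open>N * d * h\<close> of a mesh cell.\<close>
      define h where "h = r / N"
      have h0: "0 < h" using r0 N0 by (simp add: h_def)
      have sh: "- real N \<le> s / h" "s / h \<le> real N"
      proof -
        have eq: "s / h = s / r * N" by (simp add: h_def)
        have "-1 \<le> s / r" "s / r \<le> 1"
          using s r0 by (simp_all add: pos_le_divide_eq pos_divide_le_eq abs_le_iff)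
        then show "- real N \<le> s / h" "s / h \<le> real N"
          unfolding eq using mult_right_mono[of "-1" "s / r" "real N"] mult_right_mono[of "s / r" 1 "real N"] by simp_all
      qed
      have grid: "\<bar>cnt N w (p + pt N j) - cnt N w p - N * d * pt N j\<bar> \<le> 2 * K" if j: "j \<in> {- int N..int N}" for j
      proof -
        have "dev N j w < K" using w j by (auto simp: G_def K_def)
        moreover have "\<bar>N * (F (p + pt N j) - F p) - N * d * pt N j\<bar> \<le> K"
        proof -
          have "\<bar>F (p + pt N j) - F p - d * pt N j\<bar> \<le> L * r\<^sup>2"
            using taylor[of "pt N j"] ptr[OF j] r(1) mult_left_mono[OF abs_power2_le[OF ptr[OF j]] L] by linarith
          then have "N * \<bar>F (p + pt N j) - F p - d * pt N j\<bar> \<le> N * (L * r\<^sup>2)" by (intro mult_left_mono) auto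
          also have "N * \<bar>F (p + pt N j) - F p - d * pt N j\<bar> = \<bar>N * (F (p + pt N j) - F p) - N * d * pt N j\<bar>"
          proof -
            have "N * (F (p + pt N j) - F p) - N * d * pt N j = N * (F (p + pt N j) - F p - d * pt N j)" by (simp add: algebra_simps)
            then show ?thesis by (simp add: abs_mult)
          qed
          finally show ?thesis using r(4) by linarith
        qed
        ultimately show ?thesis unfolding dev_def by linarith
      qed
      have pt_h: "pt N j = h * real_of_int j" for j by (simp add: pt_def h_def r_def)
      have NdK: "N * d * h \<le> K" using r(3) N0 by (simp add: h_def mult_ac)
      have up: "cnt N w (p + s) - cnt N w p \<le> N * d * s + 3 * K"
      proof -
        define j where "j = \<lceil>s / h\<rceil>"
        have j: "j \<in> {- int N..int N}" using sh unfolding j_def by (auto simp: le_ceiling_iff ceiling_le_iff)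
        have "s / h \<le> real_of_int j" "real_of_int j < s / h + 1" unfolding j_def by linarith+
        then have jj: "s \<le> pt N j" "pt N j \<le> s + h" using h0 unfolding pt_h by (simp_all add: field_simps)
        have "cnt N w (p + s) \<le> cnt N w (p + pt N j)" using jj by (intro cnt_mono) auto
        moreover have "N * d * pt N j \<le> N * d * (s + h)" using jj d by (intro mult_left_mono) auto
        moreover have "N * d * (s + h) = N * d * s + N * d * h" by (simp add: distrib_left)
        ultimately show ?thesis using grid[OF j] NdK by linarith
      qed
      have lo: "N * d * s - 3 * K \<le> cnt N w (p + s) - cnt N w p"
      proof -
        define j where "j = \<lfloor>s / h\<rfloor>"
        have j: "j \<in> {- int N..int N}" using sh unfolding j_def by (auto simp: le_floor_iff floor_le_iff)
        have "real_of_int j \<le> s / h" "s / h - 1 < real_of_int j" unfolding j_def by linarith+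
        then have jj: "pt N j \<le> s" "s - h \<le> pt N j" using h0 unfolding pt_h by (simp_all add: field_simps)
        have "cnt N w (p + pt N j) \<le> cnt N w (p + s)" using jj by (intro cnt_mono) auto
        moreover have "N * d * (s - h) \<le> N * d * pt N j" using jj d by (intro mult_left_mono) auto
        moreover have "N * d * (s - h) = N * d * s - N * d * h" by (simp add: right_diff_distrib)
        ultimately show ?thesis using grid[OF j] NdK by linarith
      qed
      show ?thesis using up lo by linarith
    qed
    show ?case using 1 2 unfolding K_def r_def by blast
  qed
  show ?thesis by (rule that[OF G e main])
qed

text \<open>The choice \<open>c = l / (2 * C^2 * sqrt N)\<close> minimizes the exponent of
  \<open>tail_bound\<close>; the upper bound on \<open>l\<close> is its condition
  \<open>c * C \<le> 1\<close>.\<close>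

lemma sum_tail:
  assumes g[measurable]: "g \<in> borel_measurable borel" and C: "\<And>x. \<bar>g x\<bar> \<le> C" "1 \<le> C" and mean: "(\<integral>x. g x \<partial>D) = 0"
    and N: "1 \<le> N" and l: "0 < l" "l \<le> 2 * C * sqrt N"
  shows "prob {w \<in> space M. l * sqrt N \<le> \<bar>S g N w\<bar>} \<le> 2 * exp (- (l\<^sup>2 / (4 * C\<^sup>2)))"
proof -
  define c where "c = l / (2 * C\<^sup>2 * sqrt N)"
  have c: "0 < c" "c * C \<le> 1" using C l N by (auto simp: c_def power2_eq_square field_simps)
  have "(\<integral>x. (g x)\<^sup>2 \<partial>D) \<le> (\<integral>x. C\<^sup>2 \<partial>D)"
    by (intro integral_mono integrable_bounded_D[where B="C\<^sup>2"]) (auto intro: abs_power2_le[OF C(1)])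
  then have var: "(\<integral>x. (g x)\<^sup>2 \<partial>D) \<le> C\<^sup>2" using D.prob_space by simp
  have "prob {w \<in> space M. l * sqrt N \<le> \<bar>S g N w\<bar>} \<le> 2 * exp (N * c\<^sup>2 * C\<^sup>2 - c * (l * sqrt N))"
    by (rule tail_bound[OF g C(1) mean var c])
  also have "N * c\<^sup>2 * C\<^sup>2 - c * (l * sqrt N) = - (l\<^sup>2 / (4 * C\<^sup>2))"
  proof -
    have "N * c\<^sup>2 * C\<^sup>2 = l\<^sup>2 / (4 * C\<^sup>2)"
      using C N by (simp add: c_def power_divide power_mult_distrib) (simp add: power2_eq_square power4_eq_xxxx)
    moreover have "c * (l * sqrt N) = l\<^sup>2 / (2 * C\<^sup>2)"
      using N by (simp add: c_def power2_eq_square)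
    ultimately show ?thesis by simp
  qed
  finally show ?thesis .
qed

definition typical :: "nat \<Rightarrow> 'a \<Rightarrow> bool" where
  "typical N w \<longleftrightarrow> (\<forall>s. \<bar>s\<bar> \<le> rad N \<longrightarrow> \<bar>cnt N w (\<xi> + s) - cnt N w \<xi> - N * f \<xi> * s\<bar> \<le> 3 * N powr (3/8))
    \<and> (\<forall>s. \<bar>s\<bar> \<le> rad N \<longrightarrow> \<bar>cnt N w (\<eta> + s) - cnt N w \<eta> - N * f \<eta> * s\<bar> \<le> 3 * N powr (3/8))
    \<and> (\<forall>g\<in>{z, v, A, B}. \<bar>S g N w\<bar> \<le> ln N * sqrt N)"

text \<open>The exceptional event is covered by two oscillation failures and four tail events at
  level \<open>ln N\<close>, whose bound beats every power of \<open>N\<close>. An event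
  \<open>G N\<close> stands in for \<open>typical\<close>, because that predicate quantifies over
  uncountably many \<open>s\<close> and its measurability is not immediate.\<close>

lemma typical_event:
  obtains G :: "nat \<Rightarrow> 'a set" and e :: "nat \<Rightarrow> real" where "\<And>N. G N \<in> events" "e \<longlonglongrightarrow> 0"
    "\<forall>\<^sub>F N in sequentially. prob (space M - G N) \<le> e N / sqrt N \<and> (\<forall>w\<in>G N. typical N w)"
proof -
  have osc: "\<exists>G e. (\<forall>N. G N \<in> events) \<and> e \<longlonglongrightarrow> (0::real) \<and> (\<forall>\<^sub>F N in sequentially. prob (space M - G N) \<le> e N / sqrt N \<and>
      (\<forall>w\<in>G N. \<forall>s. \<bar>s\<bar> \<le> rad N \<longrightarrow> \<bar>cnt N w (p + s) - cnt N w p - N * f p * s\<bar> \<le> 3 * N powr (3/8)))"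
    if "deriv_lipschitz_near F f p" "0 < f p" for p
  proof -
    show ?thesis
    proof (rule deriv_lipschitz_nearE[OF that])
      fix \<delta> L :: real
      assume *: "0 < \<delta>" "0 \<le> L" "\<And>s. \<bar>s\<bar> \<le> \<delta> \<Longrightarrow> \<bar>F (p + s) - F p - f p * s\<bar> \<le> L * s\<^sup>2"
      show ?thesis
        by (rule oscillation[OF that(2) *]) blast+
    qed
  qed
  have "deriv_lipschitz_near F f \<xi>" "0 < f \<xi>" "deriv_lipschitz_near F f \<eta>" "0 < f \<eta>"
    using F_near_\<alpha> F_near_\<beta> f_pos by (simp_all add: \<xi>_def \<eta>_def)
  note osc\<xi> = osc[OF this(1,2)] and osc\<eta> = osc[OF this(3,4)]
  obtain G1 e1 where "(\<forall>N. G1 N \<in> events) \<and> e1 \<longlonglongrightarrow> (0::real) \<and> (\<forall>\<^sub>F N in sequentially. prob (space M - G1 N) \<le> e1 N / sqrt N \<and>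
      (\<forall>w\<in>G1 N. \<forall>s. \<bar>s\<bar> \<le> rad N \<longrightarrow> \<bar>cnt N w (\<xi> + s) - cnt N w \<xi> - N * f \<xi> * s\<bar> \<le> 3 * N powr (3/8)))"
    using osc\<xi> by (elim exE) (rule that)
  then have G1: "\<And>N. G1 N \<in> events" "e1 \<longlonglongrightarrow> 0"
    "\<forall>\<^sub>F N in sequentially. prob (space M - G1 N) \<le> e1 N / sqrt N \<and>
      (\<forall>w\<in>G1 N. \<forall>s. \<bar>s\<bar> \<le> rad N \<longrightarrow> \<bar>cnt N w (\<xi> + s) - cnt N w \<xi> - N * f \<xi> * s\<bar> \<le> 3 * N powr (3/8))"
    by simp_all
  obtain G2 e2 where "(\<forall>N. G2 N \<in> events) \<and> e2 \<longlonglongrightarrow> (0::real) \<and> (\<forall>\<^sub>F N in sequentially. prob (space M - G2 N) \<le> e2 N / sqrt N \<and>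
      (\<forall>w\<in>G2 N. \<forall>s. \<bar>s\<bar> \<le> rad N \<longrightarrow> \<bar>cnt N w (\<eta> + s) - cnt N w \<eta> - N * f \<eta> * s\<bar> \<le> 3 * N powr (3/8)))"
    using osc\<eta> by (elim exE) (rule that)
  then have G2: "\<And>N. G2 N \<in> events" "e2 \<longlonglongrightarrow> 0"
    "\<forall>\<^sub>F N in sequentially. prob (space M - G2 N) \<le> e2 N / sqrt N \<and>
      (\<forall>w\<in>G2 N. \<forall>s. \<bar>s\<bar> \<le> rad N \<longrightarrow> \<bar>cnt N w (\<eta> + s) - cnt N w \<eta> - N * f \<eta> * s\<bar> \<le> 3 * N powr (3/8))"
    by simp_all
  obtain C where C: "1 \<le> C" "\<And>x. \<bar>z x\<bar> \<le> C \<and> \<bar>v x\<bar> \<le> C \<and> \<bar>A x\<bar> \<le> C \<and> \<bar>B x\<bar> \<le> C" using bound_exists by blast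
  define H where "H g N = {w \<in> space M. \<bar>S g N w\<bar> < ln N * sqrt N}" for g N
  define G where "G N = G1 N \<inter> G2 N \<inter> H z N \<inter> H v N \<inter> H A N \<inter> H B N" for N
  define e3 where "e3 N = sqrt N * (8 * exp (- ((ln (real N))\<^sup>2 / (4 * C\<^sup>2))))" for N :: nat
  have H[measurable]: "H z N \<in> events" "H v N \<in> events" "H A N \<in> events" "H B N \<in> events" for N
    unfolding H_def by measurable
  have e3: "e3 \<longlonglongrightarrow> 0"
  proof -
    have "0 < 1 / (4 * C\<^sup>2)" using C by simp
    then have "(\<lambda>N::nat. sqrt N * (8 * exp (- ((ln (real N))\<^sup>2 * (1 / (4 * C\<^sup>2)))))) \<longlonglongrightarrow> 0"
      by real_asymp
    then show ?thesis by (simp add: e3_def[abs_def])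
  qed
  have lim: "(\<lambda>N. e1 N + e2 N + e3 N) \<longlonglongrightarrow> 0"
    using tendsto_add[OF tendsto_add[OF G1(2) G2(2)] e3] by simp
  have ev: "\<forall>\<^sub>F N :: nat in sequentially. 1 \<le> N \<and> 0 < ln (real N) \<and> ln (real N) \<le> 2 * C * sqrt N"
  proof (intro eventually_conj)
    show "\<forall>\<^sub>F N :: nat in sequentially. 1 \<le> N" by (rule eventually_ge_at_top)
    show "\<forall>\<^sub>F N :: nat in sequentially. 0 < ln (real N)" by real_asymp
    have "0 < 2 * C" using C by simp
    then show "\<forall>\<^sub>F N :: nat in sequentially. ln (real N) \<le> 2 * C * sqrt N" by real_asymp
  qed
  have "\<forall>\<^sub>F N in sequentially. prob (space M - G N) \<le> (e1 N + e2 N + e3 N) / sqrt N \<and> (\<forall>w\<in>G N. typical N w)"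
    using G1(3) G2(3) ev
  proof eventually_elim
    case (elim N)
    have tail: "prob (space M - H g N) \<le> e3 N / sqrt N / 4" if "g \<in> {z, v, A, B}" for g
    proof -
      have "space M - H g N = {w \<in> space M. ln N * sqrt N \<le> \<bar>S g N w\<bar>}" by (auto simp: H_def)
      moreover have "g \<in> borel_measurable borel" "\<And>x. \<bar>g x\<bar> \<le> C" "(\<integral>x. g x \<partial>D) = 0"
        using that C means by (auto simp: zvAB_measurable)
      ultimately show ?thesis
        using sum_tail[of g C N "ln N"] elim(3) C by (simp add: e3_def)
    qed
    have "space M - G N \<subseteq> (space M - G1 N) \<union> ((space M - G2 N) \<union> ((space M - H z N) \<union> ((space M - H v N) \<union> ((space M - H A N) \<union> (space M - H B N)))))"
      by (auto simp: G_def)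
    then have "prob (space M - G N) \<le> prob ((space M - G1 N) \<union> ((space M - G2 N) \<union> ((space M - H z N) \<union> ((space M - H v N) \<union> ((space M - H A N) \<union> (space M - H B N))))))"
      using G1(1) G2(1) H by (intro finite_measure_mono) auto
    also have "\<dots> \<le> prob (space M - G1 N) + (prob (space M - G2 N) + (prob (space M - H z N) + (prob (space M - H v N) + (prob (space M - H A N) + prob (space M - H B N)))))"
      using G1(1) G2(1) H by (intro order_trans[OF measure_Un_le] add_mono order_refl) auto
    also have "\<dots> \<le> e1 N / sqrt N + (e2 N / sqrt N + (e3 N / sqrt N / 4 + (e3 N / sqrt N / 4 + (e3 N / sqrt N / 4 + e3 N / sqrt N / 4))))"
      using elim by (intro add_mono tail) auto
    also have "\<dots> = (e1 N + e2 N + e3 N) / sqrt N" by (simp add: add_divide_distrib)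
    finally have "prob (space M - G N) \<le> (e1 N + e2 N + e3 N) / sqrt N" .
    moreover have "typical N w" if "w \<in> G N" for w
      using that elim unfolding typical_def by (auto simp: G_def H_def)
    ultimately show ?case by blast
  qed
  moreover have "G N \<in> events" for N using G1(1) G2(1) unfolding G_def by (intro sets.Int H) auto
  ultimately show ?thesis using that[of G "\<lambda>N. e1 N + e2 N + e3 N"] lim by blast
qed

end

section \<open>Order statistics\<close>

lemma sum_order_stat: "(\<Sum>i=1..N. g (order_stat X N i w)) = (\<Sum>j<N. g (X j w))"
proof -
  define xs where "xs = map (\<lambda>j. X j w) [0..<N]"
  have len: "length xs = N" by (simp add: xs_def)
  have "(\<Sum>i=1..N. g (order_stat X N i w)) = (\<Sum>i<N. g (sort xs ! i))"
    unfolding order_stat_def xs_def[symmetric]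
    by (rule sum.reindex_bij_witness[of _ Suc "\<lambda>i. i - 1"]) auto
  also have "\<dots> = sum_list (map g (sort xs))"
    by (simp add: sum_list_sum_nth len atLeast0LessThan)
  also have "\<dots> = sum_list (map g xs)"
    by (metis mset_map mset_sort sum_mset_sum_list)
  also have "\<dots> = (\<Sum>j<N. g (X j w))"
    by (simp add: xs_def comp_def interv_sum_list_conv_sum_set_nat atLeast0LessThan)
  finally show ?thesis .
qed

lemma order_stat_mono: "1 \<le> i \<Longrightarrow> i \<le> j \<Longrightarrow> j \<le> N \<Longrightarrow> order_stat X N i w \<le> order_stat X N j w"
  unfolding order_stat_def by (intro sorted_nth_mono) auto

text \<open>Observations above the \<open>k\<close>-th have vanishing positive part and the
  \<open>k\<close>-th contributes 0, so the same threshold serves for the sum of the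
  \<open>k\<close> smallest and of the \<open>k - 1\<close> smallest values. The first case is used
  at rank \<open>mb N\<close>, the second at rank \<open>ka N + 1\<close>.\<close>

lemma partial_sum_order_stat:
  assumes k: "1 \<le> k" "k \<le> N" and K: "K = k \<or> Suc K = k"
  shows "real K * order_stat X N k w - (\<Sum>j<N. max 0 (order_stat X N k w - X j w)) = (\<Sum>i=1..K. order_stat X N i w)"
proof -
  let ?y = "\<lambda>i. order_stat X N i w"
  have "(\<Sum>j<N. max 0 (?y k - X j w)) = (\<Sum>i=1..N. max 0 (?y k - ?y i))"
    by (rule sum_order_stat[symmetric])
  also have "\<dots> = (\<Sum>i\<in>{1..K} \<union> {K+1..N}. max 0 (?y k - ?y i))"
    using k K by (intro sum.cong) auto
  also have "\<dots> = (\<Sum>i=1..K. max 0 (?y k - ?y i)) + (\<Sum>i=K+1..N. max 0 (?y k - ?y i))"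
    by (rule sum.union_disjoint) auto
  also have "(\<Sum>i=1..K. max 0 (?y k - ?y i)) = (\<Sum>i=1..K. ?y k - ?y i)"
  proof (rule sum.cong)
    fix i assume "i \<in> {1..K}"
    then have "?y i \<le> ?y k" using k K by (intro order_stat_mono) auto
    then show "max 0 (?y k - ?y i) = ?y k - ?y i" by simp
  qed simp
  also have "(\<Sum>i=K+1..N. max 0 (?y k - ?y i)) = 0"
  proof (rule sum.neutral, rule ballI)
    fix i assume "i \<in> {K+1..N}"
    then have "?y k \<le> ?y i" using k K by (intro order_stat_mono) auto
    then show "max 0 (?y k - ?y i) = 0" by simp
  qed
  finally show ?thesis by (simp add: sum_subtractf)
qed

text \<open>Clamping the sample at two of its order statistics reproduces the weights of the
  Winsorized sums; with \<open>g\<close> the identity and the square it covers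
  \<open>muW_hat\<close> and \<open>SN\<close>.\<close>

lemma sum_clamp_order_stat:
  fixes g :: "real \<Rightarrow> real"
  assumes k: "1 \<le> k" "k < m" "m \<le> N"
  shows "(\<Sum>j<N. g (max (order_stat X N k w) (min (order_stat X N m w) (X j w))))
    = real k * g (order_stat X N k w) + (\<Sum>i=k+1..m-1. g (order_stat X N i w)) + (real N - real m + 1) * g (order_stat X N m w)"
proof -
  let ?y = "\<lambda>i. order_stat X N i w"
  let ?h = "\<lambda>t. g (max (?y k) (min (?y m) t))"
  have km: "?y k \<le> ?y m" using k by (intro order_stat_mono) auto
  have "(\<Sum>j<N. ?h (X j w)) = (\<Sum>i=1..N. ?h (?y i))"
    by (rule sum_order_stat[symmetric])
  also have "\<dots> = (\<Sum>i\<in>({1..k} \<union> {k+1..m-1}) \<union> {m..N}. ?h (?y i))"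
    using k by (intro sum.cong) auto
  also have "\<dots> = (\<Sum>i\<in>{1..k} \<union> {k+1..m-1}. ?h (?y i)) + (\<Sum>i=m..N. ?h (?y i))"
    using k by (intro sum.union_disjoint) auto
  also have "(\<Sum>i\<in>{1..k} \<union> {k+1..m-1}. ?h (?y i)) = (\<Sum>i=1..k. ?h (?y i)) + (\<Sum>i=k+1..m-1. ?h (?y i))"
    by (rule sum.union_disjoint) auto
  also have "(\<Sum>i=1..k. ?h (?y i)) = (\<Sum>i=1..k. g (?y k))"
  proof (rule sum.cong)
    fix i assume "i \<in> {1..k}"
    then have "?y i \<le> ?y k" using k by (intro order_stat_mono) auto
    then have "max (?y k) (min (?y m) (?y i)) = ?y k" using km by auto
    then show "?h (?y i) = g (?y k)" by simp
  qed simp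
  also have "(\<Sum>i=k+1..m-1. ?h (?y i)) = (\<Sum>i=k+1..m-1. g (?y i))"
  proof (rule sum.cong)
    fix i assume "i \<in> {k+1..m-1}"
    then have "?y k \<le> ?y i" "?y i \<le> ?y m" using k by (auto intro!: order_stat_mono)
    then show "?h (?y i) = g (?y i)" by simp
  qed simp
  also have "(\<Sum>i=m..N. ?h (?y i)) = (\<Sum>i=m..N. g (?y m))"
  proof (rule sum.cong)
    fix i assume "i \<in> {m..N}"
    then have "?y m \<le> ?y i" using k by (intro order_stat_mono) auto
    then have "max (?y k) (min (?y m) (?y i)) = ?y m" using km by auto
    then show "?h (?y i) = g (?y m)" by simp
  qed simp
  finally show ?thesis using k by (simp add: of_nat_diff algebra_simps)
qed

text \<open>Ties are possible, so the count at an order statistic is only bounded below, and the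
  count strictly to its left only bounded above.\<close>

lemma order_stat_count_ge:
  assumes k: "1 \<le> k" "k \<le> N"
  shows "real k \<le> (\<Sum>j<N. indicator {..order_stat X N k w} (X j w))"
proof -
  have "real k = (\<Sum>i=1..k. 1)" by simp
  also have "\<dots> = (\<Sum>i=1..k. indicator {..order_stat X N k w} (order_stat X N i w))"
    using k by (intro sum.cong) (auto simp: indicator_def intro: order_stat_mono)
  also have "\<dots> \<le> (\<Sum>i=1..N. indicator {..order_stat X N k w} (order_stat X N i w))"
    using k by (intro sum_mono2) auto
  also have "\<dots> = (\<Sum>j<N. indicator {..order_stat X N k w} (X j w))" by (rule sum_order_stat)
  finally show ?thesis .
qed

lemma order_stat_count_less:
  assumes k: "1 \<le> k" "k \<le> N" and y: "y < order_stat X N k w"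
  shows "(\<Sum>j<N. indicator {..y} (X j w)) \<le> real k - 1"
proof -
  have "(\<Sum>j<N. indicator {..y} (X j w)) = (\<Sum>i=1..N. indicator {..y} (order_stat X N i w))"
    by (rule sum_order_stat[symmetric])
  also have "\<dots> = (\<Sum>i\<in>{1..<k} \<union> {k..N}. indicator {..y} (order_stat X N i w))"
    using k by (intro sum.cong) auto
  also have "\<dots> = (\<Sum>i\<in>{1..<k}. indicator {..y} (order_stat X N i w)) + (\<Sum>i\<in>{k..N}. indicator {..y} (order_stat X N i w))"
    by (rule sum.union_disjoint) auto
  also have "(\<Sum>i\<in>{k..N}. indicator {..y} (order_stat X N i w)) = (0 :: real)"
  proof (rule sum.neutral, rule ballI)
    fix i assume "i \<in> {k..N}"
    then have "order_stat X N k w \<le> order_stat X N i w" using k by (intro order_stat_mono) auto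
    then show "indicator {..y} (order_stat X N i w) = (0 :: real)" using y by (auto simp: indicator_def)
  qed
  also have "(\<Sum>i\<in>{1..<k}. indicator {..y} (order_stat X N i w)) \<le> (\<Sum>i\<in>{1..<k}. 1 :: real)"
    by (intro sum_mono) (auto simp: indicator_def)
  finally show ?thesis using k by (simp add: of_nat_diff)
qed

text \<open>Subdivision into \<open>n\<close> equal pieces keeps the linear part of the bound and
  divides the quadratic part by \<open>n\<close>; then \<open>n\<close> tends to infinity.\<close>

lemma telescoping_bound:
  fixes \<phi> :: "real \<Rightarrow> real"
  assumes xy: "x \<le> y" and b: "\<And>s t. x \<le> s \<Longrightarrow> s \<le> t \<Longrightarrow> t \<le> y \<Longrightarrow> \<bar>\<phi> t - \<phi> s\<bar> \<le> (t - s) * (\<rho> + E * (t - s))"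
  shows "\<bar>\<phi> y - \<phi> x\<bar> \<le> (y - x) * \<rho>"
proof -
  have fin: "\<bar>\<phi> y - \<phi> x\<bar> \<le> (y - x) * (\<rho> + E * ((y - x) * (1 / real n)))" if n: "1 \<le> n" for n :: nat
  proof -
    define h where "h = (y - x) / n"
    have h: "0 \<le> h" "n * h = y - x" using xy n by (auto simp: h_def)
    have "(\<Sum>i<n. \<phi> (x + real (Suc i) * h) - \<phi> (x + real i * h)) = \<phi> (x + real n * h) - \<phi> (x + real 0 * h)"
      by (rule sum_lessThan_telescope)
    then have "\<phi> y - \<phi> x = (\<Sum>i<n. \<phi> (x + real (Suc i) * h) - \<phi> (x + real i * h))"
      unfolding h(2) by simp
    also have "\<bar>\<dots>\<bar> \<le> (\<Sum>i<n. h * (\<rho> + E * h))"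
    proof (rule order_trans[OF sum_abs], rule sum_mono)
      fix i assume i: "i \<in> {..<n}"
      have "real (Suc i) * h \<le> n * h" using i h by (intro mult_right_mono) auto
      then have "\<bar>\<phi> (x + real (Suc i) * h) - \<phi> (x + real i * h)\<bar> \<le> ((x + real (Suc i) * h) - (x + real i * h)) * (\<rho> + E * ((x + real (Suc i) * h) - (x + real i * h)))"
        using h by (intro b) (auto simp: distrib_right)
      also have "(x + real (Suc i) * h) - (x + real i * h) = h" by (simp add: distrib_right)
      finally show "\<bar>\<phi> (x + real (Suc i) * h) - \<phi> (x + real i * h)\<bar> \<le> h * (\<rho> + E * h)" .
    qed
    also have "\<dots> = (n * h) * (\<rho> + E * h)" by simp
    also have "\<dots> = (y - x) * (\<rho> + E * ((y - x) * (1 / real n)))" unfolding h(2) by (simp add: h_def)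
    finally show ?thesis .
  qed
  have "(\<lambda>n. (y - x) * (\<rho> + E * ((y - x) * (1 / real n)))) \<longlonglongrightarrow> (y - x) * (\<rho> + E * ((y - x) * 0))"
    by (intro tendsto_intros lim_1_over_n)
  then show ?thesis
    using fin by (intro LIMSEQ_le_const[of _ "(y - x) * \<rho>"]) auto
qed

lemma hinge_increment:
  fixes s t x :: real
  assumes "s \<le> t"
  shows "(t - s) * indicator {..s} x \<le> max 0 (t - x) - max 0 (s - x)"
    "max 0 (t - x) - max 0 (s - x) \<le> (t - s) * indicator {..t} x"
  using assms by (auto simp: indicator_def)

text \<open>The sum of the \<open>K\<close> smallest observations is \<open>K a - \<Sum>(a - x)\<^sup>+\<close> at the corresponding order statistic \<open>a\<close>;
  replacing \<open>a\<close> by the true quantile \<open>p\<close> costs the square of the count deviation.\<close>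

lemma hinge_sum_expansion:
  fixes x :: "nat \<Rightarrow> real" and p r u \<rho> E K :: real and N :: nat
  defines "c \<equiv> \<lambda>y. \<Sum>j<N. indicator {..y} (x j) :: real"
  defines "H \<equiv> \<lambda>y. \<Sum>j<N. max 0 (y - x j)"
  assumes osc: "\<And>s. \<bar>s\<bar> \<le> r \<Longrightarrow> \<bar>c (p + s) - c p - E * s\<bar> \<le> \<rho>"
    and E: "0 < E" and \<rho>: "0 \<le> \<rho>" and u: "\<bar>u\<bar> \<le> r" and K: "\<bar>E * u - (K - c p)\<bar> \<le> \<rho> + 2"
  shows "\<bar>(K * (p + u) - H (p + u)) - (K * p - H p) - (K - c p)\<^sup>2 / (2 * E)\<bar> \<le> \<rho> * r + (\<rho> + 2)\<^sup>2 / (2 * E)"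
proof -
  \<comment> \<open>\<open>H\<close> minus its quadratic model around \<open>p\<close>. The slope of
    \<open>H\<close> is the count, which is linear up to \<open>\<rho>\<close>, so the increments of
    \<open>\<phi>\<close> are controlled by \<open>\<rho>\<close> through
    \<open>telescoping_bound\<close>.\<close>
  define \<phi> where "\<phi> s = H (p + s) - c p * s - E * s\<^sup>2 / 2" for s
  have inc: "\<bar>\<phi> t - \<phi> s\<bar> \<le> (t - s) * (\<rho> + E / 2 * (t - s))" if st: "s \<le> t" "\<bar>s\<bar> \<le> r" "\<bar>t\<bar> \<le> r" for s t
  proof -
    have d: "\<phi> t - \<phi> s = (H (p + t) - H (p + s)) - (t - s) * (c p + E * (t + s) / 2)"
      unfolding \<phi>_def by (simp add: field_simps power2_eq_square)
    have "H (p + t) - H (p + s) \<le> (t - s) * c (p + t)"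
      unfolding H_def c_def sum_subtractf[symmetric] sum_distrib_left
      using hinge_increment(2)[of "p + s" "p + t"] st by (intro sum_mono) auto
    also have "\<dots> \<le> (t - s) * (c p + E * t + \<rho>)"
      using osc[OF st(3)] st by (intro mult_left_mono) auto
    finally have up: "\<phi> t - \<phi> s \<le> (t - s) * (c p + E * t + \<rho>) - (t - s) * (c p + E * (t + s) / 2)" unfolding d by simp
    have "(t - s) * (c p + E * s - \<rho>) \<le> (t - s) * c (p + s)"
      using osc[OF st(2)] st by (intro mult_left_mono) auto
    also have "\<dots> \<le> H (p + t) - H (p + s)"
      unfolding H_def c_def sum_subtractf[symmetric] sum_distrib_left
      using hinge_increment(1)[of "p + s" "p + t"] st by (intro sum_mono) auto
    finally have lo: "(t - s) * (c p + E * s - \<rho>) - (t - s) * (c p + E * (t + s) / 2) \<le> \<phi> t - \<phi> s" unfolding d by simp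
    have e1: "(t - s) * (c p + E * t + \<rho>) - (t - s) * (c p + E * (t + s) / 2) = (t - s) * (\<rho> + E / 2 * (t - s))"
      and e2: "(t - s) * (c p + E * s - \<rho>) - (t - s) * (c p + E * (t + s) / 2) = - ((t - s) * (\<rho> + E / 2 * (t - s)))"
      by (simp_all add: field_simps)
    show ?thesis using up lo unfolding e1 e2 by linarith
  qed
  have r0: "0 \<le> r" using u by linarith
  have "\<bar>\<phi> u - \<phi> 0\<bar> \<le> \<rho> * r"
  proof (cases "0 \<le> u")
    case True
    have "\<bar>\<phi> u - \<phi> 0\<bar> \<le> (u - 0) * \<rho>"
    proof (rule telescoping_bound[where E="E / 2"])
      fix s t assume "0 \<le> s" "s \<le> t" "t \<le> u"
      then show "\<bar>\<phi> t - \<phi> s\<bar> \<le> (t - s) * (\<rho> + E / 2 * (t - s))"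
        using True u by (intro inc) auto
    qed (use True in simp)
    also have "\<dots> \<le> r * \<rho>" using u \<rho> by (intro mult_right_mono) auto
    finally show ?thesis by (simp add: mult.commute)
  next
    case False
    have "\<bar>\<phi> 0 - \<phi> u\<bar> \<le> (0 - u) * \<rho>"
    proof (rule telescoping_bound[where E="E / 2"])
      fix s t assume "u \<le> s" "s \<le> t" "t \<le> 0"
      then show "\<bar>\<phi> t - \<phi> s\<bar> \<le> (t - s) * (\<rho> + E / 2 * (t - s))"
        using False u by (intro inc) auto
    qed (use False in simp)
    also have "\<dots> \<le> r * \<rho>" using u \<rho> by (intro mult_right_mono) auto
    finally show ?thesis by (simp add: mult.commute abs_minus_commute)
  qed
  \<comment> \<open>Completing the square in \<open>u\<close>: the quadratic model has the extremal
    value \<open>(K - c p)^2 / (2 * E)\<close>, and \<open>u\<close> misses the extremal point by at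
    most \<open>(\<rho> + 2) / E\<close>.\<close>
  moreover have "(K * (p + u) - H (p + u)) - (K * p - H p) - (K - c p)\<^sup>2 / (2 * E)
      = - (\<phi> u - \<phi> 0) - (E * u - (K - c p))\<^sup>2 / (2 * E)"
    unfolding \<phi>_def using E by (simp add: field_simps power2_eq_square)
  moreover have "(E * u - (K - c p))\<^sup>2 / (2 * E) \<le> (\<rho> + 2)\<^sup>2 / (2 * E)"
    using E power_mono[OF K, of 2] by (intro divide_right_mono) auto
  moreover have "0 \<le> (E * u - (K - c p))\<^sup>2 / (2 * E)" using E by simp
  ultimately show ?thesis by linarith
qed

text \<open>\<open>c\<close> follows a line of slope \<open>E\<close> up to \<open>\<rho>\<close>
  and crosses level \<open>k\<close> at \<open>a\<close>. At the ends of the window the line has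
  moved by more than all the slack, which confines \<open>a\<close>; comparing it with the levels at
  \<open>a\<close> and just left of \<open>a\<close> then fixes \<open>E * (a - p)\<close>.\<close>

lemma quantile_localization:
  fixes c :: "real \<Rightarrow> real" and p r \<rho> E k K a \<Lambda> :: real
  assumes osc: "\<And>s. \<bar>s\<bar> \<le> r \<Longrightarrow> \<bar>c (p + s) - c p - E * s\<bar> \<le> \<rho>" and mono: "\<And>x y. x \<le> y \<Longrightarrow> c x \<le> c y"
    and E: "0 < E" and r: "0 < r" and k: "k \<le> c a" "\<And>y. y < a \<Longrightarrow> c y \<le> k - 1"
    and K: "\<bar>k - K\<bar> \<le> 1" "\<bar>c p - K\<bar> \<le> \<Lambda>" and big: "\<Lambda> + \<rho> + 3 < E * r"
  shows "\<bar>a - p\<bar> \<le> r \<and> \<bar>E * (a - p) - (k - c p)\<bar> \<le> \<rho> + 1"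
proof -
  define u where "u = a - p"
  have a: "a = p + u" by (simp add: u_def)
  have up: "u \<le> r"
  proof (rule ccontr)
    assume "\<not> u \<le> r"
    then have "c (p + r) \<le> k - 1" using a by (intro k(2)) auto
    moreover have "E * r - \<rho> \<le> c (p + r) - c p" using osc[of r] r by (auto simp: abs_le_iff)
    ultimately show False using K big by linarith
  qed
  have lo: "- r < u"
  proof (rule ccontr)
    assume "\<not> - r < u"
    then have "c a \<le> c (p + (- r))" using a by (intro mono) auto
    moreover have "c (p + (- r)) - c p \<le> E * (- r) + \<rho>" using osc[of "- r"] r by (auto simp: abs_le_iff)
    moreover have "E * (- r) = - (E * r)" by simp
    ultimately show False using k(1) K big by linarith
  qed
  have ur: "\<bar>u\<bar> \<le> r" using up lo by auto
  have 1: "k - c p \<le> E * u + \<rho>" using osc[OF ur] k(1) unfolding a by (auto simp: abs_le_iff)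
  have 2: "E * u - \<rho> \<le> k - 1 - c p"
  proof (rule ccontr)
    assume n: "\<not> E * u - \<rho> \<le> k - 1 - c p"
    define gap where "gap = E * u - \<rho> - (k - 1 - c p)"
    have gap: "0 < gap" using n by (simp add: gap_def)
    \<comment> \<open>With ties the count at \<open>a\<close> itself may be far above
      \<open>k\<close>, so the upper bound is taken at a point left of \<open>a\<close>, close
      enough to use up only half of the assumed gap.\<close>
    define s where "s = max (- r) (u - gap / (2 * E))"
    have s: "s < u" "- r \<le> s" using gap E lo by (auto simp: s_def)
    have "\<bar>s\<bar> \<le> r" using s up by auto
    then have "c p + E * s - \<rho> \<le> c (p + s)" using osc[of s] by (auto simp: abs_le_iff)
    also have "\<dots> \<le> k - 1" using s a by (intro k(2)) auto
    finally have "E * s \<le> E * u - gap" by (simp add: gap_def)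
    moreover have "E * (u - gap / (2 * E)) \<le> E * s" using E by (intro mult_left_mono) (auto simp: s_def)
    moreover have "E * (u - gap / (2 * E)) = E * u - gap / 2" using E by (simp add: right_diff_distrib)
    ultimately show False using gap by linarith
  qed
  show ?thesis using ur 1 2 unfolding u_def[symmetric] by (auto simp: abs_le_iff)
qed

section \<open>Expansion of the studentized trimmed mean\<close>

text \<open>With \<open>t = sqrt (1 + y)\<close> the error is exactly
  \<open>- (t - 1)^2 / 2\<close>, and \<open>y = (t - 1) * (t + 1)\<close> with
  \<open>t + 1 \<ge> 1\<close>.\<close>

lemma sqrt_one_plus_bound:
  fixes y :: real
  assumes "-1 \<le> y"
  shows "\<bar>sqrt (1 + y) - (1 + y / 2)\<bar> \<le> y\<^sup>2 / 2"
proof -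
  define t where "t = sqrt (1 + y)"
  have t: "0 \<le> t" "t\<^sup>2 = 1 + y" using assms by (auto simp: t_def)
  have y: "y = (t - 1) * (t + 1)" using t(2) by (simp add: power2_eq_square algebra_simps)
  have "sqrt (1 + y) - (1 + y / 2) = - ((t - 1)\<^sup>2 / 2)"
  proof -
    have "t - (1 + y / 2) = - ((t - 1)\<^sup>2 / 2)" using t(2) by (simp add: power2_eq_square field_simps)
    then show ?thesis by (simp add: t_def)
  qed
  moreover have "(t - 1)\<^sup>2 \<le> y\<^sup>2"
  proof -
    have "(t - 1)\<^sup>2 * 1 \<le> (t - 1)\<^sup>2 * (t + 1)\<^sup>2"
      using t(1) by (intro mult_left_mono) (auto simp: one_le_power)
    then show ?thesis by (subst y) (simp add: power_mult_distrib)
  qed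
  ultimately show ?thesis by simp
qed

context trimmed_sample
begin

abbreviation "ka N \<equiv> nat \<lfloor>\<alpha> * real N\<rfloor>"
abbreviation "mb N \<equiv> nat \<lfloor>\<beta> * real N\<rfloor>"
definition "Xa N w = order_stat X N (ka N + 1) w"
definition "Xb N w = order_stat X N (mb N) w"
definition "\<rho> N = 3 * real N powr (3/8)"

lemma cnt_\<xi>: "cnt N w \<xi> = N * \<alpha> + S A N w" and cnt_\<eta>: "cnt N w \<eta> = N * \<beta> + S B N w"
  unfolding cnt_def S_def A_def B_def by (simp_all add: sum_subtractf)

lemma ka_bounds: "real (ka N) \<le> \<alpha> * N" "\<alpha> * N < real (ka N) + 1" and mb_bounds: "real (mb N) \<le> \<beta> * N" "\<beta> * N < real (mb N) + 1"
proof -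
  have "0 \<le> \<alpha> * N" "0 \<le> \<beta> * N" using ab by auto
  then have "0 \<le> \<lfloor>\<alpha> * real N\<rfloor>" "0 \<le> \<lfloor>\<beta> * real N\<rfloor>" by simp_all
  then show "real (ka N) \<le> \<alpha> * N" "\<alpha> * N < real (ka N) + 1" "real (mb N) \<le> \<beta> * N" "\<beta> * N < real (mb N) + 1"
    by (simp_all add: of_nat_nat)
qed

definition large :: "nat \<Rightarrow> bool" where
  "large N \<longleftrightarrow> 2 \<le> N \<and> 1 \<le> ln (real N) \<and> 2 < (\<beta> - \<alpha>) * N
    \<and> ln N * sqrt N + \<rho> N + 3 < N * f \<xi> * rad N \<and> ln N * sqrt N + \<rho> N + 3 < N * f \<eta> * rad N \<and> \<xi> + rad N < \<eta> - rad N"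

lemma f_pos': "0 < f \<xi>" "0 < f \<eta>"
  using f_pos by (simp_all add: \<xi>_def \<eta>_def)

lemma eventually_large: "\<forall>\<^sub>F N in sequentially. large N"
  unfolding large_def
proof (intro eventually_conj)
  show "\<forall>\<^sub>F N :: nat in sequentially. 2 \<le> N" by (rule eventually_ge_at_top)
  show "\<forall>\<^sub>F N :: nat in sequentially. 1 \<le> ln (real N)" by real_asymp
  have "0 < \<beta> - \<alpha>" using ab by simp
  then show "\<forall>\<^sub>F N :: nat in sequentially. 2 < (\<beta> - \<alpha>) * N" by real_asymp
  have "\<forall>\<^sub>F N :: nat in sequentially. ln N * sqrt N + \<rho> N + 3 < N * d * rad N" if "0 < d" for d :: real
    unfolding \<rho>_def rad_def using that by real_asymp
  from this[OF f_pos'(1)] this[OF f_pos'(2)]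
  show "\<forall>\<^sub>F N :: nat in sequentially. ln N * sqrt N + \<rho> N + 3 < N * f \<xi> * rad N"
    "\<forall>\<^sub>F N :: nat in sequentially. ln N * sqrt N + \<rho> N + 3 < N * f \<eta> * rad N" by simp_all
  have "\<forall>\<^sub>F N :: nat in sequentially. 2 * rad N < d" if "0 < d" for d :: real
    unfolding rad_def using that by real_asymp
  then have "\<forall>\<^sub>F N :: nat in sequentially. 2 * rad N < \<eta> - \<xi>" using \<xi>_less_\<eta> by simp
  then show "\<forall>\<^sub>F N :: nat in sequentially. \<xi> + rad N < \<eta> - rad N" by eventually_elim simp
qed

text \<open>The part of \<open>N * betaN\<close> caused by rounding \<open>\<alpha> * N\<close> and
  \<open>\<beta> * N\<close>. The remaining part arises as the mean of the quadratic terms and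
  reappears as \<open>\<sigma> * k0\<close>.\<close>

definition bN :: "nat \<Rightarrow> real" where
  "bN N = - (\<alpha> * N - ka N) * (mu_ab F \<alpha> \<beta> - \<xi>) + (\<beta> * N - mb N) * (mu_ab F \<alpha> \<beta> - \<eta>)"

section \<open>Deterministic expansion on the typical event\<close>

context
  fixes N :: nat and w :: 'a
  assumes large: "large N" and typw: "typical N w"
begin

private definition "l = ln (real N)"
private definition "r = rad N"
private definition "ua = Xa N w - \<xi>"
private definition "ub = Xb N w - \<eta>"

private lemma N: "2 \<le> N" "0 < real N" "1 \<le> l" "1 \<le> sqrt N" "sqrt N * sqrt N = N"
  using large by (auto simp: large_def l_def)

private lemma r: "0 < r" "sqrt N * r = l\<^sup>2" "N * r = l\<^sup>2 * sqrt N" "N * r\<^sup>2 = l ^ 4"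
proof -
  show 1: "0 < r" "sqrt N * r = l\<^sup>2" using N by (auto simp: r_def rad_def l_def)
  have "N * r = sqrt N * (sqrt N * r)" using N(5) by (metis mult.assoc)
  then show "N * r = l\<^sup>2 * sqrt N" unfolding 1(2) by simp
  have "N * r\<^sup>2 = (sqrt N * r) * (sqrt N * r)" using N(5) by (simp add: power2_eq_square mult_ac)
  then show "N * r\<^sup>2 = l ^ 4" unfolding 1(2) by (simp flip: power_add)
qed

private lemma \<rho>0: "0 \<le> \<rho> N" by (simp add: \<rho>_def)

private lemma km: "1 \<le> ka N + 1" "ka N + 1 < mb N" "mb N \<le> N"
proof -
  have "2 < (\<beta> - \<alpha>) * N" using large by (simp add: large_def)
  then have "real (ka N + 1) < real (mb N)" using ka_bounds[of N] mb_bounds[of N] by (simp add: algebra_simps)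
  then show "ka N + 1 < mb N" by linarith
  have "\<beta> * real N \<le> 1 * real N" using ab by (intro mult_right_mono) auto
  then have "real (mb N) \<le> real N" using mb_bounds[of N] by simp
  then show "mb N \<le> N" by linarith
qed simp

private lemma osc: "\<bar>s\<bar> \<le> r \<Longrightarrow> \<bar>cnt N w (\<xi> + s) - cnt N w \<xi> - N * f \<xi> * s\<bar> \<le> \<rho> N"
  "\<bar>s\<bar> \<le> r \<Longrightarrow> \<bar>cnt N w (\<eta> + s) - cnt N w \<eta> - N * f \<eta> * s\<bar> \<le> \<rho> N"
  using typw by (auto simp: typical_def r_def \<rho>_def)

private lemma Sb: "\<bar>S z N w\<bar> \<le> l * sqrt N" "\<bar>S v N w\<bar> \<le> l * sqrt N" "\<bar>S A N w\<bar> \<le> l * sqrt N" "\<bar>S B N w\<bar> \<le> l * sqrt N"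
  using typw by (auto simp: typical_def l_def)

private lemma Ef: "0 < N * f \<xi>" "0 < N * f \<eta>"
  using f_pos' N by auto

private lemma loc_a: "\<bar>ua\<bar> \<le> r" "\<bar>N * f \<xi> * ua - (real (ka N + 1) - cnt N w \<xi>)\<bar> \<le> \<rho> N + 1"
proof -
  have "\<bar>Xa N w - \<xi>\<bar> \<le> r \<and> \<bar>N * f \<xi> * (Xa N w - \<xi>) - (real (ka N + 1) - cnt N w \<xi>)\<bar> \<le> \<rho> N + 1"
  proof (rule quantile_localization[where K="\<alpha> * N" and \<Lambda>="l * sqrt N"])
    show "real (ka N + 1) \<le> cnt N w (Xa N w)"
      unfolding cnt_def Xa_def using km by (intro order_stat_count_ge) auto
    show "cnt N w y \<le> real (ka N + 1) - 1" if "y < Xa N w" for y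
      using that km unfolding cnt_def Xa_def by (intro order_stat_count_less) auto
    show "\<bar>real (ka N + 1) - \<alpha> * N\<bar> \<le> 1" using ka_bounds[of N] unfolding of_nat_add of_nat_1 by argo
    show "\<bar>cnt N w \<xi> - \<alpha> * N\<bar> \<le> l * sqrt N" unfolding cnt_\<xi> using Sb(3) by (simp add: mult.commute)
    show "l * sqrt N + \<rho> N + 3 < N * f \<xi> * r" using large by (simp add: large_def l_def r_def)
  qed (use osc(1) cnt_mono Ef r in auto)
  then show "\<bar>ua\<bar> \<le> r" "\<bar>N * f \<xi> * ua - (real (ka N + 1) - cnt N w \<xi>)\<bar> \<le> \<rho> N + 1"
    by (auto simp: ua_def)
qed

private lemma loc_b: "\<bar>ub\<bar> \<le> r" "\<bar>N * f \<eta> * ub - (real (mb N) - cnt N w \<eta>)\<bar> \<le> \<rho> N + 1"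
proof -
  have "\<bar>Xb N w - \<eta>\<bar> \<le> r \<and> \<bar>N * f \<eta> * (Xb N w - \<eta>) - (real (mb N) - cnt N w \<eta>)\<bar> \<le> \<rho> N + 1"
  proof (rule quantile_localization[where K="\<beta> * N" and \<Lambda>="l * sqrt N"])
    show "real (mb N) \<le> cnt N w (Xb N w)"
      unfolding cnt_def Xb_def using km by (intro order_stat_count_ge) auto
    show "cnt N w y \<le> real (mb N) - 1" if "y < Xb N w" for y
      using that km unfolding cnt_def Xb_def by (intro order_stat_count_less) auto
    show "\<bar>real (mb N) - \<beta> * N\<bar> \<le> 1" using mb_bounds[of N] by argo
    show "\<bar>cnt N w \<eta> - \<beta> * N\<bar> \<le> l * sqrt N" unfolding cnt_\<eta> using Sb(4) by (simp add: mult.commute)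
    show "l * sqrt N + \<rho> N + 3 < N * f \<eta> * r" using large by (simp add: large_def l_def r_def)
  qed (use osc(2) cnt_mono Ef r in auto)
  then show "\<bar>ub\<bar> \<le> r" "\<bar>N * f \<eta> * ub - (real (mb N) - cnt N w \<eta>)\<bar> \<le> \<rho> N + 1"
    by (auto simp: ub_def)
qed

text \<open>Replaces rank minus count by the centred sum. Up to sign they differ by a rounding error
  of at most 1, and \<open>L\<close> will be of order \<open>ln N * sqrt N\<close> against
  \<open>E\<close> of order \<open>N\<close>.\<close>

private lemma square_shift:
  fixes c d s e E :: real
  assumes "\<bar>d + s\<bar> \<le> 1" "\<bar>s\<bar> \<le> L" "0 < E"
  shows "\<bar>d\<^sup>2 / (2 * E) - s\<^sup>2 / (2 * E)\<bar> \<le> (2 * L + 1) / (2 * E)"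
proof -
  have "d\<^sup>2 - s\<^sup>2 = (d + s) * (d - s)" by (simp add: power2_eq_square algebra_simps)
  also have "\<bar>\<dots>\<bar> \<le> 1 * (2 * L + 1)"
    unfolding abs_mult using assms by (intro mult_mono) auto
  finally have "\<bar>d\<^sup>2 - s\<^sup>2\<bar> / (2 * E) \<le> (2 * L + 1) / (2 * E)" using assms by (intro divide_right_mono) auto
  then show ?thesis using assms(3) by (simp add: diff_divide_distrib[symmetric])
qed

private lemma abs_diff_chain: "\<bar>a - b\<bar> \<le> d \<Longrightarrow> \<bar>b - c\<bar> \<le> e \<Longrightarrow> \<bar>a - c\<bar> \<le> d + e" for a b c d e :: real
  by linarith

private definition eN :: "real \<Rightarrow> real" where "eN d = \<rho> N * r + (\<rho> N + 2)\<^sup>2 / (2 * (real N * d)) + (2 * (l * sqrt N) + 1) / (2 * (real N * d))"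

text \<open>The trimmed sum is the difference of the sums of the \<open>mb N\<close> and the
  \<open>ka N\<close> smallest values. Each is expanded by \<open>hinge_sum_expansion\<close>; the
  hinge sums at the true quantiles combine into a sum of clamped observations, and
  \<open>mu_ab_eq\<close> turns the constants into \<open>bN N\<close>.\<close>

lemma numerator_expansion:
  "\<bar>((\<Sum>i=ka N + 1..mb N. order_stat X N i w) - (real (mb N) - real (ka N)) * mu_ab F \<alpha> \<beta>)
     - \<sigma> * (S z N w + qA * ((S A N w)\<^sup>2 / real N) + qB * ((S B N w)\<^sup>2 / real N)) - bN N\<bar>
   \<le> (\<rho> N * rad N + (\<rho> N + 2)\<^sup>2 / (2 * (real N * f \<xi>)) + (2 * (ln (real N) * sqrt (real N)) + 1) / (2 * (real N * f \<xi>)))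
     + (\<rho> N * rad N + (\<rho> N + 2)\<^sup>2 / (2 * (real N * f \<eta>)) + (2 * (ln (real N) * sqrt (real N)) + 1) / (2 * (real N * f \<eta>)))"
proof -
  define H where "H y = (\<Sum>j<N. max 0 (y - X j w))" for y
  have sumb: "(\<Sum>i=1..mb N. order_stat X N i w) = real (mb N) * Xb N w - H (Xb N w)"
    unfolding H_def Xb_def using km by (intro partial_sum_order_stat[symmetric]) auto
  have suma: "(\<Sum>i=1..ka N. order_stat X N i w) = real (ka N) * Xa N w - H (Xa N w)"
    unfolding H_def Xa_def using km by (intro partial_sum_order_stat[symmetric]) auto
  have split: "(\<Sum>i=1..mb N. order_stat X N i w) = (\<Sum>i=1..ka N. order_stat X N i w) + (\<Sum>i=ka N + 1..mb N. order_stat X N i w)"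
  proof -
    have "{1..mb N} = {1..ka N} \<union> {ka N + 1..mb N}" using km by auto
    then show ?thesis by (simp only:) (rule sum.union_disjoint, auto)
  qed
  have ea: "\<bar>(real (ka N) * Xa N w - H (Xa N w)) - (real (ka N) * \<xi> - H \<xi>) - (S A N w)\<^sup>2 / (2 * (real N * f \<xi>))\<bar> \<le> eN (f \<xi>)"
  proof -
    have "\<bar>(real (ka N) * (\<xi> + ua) - H (\<xi> + ua)) - (real (ka N) * \<xi> - H \<xi>) - (real (ka N) - cnt N w \<xi>)\<^sup>2 / (2 * (real N * f \<xi>))\<bar>
        \<le> \<rho> N * r + (\<rho> N + 2)\<^sup>2 / (2 * (real N * f \<xi>))"
      unfolding H_def cnt_def
    proof (rule hinge_sum_expansion)
      show "\<bar>N * f \<xi> * ua - (real (ka N) - (\<Sum>j<N. indicator {..\<xi>} (X j w)))\<bar> \<le> \<rho> N + 2"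
        using loc_a(2) unfolding cnt_def by (simp add: abs_le_iff)
    qed (use osc(1) Ef \<rho>0 loc_a in \<open>auto simp: cnt_def\<close>)
    moreover have "\<bar>(real (ka N) - cnt N w \<xi>)\<^sup>2 / (2 * (real N * f \<xi>)) - (S A N w)\<^sup>2 / (2 * (real N * f \<xi>))\<bar> \<le> (2 * (l * sqrt N) + 1) / (2 * (real N * f \<xi>))"
    proof (rule square_shift)
      show "\<bar>real (ka N) - cnt N w \<xi> + S A N w\<bar> \<le> 1"
        using ka_bounds[of N] unfolding cnt_\<xi> by argo
    qed (use Sb Ef in auto)
    ultimately have "\<bar>(real (ka N) * (\<xi> + ua) - H (\<xi> + ua)) - (real (ka N) * \<xi> - H \<xi>) - (S A N w)\<^sup>2 / (2 * (real N * f \<xi>))\<bar> \<le> eN (f \<xi>)"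
      unfolding eN_def by (rule abs_diff_chain)
    then show ?thesis by (simp add: ua_def)
  qed
  have eb: "\<bar>(real (mb N) * Xb N w - H (Xb N w)) - (real (mb N) * \<eta> - H \<eta>) - (S B N w)\<^sup>2 / (2 * (real N * f \<eta>))\<bar> \<le> eN (f \<eta>)"
  proof -
    have "\<bar>(real (mb N) * (\<eta> + ub) - H (\<eta> + ub)) - (real (mb N) * \<eta> - H \<eta>) - (real (mb N) - cnt N w \<eta>)\<^sup>2 / (2 * (real N * f \<eta>))\<bar>
        \<le> \<rho> N * r + (\<rho> N + 2)\<^sup>2 / (2 * (real N * f \<eta>))"
      unfolding H_def cnt_def
    proof (rule hinge_sum_expansion)
      show "\<bar>N * f \<eta> * ub - (real (mb N) - (\<Sum>j<N. indicator {..\<eta>} (X j w)))\<bar> \<le> \<rho> N + 2"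
        using loc_b(2) unfolding cnt_def by (simp add: abs_le_iff)
    qed (use osc(2) Ef \<rho>0 loc_b in \<open>auto simp: cnt_def\<close>)
    moreover have "\<bar>(real (mb N) - cnt N w \<eta>)\<^sup>2 / (2 * (real N * f \<eta>)) - (S B N w)\<^sup>2 / (2 * (real N * f \<eta>))\<bar> \<le> (2 * (l * sqrt N) + 1) / (2 * (real N * f \<eta>))"
    proof (rule square_shift)
      show "\<bar>real (mb N) - cnt N w \<eta> + S B N w\<bar> \<le> 1"
        using mb_bounds[of N] unfolding cnt_\<eta> by argo
    qed (use Sb Ef in auto)
    ultimately have "\<bar>(real (mb N) * (\<eta> + ub) - H (\<eta> + ub)) - (real (mb N) * \<eta> - H \<eta>) - (S B N w)\<^sup>2 / (2 * (real N * f \<eta>))\<bar> \<le> eN (f \<eta>)"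
      unfolding eN_def by (rule abs_diff_chain)
    then show ?thesis by (simp add: ub_def)
  qed
  \<comment> \<open>The difference of the two hinges at \<open>x\<close> is
    \<open>W x - \<eta>\<close>.\<close>
  have HW: "H \<xi> - H \<eta> = \<sigma> * S z N w + N * \<mu> - N * \<eta>"
  proof -
    have "max 0 (\<xi> - x) - max 0 (\<eta> - x) = \<sigma> * z x + \<mu> - \<eta>" for x
      using \<sigma>_pos \<xi>_less_\<eta> by (auto simp: z_def W_def max_def min_def)
    then have "H \<xi> - H \<eta> = (\<Sum>j<N. \<sigma> * z (X j w) + \<mu> - \<eta>)"
      unfolding H_def sum_subtractf[symmetric] by simp
    then show ?thesis unfolding S_def by (simp add: sum.distrib sum_subtractf sum_distrib_left)
  qed
  have q: "\<sigma> * (qA * ((S A N w)\<^sup>2 / real N)) = - ((S A N w)\<^sup>2 / (2 * (real N * f \<xi>)))"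
       "\<sigma> * (qB * ((S B N w)\<^sup>2 / real N)) = (S B N w)\<^sup>2 / (2 * (real N * f \<eta>))"
    using \<sigma>_pos by (simp_all add: qA_def qB_def)
  have b: "bN N = N * \<mu> - N * \<eta> + real (mb N) * \<eta> - real (ka N) * \<xi> - (real (mb N) - real (ka N)) * mu_ab F \<alpha> \<beta>"
    unfolding bN_def mu_ab_eq by (simp add: algebra_simps)
  have alg: "s - c = t" if "s = x - y" "x = d1 + e1" "y = d2 + e2" "t = d1 - d2 - c + e1 - e2" for s x y d1 d2 e1 e2 c t :: real
    using that by simp
  have "((\<Sum>i=ka N + 1..mb N. order_stat X N i w) - (real (mb N) - real (ka N)) * mu_ab F \<alpha> \<beta>)
     - \<sigma> * (S z N w + qA * ((S A N w)\<^sup>2 / real N) + qB * ((S B N w)\<^sup>2 / real N)) - bN N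
    = ((real (mb N) * Xb N w - H (Xb N w)) - (real (mb N) * \<eta> - H \<eta>) - (S B N w)\<^sup>2 / (2 * (real N * f \<eta>)))
      - ((real (ka N) * Xa N w - H (Xa N w)) - (real (ka N) * \<xi> - H \<xi>) - (S A N w)\<^sup>2 / (2 * (real N * f \<xi>)))"
    using sumb suma split HW q unfolding b distrib_left by linarith
  moreover have "\<bar>y - x\<bar> \<le> a + b" if "\<bar>x\<bar> \<le> a" "\<bar>y\<bar> \<le> b" for x y a b :: real
    using that by linarith
  note this[OF ea eb]
  ultimately show ?thesis unfolding eN_def l_def r_def by simp
qed

private definition "Wh x = max (Xa N w) (min (Xb N w) x)"
private definition "band p x = (indicator {..p + r} x - indicator {..p - r} x :: real)"

private lemma Wh_diff: "\<bar>Wh x - W x\<bar> \<le> r"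
  using loc_a(1) loc_b(1) unfolding Wh_def W_def ua_def ub_def by (auto simp: max_def min_def abs_le_iff)

text \<open>Outside the two bands the position of \<open>x\<close> relative to every cut, true or
  empirical, is known and the linearization is exact. In a band at most two terms remain, each at
  most \<open>r * RW\<close>.\<close>

private lemma Wh_linear:
  "\<bar>(Wh x - W x) * (W x - \<mu>) - ua * (\<xi> - \<mu>) * indicator {..\<xi>} x - ub * (\<eta> - \<mu>) * (1 - indicator {..\<eta>} x)\<bar>
    \<le> 2 * r * RW * (band \<xi> x + band \<eta> x)"
proof -
  have sep: "\<xi> + r < \<eta> - r" using large by (simp add: large_def r_def)
  have a: "\<xi> - r \<le> Xa N w" "Xa N w \<le> \<xi> + r" using loc_a(1) by (auto simp: ua_def abs_le_iff)
  have b: "\<eta> - r \<le> Xb N w" "Xb N w \<le> \<eta> + r" using loc_b(1) by (auto simp: ub_def abs_le_iff)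
  have t0: "\<bar>(Wh x - W x) * (W x - \<mu>)\<bar> \<le> r * RW"
    unfolding abs_mult using Wh_diff RW r by (intro mult_mono) auto
  have t1: "\<bar>ua * (\<xi> - \<mu>)\<bar> \<le> r * RW" "\<bar>ub * (\<eta> - \<mu>)\<bar> \<le> r * RW"
    unfolding abs_mult using loc_a(1) loc_b(1) RW r by (intro mult_mono; auto)+
  have rR: "0 \<le> r * RW" using r RW(1) by simp
  consider "x \<le> \<xi> - r" | "\<xi> - r < x" "x \<le> \<xi> + r" | "\<xi> + r < x" "x \<le> \<eta> - r" | "\<eta> - r < x" "x \<le> \<eta> + r" | "\<eta> + r < x"
    by linarith
  then show ?thesis
  proof cases
    case 1
    then have "Wh x = Xa N w" "W x = \<xi>" "x \<le> \<xi>" "x \<le> \<eta>" using a b sep r by (auto simp: Wh_def W_def)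
    then show ?thesis using 1 sep r by (simp add: ua_def band_def)
  next
    case 2
    then have "band \<xi> x = 1" "band \<eta> x = 0" "x \<le> \<eta>" using sep r by (auto simp: band_def)
    then show ?thesis using t0 t1 rR by (cases "x \<le> \<xi>") (auto simp: algebra_simps abs_le_iff)
  next
    case 3
    then have "Wh x = x" "W x = x" "\<not> x \<le> \<xi>" "x \<le> \<eta>" using a b sep r by (auto simp: Wh_def W_def)
    then show ?thesis using 3 sep r by (simp add: band_def)
  next
    case 4
    then have "band \<xi> x = 0" "band \<eta> x = 1" "\<not> x \<le> \<xi>" using sep r by (auto simp: band_def)
    then show ?thesis using t0 t1 rR by (cases "x \<le> \<eta>") (auto simp: algebra_simps abs_le_iff)
  next
    case 5
    then have "Wh x = Xb N w" "W x = \<eta>" "\<not> x \<le> \<xi>" "\<not> x \<le> \<eta>" using a b sep r by (auto simp: Wh_def W_def)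
    then show ?thesis using 5 sep r by (simp add: ub_def band_def)
  qed
qed

private lemma band_sum: "(\<Sum>j<N. band \<xi> (X j w)) \<le> 2 * (N * f \<xi> * r) + 2 * \<rho> N" "(\<Sum>j<N. band \<eta> (X j w)) \<le> 2 * (N * f \<eta> * r) + 2 * \<rho> N"
proof -
  have e: "(\<Sum>j<N. band p (X j w)) = cnt N w (p + r) - cnt N w (p + (- r))" for p
    unfolding band_def cnt_def by (simp add: sum_subtractf)
  show "(\<Sum>j<N. band \<xi> (X j w)) \<le> 2 * (N * f \<xi> * r) + 2 * \<rho> N"
    unfolding e using osc(1)[of r] osc(1)[of "- r"] r by (simp add: abs_le_iff)
  show "(\<Sum>j<N. band \<eta> (X j w)) \<le> 2 * (N * f \<eta> * r) + 2 * \<rho> N"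
    unfolding e using osc(2)[of r] osc(2)[of "- r"] r by (simp add: abs_le_iff)
qed

text \<open>The product of shift and count is split at the expected count \<open>N * g\<close>:
  there \<open>u\<close> is replaced by \<open>- s / (N * d)\<close>, while the cross term of the
  two fluctuations is at most a constant times \<open>r * l * sqrt N = l ^ 3\<close>.\<close>

private lemma count_term:
  fixes s u g p d \<kappa> :: real
  assumes p: "\<bar>p\<bar> \<le> \<kappa>" and g: "0 \<le> g" "g \<le> 1" and f: "0 < d" "1 / d \<le> \<kappa>" and u: "\<bar>u\<bar> \<le> r" and s: "\<bar>s\<bar> \<le> l * sqrt N"
    and loc: "\<bar>N * d * u + s\<bar> \<le> \<rho> N + 2"
  shows "\<bar>u * p * (N * g) + g * p / d * s\<bar> \<le> \<kappa>\<^sup>2 * (\<rho> N + 2)" "\<bar>u * p * s\<bar> \<le> \<kappa> * l ^ 3"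
proof -
  have k: "0 \<le> \<kappa>" using p by linarith
  have "u * p * (N * g) + g * p / d * s = (g * p) * (1 / d) * (N * d * u + s)"
    using f by (simp add: field_simps)
  also have "\<bar>\<dots>\<bar> \<le> (1 * \<kappa>) * \<kappa> * (\<rho> N + 2)"
    unfolding abs_mult using p g f loc k \<rho>0 by (intro mult_mono) auto
  finally show "\<bar>u * p * (N * g) + g * p / d * s\<bar> \<le> \<kappa>\<^sup>2 * (\<rho> N + 2)" by (simp add: power2_eq_square)
  have "\<bar>u * p * s\<bar> \<le> r * \<kappa> * (l * sqrt N)"
    unfolding abs_mult using u p s k r by (intro mult_mono) auto
  also have "\<dots> = \<kappa> * l * (sqrt N * r)" by simp
  also have "\<dots> = \<kappa> * l ^ 3" unfolding r(2) by (simp add: power2_eq_square power3_eq_cube)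
  finally show "\<bar>u * p * s\<bar> \<le> \<kappa> * l ^ 3" .
qed

private definition "Sh = (\<Sum>j<N. (Wh (X j w) - \<mu>)\<^sup>2)"
private definition "Th = (\<Sum>j<N. Wh (X j w) - \<mu>)"

text \<open>A variance is invariant under translation; after subtracting \<open>\<mu>\<close> the
  sum \<open>Th\<close> is of order \<open>sqrt N\<close> up to logarithms, so that
  \<open>Th^2 / N\<close> is negligible.\<close>

private lemma SN_eq: "SN X \<alpha> \<beta> N w = sqrt ((Sh - Th\<^sup>2 / N) / N)"
proof -
  have c: "(\<Sum>j<N. g (Wh (X j w))) = real (ka N + 1) * g (Xa N w) + (\<Sum>i=ka N + 1 + 1..mb N - 1. g (order_stat X N i w)) + (real N - real (mb N) + 1) * g (Xb N w)" for g :: "real \<Rightarrow> real"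
    unfolding Wh_def Xa_def Xb_def using km by (intro sum_clamp_order_stat) auto
  have d: "(a * b + s + c * d) / N = a / N * b + 1 / N * s + c / N * d" for a b s c d :: real
    by (simp add: add_divide_distrib)
  have mu: "muW_hat X \<alpha> \<beta> N w = (\<Sum>j<N. Wh (X j w)) / N"
    unfolding muW_hat_def Let_def c[of "\<lambda>x. x"] d Xa_def Xb_def by simp
  have "SN X \<alpha> \<beta> N w = sqrt ((\<Sum>j<N. (Wh (X j w))\<^sup>2) / N - ((\<Sum>j<N. Wh (X j w)) / N)\<^sup>2)"
    unfolding SN_def Let_def mu c[of "\<lambda>x. x\<^sup>2"] d Xa_def Xb_def by simp
  also have "(\<Sum>j<N. (Wh (X j w))\<^sup>2) / N - ((\<Sum>j<N. Wh (X j w)) / N)\<^sup>2 = (Sh - Th\<^sup>2 / N) / N"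
  proof -
    define P where "P = (\<Sum>j<N. (Wh (X j w))\<^sup>2)"
    define Q where "Q = (\<Sum>j<N. Wh (X j w))"
    have "Sh = P - 2 * \<mu> * Q + N * \<mu>\<^sup>2"
      unfolding Sh_def P_def Q_def by (simp add: power2_diff sum.distrib sum_subtractf sum_distrib_left mult_ac)
    moreover have "Th = Q - N * \<mu>" unfolding Th_def Q_def by (simp add: sum_subtractf)
    moreover have "P / n - (Q / n)\<^sup>2 = (P - 2 * m * Q + n * m\<^sup>2 - (Q - n * m)\<^sup>2 / n) / n" if "0 < n" for n m :: real
      using that by (simp add: field_simps power2_eq_square)
    ultimately show ?thesis
      unfolding P_def[symmetric] Q_def[symmetric] using large by (simp add: large_def)
  qed
  finally show ?thesis .
qed

private definition "sq = (Sh - Th\<^sup>2 / N) / N"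

text \<open>Passing from \<open>W\<close> to \<open>Wh\<close> changes a centred square by
  \<open>2 * \<Delta> * (W - \<mu>) + \<Delta>^2\<close>. The squares sum to at most
  \<open>N * r^2 = l ^ 4\<close>; the linear part comes essentially from the clamped observations
  and yields the terms with \<open>A\<close> and \<open>B\<close> in \<open>v\<close>. The total
  error is small against \<open>sqrt N\<close>.\<close>

lemma studentizer_expansion:
  assumes \<kappa>: "RW \<le> \<kappa>" "\<sigma> \<le> \<kappa>" "1 / f \<xi> \<le> \<kappa>" "1 / f \<eta> \<le> \<kappa>" "f \<xi> \<le> \<kappa>" "f \<eta> \<le> \<kappa>"
  obtains s where "SN X \<alpha> \<beta> N w = sqrt s"
    "\<bar>real N * s - real N * \<sigma>\<^sup>2 - 2 * \<sigma>\<^sup>2 * S v N w\<bar>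
     \<le> (ln N) ^ 4 + 16 * \<kappa>\<^sup>2 * (ln N) ^ 4 + 16 * \<kappa> * (rad N * \<rho> N) + 4 * \<kappa> * (ln N) ^ 3 + 4 * \<kappa>\<^sup>2 * (\<rho> N + 2) + (\<kappa> * ln N + (ln N)\<^sup>2)\<^sup>2"
proof -
  have \<kappa>1: "1 \<le> \<kappa>" using \<kappa>(1) RW(1) by linarith
  define \<Delta> where "\<Delta> j = Wh (X j w) - W (X j w)" for j
  define R1 where "R1 = (\<Sum>j<N. (\<Delta> j)\<^sup>2)"
  define R2 where "R2 = (\<Sum>j<N. \<Delta> j * (W (X j w) - \<mu>))"
  \<comment> \<open>\<open>lin\<close> still contains the random shifts and the actual counts;
    \<open>lin'\<close> below replaces them by centred sums.\<close>
  define lin where "lin = ua * (\<xi> - \<mu>) * cnt N w \<xi> + ub * (\<eta> - \<mu>) * (N - cnt N w \<eta>)"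
  have \<Delta>: "\<bar>\<Delta> j\<bar> \<le> r" for j unfolding \<Delta>_def by (rule Wh_diff)
  have R1: "0 \<le> R1" "R1 \<le> l ^ 4"
  proof -
    show "0 \<le> R1" unfolding R1_def by (intro sum_nonneg) auto
    have "R1 \<le> (\<Sum>j<N. r\<^sup>2)" unfolding R1_def by (intro sum_mono abs_power2_le \<Delta>)
    then show "R1 \<le> l ^ 4" using r(4) by simp
  qed
  have kN: "real N * f \<xi> * r \<le> real N * \<kappa> * r" "real N * f \<eta> * r \<le> real N * \<kappa> * r"
    using \<kappa> r N by (auto intro!: mult_right_mono mult_left_mono)
  have R2: "\<bar>R2 - lin\<bar> \<le> 8 * \<kappa>\<^sup>2 * l ^ 4 + 8 * \<kappa> * (r * \<rho> N)"
  proof -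
    have "lin = (\<Sum>j<N. ua * (\<xi> - \<mu>) * indicator {..\<xi>} (X j w) + ub * (\<eta> - \<mu>) * (1 - indicator {..\<eta>} (X j w)))"
      unfolding lin_def cnt_def by (simp add: sum.distrib sum_subtractf sum_distrib_left[symmetric])
    then have eq: "R2 - lin = (\<Sum>j<N. \<Delta> j * (W (X j w) - \<mu>) - ua * (\<xi> - \<mu>) * indicator {..\<xi>} (X j w) - ub * (\<eta> - \<mu>) * (1 - indicator {..\<eta>} (X j w)))"
      by (simp only: R2_def sum_subtractf sum.distrib diff_diff_eq)
    have "\<bar>R2 - lin\<bar> \<le> (\<Sum>j<N. 2 * r * RW * (band \<xi> (X j w) + band \<eta> (X j w)))"
      unfolding eq \<Delta>_def by (rule order_trans[OF sum_abs], rule sum_mono, rule Wh_linear)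
    also have "\<dots> = 2 * r * RW * ((\<Sum>j<N. band \<xi> (X j w)) + (\<Sum>j<N. band \<eta> (X j w)))"
      unfolding sum_distrib_left[symmetric] sum.distrib ..
    also have "\<dots> \<le> 2 * r * \<kappa> * ((2 * (N * \<kappa> * r) + 2 * \<rho> N) + (2 * (N * \<kappa> * r) + 2 * \<rho> N))"
    proof (rule mult_mono, goal_cases)
      case 1
      show ?case using r \<kappa>(1) by simp
    next
      case 2
      show ?case using band_sum kN by linarith
    next
      case 3
      show ?case using r \<kappa>1 by simp
    next
      case 4
      have "0 \<le> band p x" for p x using r by (auto simp: band_def indicator_def)
      then show ?case by (intro add_nonneg_nonneg sum_nonneg) auto
    qed
    also have "\<dots> = 8 * \<kappa>\<^sup>2 * (N * r\<^sup>2) + 8 * \<kappa> * (r * \<rho> N)"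
      by (simp add: power2_eq_square algebra_simps)
    finally show ?thesis unfolding r(4) .
  qed
  define lin' where "lin' = - (\<alpha> * (\<xi> - \<mu>) / f \<xi> * S A N w) - (1 - \<beta>) * (\<eta> - \<mu>) / f \<eta> * S B N w"
  have L: "\<bar>lin - lin'\<bar> \<le> 2 * (\<kappa>\<^sup>2 * (\<rho> N + 2)) + 2 * (\<kappa> * l ^ 3)"
  proof -
    have la: "\<bar>N * f \<xi> * ua + S A N w\<bar> \<le> \<rho> N + 2"
      using loc_a(2) ka_bounds[of N] unfolding cnt_\<xi> of_nat_add of_nat_1 by argo
    have lb: "\<bar>N * f \<eta> * ub + S B N w\<bar> \<le> \<rho> N + 2"
      using loc_b(2) mb_bounds[of N] unfolding cnt_\<eta> by argo
    have pa: "\<bar>\<xi> - \<mu>\<bar> \<le> \<kappa>" "\<bar>\<eta> - \<mu>\<bar> \<le> \<kappa>" using RW \<kappa> by (auto intro: order_trans)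
    have 1: "\<bar>ua * (\<xi> - \<mu>) * (N * \<alpha>) + \<alpha> * (\<xi> - \<mu>) / f \<xi> * S A N w\<bar> \<le> \<kappa>\<^sup>2 * (\<rho> N + 2)" "\<bar>ua * (\<xi> - \<mu>) * S A N w\<bar> \<le> \<kappa> * l ^ 3"
      by (rule count_term[where g=\<alpha>, OF pa(1) _ _ f_pos'(1) \<kappa>(3) loc_a(1) Sb(3) la]; use ab in simp)+
    have 2: "\<bar>ub * (\<eta> - \<mu>) * (N * (1 - \<beta>)) + (1 - \<beta>) * (\<eta> - \<mu>) / f \<eta> * S B N w\<bar> \<le> \<kappa>\<^sup>2 * (\<rho> N + 2)" "\<bar>ub * (\<eta> - \<mu>) * S B N w\<bar> \<le> \<kappa> * l ^ 3"
      by (rule count_term[where g="1 - \<beta>", OF pa(2) _ _ f_pos'(2) \<kappa>(4) loc_b(1) Sb(4) lb]; use ab in simp)+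
    have "lin - lin' = (ua * (\<xi> - \<mu>) * (N * \<alpha>) + \<alpha> * (\<xi> - \<mu>) / f \<xi> * S A N w) + ua * (\<xi> - \<mu>) * S A N w
        + (ub * (\<eta> - \<mu>) * (N * (1 - \<beta>)) + (1 - \<beta>) * (\<eta> - \<mu>) / f \<eta> * S B N w) - ub * (\<eta> - \<mu>) * S B N w"
      unfolding lin_def lin'_def cnt_\<xi> cnt_\<eta> by (simp add: algebra_simps)
    then show ?thesis using 1 2 by linarith
  qed
  have Sh: "Sh = (\<Sum>j<N. (W (X j w) - \<mu>)\<^sup>2) + 2 * R2 + R1"
  proof -
    have "(Wh (X j w) - \<mu>)\<^sup>2 = (W (X j w) - \<mu>)\<^sup>2 + 2 * (\<Delta> j * (W (X j w) - \<mu>)) + (\<Delta> j)\<^sup>2" for j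
      by (simp add: \<Delta>_def power2_eq_square algebra_simps)
    then show ?thesis unfolding Sh_def R1_def R2_def by (simp add: sum.distrib sum_distrib_left)
  qed
  have Sv: "2 * \<sigma>\<^sup>2 * S v N w = (\<Sum>j<N. (W (X j w) - \<mu>)\<^sup>2) - N * \<sigma>\<^sup>2 + 2 * lin'"
  proof -
    have "2 * \<sigma>\<^sup>2 * v x = (W x - \<mu>)\<^sup>2 - \<sigma>\<^sup>2 - 2 * \<alpha> * (\<xi> - \<mu>) / f \<xi> * A x - 2 * (1 - \<beta>) * (\<eta> - \<mu>) / f \<eta> * B x" for x
      unfolding v_def using \<sigma>_pos by simp
    then have "2 * \<sigma>\<^sup>2 * S v N w = (\<Sum>j<N. (W (X j w) - \<mu>)\<^sup>2 - \<sigma>\<^sup>2 - 2 * \<alpha> * (\<xi> - \<mu>) / f \<xi> * A (X j w) - 2 * (1 - \<beta>) * (\<eta> - \<mu>) / f \<eta> * B (X j w))"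
      unfolding S_def sum_distrib_left by simp
    also have "\<dots> = (\<Sum>j<N. (W (X j w) - \<mu>)\<^sup>2) - N * \<sigma>\<^sup>2 - 2 * \<alpha> * (\<xi> - \<mu>) / f \<xi> * S A N w - 2 * (1 - \<beta>) * (\<eta> - \<mu>) / f \<eta> * S B N w"
      unfolding S_def sum_subtractf sum_distrib_left[symmetric] by simp
    finally show ?thesis unfolding lin'_def by (simp add: algebra_simps diff_divide_distrib add_divide_distrib)
  qed
  have Th: "Th\<^sup>2 / N \<le> (\<kappa> * l + l\<^sup>2)\<^sup>2"
  proof -
    have "Th = \<sigma> * S z N w + (\<Sum>j<N. \<Delta> j)"
      unfolding Th_def S_def \<Delta>_def z_def sum_distrib_left sum.distrib[symmetric] using \<sigma>_pos by simp
    also have "\<bar>\<dots>\<bar> \<le> \<kappa> * (l * sqrt N) + N * r"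
    proof -
      have "\<bar>\<sigma> * S z N w\<bar> \<le> \<kappa> * (l * sqrt N)"
        unfolding abs_mult using \<kappa>(2) \<sigma>_pos Sb(1) \<kappa>1 by (intro mult_mono) auto
      moreover have "\<bar>\<Sum>j<N. \<Delta> j\<bar> \<le> (\<Sum>j<N. r)" by (rule order_trans[OF sum_abs]) (intro sum_mono \<Delta>)
      ultimately show ?thesis by simp
    qed
    also have "\<dots> = sqrt N * (\<kappa> * l + l\<^sup>2)" unfolding r(3) by (simp add: algebra_simps)
    finally have "Th\<^sup>2 \<le> (sqrt N * (\<kappa> * l + l\<^sup>2))\<^sup>2" by (rule abs_power2_le)
    also have "\<dots> = N * (\<kappa> * l + l\<^sup>2)\<^sup>2" using N by (simp add: power_mult_distrib)
    finally show ?thesis using N by (simp add: pos_divide_le_eq mult.commute)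
  qed
  have Th0: "0 \<le> Th\<^sup>2 / N" using N by simp
  have "N * sq - N * \<sigma>\<^sup>2 - 2 * \<sigma>\<^sup>2 * S v N w = 2 * (R2 - lin) + 2 * (lin - lin') + R1 - Th\<^sup>2 / N"
    unfolding sq_def Sv Sh using N by simp
  then have "\<bar>N * sq - N * \<sigma>\<^sup>2 - 2 * \<sigma>\<^sup>2 * S v N w\<bar>
     \<le> l ^ 4 + 16 * \<kappa>\<^sup>2 * l ^ 4 + 16 * \<kappa> * (r * \<rho> N) + 4 * \<kappa> * l ^ 3 + 4 * \<kappa>\<^sup>2 * (\<rho> N + 2) + (\<kappa> * l + l\<^sup>2)\<^sup>2"
    using R1 R2 L Th Th0 by argo
  then show ?thesis
    using that[of sq] SN_eq unfolding sq_def l_def r_def by blast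
qed

end

end

text \<open>The positive denominator is cleared and both sides are divided by
  \<open>\<sigma> * rn\<close>. The first-order part \<open>sv\<close> of the random scale goes to
  the left, where it becomes the term of \<open>T\<close> proportional to \<open>x\<close>; the rest
  of scale and numerator forms an error written in the shape \<open>d / sqrt N\<close>.\<close>

lemma studentized_identity:
  fixes rn \<theta> q \<sigma> S0 p b err x sv :: real
  assumes "0 < rn" "0 < \<theta>" "0 < q" "0 < \<sigma>"
  shows "(\<sigma> * (S0 + p) + b + err) / (rn * \<theta> * (\<sigma> * q)) \<le> x
    \<longleftrightarrow> S0 / rn + (p - x * (sv / rn)) / rn \<le> x - b / (\<sigma> * rn)
        + rn * (x * (\<theta> * q - 1 - sv / rn\<^sup>2) - err / (\<sigma> * rn)) / rn"
proof -
  have cancel: "0 < c \<Longrightarrow> u \<le> v \<longleftrightarrow> u / c \<le> v / c" for u v c :: real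
    by (simp add: divide_le_cancel)
  have "(\<sigma> * (S0 + p) + b + err) / (rn * \<theta> * (\<sigma> * q)) \<le> x \<longleftrightarrow> \<sigma> * (S0 + p) + b + err \<le> x * (rn * \<theta> * (\<sigma> * q))"
    using assms by (intro pos_divide_le_eq) simp
  also have "\<dots> \<longleftrightarrow> (\<sigma> * (S0 + p) + b + err) / (\<sigma> * rn) \<le> x * (rn * \<theta> * (\<sigma> * q)) / (\<sigma> * rn)"
    using mult_pos_pos[OF assms(4,1)] by (rule cancel)
  also have "(\<sigma> * (S0 + p) + b + err) / (\<sigma> * rn) = (S0 + p) / rn + b / (\<sigma> * rn) + err / (\<sigma> * rn)"
    using assms by (simp add: add_divide_distrib)
  also have "x * (rn * \<theta> * (\<sigma> * q)) / (\<sigma> * rn) = x * (\<theta> * q)"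
    using assms by simp
  also have "(S0 + p) / rn + b / (\<sigma> * rn) + err / (\<sigma> * rn) \<le> x * (\<theta> * q) \<longleftrightarrow>
      S0 / rn + (p - x * (sv / rn)) / rn \<le> x - b / (\<sigma> * rn) + rn * (x * (\<theta> * q - 1 - sv / rn\<^sup>2) - err / (\<sigma> * rn)) / rn"
  proof -
    have "S0 / rn + (p - x * (sv / rn)) / rn = (S0 + p) / rn - x * (sv / rn\<^sup>2)"
      by (simp add: add_divide_distrib diff_divide_distrib power2_eq_square)
    moreover have "rn * (x * (\<theta> * q - 1 - sv / rn\<^sup>2) - err / (\<sigma> * rn)) / rn = x * (\<theta> * q) - x - x * (sv / rn\<^sup>2) - err / (\<sigma> * rn)"
    proof -
      have "rn * u / rn = u" for u using assms by simp
      then show ?thesis by (simp only:) (simp only: right_diff_distrib mult_1_right)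
    qed
    ultimately show ?thesis by linarith
  qed
  finally show ?thesis .
qed

text \<open>\<open>\<theta>\<close> stands for the ratio of realized to nominal number of retained
  observations and \<open>sqrt (1 + y)\<close> for \<open>SN / \<sigma>\<close>. Since the latter is
  at most 2, the deviation of \<open>\<theta>\<close> counts twice.\<close>

lemma ratio_perturbation:
  fixes y e sv \<theta> \<tau> Y E :: real
  assumes y: "y = 2 * sv + e" and e: "\<bar>e\<bar> \<le> E" and Y: "\<bar>y\<bar> \<le> Y" "Y \<le> 1" and \<theta>: "\<bar>\<theta> - 1\<bar> \<le> \<tau>"
  shows "\<bar>\<theta> * sqrt (1 + y) - 1 - sv\<bar> \<le> E / 2 + Y\<^sup>2 / 2 + 2 * \<tau>"
proof -
  have "\<bar>sqrt (1 + y) - (1 + y / 2)\<bar> \<le> y\<^sup>2 / 2" using Y by (intro sqrt_one_plus_bound) auto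
  also have "\<dots> \<le> Y\<^sup>2 / 2" using abs_power2_le[OF Y(1)] by simp
  finally have 1: "\<bar>sqrt (1 + y) - (1 + y / 2)\<bar> \<le> Y\<^sup>2 / 2" .
  have "sqrt (1 + y) \<le> 2" using Y by (intro real_le_lsqrt) auto
  then have "\<bar>(\<theta> - 1) * sqrt (1 + y)\<bar> \<le> \<tau> * 2"
    unfolding abs_mult using Y \<theta> by (intro mult_mono) auto
  moreover have "\<theta> * sqrt (1 + y) - 1 - sv = (\<theta> - 1) * sqrt (1 + y) + (sqrt (1 + y) - (1 + y / 2)) + e / 2"
    unfolding y by (simp add: algebra_simps)
  ultimately show ?thesis using 1 e by linarith
qed

context trimmed_sample
begin

text \<open>Reduces events about order statistics to counts, which are sums of indicators and hence
  measurable.\<close>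

lemma order_stat_le_iff:
  assumes "1 \<le> i" "i \<le> N"
  shows "order_stat X N i w \<le> y \<longleftrightarrow> real i \<le> cnt N w y"
proof
  assume "order_stat X N i w \<le> y"
  have "real i \<le> cnt N w (order_stat X N i w)" unfolding cnt_def by (rule order_stat_count_ge[OF assms])
  also have "\<dots> \<le> cnt N w y" by (rule cnt_mono) fact
  finally show "real i \<le> cnt N w y" .
next
  assume "real i \<le> cnt N w y"
  then show "order_stat X N i w \<le> y"
    using order_stat_count_less[OF assms, where y=y and w=w and X=X] unfolding cnt_def by (cases "order_stat X N i w \<le> y") auto
qed

lemma order_stat_measurable:
  assumes "1 \<le> i" "i \<le> N"
  shows "order_stat X N i \<in> borel_measurable M"
proof (rule borel_measurableI_le)
  note [measurable] = X_meas
  show "{w \<in> space M. order_stat X N i w \<le> y} \<in> events" for y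
    unfolding order_stat_le_iff[OF assms] cnt_def by measurable
qed

definition studentized :: "nat \<Rightarrow> 'a \<Rightarrow> real" where
  "studentized N w = sqrt N * (trimmed_mean X \<alpha> \<beta> N w - mu_ab F \<alpha> \<beta>) / (inverse (\<beta> - \<alpha>) * SN X \<alpha> \<beta> N w)"

text \<open>\<open>order_stat\<close> denotes an order statistic only for indices between 1 and
  \<open>N\<close>; \<open>large N\<close> guarantees this range for all indices that occur.\<close>

lemma studentized_measurable:
  assumes "large N"
  shows "studentized N \<in> borel_measurable M"
proof -
  have km: "ka N + 1 < mb N" "mb N \<le> N"
  proof -
    have "2 < (\<beta> - \<alpha>) * N" using assms by (simp add: large_def)
    then have "real (ka N) + 1 < real (mb N)"
      using ka_bounds[of N] mb_bounds[of N] unfolding left_diff_distrib by argo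
    then have "real (ka N + 1) < real (mb N)" by (simp only: of_nat_add of_nat_1)
    then show "ka N + 1 < mb N" by (simp only: of_nat_less_iff)
    have "\<beta> * real N \<le> 1 * real N" using ab by (intro mult_right_mono) auto
    then have "real (mb N) \<le> real N" using mb_bounds[of N] by argo
    then show "mb N \<le> N" by (simp only: of_nat_le_iff)
  qed
  have m: "(\<lambda>w. \<Sum>i\<in>I. g (order_stat X N i w)) \<in> borel_measurable M" if "I \<subseteq> {1..N}" "g \<in> borel_measurable borel" for I and g :: "real \<Rightarrow> real"
  proof (rule borel_measurable_sum)
    fix i assume "i \<in> I"
    then have "1 \<le> i" "i \<le> N" using that(1) by auto
    from measurable_compose[OF order_stat_measurable[OF this] that(2)]
    show "(\<lambda>w. g (order_stat X N i w)) \<in> borel_measurable M" .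
  qed
  have i: "{ka N + 1..mb N} \<subseteq> {1..N}" "{ka N + 1 + 1..mb N - 1} \<subseteq> {1..N}" using km by auto
  have [measurable]: "order_stat X N (ka N + 1) \<in> borel_measurable M" "order_stat X N (mb N) \<in> borel_measurable M"
    using km by (auto intro!: order_stat_measurable)
  have [measurable]: "(\<lambda>w. \<Sum>i=ka N + 1..mb N. order_stat X N i w) \<in> borel_measurable M"
    "(\<lambda>w. \<Sum>i=ka N + 1 + 1..mb N - 1. order_stat X N i w) \<in> borel_measurable M"
    by (rule m[OF i(1), of "\<lambda>x. x"] m[OF i(2), of "\<lambda>x. x"]; simp)+
  have [measurable]: "(\<lambda>w. \<Sum>i=ka N + 1 + 1..mb N - 1. (order_stat X N i w)\<^sup>2) \<in> borel_measurable M"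
    by (rule m[OF i(2)]) measurable
  have [measurable]: "muW_hat X \<alpha> \<beta> N \<in> borel_measurable M"
    unfolding muW_hat_def[abs_def] Let_def by measurable
  have [measurable]: "SN X \<alpha> \<beta> N \<in> borel_measurable M"
    unfolding SN_def[abs_def] Let_def by measurable
  have [measurable]: "trimmed_mean X \<alpha> \<beta> N \<in> borel_measurable M"
    unfolding trimmed_mean_def[abs_def] by measurable
  show ?thesis unfolding studentized_def[abs_def] by measurable
qed

end

lemma sum_le_double:
  fixes a b c b' b'' c' c'' :: real
  assumes "b' \<le> b" "b'' \<le> b" "c' \<le> c" "c'' \<le> c"
  shows "(a + b' + c') + (a + b'' + c'') \<le> 2 * (a + b + c)"
  using add_mono[OF add_mono[OF assms(1,2)] add_mono[OF assms(3,4)]] by (simp add: algebra_simps)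

lemma abs_diff_le_add:
  fixes a b c d :: real
  shows "\<bar>a\<bar> \<le> c \<Longrightarrow> \<bar>b\<bar> \<le> d \<Longrightarrow> \<bar>a - b\<bar> \<le> c + d"
  by linarith

context trimmed_sample
begin

text \<open>Constants defined in a context with hypotheses unfold only under them; these are
  discharged once for the functions at hand.\<close>

lemma
  shows T_eq: "T z v A B qA qB N x w = S z N w / sqrt N + (qA * ((S A N w)\<^sup>2 / N) + qB * ((S B N w)\<^sup>2 / N) - x * (S v N w / sqrt N)) / sqrt N"
    and T_borel: "T z v A B qA qB N x \<in> borel_measurable M"
    and c0_eq: "c0 A B qA qB = qA * (\<integral>y. (A y)\<^sup>2 \<partial>D) + qB * (\<integral>y. (B y)\<^sup>2 \<partial>D)"
    and c1_eq: "c1 z v = (\<integral>y. z y * v y \<partial>D)"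
    and c2_eq: "c2 z A B qA qB = (\<integral>y. (z y) ^ 3 \<partial>D) / 6 + qA * (\<integral>y. z y * A y \<partial>D)\<^sup>2 + qB * (\<integral>y. z y * B y \<partial>D)\<^sup>2"
proof -
  obtain C where C: "1 \<le> C" "\<And>x. \<bar>z x\<bar> \<le> C" "\<And>x. \<bar>v x\<bar> \<le> C" "\<And>x. \<bar>A x\<bar> \<le> C" "\<And>x. \<bar>B x\<bar> \<le> C" using bound_exists by blast
  note ctx = zvAB_measurable(1) C(2) zvAB_measurable(4) C(3) zvAB_measurable(2) C(4) zvAB_measurable(3) C(5) C(1) means z_var
  show "T z v A B qA qB N x w = S z N w / sqrt N + (qA * ((S A N w)\<^sup>2 / N) + qB * ((S B N w)\<^sup>2 / N) - x * (S v N w / sqrt N)) / sqrt N"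
    unfolding T_def[OF ctx] pert_def[OF ctx] ..
  show "T z v A B qA qB N x \<in> borel_measurable M" by (rule T_measurable[OF ctx])
  show "c0 A B qA qB = qA * (\<integral>y. (A y)\<^sup>2 \<partial>D) + qB * (\<integral>y. (B y)\<^sup>2 \<partial>D)" by (rule c0_def[OF ctx])
  show "c1 z v = (\<integral>y. z y * v y \<partial>D)" by (rule c1_def[OF ctx])
  show "c2 z A B qA qB = (\<integral>y. (z y) ^ 3 \<partial>D) / 6 + qA * (\<integral>y. z y * A y \<partial>D)\<^sup>2 + qB * (\<integral>y. z y * B y \<partial>D)\<^sup>2" by (rule c2_def[OF ctx])
qed

definition "k0 = (\<beta> * (1 - \<beta>) / f \<eta> - \<alpha> * (1 - \<alpha>) / f \<xi>) / (2 * \<sigma>)"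
definition "k1 = (lambda1 F \<alpha> \<beta> + 2 * lambda2 F f \<alpha> \<beta>) / 2"
definition "k2 = lambda1 F \<alpha> \<beta> / 6 + lambda2 F f \<alpha> \<beta> / 2"

lemma c012: "c0 A B qA qB = k0" "c1 z v = k1" "c2 z A B qA qB = k2"
proof -
  show "c0 A B qA qB = k0"
    unfolding c0_eq A_square B_square unfolding k0_def qA_def qB_def using \<sigma>_pos f_pos' by (simp add: field_simps)
  show "c1 z v = k1" unfolding c1_eq z_v k1_def ..
  have "delta2W F f \<alpha> \<beta> = - (\<alpha>\<^sup>2 * (\<xi> - \<mu>)\<^sup>2 / f \<xi>) + (1 - \<beta>)\<^sup>2 * (\<eta> - \<mu>)\<^sup>2 / f \<eta>"
    unfolding delta2W_def \<xi>_def[symmetric] \<eta>_def[symmetric] \<mu>_def[symmetric] by (simp add: power2_commute)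
  then have l2: "lambda2 F f \<alpha> \<beta> = - (\<alpha>\<^sup>2 * (\<xi> - \<mu>)\<^sup>2 / f \<xi> / \<sigma> ^ 3) + (1 - \<beta>)\<^sup>2 * (\<eta> - \<mu>)\<^sup>2 / f \<eta> / \<sigma> ^ 3"
    unfolding lambda2_def \<sigma>_def by (simp add: diff_divide_distrib)
  have q: "r / (2 * s * g) * (a * p / s)\<^sup>2 = r * (a\<^sup>2 * p\<^sup>2 / g / s ^ 3 / 2)" for r a p s g :: real
    by (simp add: power_mult_distrib power_divide power3_eq_cube power2_eq_square mult_ac)
  show "c2 z A B qA qB = k2"
    unfolding c2_eq z_cube z_A z_B k2_def l2 unfolding qA_def qB_def power2_minus q by simp
qed

lemma edgeworth_sample:
  obtains e :: "nat \<Rightarrow> real" where "e \<longlonglongrightarrow> 0" "\<forall>\<^sub>F N in sequentially. \<forall>x y. \<bar>x\<bar> \<le> ln N \<longrightarrow>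
    \<bar>prob {w \<in> space M. T z v A B qA qB N x w \<le> y} - edge_cdf (k0 / sqrt N) (- (x * k1 / sqrt N)) (k2 / sqrt N) y\<bar> \<le> e N / sqrt N"
proof -
  obtain C where C: "1 \<le> C" "\<And>x. \<bar>z x\<bar> \<le> C" "\<And>x. \<bar>v x\<bar> \<le> C" "\<And>x. \<bar>A x\<bar> \<le> C" "\<And>x. \<bar>B x\<bar> \<le> C" using bound_exists by blast
  note ctx = zvAB_measurable(1) C(2) zvAB_measurable(4) C(3) zvAB_measurable(2) C(4) zvAB_measurable(3) C(5) C(1) means z_var
  obtain \<kappa> \<zeta>0 where "0 < \<kappa> \<and> 0 < \<zeta>0 \<and> (\<forall>s \<zeta>. \<bar>\<zeta>\<bar> \<le> \<zeta>0 \<longrightarrow>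
      (\<Sum>c<3. cmod (CLINT y|D. iexp (s * (z y - \<zeta> * v y)) * indicator {y. cell y = c} y)) \<le> 1 - \<kappa> * min 1 (s\<^sup>2))"
    using cramer_condition by (elim exE) (rule that)
  note \<kappa> = this[THEN conjunct1] this[THEN conjunct2, THEN conjunct1] this[THEN conjunct2, THEN conjunct2, rule_format]
  have cell: "cell \<in> borel \<rightarrow>\<^sub>M count_space UNIV" unfolding cell_def[abs_def] by measurable
  have A': "A y = (\<lambda>c. if c = 0 then 1 - \<alpha> else - \<alpha>) (cell y)" for y
    by (simp add: A_def cell_def)
  have B': "B y = (\<lambda>c. if c \<le> 1 then 1 - \<beta> else - \<beta>) (cell y)" for y
    using \<xi>_less_\<eta> by (auto simp: B_def cell_def)
  have c3: "cell y < 3" for y by (simp add: cell_def)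
  show ?thesis
  proof (rule edgeworth_T[OF ctx cell c3 A' B' \<kappa>, of qA qB])
    fix e :: "nat \<Rightarrow> real"
    assume "e \<longlonglongrightarrow> 0" "\<forall>\<^sub>F N in sequentially. \<forall>x y. \<bar>x\<bar> \<le> ln N \<longrightarrow>
      \<bar>prob {w \<in> space M. T z v A B qA qB N x w \<le> y} - edge_cdf (c0 A B qA qB / sqrt N) (- (x * c1 z v / sqrt N)) (c2 z A B qA qB / sqrt N) y\<bar> \<le> e N / sqrt N"
    then show thesis unfolding c012 by (rule that)
  qed
qed

text \<open>Error budget: \<open>E1\<close> for the numerator, \<open>E2\<close> for
  \<open>N\<close> times the squared scale, \<open>EY\<close> for the relative deviation of the
  squared scale, \<open>ER\<close> for the relative scale error beyond its linear part,
  \<open>Estud\<close> for the total in units of \<open>1 / sqrt N\<close>.\<close>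

definition E1 :: "real \<Rightarrow> nat \<Rightarrow> real" where
  "E1 \<kappa> N = 2 * (\<rho> N * rad N + (\<rho> N + 2)\<^sup>2 * \<kappa> / (2 * real N) + (2 * (ln (real N) * sqrt (real N)) + 1) * \<kappa> / (2 * real N))"
definition E2 :: "real \<Rightarrow> nat \<Rightarrow> real" where
  "E2 \<kappa> N = (ln (real N)) ^ 4 + 16 * \<kappa>\<^sup>2 * (ln (real N)) ^ 4 + 16 * \<kappa> * (rad N * \<rho> N) + 4 * \<kappa> * (ln (real N)) ^ 3 + 4 * \<kappa>\<^sup>2 * (\<rho> N + 2) + (\<kappa> * ln (real N) + (ln (real N))\<^sup>2)\<^sup>2"
definition EY :: "real \<Rightarrow> nat \<Rightarrow> real" where
  "EY \<kappa> N = 2 * (ln (real N) / sqrt (real N)) + E2 \<kappa> N * \<kappa>\<^sup>2 / real N"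
definition ER :: "real \<Rightarrow> nat \<Rightarrow> real" where
  "ER \<kappa> N = E2 \<kappa> N * \<kappa>\<^sup>2 / real N / 2 + (EY \<kappa> N)\<^sup>2 / 2 + 2 * (\<kappa> / real N)"
definition Estud :: "real \<Rightarrow> nat \<Rightarrow> real" where
  "Estud \<kappa> N = sqrt (real N) * (ln (real N) * ER \<kappa> N) + E1 \<kappa> N * \<kappa>"

lemma Estud_tendsto:
  assumes "0 < \<kappa>"
  shows "EY \<kappa> \<longlonglongrightarrow> 0" "Estud \<kappa> \<longlonglongrightarrow> 0"
proof -
  show "EY \<kappa> \<longlonglongrightarrow> 0"
    unfolding EY_def[abs_def] E2_def rad_def \<rho>_def using assms by real_asymp
  show "Estud \<kappa> \<longlonglongrightarrow> 0"
    unfolding Estud_def[abs_def] ER_def EY_def E1_def E2_def rad_def \<rho>_def using assms by real_asymp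
qed

text \<open>Dominating all constants by one \<open>\<kappa>\<close> lets the error bound depend on
  \<open>N\<close> alone. The number \<open>d\<close> depends on the outcome and on
  \<open>x\<close>, but its bound does not, which is what the later sandwich argument
  requires.\<close>

lemma studentized_le_iff:
  assumes large: "large N" and typical: "typical N w" and x: "\<bar>x\<bar> \<le> ln N" and Y: "EY \<kappa> N \<le> 1 / 2"
    and \<kappa>: "RW \<le> \<kappa>" "\<sigma> \<le> \<kappa>" "1 / f \<xi> \<le> \<kappa>" "1 / f \<eta> \<le> \<kappa>" "f \<xi> \<le> \<kappa>" "f \<eta> \<le> \<kappa>" "1 / \<sigma> \<le> \<kappa>" "1 / (\<beta> - \<alpha>) \<le> \<kappa>"
  obtains d where "\<bar>d\<bar> \<le> Estud \<kappa> N"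
    "studentized N w \<le> x \<longleftrightarrow> T z v A B qA qB N x w \<le> x - bN N / (\<sigma> * sqrt N) + d / sqrt N"
proof -
  define n where "n = real N"
  define rn where "rn = sqrt n"
  define l where "l = ln n"
  define mk where "mk = real (mb N) - real (ka N)"
  define \<theta> where "\<theta> = mk / (n * (\<beta> - \<alpha>))"
  define nu where "nu = (\<Sum>i=ka N + 1..mb N. order_stat X N i w) - mk * mu_ab F \<alpha> \<beta>"
  define p where "p = qA * ((S A N w)\<^sup>2 / n) + qB * ((S B N w)\<^sup>2 / n)"
  define err where "err = nu - \<sigma> * (S z N w + p) - bN N"
  define sv where "sv = S v N w / n"
  have n: "2 \<le> n" "1 \<le> l" "2 < (\<beta> - \<alpha>) * n" using large by (auto simp: large_def n_def l_def)
  have rn: "0 < rn" "rn\<^sup>2 = n" using n by (auto simp: rn_def)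
  have ba: "0 < \<beta> - \<alpha>" using ab by simp
  have \<kappa>1: "1 \<le> \<kappa>" using \<kappa>(1) RW(1) by linarith
  have mk: "\<bar>mk - n * (\<beta> - \<alpha>)\<bar> \<le> 1"
    using ka_bounds[of N] mb_bounds[of N] unfolding mk_def n_def[symmetric] right_diff_distrib by argo
  have mk0: "0 < mk" using mk n(3) by (simp add: mult.commute abs_le_iff)
  have \<theta>0: "0 < \<theta>" using mk0 n ba by (simp add: \<theta>_def)
  have \<theta>: "\<bar>\<theta> - 1\<bar> \<le> \<kappa> / n"
  proof -
    have "\<theta> - 1 = (mk - n * (\<beta> - \<alpha>)) / (n * (\<beta> - \<alpha>))"
      using n ba by (simp add: \<theta>_def diff_divide_distrib)
    also have "\<bar>\<dots>\<bar> \<le> 1 / (n * (\<beta> - \<alpha>))"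
      unfolding abs_divide using mk n ba by (simp add: divide_right_mono)
    also have "\<dots> = 1 / (\<beta> - \<alpha>) / n" by simp
    also have "\<dots> \<le> \<kappa> / n" using \<kappa>(8) n by (intro divide_right_mono) auto
    finally show ?thesis .
  qed
  obtain s where s: "SN X \<alpha> \<beta> N w = sqrt s" "\<bar>n * s - n * \<sigma>\<^sup>2 - 2 * \<sigma>\<^sup>2 * S v N w\<bar> \<le> E2 \<kappa> N"
    using studentizer_expansion[OF large typical \<kappa>(1-6)] unfolding E2_def n_def by blast
  define y where "y = s / \<sigma>\<^sup>2 - 1"
  define e where "e = y - 2 * sv"
  have e: "\<bar>e\<bar> \<le> E2 \<kappa> N * \<kappa>\<^sup>2 / n"
  proof -
    have "e = (n * s - n * \<sigma>\<^sup>2 - 2 * \<sigma>\<^sup>2 * S v N w) / (n * \<sigma>\<^sup>2)"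
      using n \<sigma>_pos by (simp add: e_def y_def sv_def diff_divide_distrib)
    also have "\<bar>\<dots>\<bar> \<le> E2 \<kappa> N / (n * \<sigma>\<^sup>2)"
      unfolding abs_divide using s(2) n by (simp add: divide_right_mono)
    also have "\<dots> = E2 \<kappa> N * (1 / \<sigma>)\<^sup>2 / n" by (simp add: power_divide)
    also have "\<dots> \<le> E2 \<kappa> N * \<kappa>\<^sup>2 / n"
      using \<kappa>(7) \<sigma>_pos n s(2) by (intro divide_right_mono mult_left_mono power_mono) auto
    finally show ?thesis .
  qed
  have y: "\<bar>y\<bar> \<le> EY \<kappa> N"
  proof -
    have "\<bar>sv\<bar> \<le> l * rn / n"
      using typical n unfolding typical_def sv_def l_def rn_def n_def by (simp add: divide_right_mono)
    also have "\<dots> = l / rn" using rn by (simp add: rn(2)[symmetric] power2_eq_square)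
    finally have "\<bar>y\<bar> \<le> 2 * (l / rn) + E2 \<kappa> N * \<kappa>\<^sup>2 / n" using e unfolding e_def by argo
    then show ?thesis unfolding EY_def l_def rn_def n_def .
  qed
  define q where "q = sqrt (1 + y)"
  \<comment> \<open>\<open>EY \<kappa> N \<le> 1 / 2\<close> keeps \<open>1 + y\<close> positive, so
    \<open>SN\<close> does not vanish and its denominator may be cleared.\<close>
  have q0: "0 < q" using y Y by (simp add: q_def)
  have SN: "SN X \<alpha> \<beta> N w = \<sigma> * q"
  proof -
    have "s = \<sigma>\<^sup>2 * (1 + y)" using \<sigma>_pos by (simp add: y_def)
    then show ?thesis using \<sigma>_pos unfolding s(1) q_def by (simp add: real_sqrt_mult)
  qed
  have R: "\<bar>\<theta> * q - 1 - sv\<bar> \<le> ER \<kappa> N"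
    unfolding q_def ER_def n_def[symmetric]
    by (rule ratio_perturbation[OF _ e y _ \<theta>]) (use Y in \<open>auto simp: e_def\<close>)
  have err: "\<bar>err\<bar> \<le> E1 \<kappa> N"
  proof -
    have d: "c / (2 * (n * g)) \<le> c * \<kappa> / (2 * n)" if "0 \<le> c" "1 / g \<le> \<kappa>" for c g :: real
    proof -
      have "c / (2 * (n * g)) = c / (2 * n) * (1 / g)" by simp
      also have "\<dots> \<le> c / (2 * n) * \<kappa>" using that n by (intro mult_left_mono) auto
      finally show ?thesis by simp
    qed
    have "0 \<le> (\<rho> N + 2)\<^sup>2" "0 \<le> 2 * (l * rn) + 1" using n rn by auto
    note d = d[OF this(1) \<kappa>(3)] d[OF this(1) \<kappa>(4)] d[OF this(2) \<kappa>(3)] d[OF this(2) \<kappa>(4)]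
    have "\<bar>err\<bar> \<le> (\<rho> N * rad N + (\<rho> N + 2)\<^sup>2 / (2 * (n * f \<xi>)) + (2 * (l * rn) + 1) / (2 * (n * f \<xi>)))
      + (\<rho> N * rad N + (\<rho> N + 2)\<^sup>2 / (2 * (n * f \<eta>)) + (2 * (l * rn) + 1) / (2 * (n * f \<eta>)))"
      unfolding err_def nu_def mk_def p_def l_def rn_def n_def add.assoc[symmetric]
      using numerator_expansion[OF large typical] by (simp only: add.assoc)
    also have "\<dots> \<le> E1 \<kappa> N"
      unfolding E1_def n_def[symmetric] rn_def[symmetric] l_def[symmetric] by (rule sum_le_double[OF d])
    finally show ?thesis .
  qed
  define d where "d = rn * (x * (\<theta> * q - 1 - sv) - err / (\<sigma> * rn))"
  have "\<bar>d\<bar> \<le> Estud \<kappa> N"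
  proof -
    have "\<bar>x * (\<theta> * q - 1 - sv)\<bar> \<le> l * ER \<kappa> N"
      unfolding abs_mult using x R n by (intro mult_mono) (auto simp: l_def n_def)
    then have 1: "\<bar>rn * (x * (\<theta> * q - 1 - sv))\<bar> \<le> rn * (l * ER \<kappa> N)"
      unfolding abs_mult[of rn] using rn by (simp add: mult_left_mono)
    have "\<bar>err * (1 / \<sigma>)\<bar> \<le> E1 \<kappa> N * \<kappa>"
      unfolding abs_mult using err \<kappa>(7) \<sigma>_pos by (intro mult_mono) auto
    moreover have "d = rn * (x * (\<theta> * q - 1 - sv)) - err * (1 / \<sigma>)"
      unfolding d_def right_diff_distrib using rn by simp
    moreover note abs_diff_le_add[OF 1]
    ultimately show ?thesis unfolding Estud_def l_def rn_def n_def by simp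
  qed
  moreover have "studentized N w \<le> x \<longleftrightarrow> T z v A B qA qB N x w \<le> x - bN N / (\<sigma> * rn) + d / rn"
  proof -
    have "studentized N w = nu / (rn * \<theta> * (\<sigma> * q))"
    proof -
      have "trimmed_mean X \<alpha> \<beta> N w - mu_ab F \<alpha> \<beta> = nu / mk"
        unfolding trimmed_mean_def nu_def mk_def[symmetric] using mk0 by (simp add: diff_divide_distrib)
      then have "studentized N w = rn * (nu / mk) / (inverse (\<beta> - \<alpha>) * (\<sigma> * q))"
        unfolding studentized_def SN rn_def n_def by simp
      also have "\<dots> = nu / (rn * \<theta> * (\<sigma> * q))"
        using rn mk0 n ba q0 \<sigma>_pos unfolding \<theta>_def by (simp add: rn(2)[symmetric] power2_eq_square divide_inverse mult_ac)
      finally show ?thesis .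
    qed
    also have "nu = \<sigma> * (S z N w + p) + bN N + err" by (simp add: err_def)
    finally have st: "studentized N w = (\<sigma> * (S z N w + p) + bN N + err) / (rn * \<theta> * (\<sigma> * q))" .
    show ?thesis
      unfolding st studentized_identity[OF rn(1) \<theta>0 q0 \<sigma>_pos, where sv="S v N w"] T_eq d_def p_def rn(2)
      unfolding rn_def n_def sv_def ..
  qed
  ultimately show ?thesis using that unfolding rn_def n_def by blast
qed

end

section \<open>Uniform approximation\<close>

lemma phi_le_exp: "phi x \<le> exp (- x\<^sup>2 / 2)"
proof -
  have "1 \<le> sqrt (2 * pi)" using pi_ge_two by (intro real_le_rsqrt) auto
  then show ?thesis unfolding phi_def std_normal_density_def by (simp add: divide_le_eq)
qed

lemma phi_square_bound: "phi x * (1 + x\<^sup>2) \<le> 4 * exp (- x\<^sup>2 / 4)"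
proof -
  have "1 + x\<^sup>2 \<le> 4 * exp (x\<^sup>2 / 4)" using exp_ge_add_one_self[of "x\<^sup>2 / 4"] zero_le_power2[of x] by linarith
  then have "phi x * (1 + x\<^sup>2) \<le> exp (- x\<^sup>2 / 2) * (4 * exp (x\<^sup>2 / 4))"
    using phi_le_exp phi_nonneg by (intro mult_mono) auto
  also have "\<dots> = 4 * exp (- x\<^sup>2 / 4)" by (simp add: exp_add[symmetric])
  finally show ?thesis .
qed

text \<open>\<open>Phi - phi\<close> has derivative \<open>(1 + t) * phi t\<close>, nonpositive for
  \<open>t \<le> -1\<close>, and tends to 0 at minus infinity; the limit is that of
  \<open>edge_cdf 1 0 0\<close>.\<close>

lemma Phi_lower_tail:
  assumes "x \<le> -1"
  shows "0 \<le> Phi x" "Phi x \<le> phi x"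
proof -
  show "0 \<le> Phi x" unfolding Phi_cdf by (rule nd.cdf_nonneg)
  let ?g = "edge_cdf 1 0 0"
  have g: "?g y = Phi y - phi y" for y by (simp add: edge_cdf_def)
  have "(?g \<longlongrightarrow> 0) at_bot" by (rule edge_cdf_at_bot)
  moreover have "\<forall>\<^sub>F y in at_bot. ?g x \<le> ?g y"
    unfolding eventually_at_bot_linorder g
  proof (intro exI allI impI)
    fix y assume "y \<le> x"
    then show "Phi x - phi x \<le> Phi y - phi y"
    proof (rule DERIV_nonpos_imp_nonincreasing)
      fix t assume t: "y \<le> t" "t \<le> x"
      have "((\<lambda>y. Phi y - phi y) has_real_derivative phi t - - t * phi t) (at t)"
        by (intro DERIV_diff Phi_deriv phi_deriv)
      moreover have "phi t - - t * phi t = (1 + t) * phi t" by (simp add: algebra_simps)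
      moreover have "(1 + t) * phi t \<le> 0" using t assms phi_nonneg[of t] by (intro mult_nonpos_nonneg) auto
      ultimately show "\<exists>d. ((\<lambda>y. Phi y - phi y) has_real_derivative d) (at t) \<and> d \<le> 0" by metis
    qed
  qed
  ultimately have "?g x \<le> 0" by (rule tendsto_lowerbound) simp
  then show "Phi x \<le> phi x" by (simp add: g)
qed

lemma Phi_upper_tail:
  assumes "1 \<le> x"
  shows "Phi x \<le> 1" "1 - Phi x \<le> phi x"
proof -
  show "Phi x \<le> 1" unfolding Phi_cdf by (rule nd.cdf_bounded_prob)
  have "(phi \<longlongrightarrow> 0) at_top" unfolding phi_def[abs_def] std_normal_density_def by real_asymp
  moreover have "(Phi \<longlongrightarrow> 1) at_top" using nd.cdf_lim_at_top_prob by (simp add: Phi_cdf[abs_def])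
  ultimately have "((\<lambda>y. Phi y + phi y) \<longlongrightarrow> 1 + 0) at_top" by (intro tendsto_add)
  moreover have "\<forall>\<^sub>F y in at_top. Phi y + phi y \<le> Phi x + phi x"
    unfolding eventually_at_top_linorder
  proof (intro exI allI impI)
    fix y assume "x \<le> y"
    then show "Phi y + phi y \<le> Phi x + phi x"
    proof (rule DERIV_nonpos_imp_nonincreasing)
      fix t assume t: "x \<le> t" "t \<le> y"
      have "((\<lambda>y. Phi y + phi y) has_real_derivative phi t + - t * phi t) (at t)"
        by (intro DERIV_add Phi_deriv phi_deriv)
      moreover have "phi t + - t * phi t = (1 - t) * phi t" by (simp add: algebra_simps)
      moreover have "(1 - t) * phi t \<le> 0" using t assms phi_nonneg[of t] by (intro mult_nonpos_nonneg) auto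
      ultimately show "\<exists>d. ((\<lambda>y. Phi y + phi y) has_real_derivative d) (at t) \<and> d \<le> 0" by metis
    qed
  qed
  ultimately have "1 + 0 \<le> Phi x + phi x" by (rule tendsto_upperbound) simp
  then show "1 - Phi x \<le> phi x" by simp
qed

text \<open>\<open>Phi\<close> needs a first-order expansion, as the shift is of order
  \<open>1 / r\<close>; the polynomial already carries \<open>1 / r\<close> and needs only its
  Lipschitz bound. Its middle coefficient contains \<open>x\<close> and multiplies an argument close
  to \<open>x\<close>, hence \<open>x^2 * k1\<close>.\<close>

lemma edge_cdf_shift:
  fixes x b d r l k0 k1 k2 R :: real
  assumes r: "0 < r" and x: "\<bar>x\<bar> \<le> l" and b: "\<bar>b\<bar> \<le> R" and d: "\<bar>d\<bar> \<le> \<delta>" "\<delta> \<le> 1"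
  shows "\<bar>edge_cdf (k0 / r) (- (x * k1 / r)) (k2 / r) (x - b / r + d / r) - (Phi x - phi x * (b + k0 - x\<^sup>2 * k1 + k2 * (x\<^sup>2 - 1)) / r)\<bar>
    \<le> (12 * \<delta> + (12 * (R + 1)\<^sup>2 + 48 * (\<bar>k0\<bar> + l * \<bar>k1\<bar> + \<bar>k2\<bar>) * (R + 1)) / r) / r"
proof -
  define h where "h = (d - b) / r"
  define P where "P y = phi y * (k0 / r + - (x * k1 / r) * y + k2 / r * (y\<^sup>2 - 1))" for y
  have y: "x - b / r + d / r = x + h" by (simp add: h_def diff_divide_distrib)
  have h: "\<bar>h\<bar> \<le> (R + 1) / r"
    unfolding h_def abs_divide using b d r by (simp add: divide_right_mono)
  have "\<bar>Phi (x + h) - Phi x - phi x * h\<bar> \<le> 12 * h\<^sup>2" by (rule Phi_taylor)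
  also have "\<dots> \<le> 12 * (R + 1)\<^sup>2 / r / r"
    using abs_power2_le[OF h] by (simp add: power_divide power2_eq_square)
  finally have 1: "\<bar>Phi (x + h) - Phi x - phi x * h\<bar> \<le> 12 * (R + 1)\<^sup>2 / r / r" .
  have "\<bar>P (x + h) - P x\<bar> \<le> 48 * (\<bar>k0 / r\<bar> + \<bar>- (x * k1 / r)\<bar> + \<bar>k2 / r\<bar>) * \<bar>x + h - x\<bar>"
    unfolding P_def by (rule edge_poly_lipschitz)
  also have "\<bar>k0 / r\<bar> + \<bar>- (x * k1 / r)\<bar> + \<bar>k2 / r\<bar> = (\<bar>k0\<bar> + \<bar>x\<bar> * \<bar>k1\<bar> + \<bar>k2\<bar>) / r"
    using r by (simp add: abs_mult add_divide_distrib)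
  also have "48 * ((\<bar>k0\<bar> + \<bar>x\<bar> * \<bar>k1\<bar> + \<bar>k2\<bar>) / r) * \<bar>x + h - x\<bar> \<le> 48 * ((\<bar>k0\<bar> + l * \<bar>k1\<bar> + \<bar>k2\<bar>) / r) * ((R + 1) / r)"
    using h x r by (intro mult_mono divide_right_mono add_mono) auto
  also have "\<dots> = 48 * (\<bar>k0\<bar> + l * \<bar>k1\<bar> + \<bar>k2\<bar>) * (R + 1) / r / r" by simp
  finally have 2: "\<bar>P (x + h) - P x\<bar> \<le> 48 * (\<bar>k0\<bar> + l * \<bar>k1\<bar> + \<bar>k2\<bar>) * (R + 1) / r / r" .
  have "\<bar>phi x * d\<bar> \<le> 12 * \<delta>"
    unfolding abs_mult using d power_phi_bound[of 0 x] phi_nonneg[of x] by (intro mult_mono) auto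
  then have 3: "\<bar>phi x * d / r\<bar> \<le> 12 * \<delta> / r" unfolding abs_divide using r by (simp add: divide_right_mono)
  have "edge_cdf (k0 / r) (- (x * k1 / r)) (k2 / r) (x + h) = Phi (x + h) - P (x + h)"
    by (simp add: edge_cdf_def P_def)
  moreover have "phi x * (b + k0 - x\<^sup>2 * k1 + k2 * (x\<^sup>2 - 1)) / r = phi x * d / r - phi x * h + P x"
    unfolding h_def P_def using r by (simp add: field_simps power2_eq_square)
  ultimately have "edge_cdf (k0 / r) (- (x * k1 / r)) (k2 / r) (x + h) - (Phi x - phi x * (b + k0 - x\<^sup>2 * k1 + k2 * (x\<^sup>2 - 1)) / r)
      = (Phi (x + h) - Phi x - phi x * h) - (P (x + h) - P x) + phi x * d / r"
    by linarith
  also have "\<bar>\<dots>\<bar> \<le> 12 * (R + 1)\<^sup>2 / r / r + 48 * (\<bar>k0\<bar> + l * \<bar>k1\<bar> + \<bar>k2\<bar>) * (R + 1) / r / r + 12 * \<delta> / r"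
    using 1 2 3 by linarith
  finally show ?thesis unfolding y by (simp add: add_divide_distrib)
qed

context trimmed_sample
begin

text \<open>Coefficient matching: \<open>6 * (k1 - k2) = 2 * lambda1 + 3 * lambda2\<close> for
  \<open>x^2\<close>, \<open>6 * k2 = lambda1 + 3 * lambda2\<close> for the constant term, and
  \<open>N * betaN = bN + \<sigma> * k0\<close>.\<close>

lemma H_N_eq:
  assumes "1 \<le> N"
  shows "H_N F f \<alpha> \<beta> N x = Phi x - phi x * (bN N / \<sigma> + k0 - x\<^sup>2 * k1 + k2 * (x\<^sup>2 - 1)) / sqrt N"
proof -
  have "0 \<le> \<alpha> * N" "0 \<le> \<beta> * N" using ab by auto
  then have fl: "real_of_int \<lfloor>\<alpha> * N\<rfloor> = real (ka N)" "real_of_int \<lfloor>\<beta> * N\<rfloor> = real (mb N)" by (simp_all add: of_nat_nat)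
  have k0: "\<sigma> * k0 = 1 / 2 * \<beta> * (1 - \<beta>) / f \<eta> - 1 / 2 * \<alpha> * (1 - \<alpha>) / f \<xi>"
    using \<sigma>_pos by (simp add: k0_def)
  have "N * betaN F f \<alpha> \<beta> N = bN N + \<sigma> * k0"
    unfolding betaN_def fl \<xi>_def[symmetric] \<eta>_def[symmetric] bN_def k0 using assms by simp
  then have "6 * N * betaN F f \<alpha> \<beta> N / \<sigma> = 6 * (bN N / \<sigma> + k0)"
    using \<sigma>_pos by (simp add: mult.assoc add_divide_distrib)
  then have "H_N F f \<alpha> \<beta> N x = Phi x + phi x / (6 * sqrt N) * ((2 * x\<^sup>2 + 1) * lambda1 F \<alpha> \<beta> + 3 * (x\<^sup>2 + 1) * lambda2 F f \<alpha> \<beta> - 6 * (bN N / \<sigma> + k0))"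
    unfolding H_N_def \<sigma>_def by simp
  also have "(2 * x\<^sup>2 + 1) * lambda1 F \<alpha> \<beta> + 3 * (x\<^sup>2 + 1) * lambda2 F f \<alpha> \<beta> - 6 * (bN N / \<sigma> + k0)
     = - 6 * (bN N / \<sigma> + k0 - x\<^sup>2 * k1 + k2 * (x\<^sup>2 - 1))"
    unfolding k1_def k2_def by (simp add: field_simps)
  also have "phi x / (6 * s) * (- 6 * Q) = - (phi x * Q / s)" for Q s by simp
  finally show ?thesis by simp
qed

definition "bB = (\<bar>mu_ab F \<alpha> \<beta> - \<xi>\<bar> + \<bar>mu_ab F \<alpha> \<beta> - \<eta>\<bar>) / \<sigma>"

lemma bN_bound: "\<bar>bN N / \<sigma>\<bar> \<le> bB"
proof -
  have "\<bar>\<alpha> * N - ka N\<bar> \<le> 1" "\<bar>\<beta> * N - mb N\<bar> \<le> 1"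
    using ka_bounds[of N] mb_bounds[of N] by argo+
  then have "\<bar>(\<alpha> * N - ka N) * (mu_ab F \<alpha> \<beta> - \<xi>)\<bar> \<le> 1 * \<bar>mu_ab F \<alpha> \<beta> - \<xi>\<bar>" "\<bar>(\<beta> * N - mb N) * (mu_ab F \<alpha> \<beta> - \<eta>)\<bar> \<le> 1 * \<bar>mu_ab F \<alpha> \<beta> - \<eta>\<bar>"
    unfolding abs_mult by (intro mult_right_mono; simp)+
  moreover have "\<bar>- a + b\<bar> \<le> c + d" if "\<bar>a\<bar> \<le> 1 * c" "\<bar>b\<bar> \<le> 1 * d" for a b c d :: real
    using that by linarith
  ultimately have "\<bar>bN N\<bar> \<le> \<bar>mu_ab F \<alpha> \<beta> - \<xi>\<bar> + \<bar>mu_ab F \<alpha> \<beta> - \<eta>\<bar>"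
    unfolding bN_def mult_minus_left by blast
  then show ?thesis unfolding bB_def abs_divide using \<sigma>_pos by (simp add: divide_right_mono)
qed

lemma bB_nonneg: "0 \<le> bB"
  by (rule order_trans[OF abs_ge_zero bN_bound])

definition "Ptail = 1 + 4 * (bB + \<bar>k0\<bar> + \<bar>k1\<bar> + \<bar>k2\<bar>)"

text \<open>The correction grows like \<open>1 + x^2\<close>; half of the Gaussian exponent absorbs
  this, which leaves \<open>exp (- l^2 / 4)\<close>.\<close>

lemma H_N_tail:
  assumes N: "1 \<le> N" and l: "1 \<le> l" "l \<le> \<bar>x\<bar>"
  shows "\<bar>H_N F f \<alpha> \<beta> N x - (if 0 < x then 1 else 0)\<bar> \<le> Ptail * exp (- l\<^sup>2 / 4)"
proof -
  define K where "K = bB + \<bar>k0\<bar> + \<bar>k1\<bar> + \<bar>k2\<bar>"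
  have K0: "0 \<le> K" using bB_nonneg by (simp add: K_def)
  have lx: "l\<^sup>2 \<le> x\<^sup>2" using l power_mono[of l "\<bar>x\<bar>" 2] by simp
  have ex: "exp (- x\<^sup>2 / 4) \<le> exp (- l\<^sup>2 / 4)" using lx by simp
  have "phi x \<le> exp (- x\<^sup>2 / 4)" using phi_le_exp[of x] by (rule order_trans) simp
  then have ph: "phi x \<le> exp (- l\<^sup>2 / 4)" using ex by linarith
  have main: "\<bar>Phi x - (if 0 < x then 1 else 0)\<bar> \<le> exp (- l\<^sup>2 / 4)"
  proof (cases "0 < x")
    case True
    then have "1 \<le> x" using l by linarith
    then show ?thesis using Phi_upper_tail[of x] ph True by simp
  next
    case False
    then have "x \<le> -1" using l by linarith
    then show ?thesis using Phi_lower_tail[of x] ph False by simp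
  qed
  have "\<bar>bN N / \<sigma> + k0 - x\<^sup>2 * k1 + k2 * (x\<^sup>2 - 1)\<bar> \<le> K * (1 + x\<^sup>2)"
  proof -
    have "\<bar>k2 * (x\<^sup>2 - 1)\<bar> \<le> \<bar>k2\<bar> * (1 + x\<^sup>2)" unfolding abs_mult by (intro mult_left_mono) (auto simp: abs_le_iff)
    moreover have "\<bar>x\<^sup>2 * k1\<bar> = x\<^sup>2 * \<bar>k1\<bar>" by (simp add: abs_mult)
    moreover have "0 \<le> bB * x\<^sup>2" "0 \<le> \<bar>k0\<bar> * x\<^sup>2" using bB_nonneg by simp_all
    moreover have "K * (1 + x\<^sup>2) = bB + bB * x\<^sup>2 + \<bar>k0\<bar> + \<bar>k0\<bar> * x\<^sup>2 + \<bar>k1\<bar> + x\<^sup>2 * \<bar>k1\<bar> + \<bar>k2\<bar> * (1 + x\<^sup>2)"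
      by (simp add: K_def algebra_simps)
    ultimately show ?thesis using bN_bound[of N] abs_ge_zero[of k1] by linarith
  qed
  then have "\<bar>phi x * (bN N / \<sigma> + k0 - x\<^sup>2 * k1 + k2 * (x\<^sup>2 - 1))\<bar> \<le> phi x * (K * (1 + x\<^sup>2))"
    unfolding abs_mult using phi_nonneg[of x] by (simp add: mult_left_mono)
  also have "\<dots> = K * (phi x * (1 + x\<^sup>2))" by simp
  also have "\<dots> \<le> K * (4 * exp (- x\<^sup>2 / 4))" using K0 phi_square_bound by (intro mult_left_mono)
  also have "\<dots> \<le> K * (4 * exp (- l\<^sup>2 / 4))" using K0 ex by (intro mult_left_mono) auto
  finally have p: "\<bar>phi x * (bN N / \<sigma> + k0 - x\<^sup>2 * k1 + k2 * (x\<^sup>2 - 1))\<bar> \<le> K * (4 * exp (- l\<^sup>2 / 4))" .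
  have "\<bar>phi x * (bN N / \<sigma> + k0 - x\<^sup>2 * k1 + k2 * (x\<^sup>2 - 1)) / sqrt N\<bar> \<le> \<bar>phi x * (bN N / \<sigma> + k0 - x\<^sup>2 * k1 + k2 * (x\<^sup>2 - 1))\<bar> / 1"
    unfolding abs_divide using N by (intro divide_left_mono) auto
  then have "\<bar>phi x * (bN N / \<sigma> + k0 - x\<^sup>2 * k1 + k2 * (x\<^sup>2 - 1)) / sqrt N\<bar> \<le> K * (4 * exp (- l\<^sup>2 / 4))" using p by simp
  moreover have "\<bar>a - b - c\<bar> \<le> d + e" if "\<bar>a - c\<bar> \<le> d" "\<bar>b\<bar> \<le> e" for a b c d e :: real
    using that by linarith
  note this[OF main]
  ultimately have "\<bar>H_N F f \<alpha> \<beta> N x - (if 0 < x then 1 else 0)\<bar> \<le> exp (- l\<^sup>2 / 4) + K * (4 * exp (- l\<^sup>2 / 4))"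
    unfolding H_N_eq[OF N] by blast
  then show ?thesis unfolding Ptail_def K_def[symmetric] by (simp add: algebra_simps)
qed

end

context trimmed_sample
begin

lemma dominating_constant:
  obtains \<kappa> where "0 < \<kappa>" "RW \<le> \<kappa>" "\<sigma> \<le> \<kappa>" "1 / f \<xi> \<le> \<kappa>" "1 / f \<eta> \<le> \<kappa>" "f \<xi> \<le> \<kappa>" "f \<eta> \<le> \<kappa>" "1 / \<sigma> \<le> \<kappa>" "1 / (\<beta> - \<alpha>) \<le> \<kappa>"
proof (rule that)
  define \<kappa> where "\<kappa> = RW + \<sigma> + 1 / f \<xi> + 1 / f \<eta> + f \<xi> + f \<eta> + 1 / \<sigma> + 1 / (\<beta> - \<alpha>)"
  have "0 < RW" "0 < \<sigma>" "0 < 1 / f \<xi>" "0 < 1 / f \<eta>" "0 < f \<xi>" "0 < f \<eta>" "0 < 1 / \<sigma>" "0 < 1 / (\<beta> - \<alpha>)"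
    using RW(1) \<sigma>_pos f_pos' ab by simp_all
  then show "0 < \<kappa>" "RW \<le> \<kappa>" "\<sigma> \<le> \<kappa>" "1 / f \<xi> \<le> \<kappa>" "1 / f \<eta> \<le> \<kappa>" "f \<xi> \<le> \<kappa>" "f \<eta> \<le> \<kappa>" "1 / \<sigma> \<le> \<kappa>" "1 / (\<beta> - \<alpha>) \<le> \<kappa>"
    unfolding \<kappa>_def by linarith+
qed

lemma Estud_nonneg:
  assumes \<kappa>: "0 \<le> \<kappa>" and large: "large N"
  shows "0 \<le> Estud \<kappa> N"
proof -
  have l: "0 \<le> ln (real N)" using large by (simp add: large_def)
  have r: "0 \<le> rad N" "0 \<le> \<rho> N" by (simp_all add: rad_def \<rho>_def)
  have "0 \<le> E2 \<kappa> N" unfolding E2_def using l r \<kappa>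
    by (intro add_nonneg_nonneg mult_nonneg_nonneg zero_le_power) simp_all
  then have "0 \<le> ER \<kappa> N" unfolding ER_def using \<kappa>
    by (intro add_nonneg_nonneg mult_nonneg_nonneg divide_nonneg_nonneg) simp_all
  moreover have "0 \<le> E1 \<kappa> N" unfolding E1_def using l r \<kappa>
    by (intro add_nonneg_nonneg mult_nonneg_nonneg divide_nonneg_nonneg) simp_all
  ultimately show ?thesis unfolding Estud_def using l \<kappa>
    by (intro add_nonneg_nonneg mult_nonneg_nonneg) simp_all
qed

text \<open>On \<open>G N\<close> the event lies between those where \<open>T\<close> is at most
  \<open>y (- \<epsilon>)\<close> and at most \<open>y \<epsilon>\<close>, although the shift
  \<open>d\<close> is random; off \<open>G N\<close> only the probability of the exceptional set is
  paid. Both bounding probabilities are then compared with \<open>H_N\<close>.\<close>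

lemma central_approximation:
  obtains E :: "nat \<Rightarrow> real" where "E \<longlonglongrightarrow> 0"
    "\<forall>\<^sub>F N in sequentially. \<forall>x. \<bar>x\<bar> \<le> ln N \<longrightarrow> \<bar>prob {w \<in> space M. studentized N w \<le> x} - H_N F f \<alpha> \<beta> N x\<bar> \<le> E N / sqrt N"
proof -
  obtain \<kappa> where \<kappa>0: "0 < \<kappa>" and \<kappa>: "RW \<le> \<kappa>" "\<sigma> \<le> \<kappa>" "1 / f \<xi> \<le> \<kappa>" "1 / f \<eta> \<le> \<kappa>" "f \<xi> \<le> \<kappa>" "f \<eta> \<le> \<kappa>" "1 / \<sigma> \<le> \<kappa>" "1 / (\<beta> - \<alpha>) \<le> \<kappa>"
    by (rule dominating_constant)
  obtain G eG where G: "\<And>N. G N \<in> events" "eG \<longlonglongrightarrow> 0"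
    "\<forall>\<^sub>F N in sequentially. prob (space M - G N) \<le> eG N / sqrt N \<and> (\<forall>w\<in>G N. typical N w)"
    by (rule typical_event) blast
  obtain e where e: "e \<longlonglongrightarrow> 0" "\<forall>\<^sub>F N in sequentially. \<forall>x y. \<bar>x\<bar> \<le> ln N \<longrightarrow>
    \<bar>prob {w \<in> space M. T z v A B qA qB N x w \<le> y} - edge_cdf (k0 / sqrt N) (- (x * k1 / sqrt N)) (k2 / sqrt N) y\<bar> \<le> e N / sqrt N"
    by (rule edgeworth_sample)
  \<comment> \<open>The outer bracket in the bound of \<open>edge_cdf_shift\<close> at
    \<open>r = sqrt N\<close>, \<open>l = ln N\<close>, \<open>R = bB\<close>.\<close>
  define Esh where "Esh N = 12 * Estud \<kappa> N + (12 * (bB + 1)\<^sup>2 + 48 * (\<bar>k0\<bar> + ln (real N) * \<bar>k1\<bar> + \<bar>k2\<bar>) * (bB + 1)) / sqrt (real N)" for N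
  define E where "E N = e N + eG N + Esh N" for N
  have Esh: "Esh \<longlonglongrightarrow> 0"
  proof -
    have r: "(\<lambda>N. 1 / sqrt (real N)) \<longlonglongrightarrow> 0" "(\<lambda>N. ln (real N) / sqrt (real N)) \<longlonglongrightarrow> 0" by real_asymp+
    have "(\<lambda>N. 12 * Estud \<kappa> N + ((12 * (bB + 1)\<^sup>2 + 48 * (\<bar>k0\<bar> + \<bar>k2\<bar>) * (bB + 1)) * (1 / sqrt (real N))
        + 48 * \<bar>k1\<bar> * (bB + 1) * (ln (real N) / sqrt (real N)))) \<longlonglongrightarrow> 12 * 0 + ((12 * (bB + 1)\<^sup>2 + 48 * (\<bar>k0\<bar> + \<bar>k2\<bar>) * (bB + 1)) * 0 + 48 * \<bar>k1\<bar> * (bB + 1) * 0)"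
      by (intro tendsto_add tendsto_mult tendsto_const r Estud_tendsto \<kappa>0)
    moreover have "Esh = (\<lambda>N. 12 * Estud \<kappa> N + ((12 * (bB + 1)\<^sup>2 + 48 * (\<bar>k0\<bar> + \<bar>k2\<bar>) * (bB + 1)) * (1 / sqrt (real N))
        + 48 * \<bar>k1\<bar> * (bB + 1) * (ln (real N) / sqrt (real N))))"
      by (rule ext) (simp add: Esh_def add_divide_distrib distrib_left distrib_right mult_ac)
    ultimately show ?thesis by (simp only: mult_zero_right add_0_right)
  qed
  have "(\<lambda>N. e N + eG N + Esh N) \<longlonglongrightarrow> 0 + 0 + 0" by (intro tendsto_add e(1) G(2) Esh)
  then have lim: "E \<longlonglongrightarrow> 0" by (simp add: E_def[abs_def])
  have "\<forall>\<^sub>F N in sequentially. EY \<kappa> N < 1 / 2" "\<forall>\<^sub>F N in sequentially. Estud \<kappa> N < 1"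
    by (rule order_tendstoD(2)[OF Estud_tendsto(1)[OF \<kappa>0]] order_tendstoD(2)[OF Estud_tendsto(2)[OF \<kappa>0]]; simp)+
  with eventually_large G(3) e(2)
  have "\<forall>\<^sub>F N in sequentially. \<forall>x. \<bar>x\<bar> \<le> ln N \<longrightarrow> \<bar>prob {w \<in> space M. studentized N w \<le> x} - H_N F f \<alpha> \<beta> N x\<bar> \<le> E N / sqrt N"
  proof eventually_elim
    case (elim N)
    note large = elim(1)
    have N: "1 \<le> N" "0 < sqrt (real N)" using large by (auto simp: large_def)
    have bad: "prob (space M - G N) \<le> eG N / sqrt N" and typ_G: "\<And>w. w \<in> G N \<Longrightarrow> typical N w"
      using elim(2) by auto
    have [measurable]: "studentized N \<in> borel_measurable M" by (rule studentized_measurable[OF large])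
    note [measurable] = T_borel G(1)[of N]
    show ?case
    proof (intro allI impI)
      fix x :: real
      assume x: "\<bar>x\<bar> \<le> ln N"
      define \<epsilon> where "\<epsilon> = Estud \<kappa> N"
      define y where "y d = x - bN N / \<sigma> / sqrt N + d / sqrt N" for d
      define p where "p = prob {w \<in> space M. studentized N w \<le> x}"
      define P where "P d = prob {w \<in> space M. T z v A B qA qB N x w \<le> y d}" for d
      define b where "b = prob (space M - G N)"
      have iff: "\<exists>d. \<bar>d\<bar> \<le> \<epsilon> \<and> (studentized N w \<le> x \<longleftrightarrow> T z v A B qA qB N x w \<le> y d)" if "w \<in> G N" for w
      proof (rule studentized_le_iff[OF large typ_G[OF that] x _ \<kappa>])
        show "EY \<kappa> N \<le> 1 / 2" using elim(4) by simp
      qed (auto simp: \<epsilon>_def y_def)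
      have mono: "y d \<le> y d'" if "d \<le> d'" for d d'
        unfolding y_def using that by (simp add: divide_right_mono)
      have "0 \<le> \<epsilon>"
        unfolding \<epsilon>_def using Estud_nonneg[OF _ large] \<kappa>0 by simp
      have up: "p \<le> P \<epsilon> + b"
      proof -
        have "p \<le> prob ({w \<in> space M. T z v A B qA qB N x w \<le> y \<epsilon>} \<union> (space M - G N))"
          unfolding p_def
        proof (intro finite_measure_mono subsetI)
          fix w assume w: "w \<in> {w \<in> space M. studentized N w \<le> x}"
          show "w \<in> {w \<in> space M. T z v A B qA qB N x w \<le> y \<epsilon>} \<union> (space M - G N)"
          proof (cases "w \<in> G N")
            case True
            then obtain d where "\<bar>d\<bar> \<le> \<epsilon>" "T z v A B qA qB N x w \<le> y d" using iff w by auto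
            then have "T z v A B qA qB N x w \<le> y \<epsilon>" using mono[of d \<epsilon>] by linarith
            then show ?thesis using w by auto
          qed (use w in auto)
        qed measurable
        also have "\<dots> \<le> P \<epsilon> + b" unfolding P_def b_def by (rule measure_Un_le) measurable
        finally show ?thesis .
      qed
      have low: "P (- \<epsilon>) \<le> p + b"
      proof -
        have "P (- \<epsilon>) \<le> prob ({w \<in> space M. studentized N w \<le> x} \<union> (space M - G N))"
          unfolding P_def
        proof (intro finite_measure_mono subsetI)
          fix w assume w: "w \<in> {w \<in> space M. T z v A B qA qB N x w \<le> y (- \<epsilon>)}"
          show "w \<in> {w \<in> space M. studentized N w \<le> x} \<union> (space M - G N)"
          proof (cases "w \<in> G N")
            case True
            then obtain d where "\<bar>d\<bar> \<le> \<epsilon>" "studentized N w \<le> x \<longleftrightarrow> T z v A B qA qB N x w \<le> y d" using iff by auto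
            moreover from this(1) have "y (- \<epsilon>) \<le> y d" by (intro mono) linarith
            ultimately show ?thesis using w by auto
          qed (use w in auto)
        qed measurable
        also have "\<dots> \<le> p + b" unfolding p_def b_def by (rule measure_Un_le) measurable
        finally show ?thesis .
      qed
      have app: "\<bar>P d - H_N F f \<alpha> \<beta> N x\<bar> \<le> e N / sqrt N + Esh N / sqrt N" if "\<bar>d\<bar> \<le> \<epsilon>" for d
      proof -
        have "\<bar>P d - edge_cdf (k0 / sqrt N) (- (x * k1 / sqrt N)) (k2 / sqrt N) (y d)\<bar> \<le> e N / sqrt N"
          unfolding P_def using elim(3) x by blast
        moreover have "\<bar>edge_cdf (k0 / sqrt N) (- (x * k1 / sqrt N)) (k2 / sqrt N) (y d) - H_N F f \<alpha> \<beta> N x\<bar> \<le> Esh N / sqrt N"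
          unfolding y_def H_N_eq[OF N(1)] Esh_def
          by (rule edge_cdf_shift[OF N(2) x bN_bound]) (use that elim(5) in \<open>auto simp: \<epsilon>_def\<close>)
        ultimately show ?thesis by linarith
      qed
      have "E N / sqrt N = e N / sqrt N + Esh N / sqrt N + eG N / sqrt N"
        by (simp add: E_def add_divide_distrib)
      then show "\<bar>prob {w \<in> space M. studentized N w \<le> x} - H_N F f \<alpha> \<beta> N x\<bar> \<le> E N / sqrt N"
        using app[of \<epsilon>] app[of "- \<epsilon>"] up low bad \<open>0 \<le> \<epsilon>\<close> unfolding p_def[symmetric] b_def[symmetric] by simp
    qed
  qed
  with lim show ?thesis by (rule that)
qed

text \<open>From \<open>ln N\<close> on in modulus, \<open>H_N\<close> is within a tail error of 0
  or 1, and monotonicity carries the central estimate at the boundary outwards. The tail error is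
  paid twice, at the boundary and at \<open>x\<close>.\<close>

lemma uniform_approximation:
  obtains E :: "nat \<Rightarrow> real" where "E \<longlonglongrightarrow> 0"
    "\<forall>\<^sub>F N in sequentially. \<forall>x. \<bar>prob {w \<in> space M. studentized N w \<le> x} - H_N F f \<alpha> \<beta> N x\<bar> \<le> E N / sqrt N"
proof -
  obtain E where E: "E \<longlonglongrightarrow> 0"
    "\<forall>\<^sub>F N in sequentially. \<forall>x. \<bar>x\<bar> \<le> ln N \<longrightarrow> \<bar>prob {w \<in> space M. studentized N w \<le> x} - H_N F f \<alpha> \<beta> N x\<bar> \<le> E N / sqrt N"
    by (rule central_approximation)
  define \<tau> where "\<tau> N = Ptail * (sqrt (real N) * exp (- (ln (real N))\<^sup>2 / 4))" for N
  have "(\<lambda>N. sqrt (real N) * exp (- (ln (real N))\<^sup>2 / 4)) \<longlonglongrightarrow> 0" by real_asymp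
  from tendsto_mult[OF tendsto_const this, of Ptail] have \<tau>: "\<tau> \<longlonglongrightarrow> 0" by (simp add: \<tau>_def[abs_def])
  have "(\<lambda>N. E N + 2 * \<tau> N) \<longlonglongrightarrow> 0 + 2 * 0" by (intro tendsto_add tendsto_mult tendsto_const E(1) \<tau>)
  then have lim: "(\<lambda>N. E N + 2 * \<tau> N) \<longlonglongrightarrow> 0" by simp
  have "\<forall>\<^sub>F N in sequentially. \<forall>x. \<bar>prob {w \<in> space M. studentized N w \<le> x} - H_N F f \<alpha> \<beta> N x\<bar> \<le> (E N + 2 * \<tau> N) / sqrt N"
    using eventually_large E(2)
  proof eventually_elim
    case (elim N)
    note large = elim(1)
    define l where "l = ln (real N)"
    define p where "p x = prob {w \<in> space M. studentized N w \<le> x}" for x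
    define H where "H x = H_N F f \<alpha> \<beta> N x" for x
    define t where "t = Ptail * exp (- l\<^sup>2 / 4)"
    have N: "1 \<le> N" "0 < sqrt (real N)" "1 \<le> l" using large by (auto simp: large_def l_def)
    have t: "\<tau> N / sqrt N = t" using N(2) by (simp add: \<tau>_def t_def l_def)
    have [measurable]: "studentized N \<in> borel_measurable M" by (rule studentized_measurable[OF large])
    have mono: "p x \<le> p y" if "x \<le> y" for x y
      unfolding p_def using that by (intro finite_measure_mono) auto
    have p01: "0 \<le> p x" "p x \<le> 1" for x unfolding p_def by auto
    have c: "\<bar>p x - H x\<bar> \<le> E N / sqrt N" if "\<bar>x\<bar> \<le> l" for x
      using elim(2) that unfolding p_def H_def l_def by blast
    have tail: "\<bar>H x - (if 0 < x then 1 else 0)\<bar> \<le> t" if "l \<le> \<bar>x\<bar>" for x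
      unfolding H_def t_def by (rule H_N_tail[OF N(1,3) that])
    have t0: "0 \<le> t" using tail[of l] N(3) by linarith
    have "\<bar>p x - H x\<bar> \<le> E N / sqrt N + 2 * t" for x
    proof -
      consider "\<bar>x\<bar> \<le> l" | "l < x" | "x < - l" by linarith
      then show ?thesis
      proof cases
        case 1
        then show ?thesis using c[of x] t0 by linarith
      next
        case 2
        then have "\<bar>p l - H l\<bar> \<le> E N / sqrt N" "\<bar>H l - 1\<bar> \<le> t" "\<bar>H x - 1\<bar> \<le> t" "p l \<le> p x"
          using c[of l] tail[of l] tail[of x] mono[of l x] N(3) by auto
        then show ?thesis using p01(2)[of x] by linarith
      next
        case 3
        then have "\<bar>p (- l) - H (- l)\<bar> \<le> E N / sqrt N" "\<bar>H (- l)\<bar> \<le> t" "\<bar>H x\<bar> \<le> t" "p x \<le> p (- l)"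
          using c[of "- l"] tail[of "- l"] tail[of x] mono[of x "- l"] N(3) by auto
        then show ?thesis using p01(1)[of x] by linarith
      qed
    qed
    moreover have "(E N + 2 * \<tau> N) / sqrt N = E N / sqrt N + 2 * t"
      unfolding t[symmetric] by (simp add: add_divide_distrib)
    ultimately show ?case unfolding p_def H_def by simp
  qed
  with lim show ?thesis by (rule that)
qed

end

theorem theorem2p2:
  fixes M :: "'a measure" and X :: "nat \<Rightarrow> 'a \<Rightarrow> real"
    and F f :: "real \<Rightarrow> real" and \<alpha> \<beta> :: real
  assumes "prob_space M"
    and "\<And>i. X i \<in> borel_measurable M"
    and "prob_space.indep_vars M (\<lambda>_. borel) X UNIV"
    and "\<And>i x. measure M {\<omega> \<in> space M. X i \<omega> \<le> x} = F x"
    and "0 < \<alpha>" "\<alpha> < \<beta>" "\<beta> < 1"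
    and "deriv_lipschitz_near F f (quantile F \<alpha>)"
    and "deriv_lipschitz_near F f (quantile F \<beta>)"
    and "f (quantile F \<alpha>) > 0" "f (quantile F \<beta>) > 0"
  shows "\<forall>\<epsilon>>0. \<forall>\<^sub>F N in sequentially. \<forall>x::real.
           \<bar>measure M {\<omega> \<in> space M.
               sqrt (real N) * (trimmed_mean X \<alpha> \<beta> N \<omega> - mu_ab F \<alpha> \<beta>)
                 / (inverse (\<beta> - \<alpha>) * SN X \<alpha> \<beta> N \<omega>) \<le> x}
            - H_N F f \<alpha> \<beta> N x\<bar> \<le> \<epsilon> / sqrt (real N)"
proof (intro allI impI)
  fix \<epsilon> :: real
  assume \<epsilon>: "0 < \<epsilon>"
  interpret prob_space M by fact
  define D where "D = distr M borel (X 0)"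
  have real: "real_distribution (distr M borel (X i))" for i
    using assms(2) by (rule real_distribution_distr)
  have cdf: "cdf (distr M borel (X i)) x = F x" for i x
  proof -
    have "X i -` {..x} \<inter> space M = {\<omega> \<in> space M. X i \<omega> \<le> x}" by auto
    then show ?thesis unfolding cdf_def using assms(2,4) by (simp add: measure_distr)
  qed
  \<comment> \<open>The assumption equates distribution functions; uniqueness turns this into the
    equality of laws that \<open>iid_sample\<close> asks for.\<close>
  have distr: "distr M borel (X i) = D" for i
    unfolding D_def by (rule cdf_unique[OF real real]) (simp add: cdf fun_eq_iff)
  interpret trimmed_sample M X D F f \<alpha> \<beta>
    by unfold_locales (use assms distr cdf[of 0] in \<open>simp_all add: D_def\<close>)
  obtain E where E: "E \<longlonglongrightarrow> 0"
    "\<forall>\<^sub>F N in sequentially. \<forall>x. \<bar>prob {w \<in> space M. studentized N w \<le> x} - H_N F f \<alpha> \<beta> N x\<bar> \<le> E N / sqrt N"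
    by (rule uniform_approximation)
  from order_tendstoD(2)[OF E(1) \<epsilon>] E(2)
  show "\<forall>\<^sub>F N in sequentially. \<forall>x::real.
           \<bar>measure M {\<omega> \<in> space M.
               sqrt (real N) * (trimmed_mean X \<alpha> \<beta> N \<omega> - mu_ab F \<alpha> \<beta>)
                 / (inverse (\<beta> - \<alpha>) * SN X \<alpha> \<beta> N \<omega>) \<le> x}
            - H_N F f \<alpha> \<beta> N x\<bar> \<le> \<epsilon> / sqrt (real N)"
  proof eventually_elim
    case (elim N)
    have "E N / sqrt N \<le> \<epsilon> / sqrt N" using elim(1) by (intro divide_right_mono) auto
    then show ?case using elim(2) unfolding studentized_def by (meson order_trans)
  qed
qed

end
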